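(* Let $f:\mathbb{R}^n\times\mathbb{R}^2\to\mathbb{R}^n$ be analytic, consider $\dot x=f(x;\mu)$ with $\mu=(\mu_1,\mu_2)\in\mathbb{R}^2$, and assume (M1)-(M5) of the context with $n_0=2$. Suppose that condition (C) holds, i.e. besides $\dot x^{\mathrm h}(t)$ the variational equation along $x^{\mathrm h}(t)$ has another independent bounded solution (this is $\varphi_2(t)$). Let $a_1\in\mathbb{R}^2$, $b_1\in\mathbb{R}$, $\bar a_2\in\mathbb{R}^2$, $\bar b_2\in\mathbb{R}$ be the quantities defined in the context. Suppose that the $2\times2$ matrix $(a_1^*,\bar a_2^* )$ is nonsingular and $(b_1,\bar b_2)\ne(0,0)$. Then for some open interval $I\ni0$ there exist differentiable functions $\phi_j:I\to\mathbb{R}$ with $\phi_j(0)=0$, $j=1$ or $2$, and $\phi:I\to\mathbb{R}^2$ with $\phi(0)=0$, $\phi''(0)\neq0$ and $\phi(\alpha)=\phi(-\alpha)$ for $\alpha\in I$, such that a homoclinic orbit to $x=0$ exists on $X^+$ for $\mu_1=\phi_1(\mu_2)$ or $\mu_2=\phi_2(\mu_1)$, and an $S$-conjugate pair of homoclinic orbits to $x=0$ exists for $\mu=\phi(\alpha)$ ($\alpha\ne0$); that is, a pitchfork bifurcation of homoclinic orbits occurs.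
   Context: Throughout, $x=0$ is an equilibrium for $\mu$ near $0$, $*$ denotes transpose, and $\langle\cdot,\cdot\rangle$ is the Euclidean inner product. (M1) $x=0$ is a hyperbolic saddle at $\mu=0$; $\mathrm{D}_xf(0;0)$ has $n_{\mathrm s}$ eigenvalues with negative and $n_{\mathrm u}$ with positive real part, $n_{\mathrm s}+n_{\mathrm u}=n$. (M2) $x=0$ has a homoclinic orbit $x^{\mathrm h}(t)$ at $\mu=0$. (M3) The variational equation (VE) $\dot\xi=\mathrm{D}_xf(x^{\mathrm h}(t);0)\xi$ has just $n_0$ independent bounded solutions $\varphi_1(t)=\dot x^{\mathrm h}(t),\varphi_2(t),\dots,\varphi_{n_0}(t)$. Here $n_0=2$. (M4) There is an $n\times n$ matrix $S$ with $S^2=\mathrm{id}_n$ and $Sf(x;\mu)=f(Sx;\mu)$. Put $X^{\pm}=\{x\in\mathbb{R}^n: Sx=\pm x\}$, so $\mathbb{R}^n=X^+\oplus X^-$. Solutions $\bar x(t)$ and $S\bar x(t)$ are called $S$-conjugate if $\bar x(t)\ne S\bar x(t)$. (M5) For every $t\in\mathbb{R}$, $x^{\mathrm h}(t),\psi_{n_{\mathrm s}+1}(t)\in X^+$ and $\varphi_2(t),\psi_{n_{\mathrm s}+2}(t)\in X^-$. Here $\Phi(t)=(\varphi_1,\dots,\varphi_n)$ is a fundamental matrix of the VE with $\varphi_1,\varphi_2$ as in (M3) such that: $\varphi_1,\varphi_2\to0$ as $t\to\pm\infty$; $\varphi_j\to0$ as $t\to+\infty$ and $\varphi_j\to\infty$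 as $t\to-\infty$ for $3\le j\le n_{\mathrm s}$; $\varphi_j\to\infty$ as $t\to\pm\infty$ for $j=n_{\mathrm s}+1,n_{\mathrm s}+2$; $\varphi_j\to\infty$ as $t\to+\infty$ and $\varphi_j\to0$ as $t\to-\infty$ for $j\ge n_{\mathrm s}+3$. Moreover, with the eigenvalues $\tilde\lambda_1,\dots,\tilde\lambda_n$ of $\mathrm{D}_xf(0;0)$ (repeated according to algebraic multiplicity; negative real part for $j\le n_{\mathrm s}$, positive for $j>n_{\mathrm s}$), there are integers $k_j\ge0$ and a permutation $\sigma$ of $\{1,\dots,n\}$ with $\varphi_j(t)t^{-k_j}e^{-\mathrm{Re}(\tilde\lambda_j)t}=O(1)$ as $t\to+\infty$ and $\varphi_j(t)t^{-k_{\sigma(j)}}e^{-\mathrm{Re}(\tilde\lambda_{\sigma(j)})t}=O(1)$ as $t\to-\infty$. The functions $\psi_j$ are defined by $\langle\psi_j(t),\varphi_k(t)\rangle=\delta_{jk}$, i.e. $(\psi_1,\dots,\psi_n)=(\Phi^* )^{-1}$. Fix $\kappa>0$ with $\kappa<\frac14|\mathrm{Re}\,\tilde\lambda_j|$ for all $j$, and let $\mathscr{Z}^0=\{z\in C^0(\mathbb{R},\mathbb{R}^n):\sup_t|z(t)|e^{\kappa|t|}<\infty\}$, $\mathscr{Z}^1=\{z\in C^1(\mathbb{R},\mathbb{R}^n):\sup_t|z(t)|e^{\kappa|t|}<\infty,\ \sup_t|\dot z(t)|e^{\kappa|t|}<\infty\}$, $\bar{\mathscr Z}^1=\{z\in\mathscr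 Z^1:\langle\psi_j(0),z(0)\rangle=0,\ j=1,2\}$. Let $q:\mathbb{R}\to\mathbb{R}$ be a continuous function satisfying $\sup_t|q(t)|e^{\kappa t}<\infty$ and $\int_{-\infty}^\infty q(t)\,\mathrm dt=1$, and define a projection $\Pi:\mathscr Z^0\to\mathscr Z^0$ by $\Pi(z)(t)=q(t)\sum_{j=1}^{2}\Big(\int_{-\infty}^\infty\langle\psi_{n_{\mathrm s}+j}(\tau),z(\tau)\rangle\,\mathrm d\tau\Big)\varphi_{n_{\mathrm s}+j}(t)$. Let $\bar\xi^\mu$ and $\bar\xi^\alpha$ be the unique solutions in $\bar{\mathscr Z}^1$ of $\dot\xi=\mathrm{D}_xf(x^{\mathrm h}(t);0)\xi+(\mathrm{id}-\Pi)\mathrm{D}_\mu f(x^{\mathrm h}(t);0)\mu$ and $\dot\xi=\mathrm{D}_xf(x^{\mathrm h}(t);0)\xi+\frac12(\mathrm{id}-\Pi)\mathrm{D}_x^2f(x^{\mathrm h}(t);0)(\varphi_2(t),\varphi_2(t))$, respectively. Define, for $\mu\in\mathbb{R}^2$, $a_1\mu=\int_{-\infty}^\infty\langle\psi_{n_{\mathrm s}+1}(t),\mathrm{D}_\mu f(x^{\mathrm h}(t);0)\mu\rangle\,\mathrm dt$, $b_1=\frac12\int_{-\infty}^\infty\langle\psi_{n_{\mathrm s}+1}(t),\mathrm{D}_x^2f(x^{\mathrm h}(t);0)(\varphi_2(t),\varphi_2(t))\rangle\,\mathrm dt$, $\bar a_2\mu=\int_{-\infty}^\infty\langle\psi_{n_{\mathrm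 s}+2}(t),\mathrm{D}_\mu\mathrm{D}_xf(x^{\mathrm h}(t);0)(\mu,\varphi_2(t))+\mathrm{D}_x^2f(x^{\mathrm h}(t);0)(\bar\xi^\mu(t),\varphi_2(t))\rangle\,\mathrm dt$, $\bar b_2=\int_{-\infty}^\infty\langle\psi_{n_{\mathrm s}+2}(t),\frac16\mathrm{D}_x^3f(x^{\mathrm h}(t);0)(\varphi_2(t),\varphi_2(t),\varphi_2(t))+\mathrm{D}_x^2f(x^{\mathrm h}(t);0)(\bar\xi^\alpha(t),\varphi_2(t))\rangle\,\mathrm dt$. The homoclinic orbits considered have the form $x=x^{\mathrm h}(t)+\alpha\varphi_2(t)+O(\sqrt{\alpha^4+|\mu|^2})$; such an orbit with $\alpha\ne0$ is not contained in $X^+$ and so has an $S$-conjugate counterpart.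
   Formalization: Condition (M5) is read so that, besides the stated memberships, ψ_{n_s+1}(t) is orthogonal to X^- and ψ_{n_s+2}(t) is orthogonal to X^+; this is automatic when S is symmetric, and without it the claim can fail for a non-symmetric S. *)

theory Defs
  imports "HOL-Analysis.Analysis" "HOL-Library.Landau_Symbols" "HOL-Combinatorics.Permutations"
begin

subsection \<open>Analytic vector fields and their derivatives\<close>

(* Locally a convergent power series in the coordinates; k ranges over multi-indices,
   represented as functions on Basis that are undefined elsewhere. *)
definition real_analytic_at :: "('a::euclidean_space \<Rightarrow> 'b::real_normed_vector) \<Rightarrow> 'a \<Rightarrow> bool" where
  "real_analytic_at g x \<longleftrightarrow>
     (\<exists>r>0. \<exists>c :: ('a \<Rightarrow> nat) \<Rightarrow> 'b. \<forall>h\<in>ball 0 r.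
        ((\<lambda>k. (\<Prod>b\<in>Basis. (h \<bullet> b) ^ k b) *\<^sub>R c k) has_sum g (x + h)) (Basis \<rightarrow>\<^sub>E UNIV))"

type_synonym 'n vfield = "real^'n \<Rightarrow> real^2 \<Rightarrow> real^'n"

definition Dx :: "'n::finite vfield \<Rightarrow> real^'n \<Rightarrow> real^2 \<Rightarrow> real^'n \<Rightarrow> real^'n" where
  "Dx f x \<mu> u = frechet_derivative (\<lambda>y. f y \<mu>) (at x) u"

definition Dxx :: "'n::finite vfield \<Rightarrow> real^'n \<Rightarrow> real^2 \<Rightarrow> real^'n \<Rightarrow> real^'n \<Rightarrow> real^'n" where
  "Dxx f x \<mu> u v = frechet_derivative (\<lambda>y. Dx f y \<mu> v) (at x) u"

definition Dxxx ::
  "'n::finite vfield \<Rightarrow> real^'n \<Rightarrow> real^2 \<Rightarrow> real^'n \<Rightarrow> real^'n \<Rightarrow> real^'n \<Rightarrow> real^'n" where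
  "Dxxx f x \<mu> u v w = frechet_derivative (\<lambda>y. Dxx f y \<mu> v w) (at x) u"

definition Dmu :: "'n::finite vfield \<Rightarrow> real^'n \<Rightarrow> real^2 \<Rightarrow> real^2 \<Rightarrow> real^'n" where
  "Dmu f x \<mu> m = frechet_derivative (\<lambda>\<nu>. f x \<nu>) (at \<mu>) m"

definition DmuDx :: "'n::finite vfield \<Rightarrow> real^'n \<Rightarrow> real^2 \<Rightarrow> real^2 \<Rightarrow> real^'n \<Rightarrow> real^'n" where
  "DmuDx f x \<mu> m v = frechet_derivative (\<lambda>\<nu>. Dx f x \<nu> v) (at \<mu>) m"

subsection \<open>Homoclinic orbits and symmetry\<close>

definition homoclinic :: "'n::finite vfield \<Rightarrow> real^2 \<Rightarrow> (real \<Rightarrow> real^'n) \<Rightarrow> bool" where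
  "homoclinic f \<mu> x \<longleftrightarrow>
     (\<forall>t. (x has_vector_derivative f (x t) \<mu>) (at t)) \<and>
     (x \<longlongrightarrow> 0) at_top \<and> (x \<longlongrightarrow> 0) at_bot \<and> (\<exists>t. x t \<noteq> 0)"

definition Xplus :: "real^'n^'n \<Rightarrow> (real^'n::finite) set" where
  "Xplus S = {x. S *v x = x}"

definition Xminus :: "real^'n^'n \<Rightarrow> (real^'n::finite) set" where
  "Xminus S = {x. S *v x = - x}"

definition S_conjugate ::
  "real^'n^'n \<Rightarrow> (real \<Rightarrow> real^'n::finite) \<Rightarrow> (real \<Rightarrow> real^'n) \<Rightarrow> bool" where
  "S_conjugate S x y \<longleftrightarrow> (\<forall>t. y t = S *v x t) \<and> y \<noteq> x"

subsection \<open>The saddle, its variational equation and the fundamental system\<close>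

(* l 1, ..., l n are the eigenvalues, repeated according to algebraic multiplicity *)
definition eigenvalue_list :: "real^'n^'n \<Rightarrow> (nat \<Rightarrow> complex) \<Rightarrow> bool" where
  "eigenvalue_list A l \<longleftrightarrow>
     (\<forall>z::complex. det (mat z - (\<chi> i j. complex_of_real (A $ i $ j)) :: complex^'n^'n)
        = (\<Prod>j=1..CARD('n::finite). z - l j))"

definition hyperbolic_saddle :: "'n::finite vfield \<Rightarrow> nat \<Rightarrow> nat \<Rightarrow> (nat \<Rightarrow> complex) \<Rightarrow> bool" where
  "hyperbolic_saddle f ns nu l \<longleftrightarrow>
     1 \<le> ns \<and> 1 \<le> nu \<and> ns + nu = CARD('n) \<and>
     eigenvalue_list (matrix (Dx f 0 0)) l \<and>
     (\<forall>j\<in>{1..ns}. Re (l j) < 0) \<and> (\<forall>j\<in>{ns+1..ns+nu}. Re (l j) > 0)"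

definition VE_solution ::
  "'n::finite vfield \<Rightarrow> (real \<Rightarrow> real^'n) \<Rightarrow> (real \<Rightarrow> real^'n) \<Rightarrow> bool" where
  "VE_solution f xh \<xi> \<longleftrightarrow> (\<forall>t. (\<xi> has_vector_derivative Dx f (xh t) 0 (\<xi> t)) (at t))"

definition lin_indep_funs :: "nat \<Rightarrow> (nat \<Rightarrow> real \<Rightarrow> 'a::real_vector) \<Rightarrow> bool" where
  "lin_indep_funs m F \<longleftrightarrow>
     (\<forall>c. (\<forall>t. (\<Sum>j=1..m. c j *\<^sub>R F j t) = 0) \<longrightarrow> (\<forall>j\<in>{1..m}. c j = 0))"

(* The VE has just n0 independent bounded solutions phi 1 = xh', phi 2, ..., phi n0. *)
definition bounded_VE_basis ::
  "'n::finite vfield \<Rightarrow> (real \<Rightarrow> real^'n) \<Rightarrow> nat \<Rightarrow> (nat \<Rightarrow> real \<Rightarrow> real^'n) \<Rightarrow> bool" where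
  "bounded_VE_basis f xh n0 \<phi> \<longleftrightarrow>
     (\<forall>t. (xh has_vector_derivative \<phi> 1 t) (at t)) \<and>
     (\<forall>j\<in>{1..n0}. VE_solution f xh (\<phi> j) \<and> bounded (range (\<phi> j))) \<and>
     lin_indep_funs n0 \<phi> \<and>
     (\<forall>\<xi>. VE_solution f xh \<xi> \<and> bounded (range \<xi>) \<longrightarrow>
        (\<exists>c. \<forall>t. \<xi> t = (\<Sum>j=1..n0. c j *\<^sub>R \<phi> j t)))"

definition condition_C ::
  "'n::finite vfield \<Rightarrow> (real \<Rightarrow> real^'n) \<Rightarrow> (real \<Rightarrow> real^'n) \<Rightarrow> bool" where
  "condition_C f xh \<phi>2 \<longleftrightarrow>
     VE_solution f xh \<phi>2 \<and> bounded (range \<phi>2) \<and>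
     (\<forall>c d. (\<forall>t. c *\<^sub>R vector_derivative xh (at t) + d *\<^sub>R \<phi>2 t = 0) \<longrightarrow> c = 0 \<and> d = 0)"

definition fundamental_system ::
  "'n::finite vfield \<Rightarrow> (real \<Rightarrow> real^'n) \<Rightarrow> nat \<Rightarrow> (nat \<Rightarrow> complex) \<Rightarrow> (nat \<Rightarrow> real \<Rightarrow> real^'n) \<Rightarrow> bool" where
  "fundamental_system f xh ns l \<phi> \<longleftrightarrow>
     (\<forall>j\<in>{1..CARD('n)}. VE_solution f xh (\<phi> j)) \<and> lin_indep_funs CARD('n) \<phi> \<and>
     (\<forall>j\<in>{1,2}. (\<phi> j \<longlongrightarrow> 0) at_top \<and> (\<phi> j \<longlongrightarrow> 0) at_bot) \<and>
     (\<forall>j\<in>{3..ns}. (\<phi> j \<longlongrightarrow> 0) at_top \<and> filterlim (\<phi> j) at_infinity at_bot) \<and>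
     (\<forall>j\<in>{ns+1,ns+2}. filterlim (\<phi> j) at_infinity at_top \<and> filterlim (\<phi> j) at_infinity at_bot) \<and>
     (\<forall>j\<in>{ns+3..CARD('n)}. filterlim (\<phi> j) at_infinity at_top \<and> (\<phi> j \<longlongrightarrow> 0) at_bot) \<and>
     (\<exists>(k::nat \<Rightarrow> nat) \<sigma>. \<sigma> permutes {1..CARD('n)} \<and>
        (\<forall>j\<in>{1..CARD('n)}.
           (\<lambda>t. norm ((exp (- Re (l j) * t) / t ^ k j) *\<^sub>R \<phi> j t)) \<in> O[at_top](\<lambda>_. 1) \<and>
           (\<lambda>t. norm ((exp (- Re (l (\<sigma> j)) * t) / t ^ k (\<sigma> j)) *\<^sub>R \<phi> j t)) \<in> O[at_bot](\<lambda>_. 1)))"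

(* (psi 1, ..., psi n) is the inverse of the transpose of (phi 1, ..., phi n) *)
definition dual_system ::
  "(nat \<Rightarrow> real \<Rightarrow> real^'n) \<Rightarrow> (nat \<Rightarrow> real \<Rightarrow> real^'n::finite) \<Rightarrow> bool" where
  "dual_system \<phi> \<psi> \<longleftrightarrow>
     (\<forall>t. \<forall>j\<in>{1..CARD('n)}. \<forall>k\<in>{1..CARD('n)}. \<psi> j t \<bullet> \<phi> k t = (if j = k then 1 else 0))"

(* The functions psi j act as covectors, so their symmetry type only matters through the pairing
   with R^n = Xplus + Xminus.  When that splitting is orthogonal (S symmetric), membership in
   Xplus (Xminus) already says that the pairing with Xminus (Xplus) vanishes.  For a non-symmetric
   involution S it need not, so the two orthogonality clauses are listed here explicitly. *)
definition symmetry_types ::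
  "real^'n^'n \<Rightarrow> nat \<Rightarrow> (real \<Rightarrow> real^'n::finite) \<Rightarrow> (nat \<Rightarrow> real \<Rightarrow> real^'n) \<Rightarrow>
   (nat \<Rightarrow> real \<Rightarrow> real^'n) \<Rightarrow> bool" where
  "symmetry_types S ns xh \<phi> \<psi> \<longleftrightarrow>
     (\<forall>t. xh t \<in> Xplus S \<and> \<psi> (ns+1) t \<in> Xplus S \<and> \<phi> 2 t \<in> Xminus S \<and> \<psi> (ns+2) t \<in> Xminus S \<and>
          (\<forall>v\<in>Xminus S. \<psi> (ns+1) t \<bullet> v = 0) \<and> (\<forall>v\<in>Xplus S. \<psi> (ns+2) t \<bullet> v = 0))"

subsection \<open>Weighted function spaces and the projection\<close>

definition Z0 :: "real \<Rightarrow> (real \<Rightarrow> 'a::real_normed_vector) set" where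
  "Z0 \<kappa> = {z. continuous_on UNIV z \<and> bdd_above (range (\<lambda>t. norm (z t) * exp (\<kappa> * \<bar>t\<bar>)))}"

definition Z1 :: "real \<Rightarrow> (real \<Rightarrow> 'a::real_normed_vector) set" where
  "Z1 \<kappa> = {z \<in> Z0 \<kappa>. \<exists>z' \<in> Z0 \<kappa>. \<forall>t. (z has_vector_derivative z' t) (at t)}"

definition Z1bar :: "real \<Rightarrow> (nat \<Rightarrow> real \<Rightarrow> 'a::real_inner) \<Rightarrow> (real \<Rightarrow> 'a) set" where
  "Z1bar \<kappa> \<psi> = {z \<in> Z1 \<kappa>. \<forall>j\<in>{1,2}. \<psi> j 0 \<bullet> z 0 = 0}"

definition Proj ::
  "nat \<Rightarrow> (nat \<Rightarrow> real \<Rightarrow> 'a::real_inner) \<Rightarrow> (nat \<Rightarrow> real \<Rightarrow> 'a) \<Rightarrow> (real \<Rightarrow> real) \<Rightarrow> (real \<Rightarrow> 'a) \<Rightarrow> real \<Rightarrow> 'a" where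
  "Proj ns \<phi> \<psi> q z t =
     q t *\<^sub>R (\<Sum>j=1..2. (LINT \<tau>|lborel. \<psi> (ns+j) \<tau> \<bullet> z \<tau>) *\<^sub>R \<phi> (ns+j) t)"

(* the weight exp (kappa * t) is not exp (kappa * |t|); decay of q * phi (ns+j) at both ends is
   imposed by the requirement that the projection maps Z0 into itself *)
definition admissible_cutoff ::
  "real \<Rightarrow> nat \<Rightarrow> (nat \<Rightarrow> real \<Rightarrow> 'a::real_inner) \<Rightarrow> (nat \<Rightarrow> real \<Rightarrow> 'a) \<Rightarrow> (real \<Rightarrow> real) \<Rightarrow> bool" where
  "admissible_cutoff \<kappa> ns \<phi> \<psi> q \<longleftrightarrow>
     continuous_on UNIV q \<and> bdd_above (range (\<lambda>t. \<bar>q t\<bar> * exp (\<kappa> * t))) \<and>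
     has_bochner_integral lborel q 1 \<and> Proj ns \<phi> \<psi> q ` Z0 \<kappa> \<subseteq> Z0 \<kappa>"

(* xi is the unique solution in Z of  xi' = D_x f(xh;0) xi + (id - Pi) g *)
definition unique_projected_solution ::
  "'n::finite vfield \<Rightarrow> (real \<Rightarrow> real^'n) \<Rightarrow> ((real \<Rightarrow> real^'n) \<Rightarrow> real \<Rightarrow> real^'n) \<Rightarrow>
   (real \<Rightarrow> real^'n) set \<Rightarrow> (real \<Rightarrow> real^'n) \<Rightarrow> (real \<Rightarrow> real^'n) \<Rightarrow> bool" where
  "unique_projected_solution f xh P Z g \<xi> \<longleftrightarrow>
     (let sol = (\<lambda>\<eta>. \<forall>t. (\<eta> has_vector_derivative Dx f (xh t) 0 (\<eta> t) + (g t - P g t)) (at t))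
      in \<xi> \<in> Z \<and> sol \<xi> \<and> (\<forall>\<eta>\<in>Z. sol \<eta> \<longrightarrow> \<eta> = \<xi>))"

subsection \<open>The bifurcation coefficients\<close>

text \<open>The arguments \<open>\<psi>1\<close>, \<open>\<psi>2\<close> below stand for the members number \<open>ns + 1\<close>, \<open>ns + 2\<close> of the
  dual system.\<close>

definition coeff_a1 ::
  "'n::finite vfield \<Rightarrow> (real \<Rightarrow> real^'n) \<Rightarrow> (real \<Rightarrow> real^'n) \<Rightarrow> real^2 \<Rightarrow> real" where
  "coeff_a1 f xh \<psi>1 \<mu> = (LINT t|lborel. \<psi>1 t \<bullet> Dmu f (xh t) 0 \<mu>)"

definition coeff_b1 ::
  "'n::finite vfield \<Rightarrow> (real \<Rightarrow> real^'n) \<Rightarrow> (real \<Rightarrow> real^'n) \<Rightarrow> (real \<Rightarrow> real^'n) \<Rightarrow> real" where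
  "coeff_b1 f xh \<phi>2 \<psi>1 = 1/2 * (LINT t|lborel. \<psi>1 t \<bullet> Dxx f (xh t) 0 (\<phi>2 t) (\<phi>2 t))"

definition coeff_a2 ::
  "'n::finite vfield \<Rightarrow> (real \<Rightarrow> real^'n) \<Rightarrow> (real \<Rightarrow> real^'n) \<Rightarrow> (real \<Rightarrow> real^'n) \<Rightarrow>
   (real^2 \<Rightarrow> real \<Rightarrow> real^'n) \<Rightarrow> real^2 \<Rightarrow> real" where
  "coeff_a2 f xh \<phi>2 \<psi>2 \<xi>\<mu> \<mu> =
     (LINT t|lborel. \<psi>2 t \<bullet> (DmuDx f (xh t) 0 \<mu> (\<phi>2 t) + Dxx f (xh t) 0 (\<xi>\<mu> \<mu> t) (\<phi>2 t)))"

definition coeff_b2 ::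
  "'n::finite vfield \<Rightarrow> (real \<Rightarrow> real^'n) \<Rightarrow> (real \<Rightarrow> real^'n) \<Rightarrow> (real \<Rightarrow> real^'n) \<Rightarrow>
   (real \<Rightarrow> real^'n) \<Rightarrow> real" where
  "coeff_b2 f xh \<phi>2 \<psi>2 \<xi>\<alpha> =
     (LINT t|lborel. \<psi>2 t \<bullet> ((1/6) *\<^sub>R Dxxx f (xh t) 0 (\<phi>2 t) (\<phi>2 t) (\<phi>2 t)
                             + Dxx f (xh t) 0 (\<xi>\<alpha> t) (\<phi>2 t)))"

(* the 2x2 matrix with columns a1^*, a2^*, where the row vectors a1, a2 are given as linear forms *)
definition coeff_matrix :: "(real^2 \<Rightarrow> real) \<Rightarrow> (real^2 \<Rightarrow> real) \<Rightarrow> real^2^2" where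
  "coeff_matrix a1 a2 = (\<chi> i j. if j = 1 then a1 (axis i 1) else a2 (axis i 1))"

(* x = xh + alpha * phi2 + O(sqrt(alpha^4 + |mu|^2)), uniformly in time, with constant C *)
definition near_orbit ::
  "real \<Rightarrow> (real \<Rightarrow> 'a::real_normed_vector) \<Rightarrow> (real \<Rightarrow> 'a) \<Rightarrow> real \<Rightarrow> real^2 \<Rightarrow> (real \<Rightarrow> 'a) \<Rightarrow> bool" where
  "near_orbit C xh \<phi>2 \<alpha> \<mu> x \<longleftrightarrow>
     (\<forall>t. norm (x t - (xh t + \<alpha> *\<^sub>R \<phi>2 t)) \<le> C * sqrt (\<alpha> ^ 4 + (norm \<mu>)\<^sup>2))"

end

theory Submission
  imports Defs "HOL-Computational_Algebra.Fundamental_Theorem_Algebra" "HOL-Real_Asymp.Real_Asymp"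
begin

text \<open>The adjoint functions \<open>\<psi>\<close> are quotients of determinants, so Liouville's formula together with
  the growth rates of the \<open>\<phi>\<close> shows that the two functions with index \<open>ns + 1\<close> and \<open>ns + 2\<close>
  decay exponentially at both ends and are the only obstructions to solving the inhomogeneous
  variational equation by bounded functions.  Because of the symmetry types, \<open>Xplus\<close> and
  \<open>Xminus\<close> carry one obstruction each.

  Write \<open>x = xh + \<alpha> \<phi>2 + \<alpha>\<^sup>2 u + \<alpha>\<^sup>3 v\<close> and \<open>\<mu> = \<alpha>\<^sup>2 \<nu>\<close> with \<open>u\<close> even and \<open>v\<close> odd under \<open>S\<close>.
  After division by \<open>\<alpha>\<^sup>2\<close> and \<open>\<alpha>\<^sup>3\<close> the even and the odd part of the equation are regular at
  \<open>\<alpha> = 0\<close>, where they are linear and solvable precisely because the matrix of the coefficients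
  \<open>a1\<close>, \<open>a2\<close> is nonsingular; \<open>\<nu>\<close> is then nonzero because \<open>(b1, b2)\<close> is.  A contraction argument in
  the space of bounded continuous functions continues the solution to small \<open>\<alpha>\<close>, and reflecting
  it gives the conjugate orbit.  The orbits in \<open>Xplus\<close> come from the same argument, with the single
  solvability condition \<open>a1\<close> removing one component of \<open>\<mu>\<close>.  A bounded orbit close to \<open>xh\<close> is
  homoclinic since the saddle is hyperbolic.\<close>

subsection \<open>Linear systems, determinants and dual frames\<close>

text \<open>Working with merely bounded functions has a price. A bounded solution of the
  inhomogeneous variational equation is determined only up to multiples of \<open>xh'\<close> and
  \<open>\<phi> 2\<close>, whereas \<open>a2\<close> and \<open>b2\<close> are defined through one
  particular solution, normalised at time 0 and belonging to a projected equation. Two observations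
  bridge this gap. Integrals against \<open>\<psi> (ns+2)\<close> do not see the ambiguity: the
  multiple of \<open>xh'\<close> contributes a total derivative and the multiple of
  \<open>\<phi> 2\<close> has the wrong parity. Moreover, nonsingularity of the matrix is used in
  the form that \<open>a1\<close> and \<open>a2\<close> have no common zero, so \<open>a2\<close>
  has to be identified only on the kernel of \<open>a1\<close>, where both solvability conditions
  hold and the projection disappears; in the same way \<open>b2\<close> matters only when
  \<open>b1\<close> is zero. Evenness of the parameter curve is not derived from uniqueness of the
  branch: the solution for positive \<alpha> is used on both sides, through
  \<open>\<alpha>\<^sup>2 \<nu> \<bar>\<alpha>\<bar>\<close>, and the factor
  \<open>\<alpha>\<^sup>2\<close> is what keeps this curve differentiable at 0 with a second
  derivative there.\<close>

lemma det_has_vector_derivative: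
  fixes M :: "real \<Rightarrow> 'a::real_normed_field^'n::finite^'n"
  assumes "\<And>i j. ((\<lambda>t. M t $ i $ j) has_vector_derivative (A ** M t0) $ i $ j) (at t0)"
  shows "((\<lambda>t. det (M t)) has_vector_derivative trace A * det (M t0)) (at t0)"
proof -
  let ?U = "UNIV :: 'n set"
  let ?M' = "A ** M t0"
  have prod': "((\<lambda>t. \<Prod>i\<in>?U. M t $ i $ p i) has_vector_derivative
     (\<Sum>i\<in>?U. ?M' $ i $ p i * (\<Prod>j\<in>?U-{i}. M t0 $ j $ p j))) (at t0)" for p
    using has_derivative_prod[of ?U "\<lambda>i t. M t $ i $ p i" "\<lambda>i y. y *\<^sub>R ?M' $ i $ p i" t0 UNIV] assms
    by (simp add: has_vector_derivative_def scaleR_sum_right)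
  have "((\<lambda>t. det (M t)) has_vector_derivative
     (\<Sum>p | p permutes ?U. of_int (sign p) * (\<Sum>i\<in>?U. ?M' $ i $ p i * (\<Prod>j\<in>?U-{i}. M t0 $ j $ p j)))) (at t0)"
    unfolding det_def by (intro derivative_intros prod')
  also have "(\<Sum>p | p permutes ?U. of_int (sign p) * (\<Sum>i\<in>?U. ?M' $ i $ p i * (\<Prod>j\<in>?U-{i}. M t0 $ j $ p j)))
     = (\<Sum>i\<in>?U. \<Sum>p | p permutes ?U. of_int (sign p) * (?M' $ i $ p i * (\<Prod>j\<in>?U-{i}. M t0 $ j $ p j)))"
    unfolding sum_distrib_left by (rule sum.swap)
  also have "\<dots> = (\<Sum>i\<in>?U. A $ i $ i * det (M t0))"
  proof (rule sum.cong[OF refl])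
    fix k :: 'n
    \<comment> \<open>Row k of the derivative is a combination of the rows of \<open>M t0\<close>
      with coefficients from row k of \<open>A\<close>; Cramer's rule for rows leaves only the
      diagonal coefficient.\<close>
    let ?N = "\<chi> i. if i = k then (\<Sum>l\<in>?U. (A $ k) $ l *s row l (M t0)) else row i (M t0)"
    have N: "?N $ i $ j = (if i = k then ?M' $ k $ j else M t0 $ i $ j)" for i j
      by (simp add: matrix_matrix_mult_def row_def)
    have "det ?N = A $ k $ k * det (M t0)" by (rule cramer_lemma_transpose)
    moreover have "det ?N = (\<Sum>p | p permutes ?U. of_int (sign p) * (?M' $ k $ p k * (\<Prod>j\<in>?U-{k}. M t0 $ j $ p j)))"
      unfolding det_def
    proof (intro sum.cong refl arg_cong2[where f="(*)"])
      fix p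
      have "(\<Prod>i\<in>?U. ?N $ i $ p i) = ?N $ k $ p k * (\<Prod>i\<in>?U-{k}. ?N $ i $ p i)"
        by (rule prod.remove) auto
      also have "\<dots> = ?M' $ k $ p k * (\<Prod>j\<in>?U-{k}. M t0 $ j $ p j)"
        unfolding N by (auto intro!: arg_cong2[where f="(*)"] prod.cong)
      finally show "(\<Prod>i\<in>?U. ?N $ i $ p i) = ?M' $ k $ p k * (\<Prod>j\<in>?U-{k}. M t0 $ j $ p j)" .
    qed
    ultimately show "(\<Sum>p | p permutes ?U. of_int (sign p) * (?M' $ k $ p k * (\<Prod>j\<in>?U-{k}. M t0 $ j $ p j))) = A $ k $ k * det (M t0)"
      by simp
  qed
  also have "\<dots> = trace A * det (M t0)" by (simp add: trace_def sum_distrib_right)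
  finally show ?thesis .
qed

text \<open>The determinant of \<open>1 - s A\<close> is differentiated at s = 0 in two ways: as a
  determinant, which gives minus the trace, and as a product over the eigenvalues.\<close>

lemma trace_eq_sum_eigenvalues:
  fixes A :: "real^'n::finite^'n"
  assumes "eigenvalue_list A l"
  shows "trace A = (\<Sum>j=1..CARD('n). Re (l j))"
proof -
  let ?n = "CARD('n)"
  define Ac :: "complex^'n^'n" where "Ac = (\<chi> i j. complex_of_real (A $ i $ j))"
  define M where "M s = (\<chi> i j. (mat 1 $ i $ j :: complex) - complex_of_real s * Ac $ i $ j)" for s
  have M0: "M 0 = mat 1" by (simp add: M_def vec_eq_iff)
  have "((\<lambda>s. det (M s)) has_vector_derivative trace (- Ac) * det (M 0)) (at 0)"
  proof (rule det_has_vector_derivative)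
    fix i j
    have of: "(complex_of_real has_vector_derivative 1) (at 0)"
      using has_vector_derivative_of_real[OF DERIV_ident, where 'a=complex] by simp
    have "((\<lambda>s. (mat 1 $ i $ j :: complex) - complex_of_real s * Ac $ i $ j) has_vector_derivative 0 - 1 * Ac $ i $ j) (at 0)"
      by (intro derivative_intros of)
    then show "((\<lambda>s. M s $ i $ j) has_vector_derivative (- Ac ** M 0) $ i $ j) (at 0)"
      unfolding M0 by (simp add: M_def matrix_mul_rid)
  qed
  then have d1: "((\<lambda>s. det (M s)) has_vector_derivative trace (- Ac)) (at 0)" by (simp add: M0)
  have eq: "det (M s) = (\<Prod>j=1..?n. 1 - complex_of_real s * l j)" for s
  proof (cases "s = 0")
    case True then show ?thesis by (simp add: M0)
  next
    case False
    \<comment> \<open>Pulling the factor s out of every row turns \<open>1 - s A\<close> into the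
      characteristic matrix at \<open>1 / s\<close>.\<close>
    let ?z = "complex_of_real (1 / s)"
    have "M s = (\<chi> i. complex_of_real s *s ((mat ?z - Ac) $ i))"
      using False by (simp add: M_def vec_eq_iff mat_def algebra_simps)
    then have "det (M s) = (\<Prod>i\<in>(UNIV::'n set). complex_of_real s) * det (\<chi> i. (mat ?z - Ac) $ i)"
      by (simp only: det_rows_mul)
    then have "det (M s) = complex_of_real s ^ ?n * det (mat ?z - Ac)"
      by (simp only: vec_lambda_eta prod_constant)
    also have "det (mat ?z - Ac) = (\<Prod>j=1..?n. ?z - l j)"
      using assms[unfolded eigenvalue_list_def, THEN spec] unfolding Ac_def .
    also have "complex_of_real s ^ ?n * (\<Prod>j=1..?n. ?z - l j) = (\<Prod>j=1..?n. complex_of_real s * (?z - l j))"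
      by (simp add: prod.distrib)
    also have "\<dots> = (\<Prod>j=1..?n. 1 - complex_of_real s * l j)"
      using False by (intro prod.cong) (auto simp: algebra_simps)
    finally show ?thesis .
  qed
  have d2: "((\<lambda>s. \<Prod>j=1..?n. 1 - complex_of_real s * l j) has_vector_derivative - (\<Sum>j=1..?n. l j)) (at 0)"
  proof -
    have "((\<lambda>s. 1 - complex_of_real s * l j) has_derivative (\<lambda>y. y *\<^sub>R (- l j))) (at 0)" for j
    proof -
      have of: "(complex_of_real has_vector_derivative 1) (at 0)"
        using has_vector_derivative_of_real[OF DERIV_ident, where 'a=complex] by simp
      have "((\<lambda>s. 1 - complex_of_real s * l j) has_vector_derivative 0 - 1 * l j) (at 0)"
        by (intro derivative_intros of)
      then show ?thesis by (simp add: has_vector_derivative_def)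
    qed
    then show ?thesis
      using has_derivative_prod[of "{1..?n}" "\<lambda>j s. 1 - complex_of_real s * l j" "\<lambda>j y. y *\<^sub>R (- l j)" 0 UNIV]
      by (simp add: has_vector_derivative_def scaleR_sum_right sum_negf)
  qed
  have "trace (- Ac) = - (\<Sum>j=1..?n. l j)"
    using vector_derivative_unique_at[OF d1] d2 unfolding eq by blast
  then have "trace Ac = (\<Sum>j=1..?n. l j)" by (simp add: trace_def sum_negf)
  moreover have "Re (trace Ac) = trace A" by (simp add: trace_def Ac_def)
  ultimately show ?thesis by simp
qed

text \<open>Every permutation meets each column exactly once, so all terms of Leibniz's formula
  share one bound, the product of the column bounds.\<close>

lemma abs_det_le:
  fixes M :: "real^'n::finite^'n"
  assumes "\<And>i j. \<bar>M $ i $ j\<bar> \<le> c j"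
  shows "\<bar>det M\<bar> \<le> fact CARD('n) * (\<Prod>j\<in>UNIV. c j)"
proof -
  let ?U = "UNIV :: 'n set"
  have "\<bar>det M\<bar> \<le> (\<Sum>p | p permutes ?U. \<bar>of_int (sign p) * (\<Prod>i\<in>?U. M $ i $ p i)\<bar>)"
    unfolding det_def by (rule sum_abs)
  also have "\<dots> \<le> (\<Sum>p | p permutes ?U. \<Prod>j\<in>?U. c j)"
  proof (rule sum_mono)
    fix p assume "p \<in> {p. p permutes ?U}"
    then have p: "bij p" by (simp add: permutes_bij)
    have "\<bar>of_int (sign p) * (\<Prod>i\<in>?U. M $ i $ p i)\<bar> = (\<Prod>i\<in>?U. \<bar>M $ i $ p i\<bar>)"
      by (simp add: abs_mult abs_prod sign_def)
    also have "\<dots> \<le> (\<Prod>i\<in>?U. c (p i))" by (intro prod_mono) (auto simp: assms)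
    also have "\<dots> = (\<Prod>j\<in>?U. c j)" using prod.reindex_bij_betw[OF p] by simp
    finally show "\<bar>of_int (sign p) * (\<Prod>i\<in>?U. M $ i $ p i)\<bar> \<le> (\<Prod>j\<in>?U. c j)" .
  qed
  also have "\<dots> = fact CARD('n) * (\<Prod>j\<in>?U. c j)"
    by (simp add: card_permutations[of _ "CARD('n)"])
  finally show ?thesis .
qed

lemma differentiable_det:
  fixes M :: "real \<Rightarrow> real^'n::finite^'n"
  assumes "\<And>i j. (\<lambda>t. M t $ i $ j) differentiable (at t)"
  shows "(\<lambda>t. det (M t)) differentiable (at t)"
proof -
  obtain D where D: "\<And>i j. ((\<lambda>t. M t $ i $ j) has_derivative D i j) (at t)"
    using assms unfolding differentiable_def by metis
  have "(\<lambda>t. \<Prod>i\<in>UNIV. M t $ i $ p i) differentiable (at t)" for p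
    unfolding differentiable_def by (rule exI, rule has_derivative_prod, rule D)
  then show ?thesis
    unfolding det_def by (intro differentiable_sum differentiable_mult differentiable_const) auto
qed

lemma has_vector_derivative_vec_iff:
  fixes f :: "real \<Rightarrow> 'a::euclidean_space^'n::finite"
  shows "(f has_vector_derivative d) (at t) \<longleftrightarrow> (\<forall>i. ((\<lambda>t. f t $ i) has_vector_derivative d $ i) (at t))"
  (is "?L \<longleftrightarrow> ?R")
proof
  assume ?L then show ?R
    using bounded_linear.has_vector_derivative[OF bounded_linear_vec_nth] by blast
next
  assume R: ?R
  show ?L
    unfolding has_vector_derivative_def has_derivative_componentwise_within[of f]
  proof
    fix b :: "'a^'n" assume "b \<in> Basis"
    then obtain i u where b: "b = axis i u" by (auto simp: Basis_vec_def)
    have "((\<lambda>t. f t $ i) has_derivative (\<lambda>x. x *\<^sub>R d $ i)) (at t)"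
      using R by (simp add: has_vector_derivative_def)
    then have "((\<lambda>t. f t $ i \<bullet> u) has_derivative (\<lambda>x. (x *\<^sub>R d $ i) \<bullet> u)) (at t)"
      by (rule has_derivative_inner_left)
    then show "((\<lambda>x. f x \<bullet> b) has_derivative (\<lambda>x. x *\<^sub>R d \<bullet> b)) (at t)"
      by (simp add: b inner_axis)
  qed
qed

text \<open>\<open>\<Phi>\<close> lists the columns of a fundamental matrix and
  \<open>\<Psi>\<close> the rows of its inverse, indexed by the type \<open>'n\<close> so that
  determinants apply. The coefficient \<open>A\<close> is left general because the time-reversed
  equation is an instance as well.\<close>

locale dual_frame =
  fixes A :: "real \<Rightarrow> real^'n::finite^'n" and \<Phi> \<Psi> :: "'n \<Rightarrow> real \<Rightarrow> real^'n"
  assumes solution: "(\<Phi> j has_vector_derivative A t *v \<Phi> j t) (at t)"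
    and dual: "\<Psi> j t \<bullet> \<Phi> k t = (if j = k then 1 else 0)"
begin

definition frame :: "real \<Rightarrow> real^'n^'n" where "frame t = (\<chi> i j. \<Phi> j t $ i)"

lemma frame_expansion: "(\<Sum>j\<in>UNIV. (\<Psi> j t \<bullet> v) *\<^sub>R \<Phi> j t) = v"
proof -
  define N where "N = (\<chi> j i. \<Psi> j t $ i)"
  have "N ** frame t = mat 1"
    using dual[of _ t] by (simp add: N_def frame_def matrix_matrix_mult_def mat_def vec_eq_iff inner_vec_def)
  then have "frame t ** N = mat 1" by (rule matrix_left_right_inverse[THEN iffD1])
  then have "frame t *v (N *v v) = v" by (simp add: matrix_vector_mul_assoc)
  moreover have "N *v v = (\<chi> j. \<Psi> j t \<bullet> v)" by (simp add: N_def matrix_vector_mult_def inner_vec_def vec_eq_iff)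
  ultimately show ?thesis
    by (simp add: frame_def matrix_vector_mult_def vec_eq_iff mult.commute)
qed

text \<open>Cramer's rule for the frame matrix: the coefficients of \<open>v\<close> in the frame
  are its pairings with the dual vectors.\<close>

lemma cramer_dual:
  "det (\<chi> i j. if j = k then v $ i else \<Phi> j t $ i) = (\<Psi> k t \<bullet> v) * det (frame t)"
proof -
  have "frame t *v (\<chi> j. \<Psi> j t \<bullet> v) = v"
    using frame_expansion[of t v] by (simp add: frame_def matrix_vector_mult_def vec_eq_iff mult.commute)
  with cramer_lemma[of k "frame t" "\<chi> j. \<Psi> j t \<bullet> v"] show ?thesis
    unfolding \<open>frame t *v (\<chi> j. \<Psi> j t \<bullet> v) = v\<close> by (simp add: frame_def cong: if_cong)
qed

lemma det_frame_nonzero: "det (frame t) \<noteq> 0"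
proof -
  have "(\<Psi> k t \<bullet> \<Phi> k t) = 1" for k by (simp add: dual)
  define N where "N = (\<chi> j i. \<Psi> j t $ i)"
  have "N ** frame t = mat 1"
    using dual[of _ t] by (simp add: N_def frame_def matrix_matrix_mult_def mat_def vec_eq_iff inner_vec_def)
  then have "det N * det (frame t) = 1" by (metis det_I det_mul)
  then show ?thesis by auto
qed

lemma det_frame_derivative:
  "((\<lambda>t. det (frame t)) has_vector_derivative trace (A t) * det (frame t)) (at t)"
proof (rule det_has_vector_derivative)
  fix i j
  have "((\<lambda>t. \<Phi> j t $ i) has_vector_derivative (A t *v \<Phi> j t) $ i) (at t)"
    by (rule bounded_linear.has_vector_derivative[OF bounded_linear_vec_nth solution])
  then show "((\<lambda>t. frame t $ i $ j) has_vector_derivative (A t ** frame t) $ i $ j) (at t)"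
    by (simp add: frame_def matrix_matrix_mult_def matrix_vector_mult_def)
qed

text \<open>The regularity of the dual vectors is inherited from the frame through the quotient of
  determinants.\<close>

lemma dual_differentiable: "\<exists>d. (\<Psi> k has_vector_derivative d) (at t)"
proof -
  have entry: "\<exists>d. ((\<lambda>t. \<Phi> j t $ i) has_vector_derivative d) (at t)" for i j
    using bounded_linear.has_vector_derivative[OF bounded_linear_vec_nth solution] by blast
  have comp: "\<exists>d. ((\<lambda>t. \<Psi> k t $ m) has_vector_derivative d) (at t)" for m
  proof -
    let ?M = "\<lambda>t. (\<chi> i j. if j = k then axis m 1 $ i else \<Phi> j t $ i) :: real^'n^'n"
    have eq: "\<Psi> k t $ m = det (?M t) / det (frame t)" for t
      using cramer_dual[of k "axis m 1" t] det_frame_nonzero[of t] by (simp add: inner_axis field_simps)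
    have "(\<lambda>t. det (?M t)) differentiable (at t)"
    proof (rule differentiable_det)
      fix i j
      show "(\<lambda>t. ?M t $ i $ j) differentiable (at t)"
        using entry[of j i] by (cases "j = k") (auto simp: differentiable_def has_vector_derivative_def)
    qed
    moreover have "(\<lambda>t. det (frame t)) differentiable (at t)"
      using det_frame_derivative by (auto simp: differentiable_def has_vector_derivative_def)
    ultimately have "(\<lambda>t. \<Psi> k t $ m) differentiable (at t)"
      unfolding eq using det_frame_nonzero by (intro differentiable_divide)
    then show ?thesis using vector_derivative_works by blast
  qed
  then obtain d where "\<And>m. ((\<lambda>t. \<Psi> k t $ m) has_vector_derivative d m) (at t)" by metis
  then have "((\<lambda>t. \<chi> m. \<Psi> k t $ m) has_vector_derivative (\<chi> m. d m)) (at t)"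
    by (simp add: has_vector_derivative_vec_iff)
  then show ?thesis by auto
qed

lemma dual_continuous: "continuous_on S (\<Psi> k)"
  by (meson continuous_at_imp_continuous_on dual_differentiable has_vector_derivative_continuous)

text \<open>The dual vectors solve the adjoint equation. This is read off by differentiating their
  constant pairings with the frame and expanding an arbitrary vector in the frame; in the pairing
  with \<open>w\<close> the two terms with \<open>A\<close> cancel and only the forcing
  remains.\<close>

lemma dual_pairing_derivative:
  assumes "(w has_vector_derivative A t *v w t + h) (at t)"
  shows "((\<lambda>t. \<Psi> k t \<bullet> w t) has_vector_derivative \<Psi> k t \<bullet> h) (at t)"
proof -
  obtain d where d: "(\<Psi> k has_vector_derivative d) (at t)" using dual_differentiable by blast
  have *: "d \<bullet> \<Phi> j t = - (\<Psi> k t \<bullet> (A t *v \<Phi> j t))" for j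
  proof -
    have "((\<lambda>t. \<Psi> k t \<bullet> \<Phi> j t) has_vector_derivative \<Psi> k t \<bullet> (A t *v \<Phi> j t) + d \<bullet> \<Phi> j t) (at t)"
      by (rule bounded_bilinear.has_vector_derivative[OF bounded_bilinear_inner d solution])
    moreover have "((\<lambda>t. \<Psi> k t \<bullet> \<Phi> j t) has_vector_derivative 0) (at t)"
      unfolding dual by (rule has_vector_derivative_const)
    ultimately have "\<Psi> k t \<bullet> (A t *v \<Phi> j t) + d \<bullet> \<Phi> j t = 0" by (rule vector_derivative_unique_at)
    then show ?thesis by simp
  qed
  have dv: "d \<bullet> v = - (\<Psi> k t \<bullet> (A t *v v))" for v
  proof -
    have "d \<bullet> v = (\<Sum>j\<in>UNIV. (\<Psi> j t \<bullet> v) * (d \<bullet> \<Phi> j t))"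
      by (subst frame_expansion[of t v, symmetric]) (simp add: inner_sum_right)
    also have "\<dots> = - (\<Psi> k t \<bullet> (\<Sum>j\<in>UNIV. (\<Psi> j t \<bullet> v) *\<^sub>R (A t *v \<Phi> j t)))"
      by (simp add: * inner_sum_right sum_negf)
    also have "(\<Sum>j\<in>UNIV. (\<Psi> j t \<bullet> v) *\<^sub>R (A t *v \<Phi> j t)) = A t *v (\<Sum>j\<in>UNIV. (\<Psi> j t \<bullet> v) *\<^sub>R \<Phi> j t)"
      by (simp add: linear_sum[OF matrix_vector_mul_linear] matrix_vector_mult_scaleR)
    finally show ?thesis by (simp add: frame_expansion)
  qed
  have "((\<lambda>t. \<Psi> k t \<bullet> w t) has_vector_derivative \<Psi> k t \<bullet> (A t *v w t + h) + d \<bullet> w t) (at t)"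
    by (rule bounded_bilinear.has_vector_derivative[OF bounded_bilinear_inner d assms])
  then show ?thesis by (simp add: dv inner_add_right)
qed

lemma det_frame_lower_bound:
  assumes tr: "((\<lambda>t. trace (A t)) \<longlongrightarrow> \<Lambda>) at_top" and "\<delta> > 0"
  shows "\<exists>w>0. \<forall>\<^sub>F t in at_top. w * exp ((\<Lambda> - \<delta>) * t) \<le> \<bar>det (frame t)\<bar>"
proof -
  let ?W = "\<lambda>t. det (frame t)"
  have "\<forall>\<^sub>F t in at_top. trace (A t) > \<Lambda> - \<delta>"
    using order_tendstoD(1)[OF tr, of "\<Lambda> - \<delta>"] \<open>\<delta> > 0\<close> by simp
  then obtain T where T: "\<And>t. t \<ge> T \<Longrightarrow> trace (A t) > \<Lambda> - \<delta>"
    unfolding eventually_at_top_linorder by auto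
  \<comment> \<open>Squaring the determinant avoids a discussion of its sign. By Liouville's formula
    \<open>g\<close> is nondecreasing as soon as the trace exceeds
    \<open>\<Lambda> - \<delta>\<close>.\<close>
  define g where "g t = (?W t)\<^sup>2 * exp (- 2 * (\<Lambda> - \<delta>) * t)" for t
  have g': "(g has_real_derivative 2 * (trace (A t) - (\<Lambda> - \<delta>)) * g t) (at t)" for t
  proof -
    have "(?W has_real_derivative trace (A t) * ?W t) (at t)"
      using det_frame_derivative by (simp add: has_real_derivative_iff_has_vector_derivative)
    then show ?thesis
      unfolding g_def by (auto intro!: derivative_eq_intros simp: power2_eq_square algebra_simps)
  qed
  have mono: "g T \<le> g t" if "t \<ge> T" for t
  proof (rule DERIV_nonneg_imp_nondecreasing[OF that])
    fix x assume "T \<le> x"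
    then have "0 \<le> 2 * (trace (A x) - (\<Lambda> - \<delta>)) * g x" using T[of x] by (simp add: g_def)
    then show "\<exists>y. (g has_real_derivative y) (at x) \<and> 0 \<le> y" using g' by blast
  qed
  have "g T > 0" using det_frame_nonzero by (simp add: g_def)
  have "sqrt (g T) * exp ((\<Lambda> - \<delta>) * t) \<le> \<bar>?W t\<bar>" if "t \<ge> T" for t
  proof -
    have "(sqrt (g T) * exp ((\<Lambda> - \<delta>) * t))\<^sup>2 = g T * exp (2 * (\<Lambda> - \<delta>) * t)"
      using \<open>g T > 0\<close> by (simp add: power_mult_distrib exp_double[symmetric] mult.assoc)
    also have "\<dots> \<le> g t * exp (2 * (\<Lambda> - \<delta>) * t)" using mono[OF that] by simp
    also have "\<dots> = \<bar>?W t\<bar>\<^sup>2" by (simp add: g_def mult.assoc algebra_simps flip: exp_add)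
    finally show ?thesis by (rule power2_le_imp_le) simp
  qed
  then show ?thesis
    using \<open>g T > 0\<close> by (intro exI[of _ "sqrt (g T)"]) (auto simp: eventually_at_top_linorder)
qed

text \<open>By Cramer's rule each dual vector is a quotient of determinants, and Liouville's formula
  prevents the denominator from being much smaller than the product of the growth rates.\<close>

lemma dual_exp_bound:
  assumes tr: "((\<lambda>t. trace (A t)) \<longlongrightarrow> (\<Sum>j\<in>UNIV. \<rho> j)) at_top"
    and gr: "\<And>j \<epsilon>. \<epsilon> > 0 \<Longrightarrow> \<exists>C. \<forall>\<^sub>F t in at_top. norm (\<Phi> j t) \<le> C * exp ((\<rho> j + \<epsilon>) * t)"
    and "\<epsilon> > 0"
  shows "\<exists>C. \<forall>\<^sub>F t in at_top. norm (\<Psi> k t) \<le> C * exp ((\<epsilon> - \<rho> k) * t)"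
proof -
  let ?N = "CARD('n)" and ?\<Lambda> = "\<Sum>j\<in>UNIV. \<rho> j"
  \<comment> \<open>The loss is spread evenly: \<open>?N - 1\<close> columns of the numerator and
    the denominator cost one \<delta> each, in total \<epsilon>.\<close>
  define \<delta> where "\<delta> = \<epsilon> / ?N"
  have \<delta>: "\<delta> > 0" "?N * \<delta> = \<epsilon>" using \<open>\<epsilon> > 0\<close> by (simp_all add: \<delta>_def)
  obtain w where w: "w > 0" and W: "\<forall>\<^sub>F t in at_top. w * exp ((?\<Lambda> - \<delta>) * t) \<le> \<bar>det (frame t)\<bar>"
    using det_frame_lower_bound[OF tr \<delta>(1)] by blast
  obtain C where C: "\<And>j. \<forall>\<^sub>F t in at_top. norm (\<Phi> j t) \<le> C j * exp ((\<rho> j + \<delta>) * t)"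
    using gr[OF \<delta>(1)] by metis
  have C': "\<forall>\<^sub>F t in at_top. \<forall>j. norm (\<Phi> j t) \<le> C j * exp ((\<rho> j + \<delta>) * t)"
    using C by (subst eventually_all_finite) auto
  define K where "K = fact ?N * (\<Prod>j\<in>UNIV-{k}. C j) / w"
  have "norm (\<Psi> k t) \<le> (?N * K) * exp ((\<epsilon> - \<rho> k) * t)"
    if Wt: "w * exp ((?\<Lambda> - \<delta>) * t) \<le> \<bar>det (frame t)\<bar>"
    and Ct: "\<forall>j. norm (\<Phi> j t) \<le> C j * exp ((\<rho> j + \<delta>) * t)" for t
  proof -
    have "\<bar>\<Psi> k t $ m\<bar> \<le> K * exp ((\<epsilon> - \<rho> k) * t)" for m
    proof -
      let ?M = "(\<chi> i j. if j = k then axis m 1 $ i else \<Phi> j t $ i) :: real^'n^'n"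
      let ?c = "\<lambda>j. if j = k then 1 else C j * exp ((\<rho> j + \<delta>) * t)"
      have "\<bar>?M $ i $ j\<bar> \<le> ?c j" for i j
        using Ct[rule_format, of j] component_le_norm_cart[of "\<Phi> j t" i] by (simp add: axis_def)
      then have "\<bar>det ?M\<bar> \<le> fact ?N * (\<Prod>j\<in>UNIV. ?c j)" by (rule abs_det_le)
      also have "(\<Prod>j\<in>UNIV. ?c j) = ?c k * (\<Prod>j\<in>UNIV-{k}. ?c j)" by (rule prod.remove) auto
      also have "\<dots> = (\<Prod>j\<in>UNIV-{k}. C j * exp ((\<rho> j + \<delta>) * t))" by simp
      also have "\<dots> = (\<Prod>j\<in>UNIV-{k}. C j) * exp (\<Sum>j\<in>UNIV-{k}. (\<rho> j + \<delta>) * t)"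
        by (simp add: prod.distrib exp_sum)
      also have "(\<Sum>j\<in>UNIV-{k}. (\<rho> j + \<delta>) * t) = (\<Sum>j\<in>UNIV. (\<rho> j + \<delta>) * t) - (\<rho> k + \<delta>) * t"
        by (simp add: sum_diff1)
      also have "(\<Sum>j\<in>UNIV. (\<rho> j + \<delta>) * t) = (?\<Lambda> + \<epsilon>) * t"
        unfolding sum_distrib_right[symmetric] sum.distrib using \<delta>(2) by simp
      also have "(?\<Lambda> + \<epsilon>) * t - (\<rho> k + \<delta>) * t = (?\<Lambda> - \<delta>) * t + (\<epsilon> - \<rho> k) * t"
        by (simp add: algebra_simps)
      finally have up: "\<bar>det ?M\<bar> \<le> fact ?N * ((\<Prod>j\<in>UNIV-{k}. C j) * exp ((?\<Lambda> - \<delta>) * t + (\<epsilon> - \<rho> k) * t))" .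
      have eq: "det ?M = \<Psi> k t $ m * det (frame t)"
        using cramer_dual[of k "axis m 1" t] by (simp add: inner_axis)
      have "\<bar>\<Psi> k t $ m\<bar> * (w * exp ((?\<Lambda> - \<delta>) * t)) \<le> \<bar>\<Psi> k t $ m\<bar> * \<bar>det (frame t)\<bar>"
        by (intro mult_left_mono Wt) auto
      also have "\<dots> \<le> fact ?N * ((\<Prod>j\<in>UNIV-{k}. C j) * exp ((?\<Lambda> - \<delta>) * t + (\<epsilon> - \<rho> k) * t))"
        using up unfolding eq abs_mult .
      also have "\<dots> = (K * exp ((\<epsilon> - \<rho> k) * t)) * (w * exp ((?\<Lambda> - \<delta>) * t))"
        using w by (simp add: K_def exp_add)
      finally show ?thesis using w by (simp add: mult_le_cancel_right)
    qed
    then have "(\<Sum>m\<in>UNIV. \<bar>\<Psi> k t $ m\<bar>) \<le> (\<Sum>m\<in>(UNIV::'n set). K * exp ((\<epsilon> - \<rho> k) * t))"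
      by (intro sum_mono)
    then show ?thesis using norm_le_l1_cart[of "\<Psi> k t"] by simp
  qed
  with W C' have "\<forall>\<^sub>F t in at_top. norm (\<Psi> k t) \<le> (?N * K) * exp ((\<epsilon> - \<rho> k) * t)"
    by (rule eventually_elim2)
  then show ?thesis by blast
qed

end

section \<open>Scalar linear equations with bounded forcing\<close>

lemma linear_ode_exp:
  fixes y :: "real \<Rightarrow> complex"
  assumes "\<And>t. (y has_vector_derivative l * y t + g t) (at t)"
  shows "((\<lambda>t. exp (- (l * of_real t)) * y t) has_vector_derivative exp (- (l * of_real t)) * g t) (at t)"
proof -
  have e: "((\<lambda>t. exp (- (l * of_real t))) has_vector_derivative - l * exp (- (l * of_real t))) (at t)"
  proof -
    have "((\<lambda>z. exp (- (l * z))) has_field_derivative - l * exp (- (l * of_real t))) (at (of_real t))"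
      by (auto intro!: derivative_eq_intros)
    then show ?thesis by (rule has_vector_derivative_real_field)
  qed
  show ?thesis
    using has_vector_derivative_mult[OF e assms[of t]] by (simp add: algebra_simps)
qed

lemma bounded_linear_ode_zero:
  fixes y :: "real \<Rightarrow> complex"
  assumes "\<And>t. (y has_vector_derivative l * y t) (at t)" "Re l \<noteq> 0" "bounded (range y)"
  shows "y t = 0"
proof -
  have "((\<lambda>t. exp (- (l * of_real t)) * y t) has_vector_derivative 0) (at t)" for t
    using linear_ode_exp[of y l "\<lambda>_. 0"] assms(1) by simp
  then obtain c where c: "\<And>s. exp (- (l * of_real s)) * y s = c"
    using has_vector_derivative_zero_constant[of UNIV "\<lambda>t. exp (- (l * of_real t)) * y t"] by auto
  then have "exp (- (l * of_real s)) * y s = exp (- (l * of_real 0)) * y 0" for s by metis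
  then have y: "y s = exp (l * of_real s) * y 0" for s
    by (metis exp_minus_inverse mult.left_commute mult.right_neutral mult_zero_right exp_zero minus_zero of_real_0)
  obtain M where M: "\<And>s. norm (y s) \<le> M" using assms(3) by (auto simp: bounded_iff)
  have "norm (y 0) = 0"
  proof (rule ccontr)
    assume "norm (y 0) \<noteq> 0"
    then have p: "norm (y 0) > 0" by simp
    \<comment> \<open>Dividing by \<open>Re l\<close> puts s on the side where the exponential grows
      and makes the exponent \<open>M / norm (y 0)\<close>; then \<open>1 + x \<le> exp x\<close>
      beats the bound M.\<close>
    define s where "s = (M / norm (y 0)) / Re l"
    have "M / norm (y 0) < exp (Re l * s)"
      using assms(2) less_le_trans[OF _ exp_ge_add_one_self, of "M / norm (y 0)"] by (simp add: s_def)
    then have "M < exp (Re l * s) * norm (y 0)" using p by (simp add: field_simps)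
    also have "\<dots> = norm (y s)" by (subst y[of s]) (simp add: norm_mult)
    finally show False using M[of s] by simp
  qed
  then show ?thesis using y[of t] by simp
qed

text \<open>The bounded solution is the convolution of \<open>g\<close> with the decaying
  exponential over the whole past. With \<open>G\<close> an antiderivative of the weighted forcing
  it is \<open>exp (l t) (G t - c)\<close>, where \<open>c\<close> is the limit of \<open>G\<close>
  at minus infinity.\<close>

lemma bounded_linear_ode_solution_neg:
  fixes g :: "real \<Rightarrow> complex"
  assumes g: "continuous_on UNIV g" "\<And>t. norm (g t) \<le> M" and l: "Re l < 0"
  shows "\<exists>y. (\<forall>t. (y has_vector_derivative l * y t + g t) (at t)) \<and> (\<forall>t. norm (y t) \<le> M / \<bar>Re l\<bar>)"
proof -
  let ?r = "- Re l"
  have "\<exists>G. \<forall>t. - \<infinity> < ereal t \<longrightarrow> ereal t < \<infinity> \<longrightarrow> (G has_vector_derivative exp (- (l * of_real t)) * g t) (at t)"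
    using g(1) by (intro einterval_antiderivative continuous_intros)
      (auto simp: continuous_on_eq_continuous_at intro!: continuous_intros)
  then obtain G where G: "\<And>t. (G has_vector_derivative exp (- (l * of_real t)) * g t) (at t)" by auto
  have M: "0 \<le> M" using g(2)[of 0] norm_ge_zero order_trans by blast
  \<comment> \<open>The increments of \<open>G\<close> are dominated by those of an explicit
    primitive of the weight, which tends to 0 at minus infinity; this yields both the existence of
    the limit and the final bound.\<close>
  have bd: "norm (G b - G a) \<le> M / ?r * exp (?r * b) - M / ?r * exp (?r * a)" if "a \<le> b" for a b
  proof (cases "a = b")
    case False
    show ?thesis
    proof (rule differentiable_bound_general[where f=G and \<phi>="\<lambda>t. M / ?r * exp (?r * t)"
          and f'="\<lambda>t. exp (- (l * of_real t)) * g t" and \<phi>'="\<lambda>t. M * exp (?r * t)"])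
      show "a < b" using that False by simp
      show "continuous_on {a..b} (\<lambda>t. M / ?r * exp (?r * t))" by (intro continuous_intros)
      show "continuous_on {a..b} G" using G by (meson continuous_at_imp_continuous_on has_vector_derivative_continuous)
      show "((\<lambda>t. M / ?r * exp (?r * t)) has_vector_derivative M * exp (?r * x)) (at x)" for x
        using l by (auto intro!: derivative_eq_intros simp flip: has_real_derivative_iff_has_vector_derivative)
      show "norm (exp (- (l * complex_of_real x)) * g x) \<le> M * exp (?r * x)" for x
        using mult_left_mono[OF g(2)[of x], of "exp (?r * x)"] by (simp add: norm_mult mult.commute)
    qed (rule G)
  qed simp
  have cauchy: "\<exists>c. (G \<longlongrightarrow> c) at_bot"
  proof -
    have "((\<lambda>t. M / ?r * exp (?r * t)) \<longlongrightarrow> M / ?r * 0) at_bot"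
      using l by (intro tendsto_intros filterlim_compose[OF exp_at_bot] filterlim_tendsto_pos_mult_at_bot[OF tendsto_const _ filterlim_ident]) auto
    then have z: "((\<lambda>t. M / ?r * exp (?r * t)) \<longlongrightarrow> 0) at_bot" by simp
    have "Cauchy (\<lambda>n. G (- real n))"
    proof (rule CauchyI)
      fix e :: real assume "0 < e"
      then have "\<forall>\<^sub>F t in at_bot. M / ?r * exp (?r * t) < e" using order_tendstoD(2)[OF z, of e] by simp
      then obtain N where N: "\<And>t. t \<le> N \<Longrightarrow> M / ?r * exp (?r * t) < e"
        unfolding eventually_at_bot_linorder by auto
      obtain K :: nat where K: "real K \<ge> - N" using real_arch_simple by blast
      have A: "norm (G (- real m) - G (- real n)) < e" if "m \<ge> K" "m \<le> n" for m n
      proof -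
        have "norm (G (- real m) - G (- real n)) \<le> M / ?r * exp (?r * (- real m)) - M / ?r * exp (?r * (- real n))"
          by (rule bd) (use that in auto)
        also have "\<dots> \<le> M / ?r * exp (?r * (- real m))" using M l by (simp add: zero_le_mult_iff divide_le_0_iff)
        also have "\<dots> < e" using N[of "- real m"] that K \<open>0 < e\<close> by simp
        finally show ?thesis .
      qed
      show "\<exists>K. \<forall>m\<ge>K. \<forall>n\<ge>K. norm (G (- real m) - G (- real n)) < e"
      proof (intro exI[of _ K] allI impI)
        fix m n assume "K \<le> m" "K \<le> n"
        then show "norm (G (- real m) - G (- real n)) < e"
          using A[of m n] A[of n m] by (cases "m \<le> n") (auto simp: norm_minus_commute)
      qed
    qed
    then obtain c where c: "(\<lambda>n. G (- real n)) \<longlonglongrightarrow> c" using Cauchy_convergent convergentD by blast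
    have nc: "norm (G t - c) \<le> M / ?r * exp (?r * t)" for t
    proof (rule LIMSEQ_le_const2)
      show "(\<lambda>n. norm (G t - G (- real n))) \<longlonglongrightarrow> norm (G t - c)" by (intro tendsto_intros c)
      obtain K :: nat where K: "real K \<ge> - t" using real_arch_simple by blast
      have "norm (G t - G (- real n)) \<le> M / ?r * exp (?r * t)" if "n \<ge> K" for n
      proof -
        have "norm (G t - G (- real n)) \<le> M / ?r * exp (?r * t) - M / ?r * exp (?r * (- real n))"
          by (rule bd) (use that K in linarith)
        also have "\<dots> \<le> M / ?r * exp (?r * t)" using M l by (simp add: zero_le_mult_iff divide_le_0_iff)
        finally show ?thesis .
      qed
      then show "\<exists>N. \<forall>n\<ge>N. norm (G t - G (- real n)) \<le> M / ?r * exp (?r * t)" by blast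
    qed
    have "((\<lambda>t. G t - c) \<longlongrightarrow> 0) at_bot"
      by (rule Lim_null_comparison[OF _ z]) (use nc in simp)
    then show ?thesis using LIM_zero_cancel by blast
  qed
  then obtain c where c: "(G \<longlongrightarrow> c) at_bot" by blast
  have nc: "norm (G t - c) \<le> M / ?r * exp (?r * t)" for t
  proof (rule tendsto_upperbound)
    show "((\<lambda>s. norm (G t - G s)) \<longlongrightarrow> norm (G t - c)) at_bot" by (intro tendsto_intros c)
    have "norm (G t - G s) \<le> M / ?r * exp (?r * t)" if "s \<le> t" for s
    proof -
      have "norm (G t - G s) \<le> M / ?r * exp (?r * t) - M / ?r * exp (?r * s)" by (rule bd) fact
      also have "\<dots> \<le> M / ?r * exp (?r * t)" using M l by (simp add: zero_le_mult_iff divide_le_0_iff)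
      finally show ?thesis .
    qed
    then show "\<forall>\<^sub>F s in at_bot. norm (G t - G s) \<le> M / ?r * exp (?r * t)"
      unfolding eventually_at_bot_linorder by blast
  qed simp
  define y where "y t = exp (l * of_real t) * (G t - c)" for t
  have e: "((\<lambda>t. exp (l * of_real t)) has_vector_derivative l * exp (l * of_real t)) (at t)" for t
  proof -
    have "((\<lambda>z. exp (l * z)) has_field_derivative l * exp (l * of_real t)) (at (of_real t))"
      by (auto intro!: derivative_eq_intros)
    then show ?thesis by (rule has_vector_derivative_real_field)
  qed
  have "(y has_vector_derivative l * y t + g t) (at t)" for t
  proof -
    have "((\<lambda>t. G t - c) has_vector_derivative exp (- (l * of_real t)) * g t) (at t)"
      using has_vector_derivative_diff[OF G has_vector_derivative_const] by simp
    from has_vector_derivative_mult[OF e this] have "(y has_vector_derivative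
       exp (l * of_real t) * (exp (- (l * of_real t)) * g t) + l * exp (l * of_real t) * (G t - c)) (at t)"
      unfolding y_def .
    then show ?thesis by (simp add: y_def mult.assoc[symmetric] exp_minus add.commute)
  qed
  moreover have "norm (y t) \<le> M / \<bar>Re l\<bar>" for t
  proof -
    have "norm (y t) = exp (Re l * t) * norm (G t - c)" by (simp add: y_def norm_mult)
    also have "\<dots> \<le> exp (Re l * t) * (M / ?r * exp (?r * t))" by (intro mult_left_mono nc) simp
    also have "\<dots> = M / \<bar>Re l\<bar>" using l by (simp flip: exp_add)
    finally show ?thesis .
  qed
  ultimately show ?thesis by blast
qed

text \<open>For positive real part, reversing time reduces to the decaying case; \<open>l\<close>
  and the forcing change sign.\<close>

lemma bounded_linear_ode_solution:
  fixes g :: "real \<Rightarrow> complex"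
  assumes g: "continuous_on UNIV g" "\<And>t. norm (g t) \<le> M" and l: "Re l \<noteq> 0"
  shows "\<exists>y. (\<forall>t. (y has_vector_derivative l * y t + g t) (at t)) \<and> (\<forall>t. norm (y t) \<le> M / \<bar>Re l\<bar>)"
proof (cases "Re l < 0")
  case True then show ?thesis by (intro bounded_linear_ode_solution_neg g)
next
  case False
  with l have l': "Re (- l) < 0" by simp
  have "continuous_on UNIV (\<lambda>t. - g (- t))"
    by (intro continuous_intros continuous_on_compose2[OF g(1)]) auto
  moreover have "norm (- g (- t)) \<le> M" for t using g(2) by simp
  ultimately obtain y where y: "\<And>t. (y has_vector_derivative (- l) * y t + - g (- t)) (at t)"
      "\<And>t. norm (y t) \<le> M / \<bar>Re (- l)\<bar>"
    using bounded_linear_ode_solution_neg[OF _ _ l'] by blast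
  have "((\<lambda>t. y (- t)) has_vector_derivative l * y (- t) + g t) (at t)" for t
  proof -
    have "((\<lambda>t. y (- t)) has_vector_derivative (-1) *\<^sub>R ((- l) * y (- t) + - g (- (- t)))) (at t)"
      by (rule vector_diff_chain_at[of uminus "-1" t y, unfolded o_def])
        (use y(1)[of "-t"] in \<open>auto intro!: derivative_eq_intros\<close>)
    then show ?thesis by (simp add: add.commute)
  qed
  then show ?thesis using y(2) by (intro exI[of _ "\<lambda>t. y (- t)"]) auto
qed

subsection \<open>Hyperbolic systems with constant coefficients\<close>

definition cmatrix :: "real^'n^'m \<Rightarrow> complex^'n^'m" where
  "cmatrix B = (\<chi> i j. complex_of_real (B $ i $ j))"

text \<open>Horner evaluation of the polynomial at the matrix \<open>B\<close>, with
  \<open>mat a\<close> standing for the scalar \<open>a\<close>.\<close>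

definition poly_matrix :: "'a::comm_ring_1 poly \<Rightarrow> 'a^'n^'n \<Rightarrow> 'a^'n^'n" where
  "poly_matrix p B = fold_coeffs (\<lambda>a X. mat a + B ** X) p 0"

lemma mat_0 [simp]: "mat 0 = 0"
  by (simp add: mat_def vec_eq_iff)

lemma mat_mult_nth: "(mat a ** X) $ i $ j = a * X $ i $ (j :: 'm::finite)"
  for X :: "'a::comm_ring_1^'m^'n::finite"
proof -
  have "(\<Sum>k\<in>UNIV. (if i = k then a else 0) * X $ k $ j) = (\<Sum>k\<in>UNIV. if i = k then a * X $ k $ j else 0)"
    by (intro sum.cong) auto
  then show ?thesis by (simp add: matrix_matrix_mult_def mat_def)
qed

lemma mult_mat_nth: "(X ** mat a) $ i $ j = X $ i $ j * (a :: 'a::comm_ring_1)"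
proof -
  have "(\<Sum>k\<in>UNIV. X $ i $ k * (if k = j then a else 0)) = (\<Sum>k\<in>UNIV. if k = j then X $ i $ k * a else 0)"
    by (intro sum.cong) auto
  then show ?thesis by (simp add: matrix_matrix_mult_def mat_def)
qed

lemma mat_mult: "mat a ** mat b = (mat (a * b) :: 'a::comm_ring_1^'n::finite^'n)"
  by (simp add: vec_eq_iff mat_mult_nth) (simp add: mat_def)

lemma mat_add: "mat (a + b) = (mat a + mat b :: 'a::comm_ring_1^'n^'n)"
  by (simp add: mat_def vec_eq_iff)

lemma mat_commute: "B ** mat a = (mat a ** B :: 'a::comm_ring_1^'n::finite^'n)"
  by (simp add: vec_eq_iff mat_mult_nth mult_mat_nth mult.commute)

lemma matrix_diff_mult: "(A - B) ** C = A ** C - (B ** C :: 'a::comm_ring_1^'n^'m)"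
  and matrix_mult_diff: "D ** (E - F) = D ** E - (D ** F :: 'a::comm_ring_1^'n^'m)"
  by (simp_all add: matrix_matrix_mult_def vec_eq_iff algebra_simps sum_subtractf)

lemma minus_mult_minus_matrix: "(- X) ** (- Y) = (X ** Y :: 'a::comm_ring_1^'n^'m)"
  by (simp add: matrix_matrix_mult_def)

lemma shift_vector: "(B - mat m) *v x = B *v x - m *s (x :: 'a::comm_ring_1^'n)"
proof -
  have "(\<Sum>k\<in>UNIV. (if i = k then m else 0) * x $ k) = (\<Sum>k\<in>UNIV. if i = k then m * x $ k else 0)" for i
    by (intro sum.cong) auto
  then have "mat m *v x = m *s x"
    by (simp add: matrix_vector_mult_def mat_def vec_eq_iff)
  then show ?thesis by (simp add: matrix_vector_mult_diff_rdistrib)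
qed

lemma poly_matrix_0 [simp]: "poly_matrix 0 B = 0"
  by (simp add: poly_matrix_def)

lemma poly_matrix_pCons [simp]: "poly_matrix (pCons a p) B = mat a + B ** poly_matrix p B"
  by (cases "p = 0 \<and> a = 0") (auto simp: poly_matrix_def)

lemma poly_matrix_add: "poly_matrix (p + q) B = poly_matrix p B + poly_matrix q B"
  by (induction p q rule: poly_induct2) (simp_all add: mat_add matrix_add_ldistrib)

lemma poly_matrix_smult: "poly_matrix (smult c p) B = mat c ** poly_matrix p B"
  by (induction p) (simp_all add: mat_mult matrix_add_ldistrib matrix_mul_assoc mat_commute[of B])

lemma poly_matrix_linear_mult:
  "poly_matrix ([:- m, 1:] * p) B = (B - mat m) ** poly_matrix p (B :: 'a::comm_ring_1^'n^'n)"
proof -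
  have "[:- m, 1:] * p = smult (- m) p + pCons 0 p" by simp
  then have "poly_matrix ([:- m, 1:] * p) B = mat (- m) ** poly_matrix p B + B ** poly_matrix p B"
    by (simp only: poly_matrix_add poly_matrix_smult poly_matrix_pCons mat_0 add_0_left)
  also have "mat (- m) = - (mat m :: 'a^'n^'n)" by (simp add: mat_def vec_eq_iff)
  also have "- mat m ** poly_matrix p B = - (mat m ** poly_matrix p B)"
    by (simp add: matrix_matrix_mult_def vec_eq_iff sum_negf)
  finally show ?thesis by (simp add: matrix_diff_mult)
qed

text \<open>Dependence is wanted for an indexed family, not for a set: a repeated vector shrinks the
  image but gives a relation by itself.\<close>

lemma exists_linear_relation:
  fixes v :: "nat \<Rightarrow> 'a::euclidean_space"
  shows "\<exists>c :: nat \<Rightarrow> real. (\<exists>i\<le>DIM('a). c i \<noteq> 0) \<and> (\<Sum>i\<le>DIM('a). c i *\<^sub>R v i) = 0"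
proof (cases "inj_on v {..DIM('a)}")
  case True
  have "card (v ` {..DIM('a)}) = Suc DIM('a)" using True by (simp add: card_image)
  then have "dependent (v ` {..DIM('a)})" using independent_card_le[of "v ` {..DIM('a)}"] by fastforce
  then obtain u where u: "\<exists>x\<in>v ` {..DIM('a)}. u x \<noteq> 0" "(\<Sum>x\<in>v ` {..DIM('a)}. u x *\<^sub>R x) = 0"
    using dependent_finite[of "v ` {..DIM('a)}"] by auto
  then show ?thesis
    by (intro exI[of _ "\<lambda>i. u (v i)"]) (use True in \<open>auto simp: sum.reindex\<close>)
next
  case False
  then obtain i j where ij: "i \<le> DIM('a)" "j \<le> DIM('a)" "i \<noteq> j" "v i = v j" by (auto simp: inj_on_def)
  define c where "c k = (if k = i then 1 else if k = j then - 1 else 0 :: real)" for k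
  have "(\<Sum>k\<le>DIM('a). c k *\<^sub>R v k) = (\<Sum>k\<le>DIM('a). (if k = i then v i else 0) - (if k = j then v j else 0))"
    using ij(3) by (intro sum.cong) (auto simp: c_def)
  also have "\<dots> = 0" using ij by (simp add: sum_subtractf)
  finally show ?thesis using ij by (intro exI[of _ c]) (auto simp: c_def)
qed

lemma poly_matrix_sum_monom:
  "poly_matrix (\<Sum>i\<in>I. monom (c i) i) B = (\<Sum>i\<in>I. mat (c i) ** poly_matrix (monom 1 i) B)"
proof (induction I rule: infinite_finite_induct)
  case (insert x F)
  have "monom (c x) x = smult (c x) (monom 1 x)" by (simp add: smult_monom)
  with insert show ?case by (simp add: poly_matrix_add poly_matrix_smult)
qed auto

text \<open>The powers of \<open>B\<close> lie in a space of finite real dimension, so one more of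
  them than this dimension is linearly dependent.\<close>

lemma exists_annihilating_poly:
  fixes B :: "complex^'n::finite^'n"
  shows "\<exists>p. p \<noteq> 0 \<and> poly_matrix p B = 0"
proof -
  let ?N = "DIM(complex^'n^'n)"
  obtain c :: "nat \<Rightarrow> real" where c: "\<exists>i\<le>?N. c i \<noteq> 0" "(\<Sum>i\<le>?N. c i *\<^sub>R poly_matrix (monom 1 i) B) = 0"
    using exists_linear_relation[of "\<lambda>i. poly_matrix (monom 1 i) B"] by blast
  have sc: "mat (complex_of_real a) ** X = a *\<^sub>R X" for a and X :: "complex^'n^'n"
    by (simp add: vec_eq_iff mat_mult_nth scaleR_conv_of_real[where 'a=complex])
  let ?p = "\<Sum>i\<le>?N. monom (complex_of_real (c i)) i"
  have "poly_matrix ?p B = 0" using c(2) by (simp only: poly_matrix_sum_monom sc)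
  moreover have "coeff ?p i = c i" if "i \<le> ?N" for i
    using that by (simp add: coeff_sum del: DIM_cart)
  then have "?p \<noteq> 0" using c(1) by (metis coeff_0 of_real_eq_0_iff)
  ultimately show ?thesis by blast
qed

text \<open>The value at \<open>B\<close> of the monic polynomial with roots \<open>ms\<close>. The
  roots are kept as a list so that the recursion below can peel them off one at a time.\<close>

definition root_matrix :: "'a::comm_ring_1^'n^'n \<Rightarrow> 'a list \<Rightarrow> 'a^'n^'n" where
  "root_matrix B ms = foldr (\<lambda>m X. (B - mat m) ** X) ms (mat 1)"

lemma root_matrix_Nil [simp]: "root_matrix B [] = mat 1"
  and root_matrix_Cons [simp]: "root_matrix B (m # ms) = (B - mat m) ** root_matrix B ms"
  by (simp_all add: root_matrix_def)

lemma shift_commute: "(B - mat m) ** (B - mat k) = (B - mat k) ** (B - mat m :: 'a::comm_ring_1^'n::finite^'n)"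
  by (simp add: matrix_mult_diff matrix_diff_mult mat_commute[of B] mat_mult mult.commute algebra_simps)

lemma root_matrix_commute:
  "B ** root_matrix B ms = root_matrix B ms ** (B :: 'a::comm_ring_1^'n::finite^'n)"
proof (induction ms)
  case (Cons m ms)
  have "B ** (B - mat m) = (B - mat m) ** B"
    by (simp add: matrix_mult_diff matrix_diff_mult mat_commute[of B])
  then show ?case using Cons by (simp add: matrix_mul_assoc) (simp add: matrix_mul_assoc[symmetric])
qed simp

lemma root_matrix_remove1:
  fixes B :: "'a::comm_ring_1^'n::finite^'n"
  assumes "m \<in> set ms"
  shows "root_matrix B ms = (B - mat m) ** root_matrix B (remove1 m ms)"
  using assms
proof (induction ms)
  case (Cons k ms)
  show ?case
  proof (cases "m = k")
    case False
    then have "root_matrix B (k # ms) = (B - mat k) ** ((B - mat m) ** root_matrix B (remove1 m ms))"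
      using Cons by simp
    also have "\<dots> = (B - mat m) ** ((B - mat k) ** root_matrix B (remove1 m ms))"
      by (simp add: matrix_mul_assoc shift_commute[of B m k])
    finally show ?thesis using False by simp
  qed simp
qed simp

text \<open>An annihilating polynomial splits over the complex numbers. A shortest list of roots
  with vanishing product contains only eigenvalues: for any other \<open>m\<close> the factor
  \<open>B - mat m\<close> is invertible and could be cancelled.\<close>

lemma exists_root_matrix_zero:
  fixes B :: "complex^'n::finite^'n"
  shows "\<exists>ms. root_matrix B ms = 0 \<and> (\<forall>m\<in>set ms. det (mat m - B) = 0)"
proof -
  have *: "\<exists>ms. root_matrix B ms = 0"
  proof -
    obtain p where p: "p \<noteq> 0" "poly_matrix p B = 0" using exists_annihilating_poly by blast
    obtain R where R: "p = smult (lead_coeff p) (\<Prod>x\<in>#R. [:- x, 1:])"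
      using alg_closed_imp_factorization[OF p(1)] by auto
    obtain ms where ms: "mset ms = R" using ex_mset by blast
    have "(\<Prod>x\<in>#mset ms. [:- x, 1:]) = foldr (\<lambda>m q. [:- m, 1:] * q) ms 1" for ms :: "complex list"
      by (induction ms) auto
    moreover have "poly_matrix (foldr (\<lambda>m q. [:- m, 1:] * q) ms 1) B = root_matrix B ms" for ms
    proof (induction ms)
      case Nil
      show ?case by (simp add: one_pCons)
    next
      case (Cons m ms)
      then show ?case by (simp only: foldr.simps o_def poly_matrix_linear_mult root_matrix_Cons)
    qed
    ultimately have "mat (lead_coeff p) ** root_matrix B ms = 0"
      using p(2) R ms by (metis poly_matrix_smult)
    then have "mat (inverse (lead_coeff p)) ** (mat (lead_coeff p) ** root_matrix B ms) = 0"
      by (simp add: matrix_matrix_mult_def vec_eq_iff)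
    then have "root_matrix B ms = 0"
      using p(1) by (simp add: matrix_mul_assoc mat_mult)
    then show ?thesis by blast
  qed
  define k where "k = (LEAST k. \<exists>ms. length ms = k \<and> root_matrix B ms = 0)"
  have "\<exists>ms. length ms = k \<and> root_matrix B ms = 0"
    unfolding k_def by (rule LeastI_ex) (use * in blast)
  then obtain ms where ms: "length ms = k" "root_matrix B ms = 0" by blast
  have "det (mat m - B) = 0" if m: "m \<in> set ms" for m
  proof (rule ccontr)
    assume "det (mat m - B) \<noteq> 0"
    then obtain X where "X ** (mat m - B) = mat 1" unfolding invertible_det_nz[symmetric] invertible_def by blast
    then have X: "(- X) ** (B - mat m) = mat 1"
      by (simp add: matrix_matrix_mult_def vec_eq_iff algebra_simps)
    have "(- X) ** ((B - mat m) ** root_matrix B (remove1 m ms)) = 0"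
      using ms(2) root_matrix_remove1[OF m, of B] by (simp add: matrix_matrix_mult_def vec_eq_iff)
    then have "root_matrix B (remove1 m ms) = 0" by (simp add: matrix_mul_assoc X)
    moreover have "length (remove1 m ms) < k" using m ms(1) by (metis One_nat_def Suc_pred length_pos_if_in_set length_remove1 lessI)
    ultimately show False unfolding k_def using not_less_Least by blast
  qed
  with ms(2) show ?thesis by blast
qed

lemma bounded_linear_cmatrix_vector: "bounded_linear (\<lambda>x. (M :: complex^'n::finite^'m::finite) *v x)"
proof -
  have "M *v (r *\<^sub>R x) = r *\<^sub>R (M *v x)" for r x
    unfolding vec_eq_iff matrix_vector_mult_def by (simp add: scaleR_right.sum)
  then show ?thesis
    unfolding linear_conv_bounded_linear[symmetric]
    by (intro linearI matrix_vector_right_distrib)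
qed

text \<open>Putzer's algorithm: if \<open>w\<^sub>1\<close> solves the problem for the roots \<open>ms\<close> and the right-hand
  side \<open>y\<close>, where \<open>y' = m y + g\<close>, then \<open>y + (B - m) w\<^sub>1\<close> solves it for \<open>m # ms\<close> and \<open>g\<close>.\<close>

lemma putzer:
  fixes B :: "complex^'n::finite^'n"
  assumes "\<forall>m\<in>set ms. Re m \<noteq> 0"
  shows "\<exists>C\<ge>0. \<forall>g M. continuous_on UNIV g \<and> (\<forall>t. norm (g t) \<le> M) \<longrightarrow>
    (\<exists>w h. (\<forall>t. (w has_vector_derivative B *v w t + g t - root_matrix B ms *v h t) (at t)) \<and>
       (\<forall>t. norm (w t) \<le> C * M))"
  using assms
proof (induction ms)
  case Nil
  have "\<exists>w h. (\<forall>t. (w has_vector_derivative B *v w t + g t - root_matrix B [] *v h t) (at t)) \<and>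
       (\<forall>t. norm (w t) \<le> 0 * M)" for g :: "real \<Rightarrow> complex^'n" and M :: real
  \<comment> \<open>Without roots the product is the identity, so the zero function with residue
    \<open>h = g\<close> qualifies. The residue term records what is still unsolved; it disappears
    once the product over \<open>ms\<close> is the zero matrix.\<close>
  proof (rule exI[of _ "\<lambda>_. 0"], rule exI[of _ g], intro conjI allI)
    fix t
    have "B *v 0 + g t - root_matrix B [] *v g t = 0"
      unfolding root_matrix_Nil matrix_vector_mul_lid matrix_vector_mult_0_right by simp
    then show "((\<lambda>_. 0) has_vector_derivative B *v 0 + g t - root_matrix B [] *v g t) (at t)"
      by (simp only: has_vector_derivative_const)
  qed simp
  then show ?case by (intro exI[where x="0::real"]) simp
next
  case (Cons m ms)
  then obtain C where C: "C \<ge> 0" "\<And>g M. continuous_on UNIV g \<Longrightarrow> (\<forall>t. norm (g t) \<le> M) \<Longrightarrow>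
    \<exists>w h. (\<forall>t. (w has_vector_derivative B *v w t + g t - root_matrix B ms *v h t) (at t)) \<and>
       (\<forall>t. norm (w t) \<le> C * M)" by auto
  obtain K where K: "K \<ge> 0" "\<And>x. norm ((B - mat m) *v x) \<le> norm x * K"
    using bounded_linear.nonneg_bounded[OF bounded_linear_cmatrix_vector] by blast
  let ?D = "real CARD('n) / \<bar>Re m\<bar>"
  have D: "?D \<ge> 0" by simp
  show ?case
  proof (intro exI[of _ "?D + C * ?D * K"] conjI allI impI)
    show "0 \<le> ?D + C * ?D * K" using C K by simp
    fix g :: "real \<Rightarrow> complex^'n" and M assume g: "continuous_on UNIV g \<and> (\<forall>t. norm (g t) \<le> M)"
    have "\<exists>y. (\<forall>t. (y has_vector_derivative m * y t + g t $ i) (at t)) \<and> (\<forall>t. norm (y t) \<le> M / \<bar>Re m\<bar>)" for i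
    proof (rule bounded_linear_ode_solution)
      show "continuous_on UNIV (\<lambda>t. g t $ i)" using g by (intro continuous_intros) auto
      show "norm (g t $ i) \<le> M" for t
          by (rule order_trans[OF Finite_Cartesian_Product.norm_nth_le]) (use g in blast)
    qed (use Cons.prems in auto)
    then obtain y where y: "\<And>i t. (y i has_vector_derivative m * y i t + g t $ i) (at t)"
        "\<And>i t. norm (y i t) \<le> M / \<bar>Re m\<bar>" by metis
    define Y where "Y t = (\<chi> i. y i t)" for t
    have Y': "(Y has_vector_derivative m *s Y t + g t) (at t)" for t
      unfolding has_vector_derivative_vec_iff Y_def using y(1) by simp
    have Yb: "norm (Y t) \<le> ?D * M" for t
    proof -
      have "norm (Y t) \<le> (\<Sum>i\<in>UNIV. norm (Y t $ i))" unfolding norm_vec_def by (rule L2_set_le_sum) simp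
      also have "\<dots> \<le> (\<Sum>i\<in>(UNIV::'n set). M / \<bar>Re m\<bar>)" by (intro sum_mono) (simp add: Y_def y(2))
      finally show ?thesis by simp
    qed
    have "continuous_on UNIV Y" using Y' by (meson continuous_at_imp_continuous_on has_vector_derivative_continuous)
    then obtain w h where w: "\<And>t. (w has_vector_derivative B *v w t + Y t - root_matrix B ms *v h t) (at t)"
       "\<And>t. norm (w t) \<le> C * (?D * M)" using C(2)[of Y "?D * M"] Yb by blast
    show "\<exists>w h. (\<forall>t. (w has_vector_derivative B *v w t + g t - root_matrix B (m # ms) *v h t) (at t)) \<and>
       (\<forall>t. norm (w t) \<le> (?D + C * ?D * K) * M)"
    proof (intro exI conjI allI)
      fix t
      have "((\<lambda>t. Y t + (B - mat m) *v w t) has_vector_derivative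
         (m *s Y t + g t) + (B - mat m) *v (B *v w t + Y t - root_matrix B ms *v h t)) (at t)"
        by (intro has_vector_derivative_add Y' bounded_linear.has_vector_derivative[OF bounded_linear_cmatrix_vector w(1)])
      also have "(m *s Y t + g t) + (B - mat m) *v (B *v w t + Y t - root_matrix B ms *v h t)
        = B *v (Y t + (B - mat m) *v w t) + g t - root_matrix B (m # ms) *v h t"
      proof -
        have c: "(B - mat m) *v (B *v x) = B *v ((B - mat m) *v x)" for x
          by (simp add: matrix_vector_mul_assoc matrix_mult_diff matrix_diff_mult mat_commute[of B])
        show ?thesis
          by (simp add: matrix_vector_right_distrib matrix_vector_mult_diff_distrib c
             matrix_vector_mul_assoc[symmetric] shift_vector[of B m "Y t"])
      qed
      finally show "((\<lambda>t. Y t + (B - mat m) *v w t) has_vector_derivative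
         B *v (Y t + (B - mat m) *v w t) + g t - root_matrix B (m # ms) *v h t) (at t)" .
      have "norm (Y t + (B - mat m) *v w t) \<le> ?D * M + (C * (?D * M)) * K"
        by (intro norm_triangle_le add_mono Yb order_trans[OF K(2)] mult_right_mono w(2) K(1))
      then show "norm (Y t + (B - mat m) *v w t) \<le> (?D + C * ?D * K) * M" by (simp add: algebra_simps)
    qed
  qed
qed

text \<open>The roots are peeled off from the front: the product over the remaining ones, applied to
  \<open>w\<close>, satisfies \<open>v' = m v\<close> in every component and is bounded, so it
  vanishes because \<open>Re m\<close> is nonzero.\<close>

lemma putzer_unique:
  fixes B :: "complex^'n::finite^'n"
  assumes "\<forall>m\<in>set ms. Re m \<noteq> 0" and w': "\<And>t. (w has_vector_derivative B *v w t) (at t)"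
    and "bounded (range w)" "\<And>t. root_matrix B ms *v w t = 0"
  shows "w t = 0"
  using assms
proof (induction ms arbitrary: t)
  case (Cons m ms)
  define v where "v t = root_matrix B ms *v w t" for t
  have v': "(v has_vector_derivative B *v v t) (at t)" for t
    unfolding v_def matrix_vector_mul_assoc root_matrix_commute
    using bounded_linear.has_vector_derivative[OF bounded_linear_cmatrix_vector w'] by (simp add: matrix_vector_mul_assoc)
  have "(B - mat m) *v v t = 0" for t using Cons.prems(4) by (simp add: v_def matrix_vector_mul_assoc)
  then have "B *v v t = m *s v t" for t by (simp add: shift_vector)
  with v' have v'': "((\<lambda>t. v t $ i) has_vector_derivative m * v t $ i) (at t)" for t i
    by (simp add: has_vector_derivative_vec_iff)
  have "bounded (range v)"
    using bounded_linear_image[OF Cons.prems(3) bounded_linear_cmatrix_vector] by (simp add: v_def image_image)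
  then have "bounded (range (\<lambda>t. v t $ i))" for i
    using bounded_linear_image[OF _ bounded_linear_vec_nth[of i], of "range v"] by (simp add: image_image)
  then have "v t $ i = 0" for t i
    by (intro bounded_linear_ode_zero[OF v'']) (use Cons.prems(1) in simp)
  then have "v t = 0" for t unfolding vec_eq_iff by simp
  then have "root_matrix B ms *v w t = 0" for t unfolding v_def .
  moreover have "\<forall>m\<in>set ms. Re m \<noteq> 0" using Cons.prems(1) by simp
  ultimately show ?case by (intro Cons.IH Cons.prems)
qed simp

definition hyperbolic_matrix :: "real^'n^'n \<Rightarrow> bool" where
  "hyperbolic_matrix B \<longleftrightarrow> (\<forall>z. Re z = 0 \<longrightarrow> det (mat z - cmatrix B) \<noteq> 0)"

text \<open>Reversing time replaces \<open>B\<close> by \<open>- B\<close>; behaviour at minus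
  infinity is deduced from behaviour at plus infinity in this way.\<close>

lemma hyperbolic_matrix_uminus:
  assumes "hyperbolic_matrix B" shows "hyperbolic_matrix (- B)"
  unfolding hyperbolic_matrix_def
proof (intro allI impI)
  fix z :: complex assume z: "Re z = 0"
  have "mat z - cmatrix (- B) = - (mat (- z) - cmatrix B)"
    by (simp add: mat_def cmatrix_def vec_eq_iff)
  moreover have "det (mat (- z) - cmatrix B) \<noteq> 0" using assms z by (simp add: hyperbolic_matrix_def)
  then have "invertible (mat (- z) - cmatrix B)" by (simp add: invertible_det_nz)
  then obtain X where "X ** (mat (- z) - cmatrix B) = mat 1" unfolding invertible_def by blast
  then have "(- X) ** (- (mat (- z) - cmatrix B)) = mat 1"
    by (simp only: minus_mult_minus_matrix)
  then have "invertible (- (mat (- z) - cmatrix B))" using matrix_left_right_inverse invertible_def by blast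
  ultimately show "det (mat z - cmatrix (- B)) \<noteq> 0" by (metis invertible_det_nz)
qed

lemma cmatrix_mult_Re: "Re ((cmatrix B *v w) $ i) = (B *v (\<chi> j. Re (w $ j))) $ i"
  by (simp add: cmatrix_def matrix_vector_mult_def)

lemma hyperbolic_bounded_unique:
  fixes B :: "real^'n::finite^'n"
  assumes "hyperbolic_matrix B" "\<And>t. (w has_vector_derivative B *v w t) (at t)" "bounded (range w)"
  shows "w t = 0"
proof -
  obtain ms where ms: "root_matrix (cmatrix B) ms = 0" "\<forall>m\<in>set ms. det (mat m - cmatrix B) = 0"
    using exists_root_matrix_zero by blast
  define v where "v t = (\<chi> i. complex_of_real (w t $ i))" for t
  have "(v has_vector_derivative cmatrix B *v v t) (at t)" for t
    unfolding has_vector_derivative_vec_iff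
  proof
    fix i
    have "((\<lambda>t. w t $ i) has_vector_derivative (B *v w t) $ i) (at t)"
      using assms(2)[of t] by (simp add: has_vector_derivative_vec_iff)
    then have "((\<lambda>t. complex_of_real (w t $ i)) has_vector_derivative of_real ((B *v w t) $ i)) (at t)"
      by (intro has_vector_derivative_of_real) (simp add: has_real_derivative_iff_has_vector_derivative)
    then show "((\<lambda>t. v t $ i) has_vector_derivative (cmatrix B *v v t) $ i) (at t)"
      by (simp add: v_def cmatrix_def matrix_vector_mult_def)
  qed
  moreover have "norm (v t) = norm (w t)" for t by (simp add: v_def norm_vec_def)
  then have "bounded (range v)" using assms(3) by (auto simp: bounded_iff)
  moreover have "\<forall>m\<in>set ms. Re m \<noteq> 0" using ms(2) assms(1) by (auto simp: hyperbolic_matrix_def)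
  moreover have "root_matrix (cmatrix B) ms *v v t = 0" for t by (simp add: ms(1))
  ultimately have "v t = 0" by (intro putzer_unique[of ms v "cmatrix B"])
  then have "complex_of_real (w t $ i) = 0" for i unfolding v_def vec_eq_iff by simp
  then show ?thesis unfolding vec_eq_iff by simp
qed

text \<open>After complexification the recursion runs over a list of roots whose product vanishes,
  so no residue is left; the real part solves the real equation. The constant is uniform in
  \<open>g\<close>, which makes the solution operator bounded.\<close>

lemma hyperbolic_bounded_solution:
  fixes B :: "real^'n::finite^'n"
  assumes "hyperbolic_matrix B"
  shows "\<exists>C\<ge>0. \<forall>g M. continuous_on UNIV g \<and> (\<forall>t. norm (g t) \<le> M) \<longrightarrow>
    (\<exists>w. (\<forall>t. (w has_vector_derivative B *v w t + g t) (at t)) \<and> (\<forall>t. norm (w t) \<le> C * M))"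
proof -
  obtain ms where ms: "root_matrix (cmatrix B) ms = 0" "\<forall>m\<in>set ms. det (mat m - cmatrix B) = 0"
    using exists_root_matrix_zero by blast
  have "\<forall>m\<in>set ms. Re m \<noteq> 0" using ms(2) assms(1) by (auto simp: hyperbolic_matrix_def)
  from putzer[OF this, of "cmatrix B"] obtain C where C: "C \<ge> 0"
    "\<And>g M. continuous_on UNIV g \<Longrightarrow> (\<forall>t. norm (g t) \<le> M) \<Longrightarrow>
    \<exists>w. (\<forall>t. (w has_vector_derivative cmatrix B *v w t + g t) (at t)) \<and> (\<forall>t. norm (w t) \<le> C * M)"
    unfolding ms(1) by auto
  show ?thesis
  proof (intro exI[of _ C] conjI allI impI C(1))
    fix g :: "real \<Rightarrow> real^'n" and M assume g: "continuous_on UNIV g \<and> (\<forall>t. norm (g t) \<le> M)"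
    define G where "G t = (\<chi> i. complex_of_real (g t $ i))" for t
    have "continuous_on UNIV G"
      unfolding G_def using g by (intro continuous_intros) auto
    moreover have "norm (G t) = norm (g t)" for t by (simp add: G_def norm_vec_def)
    ultimately obtain W where W: "\<And>t. (W has_vector_derivative cmatrix B *v W t + G t) (at t)" "\<And>t. norm (W t) \<le> C * M"
      using C(2)[of G M] g by auto
    define w where "w t = (\<chi> i. Re (W t $ i))" for t
    have "(w has_vector_derivative B *v w t + g t) (at t)" for t
      unfolding has_vector_derivative_vec_iff
    proof
      fix i
      have "((\<lambda>t. W t $ i) has_vector_derivative (cmatrix B *v W t + G t) $ i) (at t)"
        using W(1)[of t] by (simp add: has_vector_derivative_vec_iff)
      then have "((\<lambda>t. Re (W t $ i)) has_vector_derivative Re ((cmatrix B *v W t + G t) $ i)) (at t)"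
        by (rule bounded_linear.has_vector_derivative[OF bounded_linear_Re])
      then show "((\<lambda>t. w t $ i) has_vector_derivative (B *v w t + g t) $ i) (at t)"
        by (simp add: w_def cmatrix_mult_Re G_def)
    qed
    moreover have "norm (w t) \<le> C * M" for t
    proof -
      have "norm (w t) \<le> norm (W t)"
        unfolding norm_vec_def by (intro L2_set_mono) (auto simp: w_def abs_Re_le_cmod)
      then show ?thesis using W(2) order_trans by blast
    qed
    ultimately show "\<exists>w. (\<forall>t. (w has_vector_derivative B *v w t + g t) (at t)) \<and> (\<forall>t. norm (w t) \<le> C * M)" by blast
  qed
qed

section \<open>Integrals over the whole line\<close>

lemma integrable_inverse_one_plus_square: "integrable lborel (\<lambda>t::real. 1 / (1 + t\<^sup>2))"
proof -
  have "set_integrable lborel (einterval (- \<infinity>) \<infinity>) (\<lambda>t::real. 1 / (1 + t\<^sup>2))"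
  proof (rule interval_integral_FTC_nonneg(1)[where F=arctan and A="- (pi/2)" and B="pi/2"])
    show "DERIV arctan x :> 1 / (1 + x\<^sup>2)" for x
      using DERIV_arctan[of x] by (simp add: divide_inverse)
    show "isCont (\<lambda>t. 1 / (1 + t\<^sup>2)) x" for x :: real
    proof -
      have "1 + x\<^sup>2 \<noteq> 0" by (metis power_one sum_power2_eq_zero_iff zero_neq_one)
      then show ?thesis by (intro continuous_intros)
    qed
  qed (auto simp: ereal_tendsto_simps intro: tendsto_arctan_at_bot tendsto_arctan_at_top)
  then show ?thesis by (simp add: set_integrable_def)
qed

lemma integrable_exp_decay:
  fixes f :: "real \<Rightarrow> 'a::euclidean_space"
  assumes f: "continuous_on UNIV f" and "\<delta> > 0"
    and top: "\<forall>\<^sub>F t in at_top. norm (f t) \<le> C * exp (- \<delta> * t)"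
    and bot: "\<forall>\<^sub>F t in at_bot. norm (f t) \<le> D * exp (\<delta> * t)"
  shows "integrable lborel f" and "(f \<longlongrightarrow> 0) at_top" and "(f \<longlongrightarrow> 0) at_bot"
proof -
  \<comment> \<open>Exponential decay survives multiplication by \<open>1 + t\<^sup>2\<close>; the
    resulting global bound dominates \<open>f\<close> by a multiple of the integrable function
    \<open>1 / (1 + t\<^sup>2)\<close>.\<close>
  let ?g = "\<lambda>t. norm (f t) * (1 + t\<^sup>2)"
  have lim: "((\<lambda>t. C * exp (- \<delta> * t) * (1 + t\<^sup>2)) \<longlongrightarrow> 0) at_top"
    "((\<lambda>t. D * exp (\<delta> * t) * (1 + t\<^sup>2)) \<longlongrightarrow> 0) at_bot"
    using \<open>\<delta> > 0\<close> by real_asymp+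
  have up: "(?g \<longlongrightarrow> 0) at_top"
    by (rule tendsto_sandwich[OF _ _ tendsto_const lim(1)]) (use top in \<open>auto elim!: eventually_mono intro!: mult_right_mono\<close>)
  have down: "(?g \<longlongrightarrow> 0) at_bot"
    by (rule tendsto_sandwich[OF _ _ tendsto_const lim(2)]) (use bot in \<open>auto elim!: eventually_mono intro!: mult_right_mono\<close>)
  have le: "norm (f t) \<le> ?g t" for t by (simp add: algebra_simps)
  show "(f \<longlongrightarrow> 0) at_top" by (rule Lim_null_comparison[OF _ up]) (use le in simp)
  show "(f \<longlongrightarrow> 0) at_bot" by (rule Lim_null_comparison[OF _ down]) (use le in simp)
  obtain a where a: "\<And>t. t \<ge> a \<Longrightarrow> ?g t \<le> 1"
    using order_tendstoD(2)[OF up zero_less_one] unfolding eventually_at_top_linorder by (meson less_imp_le)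
  obtain b where b: "\<And>t. t \<le> b \<Longrightarrow> ?g t \<le> 1"
    using order_tendstoD(2)[OF down zero_less_one] unfolding eventually_at_bot_linorder by (meson less_imp_le)
  have "continuous_on {b..a} ?g" using f by (intro continuous_intros) (auto intro: continuous_on_subset)
  then have "bounded (?g ` {b..a})" by (intro compact_imp_bounded compact_continuous_image) auto
  then obtain K where "\<forall>y\<in>?g ` {b..a}. norm y \<le> K" unfolding bounded_iff by blast
  then have K: "?g t \<le> K" if "t \<in> {b..a}" for t using that by fastforce
  have "?g t \<le> max 1 K" for t using a[of t] b[of t] K[of t] by (cases "t \<le> b"; cases "t \<ge> a") auto
  then have *: "norm (f t) \<le> max 1 K * (1 / (1 + t\<^sup>2))" for t
    by (simp add: pos_le_divide_eq add_pos_nonneg)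
  show "integrable lborel f"
  proof (rule Bochner_Integration.integrable_bound)
    show "integrable lborel (\<lambda>t. max 1 K * (1 / (1 + t\<^sup>2)))"
      by (intro integrable_mult_right integrable_inverse_one_plus_square)
    show "f \<in> borel_measurable lborel" using f by (simp add: borel_measurable_continuous_onI)
    have "norm (f t) \<le> norm (max 1 K * (1 / (1 + t\<^sup>2)))" for t
      using *[of t] by (metis abs_ge_self order_trans real_norm_def)
    then show "AE t in lborel. norm (f t) \<le> norm (max 1 K * (1 / (1 + t\<^sup>2)))" by simp
  qed
qed

lemma integral_FTC_line:
  fixes F :: "real \<Rightarrow> 'a::euclidean_space"
  assumes "\<And>t. (F has_vector_derivative f t) (at t)" "continuous_on UNIV f" "integrable lborel f"
    and "(F \<longlongrightarrow> a) at_bot" "(F \<longlongrightarrow> b) at_top"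
  shows "(LINT t|lborel. f t) = b - a"
proof -
  have "(LBINT t=-\<infinity>..\<infinity>. f t) = b - a"
    by (rule interval_integral_FTC_integrable[where F=F])
      (use assms in \<open>auto simp: ereal_tendsto_simps continuous_on_eq_continuous_at set_integrable_def\<close>)
  then show ?thesis by (simp add: interval_integral_to_infinity_eq interval_lebesgue_integral_def set_lebesgue_integral_def)
qed

lemma exists_antiderivative:
  fixes f :: "real \<Rightarrow> 'a::euclidean_space"
  assumes "continuous_on UNIV f"
  shows "\<exists>F. F a = 0 \<and> (\<forall>t. (F has_vector_derivative f t) (at t))"
proof -
  have "\<exists>F. \<forall>t. - \<infinity> < ereal t \<longrightarrow> ereal t < \<infinity> \<longrightarrow> (F has_vector_derivative f t) (at t)"
    using assms by (intro einterval_antiderivative) (auto simp: continuous_on_eq_continuous_at)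
  then obtain F where F: "\<And>t. (F has_vector_derivative f t) (at t)" by auto
  show ?thesis
    by (rule exI[of _ "\<lambda>t. F t - F a"]) (auto intro!: derivative_eq_intros F)
qed

lemma antiderivative_unique:
  fixes F G :: "real \<Rightarrow> 'a::real_normed_vector"
  assumes "F a = G a" "\<And>t. (F has_vector_derivative f t) (at t)" "\<And>t. (G has_vector_derivative f t) (at t)"
  shows "F t = G t"
proof -
  have "((\<lambda>t. F t - G t) has_vector_derivative 0) (at t)" for t
    using has_vector_derivative_diff[OF assms(2,3)] by simp
  then obtain c where "\<And>t. F t - G t = c"
    using has_vector_derivative_zero_constant[of UNIV "\<lambda>t. F t - G t"] by auto
  then show ?thesis using assms(1) by (metis eq_iff_diff_eq_0)
qed

section \<open>Operators on the Banach space of bounded continuous functions\<close>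

instance bcontfun :: (metric_space, banach) banach ..

lemma bounded_linear_bcontfunI:
  fixes G :: "'x::real_normed_vector \<Rightarrow> 'd::topological_space \<Rightarrow> 'b::real_normed_vector"
  assumes "\<And>x. continuous_on UNIV (G x)" "\<And>x t. norm (G x t) \<le> K * norm x"
    and "\<And>x y t. G (x + y) t = G x t + G y t" "\<And>r x t. G (r *\<^sub>R x) t = r *\<^sub>R G x t"
  shows "\<exists>P :: 'x \<Rightarrow> ('d \<Rightarrow>\<^sub>C 'b). bounded_linear P \<and> (\<forall>x t. apply_bcontfun (P x) t = G x t) \<and> (\<forall>x. norm (P x) \<le> K * norm x)"
proof -
  define P where "P x = Bcontfun (G x)" for x
  have P: "apply_bcontfun (P x) t = G x t" for x t
    unfolding P_def by (subst Bcontfun_inverse) (auto intro: bcontfun_normI assms)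
  have n: "norm (P x) \<le> K * norm x" for x by (rule norm_bound) (simp add: P assms)
  have "bounded_linear P"
    by (rule bounded_linear_intro[of _ K]) (auto intro!: bcontfun_eqI simp: P assms n mult.commute)
  with P n show ?thesis by blast
qed

lemma norm_apply_bcontfun: "norm (apply_bcontfun f t) \<le> norm (f :: _ \<Rightarrow>\<^sub>C 'b::real_normed_vector)"
  by (rule norm_bounded)

text \<open>\<open>N\<close> is the inverse of \<open>1 - T\<close>. The Banach fixed point theorem
  provides its values, and uniqueness of the fixed point its linearity.\<close>

lemma neumann_inverse:
  fixes T :: "'x::banach \<Rightarrow> 'x"
  assumes T: "bounded_linear T" and half: "\<And>x. norm (T x) \<le> norm x / 2"
  shows "\<exists>N. bounded_linear N \<and> (\<forall>x. N x = x + T (N x))"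
proof -
  interpret T: bounded_linear T by fact
  have ex: "\<exists>!y. x + T y = y" for x
  proof (rule banach_fix_type[of "1/2"])
    show "\<forall>y z. dist (x + T y) (x + T z) \<le> 1 / 2 * dist y z"
      using half by (simp add: dist_norm T.diff[symmetric])
  qed auto
  then obtain N where N: "\<And>x. x + T (N x) = N x" by metis
  have u: "y = N x" if "x + T y = y" for x y using ex[of x] N[of x] that by blast
  have "bounded_linear N"
  proof (rule bounded_linear_intro[of _ 2])
    show "N (x + y) = N x + N y" for x y
      by (rule u[symmetric]) (use arg_cong2[OF N[of x] N[of y], of "(+)"] in \<open>simp add: T.add algebra_simps\<close>)
    show "N (r *\<^sub>R x) = r *\<^sub>R N x" for r x
      by (rule u[symmetric]) (use N[of x] in \<open>simp add: T.scaleR scaleR_add_right[symmetric]\<close>)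
    show "norm (N x) \<le> norm x * 2" for x
      using norm_triangle_ineq[of x "T (N x)"] half[of "N x"] N[of x] by simp
  qed
  then show ?thesis using N by metis
qed

text \<open>\<open>R\<close> inverts \<open>d/dt - B\<close> on bounded functions. It is assembled
  from a choice of bounded solutions, and uniqueness of these solutions makes the choice
  linear.\<close>

lemma hyperbolic_inverse:
  fixes B :: "real^'n::finite^'n"
  assumes B: "hyperbolic_matrix B"
  shows "\<exists>R C. bounded_linear R \<and> (\<forall>h. norm (R h) \<le> C * norm h) \<and> C \<ge> 0 \<and>
    (\<forall>(h :: real \<Rightarrow>\<^sub>C (real^'n)) t. (apply_bcontfun (R h) has_vector_derivative B *v apply_bcontfun (R h) t + apply_bcontfun h t) (at t)) \<and>
    (\<forall>(h :: real \<Rightarrow>\<^sub>C (real^'n)) w. (\<forall>t. (w has_vector_derivative B *v w t + apply_bcontfun h t) (at t)) \<and> bounded (range w) \<longrightarrow>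
       (\<forall>t. w t = apply_bcontfun (R h) t))"
proof -
  obtain C where C: "C \<ge> 0" "\<And>g M. continuous_on UNIV g \<Longrightarrow> (\<And>t. norm (g t) \<le> M) \<Longrightarrow>
    (\<exists>w. (\<forall>t. (w has_vector_derivative B *v w t + g t) (at t)) \<and> (\<forall>t. norm (w t) \<le> C * M))"
    using hyperbolic_bounded_solution[OF B] by blast
  have "\<exists>w. (\<forall>t. (w has_vector_derivative B *v w t + apply_bcontfun h t) (at t)) \<and> (\<forall>t. norm (w t) \<le> C * norm h)"
    for h :: "real \<Rightarrow>\<^sub>C (real^'n)"
    by (rule C(2)) (auto simp: norm_apply_bcontfun)
  then obtain G where G: "\<And>h t. (G h has_vector_derivative B *v G h t + apply_bcontfun h t) (at t)"
    "\<And>h t. norm (G h t) \<le> C * norm h" by metis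
  have u: "v t = w t"
    if v: "\<And>t. (v has_vector_derivative B *v v t + apply_bcontfun h t) (at t)" "bounded (range v)"
    and w: "\<And>t. (w has_vector_derivative B *v w t + apply_bcontfun h t) (at t)" "bounded (range w)" for v w h t
  proof -
    have "((\<lambda>t. v t - w t) has_vector_derivative B *v (v t - w t)) (at t)" for t
      using has_vector_derivative_diff[OF v(1) w(1), of t] by (simp add: matrix_vector_mult_diff_distrib)
    moreover have "bounded (range (\<lambda>t. v t - w t))" using v(2) w(2) by (rule bounded_minus_comp)
    ultimately have "v t - w t = 0" by (rule hyperbolic_bounded_unique[OF B])
    then show ?thesis by simp
  qed
  have bG: "bounded (range (G h))" for h using G(2) by (auto simp: bounded_iff)
  have "\<exists>R :: (real \<Rightarrow>\<^sub>C (real^'n)) \<Rightarrow> (real \<Rightarrow>\<^sub>C (real^'n)). bounded_linear R \<and> (\<forall>x t. apply_bcontfun (R x) t = G x t) \<and> (\<forall>x. norm (R x) \<le> C * norm x)"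
  proof (rule bounded_linear_bcontfunI)
    show "continuous_on UNIV (G h)" for h using G(1) by (meson continuous_at_imp_continuous_on has_vector_derivative_continuous)
    show "norm (G h t) \<le> C * norm h" for h t by (rule G)
    show "G (h + k) t = G h t + G k t" for h k t
    proof (rule u[where h="h + k"])
      show "(G (h + k) has_vector_derivative B *v G (h + k) t + apply_bcontfun (h + k) t) (at t)" for t by (rule G)
      show "((\<lambda>t. G h t + G k t) has_vector_derivative B *v (G h t + G k t) + apply_bcontfun (h + k) t) (at t)" for t
        using has_vector_derivative_add[OF G(1)[of h t] G(1)[of k t]]
        by (simp add: matrix_vector_right_distrib plus_bcontfun.rep_eq add.assoc add.left_commute)
      show "bounded (range (\<lambda>t. G h t + G k t))" by (intro bounded_plus_comp bG)
    qed (rule bG)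
    show "G (r *\<^sub>R h) t = r *\<^sub>R G h t" for r h t
    proof (rule u[where h="r *\<^sub>R h"])
      show "(G (r *\<^sub>R h) has_vector_derivative B *v G (r *\<^sub>R h) t + apply_bcontfun (r *\<^sub>R h) t) (at t)" for t by (rule G)
      show "((\<lambda>t. r *\<^sub>R G h t) has_vector_derivative B *v (r *\<^sub>R G h t) + apply_bcontfun (r *\<^sub>R h) t) (at t)" for t
        using bounded_linear.has_vector_derivative[OF bounded_linear_scaleR_right G(1)[of h t]]
        by (simp add: matrix_vector_mult_scaleR scaleR_bcontfun.rep_eq scaleR_add_right)
      show "bounded (range (\<lambda>t. r *\<^sub>R G h t))" by (intro bounded_scaleR_comp bG)
    qed (rule bG)
  qed
  then obtain R :: "(real \<Rightarrow>\<^sub>C (real^'n)) \<Rightarrow> (real \<Rightarrow>\<^sub>C (real^'n))" where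
    R: "bounded_linear R" "\<And>h t. apply_bcontfun (R h) t = G h t" "\<And>h. norm (R h) \<le> C * norm h" by blast
  then have RG: "apply_bcontfun (R h) = G h" for h by auto
  show ?thesis
    using R C(1) G(1) u[OF _ _ G(1) bG] by (intro exI[of _ R] exI[of _ C]) (auto simp: RG)
qed

text \<open>The equation with coefficient \<open>At\<close> is the fixed point equation
  \<open>w = R0 (h + E w)\<close> for the small multiplication operator \<open>E = At - B\<close>.
  The threshold \<epsilon> makes the norm of \<open>R0 E\<close> at most 1/2, so that
  \<open>1 - R0 E\<close> is invertible.\<close>

lemma perturbed_inverse:
  fixes B :: "real^'n::finite^'n"
  assumes B: "hyperbolic_matrix B"
  shows "\<exists>\<epsilon>>0. \<forall>At :: real \<Rightarrow> real^'n^'n. continuous_on UNIV At \<and> (\<forall>t x. norm (At t *v x - B *v x) \<le> \<epsilon> * norm x) \<longrightarrow>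
     (\<exists>R. bounded_linear R \<and> (\<forall>(h :: real \<Rightarrow>\<^sub>C (real^'n)) t. (apply_bcontfun (R h) has_vector_derivative At t *v apply_bcontfun (R h) t + apply_bcontfun h t) (at t)))"
proof -
  obtain R0 C where R0: "bounded_linear R0" "\<And>h. norm (R0 h) \<le> C * norm h" "C \<ge> 0"
    "\<And>(h :: real \<Rightarrow>\<^sub>C (real^'n)) t. (apply_bcontfun (R0 h) has_vector_derivative B *v apply_bcontfun (R0 h) t + apply_bcontfun h t) (at t)"
    using hyperbolic_inverse[OF B] by blast
  define \<epsilon> where "\<epsilon> = 1 / (2 * (C + 1))"
  have \<epsilon>: "\<epsilon> > 0" "C * \<epsilon> \<le> 1/2" using R0(3) by (auto simp: \<epsilon>_def field_simps)
  show ?thesis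
  proof (intro exI[of _ \<epsilon>] conjI allI impI \<epsilon>(1))
    fix At :: "real \<Rightarrow> real^'n^'n"
    assume At: "continuous_on UNIV At \<and> (\<forall>t x. norm (At t *v x - B *v x) \<le> \<epsilon> * norm x)"
    have "\<exists>E :: (real \<Rightarrow>\<^sub>C (real^'n)) \<Rightarrow> (real \<Rightarrow>\<^sub>C (real^'n)). bounded_linear E \<and>
       (\<forall>w t. apply_bcontfun (E w) t = At t *v apply_bcontfun w t - B *v apply_bcontfun w t) \<and> (\<forall>w. norm (E w) \<le> \<epsilon> * norm w)"
    proof (rule bounded_linear_bcontfunI)
      fix w v :: "real \<Rightarrow>\<^sub>C (real^'n)" and t r
      show "continuous_on UNIV (\<lambda>t. At t *v w t - B *v w t)"
        using At unfolding matrix_vector_mult_def by (intro continuous_intros) auto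
      show "norm (At t *v w t - B *v w t) \<le> \<epsilon> * norm w"
        using At \<epsilon>(1) norm_apply_bcontfun[of w t] by (meson less_imp_le mult_left_mono order_trans)
    qed (simp_all add: plus_bcontfun.rep_eq scaleR_bcontfun.rep_eq matrix_vector_right_distrib
           matrix_vector_mult_scaleR scaleR_diff_right)
    then obtain E :: "(real \<Rightarrow>\<^sub>C (real^'n)) \<Rightarrow> (real \<Rightarrow>\<^sub>C (real^'n))" where E: "bounded_linear E"
      "\<And>w t. apply_bcontfun (E w) t = At t *v apply_bcontfun w t - B *v apply_bcontfun w t" "\<And>w. norm (E w) \<le> \<epsilon> * norm w" by blast
    have "norm (R0 (E w)) \<le> norm w / 2" for w
    proof -
      have "norm (R0 (E w)) \<le> C * (\<epsilon> * norm w)" using R0(2,3) E(3) by (meson mult_left_mono order_trans)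
      also have "\<dots> \<le> 1/2 * norm w" using mult_right_mono[OF \<epsilon>(2), of "norm w"] by (simp add: mult.assoc)
      finally show ?thesis by simp
    qed
    then obtain N where N: "bounded_linear N" "\<And>x. N x = x + R0 (E (N x))"
      using neumann_inverse[of "\<lambda>w. R0 (E w)"] bounded_linear_compose[OF R0(1) E(1)] by auto
    define R where "R h = N (R0 h)" for h
    have R: "R h = R0 (h + E (R h))" for h
      unfolding R_def using N(2)[of "R0 h"] by (simp add: linear_add[OF bounded_linear.linear[OF R0(1)]])
    have "(apply_bcontfun (R h) has_vector_derivative At t *v apply_bcontfun (R h) t + apply_bcontfun h t) (at t)" for h t
    proof -
      have "(apply_bcontfun (R0 (h + E (R h))) has_vector_derivative B *v apply_bcontfun (R0 (h + E (R h))) t + apply_bcontfun (h + E (R h)) t) (at t)" by (rule R0)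
      then show ?thesis unfolding R[symmetric] by (simp add: plus_bcontfun.rep_eq E(2) add.commute)
    qed
    moreover have "bounded_linear R" unfolding R_def by (rule bounded_linear_compose[OF N(1) R0(1)])
    ultimately show "\<exists>R. bounded_linear R \<and> (\<forall>(h :: real \<Rightarrow>\<^sub>C (real^'n)) t. (apply_bcontfun (R h) has_vector_derivative At t *v apply_bcontfun (R h) t + apply_bcontfun h t) (at t))"
      by blast
  qed
qed

subsection \<open>Bounded solutions of asymptotically hyperbolic systems\<close>

lemma norm_matrix_vector_le:
  fixes M :: "real^'n::finite^'m::finite"
  shows "norm (M *v x) \<le> (\<Sum>i\<in>UNIV. \<Sum>j\<in>UNIV. \<bar>M $ i $ j\<bar>) * norm x"
proof -
  have "norm (M *v x) \<le> (\<Sum>i\<in>UNIV. \<bar>(M *v x) $ i\<bar>)" by (rule norm_le_l1_cart)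
  also have "\<dots> \<le> (\<Sum>i\<in>UNIV. \<Sum>j\<in>UNIV. \<bar>M $ i $ j\<bar> * norm x)"
  proof (rule sum_mono)
    fix i
    have "\<bar>(M *v x) $ i\<bar> \<le> (\<Sum>j\<in>UNIV. \<bar>M $ i $ j * x $ j\<bar>)"
      by (simp add: matrix_vector_mult_def sum_abs)
    also have "\<dots> \<le> (\<Sum>j\<in>UNIV. \<bar>M $ i $ j\<bar> * norm x)"
      by (intro sum_mono) (simp add: abs_mult mult_left_mono component_le_norm_cart)
    finally show "\<bar>(M *v x) $ i\<bar> \<le> (\<Sum>j\<in>UNIV. \<bar>M $ i $ j\<bar> * norm x)" .
  qed
  finally show ?thesis by (simp add: sum_distrib_right)
qed

lemma eventually_matrix_close:
  fixes A :: "'a \<Rightarrow> real^'n::finite^'n"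
  assumes "(A \<longlongrightarrow> B) F" "\<epsilon> > 0"
  shows "\<forall>\<^sub>F t in F. \<forall>x. norm (A t *v x - B *v x) \<le> \<epsilon> * norm x"
proof -
  let ?s = "\<lambda>t. \<Sum>i\<in>UNIV. \<Sum>j\<in>UNIV. \<bar>(A t - B) $ i $ j\<bar>"
  have "(?s \<longlongrightarrow> (\<Sum>i\<in>UNIV. \<Sum>j\<in>UNIV. \<bar>(B - B) $ i $ j\<bar>)) F"
    by (intro tendsto_intros assms(1))
  then have "\<forall>\<^sub>F t in F. ?s t < \<epsilon>" using assms(2) by (intro order_tendstoD(2)) auto
  then show ?thesis
  proof eventually_elim
    case (elim t)
    have "norm (A t *v x - B *v x) \<le> \<epsilon> * norm x" for x
    proof -
      have "A t *v x - B *v x = (A t - B) *v x" by (simp add: matrix_vector_mult_diff_rdistrib)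
      then have "norm (A t *v x - B *v x) \<le> ?s t * norm x" by (simp only: norm_matrix_vector_le)
      also have "\<dots> \<le> \<epsilon> * norm x" using elim by (intro mult_right_mono) auto
      finally show ?thesis .
    qed
    then show ?case by blast
  qed
qed

lemma sum_apply_bcontfun: "apply_bcontfun (\<Sum>j\<in>I. f j) t = (\<Sum>j\<in>I. apply_bcontfun (f j) t)"
  for f :: "'i \<Rightarrow> ('a::topological_space \<Rightarrow>\<^sub>C ('b::real_normed_vector))"
  by (induction I rule: infinite_finite_induct) (auto simp: plus_bcontfun.rep_eq zero_bcontfun.rep_eq)

text \<open>Fixing the zero at \<open>a\<close> makes the antiderivative of a continuous function
  unique and hence linear in \<open>f\<close>; the coefficients in the variation of constants
  formula become linear functionals.\<close>

definition antiderivative :: "real \<Rightarrow> (real \<Rightarrow> real) \<Rightarrow> real \<Rightarrow> real" where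
  "antiderivative a f = (SOME F. F a = 0 \<and> (\<forall>t. (F has_vector_derivative f t) (at t)))"

lemma antiderivative:
  assumes "continuous_on UNIV f"
  shows "antiderivative a f a = 0" "(antiderivative a f has_vector_derivative f t) (at t)"
proof -
  have "antiderivative a f a = 0 \<and> (\<forall>t. (antiderivative a f has_vector_derivative f t) (at t))"
    unfolding antiderivative_def by (rule someI_ex[OF exists_antiderivative[OF assms]])
  then show "antiderivative a f a = 0" "(antiderivative a f has_vector_derivative f t) (at t)" by blast+
qed

lemma antiderivative_eqI:
  assumes "continuous_on UNIV f" "G a = 0" "\<And>t. (G has_vector_derivative f t) (at t)"
  shows "antiderivative a f t = G t"
  by (rule antiderivative_unique[where f=f and a=a]) (use assms antiderivative[OF assms(1)] in auto)

lemma constant_where_derivative_zero: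
  fixes F :: "real \<Rightarrow> 'a::real_normed_vector"
  assumes "\<And>t. (F has_vector_derivative f t) (at t)" "a \<le> b" "\<And>t. a \<le> t \<Longrightarrow> t \<le> b \<Longrightarrow> f t = 0"
  shows "F a = F b"
proof -
  have "\<exists>c. \<forall>t\<in>{a..b}. F t = c"
    using has_vector_derivative_zero_constant[of "{a..b}" F] assms
    by (metis atLeastAtMost_iff convex_real_interval(5) has_vector_derivative_at_within)
  then show ?thesis using assms(2) by auto
qed

context dual_frame
begin

text \<open>Solve the equation with \<open>A\<close> replaced by a coefficient \<open>At\<close> that is uniformly close to the
  hyperbolic limit \<open>B\<close> and equals \<open>A\<close> outside a compact interval, and repair the defect
  \<open>(A - At) w\<close> by variation of constants.  The defect has compact support, so each coefficient
  function can be made to vanish on the side where the corresponding solution is unbounded.\<close>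

lemma bounded_right_inverse:
  assumes B: "hyperbolic_matrix B" and cA: "continuous_on UNIV A"
    and lim: "(A \<longlongrightarrow> B) at_top" "(A \<longlongrightarrow> B) at_bot"
    and cls: "\<And>j. bounded (\<Phi> j ` {0..}) \<or> bounded (\<Phi> j ` {..0}) \<or> j \<in> N"
    and N: "\<And>j. j \<in> N \<Longrightarrow> integrable lborel (\<Psi> j)"
      "\<And>j. j \<in> N \<Longrightarrow> (\<Psi> j \<longlongrightarrow> 0) at_top" "\<And>j. j \<in> N \<Longrightarrow> (\<Psi> j \<longlongrightarrow> 0) at_bot"
  shows "\<exists>K. bounded_linear K \<and> (\<forall>h :: real \<Rightarrow>\<^sub>C (real^'n).
     (\<forall>j\<in>N. (LINT t|lborel. \<Psi> j t \<bullet> apply_bcontfun h t) = 0) \<longrightarrow>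
     (\<forall>t. (apply_bcontfun (K h) has_vector_derivative A t *v apply_bcontfun (K h) t + apply_bcontfun h t) (at t)))"
proof -
  obtain \<epsilon> where \<epsilon>: "\<epsilon> > 0" "\<And>At. continuous_on UNIV At \<Longrightarrow> (\<And>t x. norm (At t *v x - B *v x) \<le> \<epsilon> * norm x) \<Longrightarrow>
     \<exists>R. bounded_linear R \<and> (\<forall>(h :: real \<Rightarrow>\<^sub>C (real^'n)) t.
        (apply_bcontfun (R h) has_vector_derivative At t *v apply_bcontfun (R h) t + apply_bcontfun h t) (at t))"
    using perturbed_inverse[OF B] by blast
  obtain a b where ab: "\<And>t x. t \<ge> a \<Longrightarrow> norm (A t *v x - B *v x) \<le> \<epsilon> * norm x"
    "\<And>t x. t \<le> b \<Longrightarrow> norm (A t *v x - B *v x) \<le> \<epsilon> * norm x"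
    using eventually_matrix_close[OF lim(1) \<epsilon>(1)] eventually_matrix_close[OF lim(2) \<epsilon>(1)]
    unfolding eventually_at_top_linorder eventually_at_bot_linorder by blast
  define T where "T = max 0 (max a (- b))"
  \<comment> \<open>A piecewise linear switch: \<open>At\<close> is the constant matrix
    \<open>B\<close> for \<open>\<bar>t\<bar> \<le> T\<close> and agrees with \<open>A\<close> for
    \<open>\<bar>t\<bar> \<ge> T + 1\<close>.\<close>
  define \<theta> where "\<theta> t = min 1 (max 0 (\<bar>t\<bar> - T))" for t :: real
  define At where "At t = B + \<theta> t *\<^sub>R (A t - B)" for t
  define T1 where "T1 = T + 1"
  have T1: "T1 > 0" by (simp add: T1_def T_def)
  have c\<theta>: "continuous_on UNIV \<theta>" unfolding \<theta>_def by (intro continuous_intros)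
  have cAt: "continuous_on UNIV At" unfolding At_def by (intro continuous_intros cA c\<theta>)
  have "norm (At t *v x - B *v x) \<le> \<epsilon> * norm x" for t x
  proof -
    have eq: "At t *v x - B *v x = \<theta> t *\<^sub>R (A t *v x - B *v x)"
      by (simp add: At_def matrix_vector_mult_add_rdistrib matrix_vector_mult_diff_rdistrib
          flip: scaleR_matrix_vector_assoc)
    show ?thesis
    proof (cases "\<bar>t\<bar> \<le> T")
      case True
      then show ?thesis using \<epsilon>(1) by (simp add: eq \<theta>_def)
    next
      case False
      then have "norm (A t *v x - B *v x) \<le> \<epsilon> * norm x"
        using ab(1)[of t x] ab(2)[of t x] by (auto simp: T_def abs_if split: if_splits)
      moreover have "0 \<le> \<theta> t" "\<theta> t \<le> 1" by (auto simp: \<theta>_def)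
      ultimately show ?thesis unfolding eq
        by (simp add: mult_left_le_one_le order_trans[OF mult_left_le_one_le])
    qed
  qed
  from \<epsilon>(2)[OF cAt this] obtain R where R: "bounded_linear R"
    "\<And>(h :: real \<Rightarrow>\<^sub>C (real^'n)) t. (apply_bcontfun (R h) has_vector_derivative At t *v apply_bcontfun (R h) t + apply_bcontfun h t) (at t)"
    by blast
  have AAt: "A t - At t = 0" if "\<bar>t\<bar> \<ge> T1" for t
    using that by (simp add: At_def \<theta>_def T1_def)
  \<comment> \<open>The component of the defect along the frame vector j; its antiderivative is the
    coefficient in the variation of constants formula.\<close>
  define m where "m j w t = \<Psi> j t \<bullet> ((A t - At t) *v apply_bcontfun w t)"
    for j and w :: "real \<Rightarrow>\<^sub>C (real^'n)" and t
  have cm: "continuous_on UNIV (m j w)" for j w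
    unfolding m_def matrix_vector_mult_def by (intro continuous_intros dual_continuous cA cAt continuous_on_apply_bcontfun)
  have m0: "m j w t = 0" if "\<bar>t\<bar> \<ge> T1" for j w t using AAt[OF that] by (simp add: m_def)
  let ?s = "\<lambda>t. \<Sum>i\<in>UNIV. \<Sum>k\<in>UNIV. \<bar>(A t - At t) $ i $ k\<bar>"
  have "\<exists>c\<ge>0. \<forall>w t. \<bar>m j w t\<bar> \<le> c * norm w" for j
  proof -
    have "continuous_on UNIV (\<lambda>t. norm (\<Psi> j t) * ?s t)"
      by (intro continuous_intros dual_continuous cA cAt)
    then have "bounded ((\<lambda>t. norm (\<Psi> j t) * ?s t) ` {-T1..T1})"
      by (intro compact_imp_bounded compact_continuous_image) (auto intro: continuous_on_subset)
    then obtain c where "\<forall>y\<in>(\<lambda>t. norm (\<Psi> j t) * ?s t) ` {-T1..T1}. norm y \<le> c"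
      unfolding bounded_iff by blast
    then have c: "norm (norm (\<Psi> j t) * ?s t) \<le> c" if "\<bar>t\<bar> \<le> T1" for t
      using that by (simp only: ball_simps) (meson abs_le_iff atLeastAtMost_iff minus_le_iff)
    have "\<bar>m j w t\<bar> \<le> max 0 c * norm w" for w t
    proof (cases "\<bar>t\<bar> \<le> T1")
      case True
      have "\<bar>m j w t\<bar> \<le> norm (\<Psi> j t) * norm ((A t - At t) *v apply_bcontfun w t)"
        unfolding m_def by (rule Cauchy_Schwarz_ineq2)
      also have "\<dots> \<le> norm (\<Psi> j t) * (?s t * norm w)"
        by (intro mult_left_mono order_trans[OF norm_matrix_vector_le] norm_apply_bcontfun sum_nonneg) auto
      also have "\<dots> \<le> max 0 c * norm w"
        unfolding mult.assoc[symmetric] using c[OF True] by (intro mult_right_mono) auto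
      finally show ?thesis .
    qed (use m0[of t j w] in auto)
    then show ?thesis by (intro exI[of _ "max 0 c"]) auto
  qed
  then obtain c where c: "\<And>j. c j \<ge> 0" "\<And>j w t. \<bar>m j w t\<bar> \<le> c j * norm w" by metis
  have cont\<Phi>: "continuous_on S (\<Phi> j)" for j S
    using solution by (meson continuous_at_imp_continuous_on has_vector_derivative_continuous)
  have bdI: "bounded (\<Phi> j ` {s..t})" for j s t
    by (intro compact_imp_bounded compact_continuous_image cont\<Phi>) auto
  \<comment> \<open>Integration starts at \<open>-T1\<close> when the frame vector is bounded
    towards plus infinity and at \<open>T1\<close> when it is bounded towards minus infinity, so the
    coefficient vanishes on the other side. For j in \<open>N\<close> solvability makes it vanish on
    both sides. Where the coefficient vanishes the frame vector is frozen, which gives a bounded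
    \<open>p\<close>; the operator built from \<open>p\<close> is therefore bounded on the whole
    space, also where the equation is not solvable.\<close>
  have "\<exists>a p. \<bar>a\<bar> \<le> T1 \<and> continuous_on UNIV p \<and> bounded (range p) \<and>
     (\<forall>F. F a = 0 \<and> (\<forall>t\<le>-T1. F t = F (-T1)) \<and> (\<forall>t\<ge>T1. F t = F T1) \<and> (j \<in> N \<longrightarrow> F (-T1) = F T1) \<longrightarrow>
        (\<forall>t. F t *\<^sub>R p t = F t *\<^sub>R \<Phi> j t))" for j
  proof -
    consider "bounded (\<Phi> j ` {0..})" | "bounded (\<Phi> j ` {..0})" | "j \<in> N" using cls by blast
    then show ?thesis
    proof cases
      case 1
      have "\<Phi> j (max (-T1) t) \<in> \<Phi> j ` ({-T1..0} \<union> {0..})" for t by (rule imageI) auto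
      then have "range (\<lambda>t. \<Phi> j (max (-T1) t)) \<subseteq> \<Phi> j ` {-T1..0} \<union> \<Phi> j ` {0..}" unfolding image_Un[symmetric] by blast
      with 1 bdI have b: "bounded (range (\<lambda>t. \<Phi> j (max (-T1) t)))" by (meson bounded_Un bounded_subset)
      show ?thesis
        using T1 by (intro exI[of _ "-T1"] exI[of _ "\<lambda>t. \<Phi> j (max (-T1) t)"] conjI allI impI b
            continuous_on_compose2[OF cont\<Phi>[of UNIV]] continuous_on_max continuous_on_min continuous_on_const continuous_on_id subset_UNIV) (auto simp: max_def)
    next
      case 2
      have "\<Phi> j (min T1 t) \<in> \<Phi> j ` ({0..T1} \<union> {..0})" for t by (rule imageI) auto
      then have "range (\<lambda>t. \<Phi> j (min T1 t)) \<subseteq> \<Phi> j ` {0..T1} \<union> \<Phi> j ` {..0}" unfolding image_Un[symmetric] by blast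
      with 2 bdI have b: "bounded (range (\<lambda>t. \<Phi> j (min T1 t)))" by (meson bounded_Un bounded_subset)
      show ?thesis
        using T1 by (intro exI[of _ "T1"] exI[of _ "\<lambda>t. \<Phi> j (min T1 t)"] conjI allI impI b
            continuous_on_compose2[OF cont\<Phi>[of UNIV]] continuous_on_max continuous_on_min continuous_on_const continuous_on_id subset_UNIV) (auto simp: min_def)
    next
      case 3
      have "range (\<lambda>t. \<Phi> j (max (-T1) (min T1 t))) \<subseteq> \<Phi> j ` {-T1..T1}" using T1 by auto
      with bdI have b: "bounded (range (\<lambda>t. \<Phi> j (max (-T1) (min T1 t))))" by (meson bounded_subset)
      show ?thesis
      proof (rule exI[of _ "-T1"], rule exI[of _ "\<lambda>t. \<Phi> j (max (-T1) (min T1 t))"], intro conjI allI impI b)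
        show "continuous_on UNIV (\<lambda>t. \<Phi> j (max (-T1) (min T1 t)))"
          by (rule continuous_on_compose2[OF cont\<Phi>[of UNIV]]) (auto intro!: continuous_intros)
        fix F :: "real \<Rightarrow> real" and t
        assume F: "F (-T1) = 0 \<and> (\<forall>t\<le>-T1. F t = F (-T1)) \<and> (\<forall>t\<ge>T1. F t = F T1) \<and> (j \<in> N \<longrightarrow> F (-T1) = F T1)"
        show "F t *\<^sub>R \<Phi> j (max (-T1) (min T1 t)) = F t *\<^sub>R \<Phi> j t"
        proof (cases "\<bar>t\<bar> < T1")
          case True
          then have "max (-T1) (min T1 t) = t" by linarith
          then show ?thesis by (simp only:)
        next
          case False
          then have "t \<le> -T1 \<or> T1 \<le> t" by linarith
          then have "F t = 0" using F 3 by metis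
          then show ?thesis by (simp only: scaleR_zero_left)
        qed
      qed (use T1 in simp)
    qed
  qed
  then obtain a0 p where ap: "\<And>j. \<bar>a0 j\<bar> \<le> T1" "\<And>j. continuous_on UNIV (p j)" "\<And>j. bounded (range (p j))"
     "\<And>j F t. F (a0 j) = 0 \<Longrightarrow> (\<forall>t\<le>-T1. F t = F (-T1)) \<Longrightarrow> (\<forall>t\<ge>T1. F t = F T1) \<Longrightarrow> (j \<in> N \<longrightarrow> F (-T1) = F T1) \<Longrightarrow>
        F t *\<^sub>R p j t = F t *\<^sub>R \<Phi> j t"
    by metis
  define J where "J j w = antiderivative (a0 j) (m j w)" for j w
  have J0: "J j w (a0 j) = 0" and J': "(J j w has_vector_derivative m j w t) (at t)" for j w t
    unfolding J_def by (rule antiderivative[OF cm])+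
  have Jl: "\<forall>t\<le>-T1. J j w t = J j w (-T1)" for j w
  proof (intro allI impI)
    fix t assume "t \<le> -T1"
    then show "J j w t = J j w (-T1)"
      by (intro constant_where_derivative_zero[OF J'] m0) auto
  qed
  have Jr: "\<forall>t\<ge>T1. J j w t = J j w T1" for j w
  proof (intro allI impI)
    fix t assume "t \<ge> T1"
    then show "J j w t = J j w T1"
      by (intro constant_where_derivative_zero[OF J', symmetric] m0) auto
  qed
  have cJ: "continuous_on UNIV (J j w)" for j w
    using J' by (meson continuous_at_imp_continuous_on has_vector_derivative_continuous)
  have Jb: "\<bar>J j w t\<bar> \<le> (c j * (2 * T1)) * norm w" for j w t
  proof -
    have in': "\<bar>J j w t\<bar> \<le> (c j * (2 * T1)) * norm w" if "\<bar>t\<bar> \<le> T1" for t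
    proof -
      have "norm (J j w t - J j w (a0 j)) \<le> (c j * norm w) * norm (t - a0 j)"
      proof (rule differentiable_bound[where S=UNIV and f'="\<lambda>s y. y *\<^sub>R m j w s"])
        show "(J j w has_derivative (\<lambda>y. y *\<^sub>R m j w s)) (at s within UNIV)" for s
          using J'[of j w s] by (simp add: has_vector_derivative_def)
        show "onorm (\<lambda>y. y *\<^sub>R m j w s) \<le> c j * norm w" for s
          by (rule onorm_le) (use c(2)[of j w s] in \<open>simp add: abs_mult mult.commute mult_left_mono\<close>)
      qed auto
      also have "\<dots> \<le> (c j * norm w) * (2 * T1)"
        using that ap(1)[of j] c(1)[of j] by (intro mult_left_mono) auto
      finally show ?thesis using J0 by (simp add: mult_ac)
    qed
    consider "t \<le> -T1" | "t \<ge> T1" | "\<bar>t\<bar> \<le> T1" by linarith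
    then show ?thesis
    proof cases
      case 1
      then have "J j w t = J j w (-T1)" using Jl by blast
      then show ?thesis using in'[of "-T1"] T1 by simp
    next
      case 2
      then have "J j w t = J j w T1" using Jr by blast
      then show ?thesis using in'[of T1] T1 by simp
    qed (rule in')
  qed
  have Jadd: "J j (v + w) t = J j v t + J j w t" for j v w t
    unfolding J_def[of j "v + w"]
  proof (rule antiderivative_eqI[OF cm])
    show "((\<lambda>t. J j v t + J j w t) has_vector_derivative m j (v + w) t) (at t)" for t
      using has_vector_derivative_add[OF J'[of j v t] J'[of j w t]]
      by (simp add: m_def plus_bcontfun.rep_eq matrix_vector_right_distrib inner_add_right)
  qed (simp add: J0)
  have Jscale: "J j (r *\<^sub>R w) t = r * J j w t" for j r w t
    unfolding J_def[of j "r *\<^sub>R w"]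
  proof (rule antiderivative_eqI[OF cm])
    show "((\<lambda>t. r * J j w t) has_vector_derivative m j (r *\<^sub>R w) t) (at t)" for t
      using bounded_linear.has_vector_derivative[OF bounded_linear_mult_right[of r] J'[of j w t]]
      by (simp add: m_def scaleR_bcontfun.rep_eq matrix_vector_mult_scaleR)
  qed (simp add: J0)
  have "\<exists>P :: (real \<Rightarrow>\<^sub>C (real^'n)) \<Rightarrow> (real \<Rightarrow>\<^sub>C (real^'n)). bounded_linear P \<and>
     (\<forall>w t. apply_bcontfun (P w) t = J j w t *\<^sub>R p j t)" for j
  proof -
    obtain M where M: "\<And>t. norm (p j t) \<le> M" using ap(3)[of j] by (auto simp: bounded_iff)
    have M0: "0 \<le> M" using M[of 0] norm_ge_zero order_trans by blast
    have "\<exists>P :: (real \<Rightarrow>\<^sub>C (real^'n)) \<Rightarrow> (real \<Rightarrow>\<^sub>C (real^'n)). bounded_linear P \<and>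
       (\<forall>w t. apply_bcontfun (P w) t = J j w t *\<^sub>R p j t) \<and> (\<forall>w. norm (P w) \<le> (c j * (2 * T1) * M) * norm w)"
    proof (rule bounded_linear_bcontfunI)
      show "continuous_on UNIV (\<lambda>t. J j w t *\<^sub>R p j t)" for w by (intro continuous_intros cJ ap)
      show "norm (J j w t *\<^sub>R p j t) \<le> (c j * (2 * T1) * M) * norm w" for w t
        using mult_mono[OF Jb[of j w t] M[of t]] c(1)[of j] T1 by (simp add: mult_ac)
    qed (simp_all add: Jadd Jscale scaleR_add_left)
    then show ?thesis by blast
  qed
  then obtain P :: "'n \<Rightarrow> (real \<Rightarrow>\<^sub>C (real^'n)) \<Rightarrow> (real \<Rightarrow>\<^sub>C (real^'n))" where
    P: "\<And>j. bounded_linear (P j)" "\<And>j w t. apply_bcontfun (P j w) t = J j w t *\<^sub>R p j t" by metis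
  define K where "K h = R h + (\<Sum>j\<in>UNIV. P j (R h))" for h
  have "bounded_linear K"
    unfolding K_def by (intro bounded_linear_add bounded_linear_sum R(1) bounded_linear_compose[OF P(1) R(1)])
  moreover have "(apply_bcontfun (K h) has_vector_derivative A t *v apply_bcontfun (K h) t + apply_bcontfun h t) (at t)"
    if h: "\<forall>j\<in>N. (LINT t|lborel. \<Psi> j t \<bullet> apply_bcontfun h t) = 0" for h :: "real \<Rightarrow>\<^sub>C (real^'n)" and t
  proof -
    let ?w = "apply_bcontfun (R h)"
    \<comment> \<open>The coefficient plus the pairing of \<open>\<Psi> j\<close> with the
      approximate solution has derivative \<open>\<Psi> j \<bullet> h\<close>. The pairing vanishes
      at both ends, so the integral of \<open>\<Psi> j \<bullet> h\<close> is exactly the jump of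
      the coefficient.\<close>
    have solv: "J j (R h) (-T1) = J j (R h) T1" if j: "j \<in> N" for j
    proof -
      let ?F = "\<lambda>t. J j (R h) t + \<Psi> j t \<bullet> ?w t"
      have F': "(?F has_vector_derivative \<Psi> j t \<bullet> apply_bcontfun h t) (at t)" for t
      proof -
        have "(?w has_vector_derivative A t *v ?w t + (apply_bcontfun h t - (A t - At t) *v ?w t)) (at t)"
          using R(2)[of h t] by (simp add: matrix_vector_mult_diff_rdistrib add.commute)
        then have "((\<lambda>t. \<Psi> j t \<bullet> ?w t) has_vector_derivative \<Psi> j t \<bullet> (apply_bcontfun h t - (A t - At t) *v ?w t)) (at t)"
          by (rule dual_pairing_derivative)
        from has_vector_derivative_add[OF J'[of j "R h" t] this] show ?thesis
          by (simp add: m_def inner_diff_right)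
      qed
      have z: "((\<lambda>t. \<Psi> j t \<bullet> ?w t) \<longlongrightarrow> 0) F" if "(\<Psi> j \<longlongrightarrow> 0) F" for F
      proof (rule Lim_null_comparison)
        show "\<forall>\<^sub>F t in F. norm (\<Psi> j t \<bullet> ?w t) \<le> norm (\<Psi> j t) * norm (R h)"
          unfolding real_norm_def
          by (intro always_eventually allI order_trans[OF Cauchy_Schwarz_ineq2] mult_left_mono norm_apply_bcontfun norm_ge_zero)
        show "((\<lambda>t. norm (\<Psi> j t) * norm (R h)) \<longlongrightarrow> 0) F"
          using tendsto_mult_left_zero[OF tendsto_norm_zero[OF that]] .
      qed
      have "(?F \<longlongrightarrow> J j (R h) T1 + 0) at_top"
        by (intro tendsto_add z N j tendsto_eventually eventually_mono[OF eventually_ge_at_top[of T1]]) (use Jr in blast)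
      moreover have "(?F \<longlongrightarrow> J j (R h) (-T1) + 0) at_bot"
        by (intro tendsto_add z N j tendsto_eventually eventually_mono[OF eventually_le_at_bot[of "-T1"]]) (use Jl in blast)
      moreover have "integrable lborel (\<lambda>t. \<Psi> j t \<bullet> apply_bcontfun h t)"
      proof (rule Bochner_Integration.integrable_bound)
        show "integrable lborel (\<lambda>t. norm h *\<^sub>R \<Psi> j t)" by (intro integrable_scaleR_right N j)
        show "(\<lambda>t. \<Psi> j t \<bullet> apply_bcontfun h t) \<in> borel_measurable lborel"
          by (simp add: borel_measurable_continuous_onI continuous_on_inner dual_continuous)
        have "norm (\<Psi> j t \<bullet> apply_bcontfun h t) \<le> norm (norm h *\<^sub>R \<Psi> j t)" for t
          using order_trans[OF Cauchy_Schwarz_ineq2 mult_left_mono[OF norm_apply_bcontfun[of h t] norm_ge_zero], of "\<Psi> j t"]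
          by (metis abs_norm_cancel mult.commute norm_scaleR real_norm_def)
        then show "AE t in lborel. norm (\<Psi> j t \<bullet> apply_bcontfun h t) \<le> norm (norm h *\<^sub>R \<Psi> j t)" by simp
      qed
      moreover have "continuous_on UNIV (\<lambda>t. \<Psi> j t \<bullet> apply_bcontfun h t)"
        by (intro continuous_intros dual_continuous) auto
      ultimately have "(LINT t|lborel. \<Psi> j t \<bullet> apply_bcontfun h t) = (J j (R h) T1 + 0) - (J j (R h) (-T1) + 0)"
        by (intro integral_FTC_line[OF F'])
      then show ?thesis using h j by simp
    qed
    have eq: "apply_bcontfun (K h) t = ?w t + (\<Sum>j\<in>UNIV. J j (R h) t *\<^sub>R \<Phi> j t)" for t
      unfolding K_def plus_bcontfun.rep_eq sum_apply_bcontfun P(2)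
      by (intro arg_cong2[where f="(+)"] sum.cong ap(4) J0 Jl Jr impI solv refl)
    have "((\<lambda>t. ?w t + (\<Sum>j\<in>UNIV. J j (R h) t *\<^sub>R \<Phi> j t)) has_vector_derivative
       (At t *v ?w t + apply_bcontfun h t) + (\<Sum>j\<in>UNIV. J j (R h) t *\<^sub>R (A t *v \<Phi> j t) + m j (R h) t *\<^sub>R \<Phi> j t)) (at t)"
      by (intro has_vector_derivative_add R(2) has_vector_derivative_sum
          bounded_bilinear.has_vector_derivative[OF bounded_bilinear_scaleR J' solution])
    also have "(\<Sum>j\<in>UNIV. J j (R h) t *\<^sub>R (A t *v \<Phi> j t) + m j (R h) t *\<^sub>R \<Phi> j t)
       = A t *v (\<Sum>j\<in>UNIV. J j (R h) t *\<^sub>R \<Phi> j t) + (A t - At t) *v ?w t"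
      unfolding sum.distrib m_def frame_expansion
      by (simp add: linear_sum[OF matrix_vector_mul_linear] matrix_vector_mult_scaleR)
    also have "(At t *v ?w t + apply_bcontfun h t) + (A t *v (\<Sum>j\<in>UNIV. J j (R h) t *\<^sub>R \<Phi> j t) + (A t - At t) *v ?w t)
       = A t *v apply_bcontfun (K h) t + apply_bcontfun h t"
      unfolding eq by (simp add: matrix_vector_right_distrib matrix_vector_mult_diff_rdistrib)
    finally show ?thesis unfolding eq[symmetric] .
  qed
  ultimately show ?thesis by blast
qed

end

text \<open>Multiplying the solution by a smooth step leaves a bounded solution on the whole line,
  whose size is controlled by its forcing through the inverse of \<open>d/dt - B\<close>. Each such
  step lowers the eventual bound by the factor 3/4. This takes the place of a splitting into stable
  and unstable subspaces.\<close>

lemma hyperbolic_decay: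
  fixes B :: "real^'n::finite^'n"
  assumes B: "hyperbolic_matrix B"
  shows "\<exists>\<epsilon>>0. \<forall>x r T. (\<forall>t. (x has_vector_derivative B *v x t + r t) (at t)) \<and> continuous_on UNIV r \<and>
     bounded (range x) \<and> bounded (range r) \<and> (\<forall>t\<ge>T. norm (r t) \<le> \<epsilon> * norm (x t)) \<longrightarrow> (x \<longlongrightarrow> 0) at_top"
proof -
  obtain R C where RC: "\<And>h. norm (R h) \<le> C * norm h" "C \<ge> 0"
    "\<And>(h :: real \<Rightarrow>\<^sub>C (real^'n)) w. (\<forall>t. (w has_vector_derivative B *v w t + apply_bcontfun h t) (at t)) \<Longrightarrow>
        bounded (range w) \<Longrightarrow> (\<forall>t. w t = apply_bcontfun (R h) t)"
    using hyperbolic_inverse[OF B] by blast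
  \<comment> \<open>The forcing of the cut-off solution will be at most
    \<open>3 \<epsilon> M\<close>, so the solution is at most \<open>3/8 M\<close>; where the step
    is at least 1/2 this means \<open>3/4 M\<close> for \<open>x\<close>.\<close>
  define \<epsilon> where "\<epsilon> = 1 / (8 * (C + 1))"
  have \<epsilon>: "\<epsilon> > 0" "C * (3 * \<epsilon>) \<le> 3/8" using RC(2) by (auto simp: \<epsilon>_def field_simps)
  show ?thesis
  proof (intro exI[of _ \<epsilon>] conjI \<epsilon>(1) allI impI, elim conjE)
    fix x r T
    assume x: "\<forall>t. (x has_vector_derivative B *v x t + r t) (at t)" and cr: "continuous_on UNIV r"
      and bx: "bounded (range x)" and br: "bounded (range r)" and r: "\<forall>t\<ge>T. norm (r t) \<le> \<epsilon> * norm (x t)"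
    obtain k where k: "\<And>t. norm (x t) \<le> k" using bx by (auto simp: bounded_iff)
    obtain k' where k': "\<And>t. norm (r t) \<le> k'" using br by (auto simp: bounded_iff)
    have cx: "continuous_on UNIV x" using x by (meson continuous_at_imp_continuous_on has_vector_derivative_continuous)
    have k0: "0 \<le> k" "0 \<le> k'" using k[of 0] k'[of 0] norm_ge_zero order_trans by blast+
    have step: "\<exists>\<tau>'\<ge>T. \<forall>t\<ge>\<tau>'. norm (x t) \<le> 3/4 * M" if M: "M > 0" and \<tau>: "\<tau> \<ge> T" "\<forall>t\<ge>\<tau>. norm (x t) \<le> M" for M \<tau>
    proof -
      have "((\<lambda>s. exp (\<epsilon> * (\<tau> - s)) * (k' + \<epsilon> * k)) \<longlongrightarrow> 0) at_top" using \<epsilon>(1) by real_asymp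
      then have "\<forall>\<^sub>F s in at_top. exp (\<epsilon> * (\<tau> - s)) * (k' + \<epsilon> * k) < \<epsilon> * M"
        using M \<epsilon>(1) by (intro order_tendstoD(2)) auto
      then have "\<forall>\<^sub>F s in at_top. exp (\<epsilon> * (\<tau> - s)) * (k' + \<epsilon> * k) < \<epsilon> * M \<and> s \<ge> T"
        by (intro eventually_conj eventually_ge_at_top)
      \<comment> \<open>The step is placed so late that before \<tau>, where only the global bounds
        \<open>k\<close> and \<open>k'\<close> are available, its weight is negligible.\<close>
      then obtain s where s: "exp (\<epsilon> * (\<tau> - s)) * (k' + \<epsilon> * k) < \<epsilon> * M" "s \<ge> T"
        using eventually_happens'[OF trivial_limit_at_top_linorder] by blast
      \<comment> \<open>The logistic function solves
        \<open>\<theta>' = \<epsilon> \<theta> (1 - \<theta>)\<close>: its derivative is small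
        relative to itself, so cutting off costs no more than the given forcing does.\<close>
      define \<theta> where "\<theta> t = 1 / (1 + exp (\<epsilon> * (s - t)))" for t :: real
      have \<theta>: "0 < \<theta> t" "\<theta> t \<le> 1" for t by (auto simp: \<theta>_def add_pos_pos)
      have \<theta>': "(\<theta> has_vector_derivative \<epsilon> * \<theta> t * (1 - \<theta> t)) (at t)" for t
      proof -
        have nz: "1 + exp (\<epsilon> * (s - t)) \<noteq> 0" by (metis add_pos_pos exp_gt_zero less_irrefl zero_less_one)
        have "(\<theta> has_real_derivative \<epsilon> * exp (\<epsilon> * (s - t)) / (1 + exp (\<epsilon> * (s - t)))^2) (at t)"
          unfolding \<theta>_def using nz by (auto intro!: derivative_eq_intros simp: power2_eq_square)
        also have "\<epsilon> * exp (\<epsilon> * (s - t)) / (1 + exp (\<epsilon> * (s - t)))^2 = \<epsilon> * \<theta> t * (1 - \<theta> t)"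
          using nz by (simp add: \<theta>_def field_simps power2_eq_square)
        finally show ?thesis by (simp add: has_real_derivative_iff_has_vector_derivative)
      qed
      define g where "g t = \<theta> t *\<^sub>R r t + (\<epsilon> * \<theta> t * (1 - \<theta> t)) *\<^sub>R x t" for t
      have gb: "norm (g t) \<le> 3 * \<epsilon> * M" for t
      proof -
        have a: "norm (g t) \<le> \<theta> t * norm (r t) + \<theta> t * (\<epsilon> * norm (x t))"
        proof -
          have "norm (g t) \<le> norm (\<theta> t *\<^sub>R r t) + norm ((\<epsilon> * \<theta> t * (1 - \<theta> t)) *\<^sub>R x t)"
            unfolding g_def by (rule norm_triangle_ineq)
          also have "norm ((\<epsilon> * \<theta> t * (1 - \<theta> t)) *\<^sub>R x t) = \<theta> t * (\<epsilon> * norm (x t)) * (1 - \<theta> t)"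
            using \<theta>[of t] \<epsilon>(1) by (simp add: abs_mult)
          also have "\<dots> \<le> \<theta> t * (\<epsilon> * norm (x t))"
            using \<theta>[of t] \<epsilon>(1) by (intro mult_right_le_one_le) auto
          finally show ?thesis using \<theta>[of t] by simp
        qed
        show ?thesis
        proof (cases "t \<ge> \<tau>")
          case True
          then have e2: "\<epsilon> * norm (x t) \<le> \<epsilon> * M" using \<tau>(2) \<epsilon>(1) by simp
          have "norm (r t) \<le> \<epsilon> * norm (x t)" using r \<tau>(1) True by simp
          then have e1: "norm (r t) \<le> \<epsilon> * M" using e2 by linarith
          from e1 e2 have "\<theta> t * norm (r t) + \<theta> t * (\<epsilon> * norm (x t)) \<le> 1 * (\<epsilon> * M) + 1 * (\<epsilon> * M)"
            using \<theta>[of t] \<epsilon>(1) M by (intro add_mono mult_mono) auto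
          moreover have "0 \<le> \<epsilon> * M" using \<epsilon>(1) M by simp
          ultimately show ?thesis using a by linarith
        next
          case False
          have "\<theta> t \<le> 1 / exp (\<epsilon> * (s - t))" unfolding \<theta>_def by (intro divide_left_mono) (auto intro!: mult_pos_pos add_pos_pos)
          also have "\<dots> = exp (\<epsilon> * (t - s))" by (simp add: exp_minus[symmetric] divide_inverse algebra_simps)
          also have "\<dots> \<le> exp (\<epsilon> * (\<tau> - s))" using False \<epsilon>(1) by simp
          finally have "\<theta> t * (norm (r t) + \<epsilon> * norm (x t)) \<le> exp (\<epsilon> * (\<tau> - s)) * (k' + \<epsilon> * k)"
            using \<theta>[of t] \<epsilon>(1) k[of t] k'[of t] by (intro mult_mono add_mono) auto
          moreover have "0 \<le> \<epsilon> * M" using \<epsilon>(1) M by simp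
          ultimately show ?thesis using a s(1) unfolding distrib_left by linarith
        qed
      qed
      have cg: "continuous_on UNIV g"
        unfolding g_def using \<theta>' by (intro continuous_intros cr cx)
          (meson continuous_at_imp_continuous_on has_vector_derivative_continuous)+
      define h where "h = Bcontfun g"
      have h: "apply_bcontfun h = g" unfolding h_def by (rule Bcontfun_inverse) (rule bcontfun_normI[OF cg gb])
      have nh: "norm h \<le> 3 * \<epsilon> * M" by (rule norm_bound) (simp add: h gb)
      have y': "((\<lambda>t. \<theta> t *\<^sub>R x t) has_vector_derivative B *v (\<theta> t *\<^sub>R x t) + apply_bcontfun h t) (at t)" for t
      proof -
        have "((\<lambda>t. \<theta> t *\<^sub>R x t) has_vector_derivative \<theta> t *\<^sub>R (B *v x t + r t) + (\<epsilon> * \<theta> t * (1 - \<theta> t)) *\<^sub>R x t) (at t)"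
          by (rule bounded_bilinear.has_vector_derivative[OF bounded_bilinear_scaleR \<theta>']) (use x in blast)
        then show ?thesis by (simp add: h g_def matrix_vector_mult_scaleR scaleR_add_right add.assoc)
      qed
      have bdy: "bounded (range (\<lambda>t. \<theta> t *\<^sub>R x t))"
      proof (rule boundedI)
        fix y assume "y \<in> range (\<lambda>t. \<theta> t *\<^sub>R x t)"
        then obtain t where "y = \<theta> t *\<^sub>R x t" by blast
        then show "norm y \<le> 1 * k" using \<theta>[of t] k[of t] k0 by (simp only: norm_scaleR) (intro mult_mono, auto)
      qed
      have "norm (\<theta> t *\<^sub>R x t) \<le> 3/8 * M" for t
      proof -
        have "\<theta> t *\<^sub>R x t = apply_bcontfun (R h) t" using RC(3)[of "\<lambda>t. \<theta> t *\<^sub>R x t" h] y' bdy by blast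
        then have "norm (\<theta> t *\<^sub>R x t) \<le> norm (R h)" by (simp only: norm_apply_bcontfun)
        also have "\<dots> \<le> C * (3 * \<epsilon> * M)" using RC(1)[of h] nh RC(2) by (meson mult_left_mono order_trans)
        also have "\<dots> \<le> 3/8 * M" using mult_right_mono[OF \<epsilon>(2), of M] M by (simp add: mult.assoc)
        finally show ?thesis .
      qed
      moreover have "\<theta> t \<ge> 1/2" if "t \<ge> s" for t
      proof -
        have "exp (\<epsilon> * (s - t)) \<le> 1" using that \<epsilon>(1) by (simp add: mult_nonneg_nonpos)
        then show ?thesis unfolding \<theta>_def by (simp add: field_simps add_pos_pos)
      qed
      ultimately have "norm (x t) \<le> 3/4 * M" if "t \<ge> s" for t
      proof -
        have "1/2 * norm (x t) \<le> \<theta> t * norm (x t)" using \<open>\<And>t. t \<ge> s \<Longrightarrow> \<theta> t \<ge> 1/2\<close>[OF that] by (intro mult_right_mono) auto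
        also have "\<dots> = norm (\<theta> t *\<^sub>R x t)" using \<theta>[of t] by simp
        also have "\<dots> \<le> 3/8 * M" by fact
        finally show ?thesis by simp
      qed
      then show ?thesis using s(2) by blast
    qed
    have iter: "\<exists>\<tau>\<ge>T. \<forall>t\<ge>\<tau>. norm (x t) \<le> (3/4)^n * (k + 1)" for n
    proof (induction n)
      case 0
      show ?case using k by (intro exI[of _ T]) (auto intro: add_increasing2)
    next
      case (Suc n)
      then obtain \<tau> where \<tau>: "\<tau> \<ge> T" "\<forall>t\<ge>\<tau>. norm (x t) \<le> (3/4)^n * (k + 1)" by blast
      have "(3/4)^n * (k + 1) > 0" using k0 by simp
      from step[OF this \<tau>] show ?case by (simp add: mult.assoc)
    qed
    show "(x \<longlongrightarrow> 0) at_top"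
    proof (rule tendstoI)
      fix e :: real assume "e > 0"
      have "(\<lambda>n. (3/4)^n * (k + 1)) \<longlonglongrightarrow> 0"
        using tendsto_mult_left_zero[OF LIMSEQ_power_zero[of "3/4::real"]] by simp
      then have "\<forall>\<^sub>F n in sequentially. (3/4)^n * (k + 1) < e" using \<open>e > 0\<close> by (rule order_tendstoD)
      then obtain n where n: "(3/4)^n * (k + 1) < e" by (auto simp: eventually_sequentially)
      obtain \<tau> where "\<And>t. t \<ge> \<tau> \<Longrightarrow> norm (x t) \<le> (3/4)^n * (k + 1)" using iter[of n] by blast
      then have "dist (x t) 0 < e" if "t \<ge> \<tau>" for t
        using n that by (metis dist_0_norm dist_commute order_le_less_trans)
      then show "\<forall>\<^sub>F t in at_top. dist (x t) 0 < e" unfolding eventually_at_top_linorder by blast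
    qed
  qed
qed

subsection \<open>Finitely often differentiable maps\<close>

text \<open>Higher derivatives are encoded through directional derivatives in fixed directions, so
  that every order keeps the type of \<open>f\<close> and no spaces of multilinear maps
  occur.\<close>

primrec Ck :: "nat \<Rightarrow> ('a::real_normed_vector \<Rightarrow> 'b::real_normed_vector) \<Rightarrow> bool" where
  "Ck 0 f \<longleftrightarrow> continuous_on UNIV f"
| "Ck (Suc k) f \<longleftrightarrow> (\<forall>x. f differentiable (at x)) \<and> (\<forall>v. Ck k (\<lambda>x. frechet_derivative f (at x) v))"

lemma Ck_SucI:
  assumes "\<And>x. (f has_derivative f' x) (at x)" "\<And>v. Ck k (\<lambda>x. f' x v)"
  shows "Ck (Suc k) f"
proof -
  have "frechet_derivative f (at x) = f' x" for x using frechet_derivative_at[OF assms(1)] by simp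
  with assms show ?thesis by (auto simp: differentiable_def)
qed

lemma Ck_SucD:
  "Ck (Suc k) f \<Longrightarrow> \<exists>f'. (\<forall>x. (f has_derivative f' x) (at x)) \<and> (\<forall>v. Ck k (\<lambda>x. f' x v))"
  by (intro exI[of _ "\<lambda>x. frechet_derivative f (at x)"]) (auto simp: frechet_derivative_works[symmetric])

lemma Ck_Suc_imp: "Ck (Suc k) f \<Longrightarrow> Ck k f"
proof (induction k arbitrary: f)
  case 0
  then show ?case
    by (auto simp: continuous_on_eq_continuous_at intro!: differentiable_imp_continuous_within)
next
  case (Suc k)
  then have "\<And>v. Ck (Suc k) (\<lambda>x. frechet_derivative f (at x) v)" "\<forall>x. f differentiable (at x)" by auto
  then show ?case using Suc.IH by auto
qed

lemma Ck_le: "Ck k f \<Longrightarrow> j \<le> k \<Longrightarrow> Ck j f"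
  by (induction k) (auto simp: le_Suc_eq simp del: Ck.simps dest: Ck_Suc_imp)

lemma Ck_continuous: "Ck k f \<Longrightarrow> continuous_on UNIV f"
  using Ck_le[of k f 0] by simp

lemma Ck_const: "Ck k (\<lambda>_. c)"
proof (induction k arbitrary: c)
  case (Suc k)
  show ?case by (rule Ck_SucI[OF has_derivative_const Suc])
qed auto

lemma Ck_bounded_linear: "bounded_linear f \<Longrightarrow> Ck k f"
proof (cases k)
  case 0
  then show "bounded_linear f \<Longrightarrow> Ck k f" by (simp add: linear_continuous_on)
next
  case (Suc j)
  then show "bounded_linear f \<Longrightarrow> Ck k f"
    by (auto intro!: Ck_SucI[where f'="\<lambda>_. f"] bounded_linear_imp_has_derivative Ck_const simp del: Ck.simps)
qed

lemma Ck_add: "Ck k f \<Longrightarrow> Ck k g \<Longrightarrow> Ck k (\<lambda>x. f x + g x)"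
proof (induction k arbitrary: f g)
  case (Suc k)
  obtain f' where f: "\<And>x. (f has_derivative f' x) (at x)" "\<And>v. Ck k (\<lambda>x. f' x v)" using Ck_SucD[OF Suc.prems(1)] by blast
  obtain g' where g: "\<And>x. (g has_derivative g' x) (at x)" "\<And>v. Ck k (\<lambda>x. g' x v)" using Ck_SucD[OF Suc.prems(2)] by blast
  show ?case by (rule Ck_SucI[OF has_derivative_add[OF f(1) g(1)]]) (rule Suc.IH[OF f(2) g(2)])
qed (auto intro: continuous_intros)

lemma Ck_sum: "(\<And>i. i \<in> I \<Longrightarrow> Ck k (f i)) \<Longrightarrow> Ck k (\<lambda>x. \<Sum>i\<in>I. f i x)"
  by (induction I rule: infinite_finite_induct) (auto intro: Ck_const Ck_add)

lemma Ck_bounded_linear_comp: "bounded_linear h \<Longrightarrow> Ck k f \<Longrightarrow> Ck k (\<lambda>x. h (f x))"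
proof (induction k arbitrary: f)
  case 0
  then show ?case by (auto intro: bounded_linear.continuous_on)
next
  case (Suc k)
  obtain f' where f: "\<And>x. (f has_derivative f' x) (at x)" "\<And>v. Ck k (\<lambda>x. f' x v)" using Ck_SucD[OF Suc.prems(2)] by blast
  show ?case
    by (rule Ck_SucI[OF bounded_linear.has_derivative[OF Suc.prems(1) f(1)]]) (rule Suc.IH[OF Suc.prems(1) f(2)])
qed

lemma Ck_diff: "Ck k f \<Longrightarrow> Ck k g \<Longrightarrow> Ck k (\<lambda>x. f x - g x)"
  using Ck_add[of k f "\<lambda>x. - g x"] Ck_bounded_linear_comp[OF bounded_linear_minus[OF bounded_linear_ident], of k g] by simp

lemma Ck_bilinear:
  assumes "bounded_bilinear p"
  shows "Ck k f \<Longrightarrow> Ck k g \<Longrightarrow> Ck k (\<lambda>x. p (f x) (g x))"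
proof (induction k arbitrary: f g)
  case 0
  then show ?case by (auto intro: bounded_bilinear.continuous_on[OF assms])
next
  case (Suc k)
  obtain f' where f: "\<And>x. (f has_derivative f' x) (at x)" "\<And>v. Ck k (\<lambda>x. f' x v)" using Ck_SucD[OF Suc.prems(1)] by blast
  obtain g' where g: "\<And>x. (g has_derivative g' x) (at x)" "\<And>v. Ck k (\<lambda>x. g' x v)" using Ck_SucD[OF Suc.prems(2)] by blast
  show ?case
    by (rule Ck_SucI[OF bounded_bilinear.FDERIV[OF assms f(1) g(1)]])
      (intro Ck_add Suc.IH f g Ck_Suc_imp[OF Suc.prems(1)] Ck_Suc_imp[OF Suc.prems(2)])
qed

lemma Ck_scaleR: "Ck k f \<Longrightarrow> Ck k g \<Longrightarrow> Ck k (\<lambda>x. f x *\<^sub>R g x)"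
  by (rule Ck_bilinear[OF bounded_bilinear_scaleR])

lemma Ck_power: "Ck k f \<Longrightarrow> Ck k (\<lambda>x. (f x :: real) ^ n)"
  by (induction n) (auto intro: Ck_const Ck_bilinear[OF bounded_bilinear_mult])

text \<open>The derivative of the inner map is a varying direction, whereas \<open>Ck\<close>
  controls fixed ones; expanding it in a basis of the middle space turns the chain rule into a
  finite sum of products.\<close>

lemma Ck_compose:
  fixes g :: "'a::real_normed_vector \<Rightarrow> 'b::euclidean_space"
  shows "Ck k f \<Longrightarrow> Ck k g \<Longrightarrow> Ck k (\<lambda>x. f (g x))"
proof (induction k arbitrary: f)
  case 0
  then show ?case by (auto intro: continuous_on_compose2)
next
  case (Suc k)
  obtain f' where f: "\<And>x. (f has_derivative f' x) (at x)" "\<And>v. Ck k (\<lambda>x. f' x v)" using Ck_SucD[OF Suc.prems(1)] by blast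
  obtain g' where g: "\<And>x. (g has_derivative g' x) (at x)" "\<And>v. Ck k (\<lambda>x. g' x v)" using Ck_SucD[OF Suc.prems(2)] by blast
  have eq: "f' (g x) (g' x v) = (\<Sum>b\<in>Basis. (g' x v \<bullet> b) *\<^sub>R f' (g x) b)" for x v
  proof -
    interpret bounded_linear "f' (g x)" by (rule has_derivative_bounded_linear[OF f(1)])
    show ?thesis by (subst euclidean_representation[symmetric, of "g' x v"]) (simp add: sum scaleR)
  qed
  show ?case
  proof (rule Ck_SucI)
    show "((\<lambda>x. f (g x)) has_derivative (\<lambda>v. f' (g x) (g' x v))) (at x)" for x
      using diff_chain_at[OF g(1) f(1), of x] by (simp add: o_def)
    show "Ck k (\<lambda>x. f' (g x) (g' x v))" for v
      unfolding eq
      by (intro Ck_sum Ck_scaleR Ck_bounded_linear_comp[OF bounded_linear_inner_left] g Suc.IH f Ck_Suc_imp[OF Suc.prems(2)])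
  qed
qed

lemma Ck_fst: "Ck k f \<Longrightarrow> Ck k (\<lambda>x. fst (f x))"
  and Ck_snd: "Ck k f \<Longrightarrow> Ck k (\<lambda>x. snd (f x))"
  by (rule Ck_bounded_linear_comp[OF bounded_linear_fst], assumption)
    (rule Ck_bounded_linear_comp[OF bounded_linear_snd], assumption)

lemma Ck_ident: "Ck k (\<lambda>x. x)"
  by (rule Ck_bounded_linear[OF bounded_linear_ident])

lemma Ck_Pair: "Ck k f \<Longrightarrow> Ck k g \<Longrightarrow> Ck k (\<lambda>x. (f x, g x))"
  using Ck_add[OF Ck_bounded_linear_comp[of "\<lambda>x. (x, 0)" k f] Ck_bounded_linear_comp[of "\<lambda>x. (0, x)" k g]]
  by (simp add: bounded_linear_Pair bounded_linear_ident bounded_linear_zero)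

lemma Ck_componentwise:
  fixes f :: "'a::real_normed_vector \<Rightarrow> 'b::euclidean_space"
  assumes "\<And>b. b \<in> Basis \<Longrightarrow> Ck k (\<lambda>x. f x \<bullet> b)"
  shows "Ck k f"
proof -
  have "Ck k (\<lambda>x. \<Sum>b\<in>Basis. (f x \<bullet> b) *\<^sub>R b)" by (intro Ck_sum Ck_scaleR Ck_const assms)
  then show ?thesis by (simp add: euclidean_representation)
qed

lemma Ck_dirderiv:
  "Ck (Suc k) f \<Longrightarrow> Ck k (\<lambda>x. frechet_derivative f (at x) v)"
  by simp

lemma Ck_has_derivative:
  "Ck (Suc k) f \<Longrightarrow> (f has_derivative frechet_derivative f (at x)) (at x)"
  by (simp add: frechet_derivative_works[symmetric])

lemma Ck_line_derivative:
  assumes "Ck (Suc k) f" "(g has_vector_derivative d) (at t)"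
  shows "((\<lambda>t. f (g t)) has_vector_derivative frechet_derivative f (at (g t)) d) (at t)"
  using vector_derivative_diff_chain_within[OF assms(2), of f "frechet_derivative f (at (g t))"]
    has_derivative_at_withinI[OF Ck_has_derivative[OF assms(1)]] by (simp add: o_def)

lemma frechet_derivative_linear:
  assumes "Ck (Suc k) f"
  shows "bounded_linear (frechet_derivative f (at x))"
  by (rule has_derivative_bounded_linear[OF Ck_has_derivative[OF assms]])

lemma C1_derivative_bound:
  fixes f :: "'a::euclidean_space \<Rightarrow> 'b::real_normed_vector"
  assumes "Ck (Suc 0) f"
  shows "\<exists>M\<ge>0. \<forall>p v. norm p \<le> R \<longrightarrow> norm (frechet_derivative f (at p) v) \<le> M * norm v"
proof -
  let ?D = "\<lambda>p. \<Sum>b\<in>Basis. norm (frechet_derivative f (at p) b)"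
  have "continuous_on (cball 0 R) ?D"
    using assms by (intro continuous_intros) (auto intro: continuous_on_subset)
  then have "bounded (?D ` cball 0 R)" by (intro compact_imp_bounded compact_continuous_image) auto
  then obtain M where M: "\<forall>y\<in>?D ` cball 0 R. norm y \<le> M" unfolding bounded_iff by blast
  have "norm (frechet_derivative f (at p) v) \<le> max 0 M * norm v" if "norm p \<le> R" for p v
  proof -
    interpret bounded_linear "frechet_derivative f (at p)" by (rule frechet_derivative_linear[OF assms])
    have "norm (frechet_derivative f (at p) v) = norm (\<Sum>b\<in>Basis. (v \<bullet> b) *\<^sub>R frechet_derivative f (at p) b)"
      by (subst euclidean_representation[symmetric, of v]) (simp add: sum scaleR)
    also have "\<dots> \<le> (\<Sum>b\<in>Basis. norm v * norm (frechet_derivative f (at p) b))"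
      by (intro order_trans[OF norm_sum] sum_mono) (auto intro!: mult_right_mono Basis_le_norm)
    also have "\<dots> = ?D p * norm v" by (simp add: sum_distrib_left mult.commute)
    also have "\<dots> \<le> max 0 M * norm v"
    proof (intro mult_right_mono)
      have "norm (?D p) \<le> M" using M that by (intro bspec[OF M] imageI) auto
      then show "?D p \<le> max 0 M" by simp
    qed simp
    finally show ?thesis .
  qed
  then show ?thesis by (intro exI[of _ "max 0 M"]) auto
qed

text \<open>Uniform continuity of the derivative on a compact ball gives strict differentiability
  with one \<delta> for all base points. This uniformity lets pointwise estimates pass to the
  supremum norm.\<close>

lemma C1_uniformly_strict:
  fixes f :: "'a::euclidean_space \<Rightarrow> 'b::real_normed_vector"
  assumes C1: "Ck (Suc 0) f" and "e > 0"
  shows "\<exists>\<delta>>0. \<forall>p p1 p2. norm p \<le> R \<and> norm (p1 - p) < \<delta> \<and> norm (p2 - p) < \<delta> \<longrightarrow>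
     norm (f p1 - f p2 - frechet_derivative f (at p) (p1 - p2)) \<le> e * norm (p1 - p2) \<and>
     (\<forall>v. norm (frechet_derivative f (at p1) v - frechet_derivative f (at p) v) \<le> e * norm v)"
proof -
  let ?D = "\<lambda>p. frechet_derivative f (at p)"
  define e' where "e' = e / DIM('a)"
  have e': "e' > 0" using \<open>e > 0\<close> by (simp add: e'_def)
  \<comment> \<open>The radius \<open>R + 1\<close> leaves room for points at distance less than 1
    from the smaller ball, which is why \<delta> is capped at 1 below.\<close>
  have "\<forall>b\<in>Basis. \<exists>\<delta>>0. \<forall>p\<in>cball 0 (R + 1). \<forall>p'\<in>cball 0 (R + 1). dist p' p < \<delta> \<longrightarrow> dist (?D p' b) (?D p b) < e'"
  proof
    fix b :: 'a
    have "continuous_on (cball 0 (R + 1)) (\<lambda>p. ?D p b)" using C1 by (auto intro: continuous_on_subset)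
    then have "uniformly_continuous_on (cball 0 (R + 1)) (\<lambda>p. ?D p b)"
      by (intro compact_uniformly_continuous) auto
    then show "\<exists>\<delta>>0. \<forall>p\<in>cball 0 (R + 1). \<forall>p'\<in>cball 0 (R + 1). dist p' p < \<delta> \<longrightarrow> dist (?D p' b) (?D p b) < e'"
      using e' unfolding uniformly_continuous_on_def by blast
  qed
  then obtain d where d: "\<And>b. b \<in> Basis \<Longrightarrow> d b > 0"
    "\<And>b p p'. b \<in> Basis \<Longrightarrow> p \<in> cball 0 (R + 1) \<Longrightarrow> p' \<in> cball 0 (R + 1) \<Longrightarrow> dist p' p < d b \<Longrightarrow> dist (?D p' b) (?D p b) < e'"
    by metis
  define \<delta> where "\<delta> = min 1 (Min (d ` Basis))"
  have \<delta>: "\<delta> > 0" "\<delta> \<le> 1" "\<And>b. b \<in> Basis \<Longrightarrow> \<delta> \<le> d b"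
    using d(1) by (auto simp: \<delta>_def min_le_iff_disj)
  have close: "norm (?D x v - ?D p v) \<le> e * norm v" if p: "norm p \<le> R" and x: "norm (x - p) < \<delta>" for x p v
  proof -
    interpret D: bounded_linear "?D x" by (rule frechet_derivative_linear[OF C1])
    interpret E: bounded_linear "?D p" by (rule frechet_derivative_linear[OF C1])
    have "norm x \<le> norm p + norm (x - p)" by (metis add_diff_cancel_left' diff_add_cancel norm_triangle_ineq add.commute)
    then have inb: "p \<in> cball 0 (R + 1)" "x \<in> cball 0 (R + 1)"
      using p x \<delta>(2) by (auto simp: dist_norm norm_minus_commute)
    have "?D x v - ?D p v = (\<Sum>b\<in>Basis. (v \<bullet> b) *\<^sub>R (?D x b - ?D p b))"
      by (subst (1 2) euclidean_representation[symmetric, of v])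
        (simp add: D.sum D.scaleR E.sum E.scaleR scaleR_diff_right sum_subtractf)
    also have "norm \<dots> \<le> (\<Sum>b\<in>(Basis::'a set). norm v * e')"
    proof (intro order_trans[OF norm_sum] sum_mono)
      fix b :: 'a assume b: "b \<in> Basis"
      have "dist (?D x b) (?D p b) < e'"
        using d(2)[OF b inb] \<delta>(3)[OF b] x by (simp add: dist_norm)
      then show "norm ((v \<bullet> b) *\<^sub>R (?D x b - ?D p b)) \<le> norm v * e'"
        using b by (auto simp: dist_norm intro!: mult_mono Basis_le_norm)
    qed
    also have "\<dots> = e * norm v" by (simp add: e'_def)
    finally show ?thesis .
  qed
  have "norm (f p1 - f p2 - ?D p (p1 - p2)) \<le> e * norm (p1 - p2)"
    if p: "norm p \<le> R" and p1: "norm (p1 - p) < \<delta>" and p2: "norm (p2 - p) < \<delta>" for p p1 p2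
  proof -
    let ?S = "ball p \<delta>"
    have S: "p1 \<in> ?S" "p2 \<in> ?S" "p \<in> ?S" using p1 p2 \<delta>(1) by (auto simp: dist_norm norm_minus_commute)
    have "norm (f p1 - f p2 - ?D p (p1 - p2)) \<le> norm (p1 - p2) * e"
    proof (rule differentiable_bound_linearization[of p2 p1 ?S f ?D p])
      show "p2 + t *\<^sub>R (p1 - p2) \<in> ?S" if "t \<in> {0..1}" for t
        using convexD_alt[OF convex_ball S(2,1), of t] that by (simp add: algebra_simps)
      show "(f has_derivative ?D x) (at x within ?S)" for x
        by (rule has_derivative_at_withinI[OF Ck_has_derivative[OF C1]])
      show "onorm (?D x - ?D p) \<le> e" if x: "x \<in> ?S" for x
        unfolding fun_diff_def by (rule onorm_le, rule close[OF p]) (use x in \<open>simp add: dist_norm norm_minus_commute\<close>)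
      show "p \<in> ?S" by (rule S(3))
    qed
    then show ?thesis by (simp add: mult.commute)
  qed
  with close \<delta>(1) show ?thesis by blast
qed

text \<open>Differentiation under the integral sign, with the derivative as an integral of bounded
  linear maps; it is applied to the integral form of Taylor remainders.\<close>

lemma C1_parameter_integral:
  fixes H :: "'a::euclidean_space \<times> real \<Rightarrow> 'c::euclidean_space"
  assumes H: "Ck (Suc 0) H"
  shows "Ck (Suc 0) (\<lambda>p. integral {0..1} (\<lambda>s. H (p, s)))"
proof -
  let ?D = "\<lambda>z. frechet_derivative H (at z)"
  define B where "B p s = Blinfun (\<lambda>v. ?D (p, s) (v, 0))" for p s
  have bl: "bounded_linear (\<lambda>v. ?D (p, s) (v, 0))" for p s
    by (rule bounded_linear_compose[OF frechet_derivative_linear[OF H]])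
      (intro bounded_linear_Pair bounded_linear_ident bounded_linear_zero)
  have B: "blinfun_apply (B p s) v = ?D (p, s) (v, 0)" for p s v
    unfolding B_def by (simp add: bounded_linear_Blinfun_apply[OF bl])
  have cont: "continuous_on UNIV (\<lambda>z. ?D z v)" for v using Ck_dirderiv[OF H, of v] by (simp only: Ck.simps)
  have cH: "continuous_on UNIV H" using H by (rule Ck_continuous)
  have d: "((\<lambda>p. H (p, s)) has_derivative blinfun_apply (B p s)) (at p within UNIV)" for p s
  proof -
    have "((\<lambda>p. H (p, s)) has_derivative (\<lambda>v. ?D (p, s) (v, 0))) (at p)"
      by (rule has_derivative_compose[of "\<lambda>p. (p, s)" "\<lambda>v. (v, 0)", OF _ Ck_has_derivative[OF H]])
        (auto intro!: derivative_eq_intros)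
    then show ?thesis by (simp add: B[abs_def])
  qed
  have contB: "continuous_on (UNIV \<times> cbox 0 1) (\<lambda>(p, s). B p s)"
    unfolding split_beta
    by (rule continuous_on_blinfun_componentwise) (auto simp: B intro: continuous_on_subset[OF cont])
  have "((\<lambda>p. integral (cbox 0 1) (\<lambda>s. H (p, s))) has_derivative blinfun_apply (integral (cbox 0 1) (B p))) (at p within UNIV)" for p
  proof (rule leibniz_rule[OF d _ contB])
    show "(\<lambda>s. H (p, s)) integrable_on cbox 0 1" for p
      by (intro integrable_continuous continuous_on_compose2[OF cH] continuous_intros) auto
  qed auto
  then have D: "((\<lambda>p. integral {0..1} (\<lambda>s. H (p, s))) has_derivative blinfun_apply (integral (cbox 0 1) (B p))) (at p)" for p
    by simp
  have "Ck 0 (\<lambda>p. blinfun_apply (integral (cbox 0 1) (B p)) v)" for v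
  proof -
    have "continuous_on UNIV (\<lambda>p. integral (cbox 0 1) (B p))"
      by (rule integral_continuous_on_param) (use contB in simp)
    then show ?thesis by (auto intro: continuous_intros)
  qed
  with D show ?thesis by (intro Ck_SucI[OF D])
qed

text \<open>The increment of \<open>G\<close> in direction \<open>b\<close>, started at
  \<open>p + s a\<close>, is an integral of the \<open>b\<close>-derivative. Its derivative in
  \<open>s\<close>, computed in two ways, expresses the \<open>b\<close>-increment of the
  \<open>a\<close>-derivative as an integral of the mixed derivative; differentiating once more at 0
  compares both orders.\<close>

lemma second_derivative_symmetric:
  fixes G :: "'a::euclidean_space \<Rightarrow> 'b::euclidean_space"
  assumes G: "Ck (Suc (Suc 0)) G"
  shows "frechet_derivative (\<lambda>x. frechet_derivative G (at x) b) (at p) a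
       = frechet_derivative (\<lambda>x. frechet_derivative G (at x) a) (at p) b"
proof -
  let ?d = "\<lambda>v G x. frechet_derivative G (at x) v"
  have C: "Ck (Suc 0) (?d v G)" for v using G by simp
  have cab: "continuous_on UNIV (?d a (?d b G))" using C[of b] by simp
  have line: "((\<lambda>s. F (q + s *\<^sub>R v)) has_vector_derivative ?d v F (q + s *\<^sub>R v)) (at s)"
    if "Ck (Suc k) F" for F :: "'a \<Rightarrow> 'b" and k q v s
    by (rule Ck_line_derivative[OF that]) (auto intro!: derivative_eq_intros)
  have key: "?d a G (p + t *\<^sub>R b) - ?d a G p = integral {0..t} (\<lambda>\<tau>. ?d a (?d b G) (p + \<tau> *\<^sub>R b))" if "t \<ge> 0" for t
  proof -
    define Q where "Q s = integral (cbox 0 t) (\<lambda>\<tau>. ?d b G (p + s *\<^sub>R a + \<tau> *\<^sub>R b))" for s :: real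
    have Q: "Q s = G (p + s *\<^sub>R a + t *\<^sub>R b) - G (p + s *\<^sub>R a)" for s
    proof -
      have "((\<lambda>\<tau>. ?d b G (p + s *\<^sub>R a + \<tau> *\<^sub>R b)) has_integral
         G (p + s *\<^sub>R a + t *\<^sub>R b) - G (p + s *\<^sub>R a + 0 *\<^sub>R b)) {0..t}"
        by (rule fundamental_theorem_of_calculus[OF that]) (rule has_vector_derivative_at_within[OF line[OF G]])
      then show ?thesis by (simp add: Q_def integral_unique)
    qed
    have "((\<lambda>s. integral (cbox 0 t) (\<lambda>\<tau>. ?d b G (p + s *\<^sub>R a + \<tau> *\<^sub>R b))) has_vector_derivative
       integral (cbox 0 t) (\<lambda>\<tau>. ?d a (?d b G) (p + 0 *\<^sub>R a + \<tau> *\<^sub>R b))) (at 0 within UNIV)"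
    proof (rule leibniz_rule_vector_derivative)
      show "((\<lambda>s. ?d b G (p + s *\<^sub>R a + \<tau> *\<^sub>R b)) has_vector_derivative ?d a (?d b G) (p + s *\<^sub>R a + \<tau> *\<^sub>R b)) (at s within UNIV)" for s \<tau>
        using line[OF C[of b], of "p + \<tau> *\<^sub>R b" a s] by (simp add: add_ac)
      show "(\<lambda>\<tau>. ?d b G (p + s *\<^sub>R a + \<tau> *\<^sub>R b)) integrable_on cbox 0 t" for s
        by (intro integrable_continuous continuous_on_compose2[OF Ck_continuous[OF C]] continuous_intros) auto
      show "continuous_on (UNIV \<times> cbox 0 t) (\<lambda>(s, \<tau>). ?d a (?d b G) (p + s *\<^sub>R a + \<tau> *\<^sub>R b))"
        unfolding split_beta by (intro continuous_on_compose2[OF cab] continuous_intros) auto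
    qed auto
    then have "(Q has_vector_derivative integral {0..t} (\<lambda>\<tau>. ?d a (?d b G) (p + \<tau> *\<^sub>R b))) (at 0)"
      by (simp add: Q_def[abs_def])
    moreover have "((\<lambda>s. G (p + t *\<^sub>R b + s *\<^sub>R a) - G (p + s *\<^sub>R a)) has_vector_derivative
        ?d a G (p + t *\<^sub>R b + 0 *\<^sub>R a) - ?d a G (p + 0 *\<^sub>R a)) (at 0)"
      by (intro has_vector_derivative_diff line[OF G])
    then have "(Q has_vector_derivative ?d a G (p + t *\<^sub>R b) - ?d a G p) (at 0)"
      unfolding Q[abs_def] by (simp add: add_ac)
    ultimately show ?thesis using vector_derivative_unique_at by metis
  qed
  have "((\<lambda>t. ?d a G (p + t *\<^sub>R b)) has_vector_derivative ?d b (?d a G) p) (at 0 within {0..1})"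
    using has_vector_derivative_at_within[OF line[OF C[of a], of p b 0]] by simp
  then have 1: "((\<lambda>t. ?d a G (p + t *\<^sub>R b) - ?d a G p) has_vector_derivative ?d b (?d a G) p) (at 0 within {0..1})"
    using has_vector_derivative_diff[OF _ has_vector_derivative_const] by fastforce
  have "((\<lambda>t. integral {0..t} (\<lambda>\<tau>. ?d a (?d b G) (p + \<tau> *\<^sub>R b))) has_vector_derivative
     ?d a (?d b G) (p + 0 *\<^sub>R b)) (at 0 within {0..1})"
    by (rule integral_has_vector_derivative) (auto intro!: continuous_on_compose2[OF cab] continuous_intros)
  from has_vector_derivative_transform[OF _ _ this, of "\<lambda>t. ?d a G (p + t *\<^sub>R b) - ?d a G p"]
  have 2: "((\<lambda>t. ?d a G (p + t *\<^sub>R b) - ?d a G p) has_vector_derivative ?d a (?d b G) p) (at 0 within {0..1})"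
    using key by force
  show ?thesis
    by (rule vector_derivative_unique_within_closed_interval[of 0 1 0 "\<lambda>t. ?d a G (p + t *\<^sub>R b) - ?d a G p"])
      (use 1 2 in simp_all)
qed

subsection \<open>Real analytic maps are smooth\<close>

definition monomial :: "('a::euclidean_space \<Rightarrow> nat) \<Rightarrow> 'a \<Rightarrow> real" where
  "monomial k h = (\<Prod>b\<in>Basis. (h \<bullet> b) ^ k b)"

definition multi_indices :: "('a::euclidean_space \<Rightarrow> nat) set" where
  "multi_indices = (Basis \<rightarrow>\<^sub>E UNIV)"

text \<open>The partial derivative of the monomial in direction \<open>b\<close>. For
  \<open>k b = 0\<close> the truncated exponent \<open>k b - 1\<close> is harmless because of the
  factor \<open>k b\<close>.\<close>

definition monomial_partial :: "'a::euclidean_space \<Rightarrow> ('a \<Rightarrow> nat) \<Rightarrow> 'a \<Rightarrow> real" where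
  "monomial_partial b k h = real (k b) * (h \<bullet> b) ^ (k b - 1) * (\<Prod>b'\<in>Basis-{b}. (h \<bullet> b') ^ k b')"

lemma monomial_has_derivative:
  "(monomial k has_derivative (\<lambda>v. \<Sum>b\<in>Basis. (v \<bullet> b) * monomial_partial b k h)) (at h)"
proof -
  have "((\<lambda>h. \<Prod>b\<in>Basis. (h \<bullet> b) ^ k b) has_derivative
     (\<lambda>v. \<Sum>b\<in>Basis. (real (k b) * (v \<bullet> b) * (h \<bullet> b) ^ (k b - 1)) * (\<Prod>b'\<in>Basis-{b}. (h \<bullet> b') ^ k b'))) (at h)"
    by (rule has_derivative_prod) (intro has_derivative_power has_derivative_inner_left has_derivative_ident)
  then show ?thesis
    unfolding monomial_def[abs_def] monomial_partial_def by (simp add: mult_ac)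
qed

text \<open>Being countably infinite, the multi-indices can be enumerated by the natural numbers,
  which makes the theorem on termwise differentiation of series available.\<close>

lemma infinite_multi_indices: "infinite (multi_indices :: ('a::euclidean_space \<Rightarrow> nat) set)"
proof
  assume fin: "finite (multi_indices :: ('a \<Rightarrow> nat) set)"
  let ?f = "\<lambda>n::nat. restrict (\<lambda>_. n) (Basis :: 'a set)"
  have "inj ?f"
  proof (rule injI)
    fix m n assume "?f m = ?f n"
    then have "?f m (SOME b. b \<in> Basis) = ?f n (SOME b. b \<in> Basis)" by simp
    then show "m = n" using some_in_eq[of "Basis :: 'a set"] by simp
  qed
  moreover have "range ?f \<subseteq> multi_indices" by (auto simp: multi_indices_def)
  ultimately have "finite (UNIV :: nat set)" using fin by (meson finite_imageD finite_subset)
  then show False by simp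
qed

lemma countable_multi_indices: "countable (multi_indices :: ('a::euclidean_space \<Rightarrow> nat) set)"
  unfolding multi_indices_def by (intro countable_PiE) auto

text \<open>Shifting the index by one in the entry \<open>b\<close> turns the differentiated series
  back into a power series.\<close>

lemma monomial_partial_shift:
  assumes b: "b \<in> Basis"
  shows "monomial_partial b (k(b := Suc (k b))) h = real (Suc (k b)) * monomial k h"
proof -
  have "(\<Prod>b'\<in>Basis-{b}. (h \<bullet> b') ^ (k(b := Suc (k b))) b') = (\<Prod>b'\<in>Basis-{b}. (h \<bullet> b') ^ k b')"
    by (intro prod.cong) auto
  moreover have "monomial k h = (h \<bullet> b) ^ k b * (\<Prod>b'\<in>Basis-{b}. (h \<bullet> b') ^ k b')"
    unfolding monomial_def using b by (simp add: prod.remove[of Basis b])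
  ultimately show ?thesis by (simp add: monomial_partial_def)
qed

lemma real_analytic_at_real_iff:
  "real_analytic_at (g :: 'a::euclidean_space \<Rightarrow> real) x \<longleftrightarrow>
    (\<exists>r>0. \<exists>c. \<forall>h\<in>ball 0 r. ((\<lambda>k. monomial k h * c k) has_sum g (x + h)) multi_indices)"
  unfolding real_analytic_at_def monomial_def multi_indices_def by simp

text \<open>Absolute convergence at the corner \<open>(\<rho>, \<dots>, \<rho>)\<close> of a cube inside the ball of convergence makes
  the termwise differentiated series converge uniformly on the cube of half the size, because
  \<open>m \<le> 2\<^sup>m\<close>.\<close>

lemma real_analytic_derivative:
  fixes g :: "'a::euclidean_space \<Rightarrow> real"
  assumes "real_analytic_at g x"
  shows "\<exists>r>0. \<exists>g'. (\<forall>y\<in>ball x r. (g has_derivative g' y) (at y)) \<and> (\<forall>v. real_analytic_at (\<lambda>y. g' y v) x)"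
proof -
  obtain R c where R: "R > 0" and c: "\<And>h. h \<in> ball 0 R \<Longrightarrow> ((\<lambda>k. monomial k h * c k) has_sum g (x + h)) multi_indices"
    using assms unfolding real_analytic_at_real_iff by blast
  define N where "N = real DIM('a)"
  have N: "N \<ge> 1" unfolding N_def by (simp add: Suc_leI)
  \<comment> \<open>The corner \<open>h0\<close> has norm at most \<open>N \<rho> = R / 2\<close>
    and so lies in the ball of convergence.\<close>
  define \<rho> where "\<rho> = R / (2 * N)"
  have \<rho>: "\<rho> > 0" using R N by (simp add: \<rho>_def)
  define h0 where "h0 = (\<Sum>b\<in>Basis. \<rho> *\<^sub>R b :: 'a)"
  have h0b: "h0 \<bullet> b = \<rho>" if "b \<in> Basis" for b
    using that unfolding h0_def by (simp add: inner_sum_left inner_Basis if_distrib sum.If_cases cong: if_cong)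
  have "norm h0 \<le> (\<Sum>b\<in>(Basis::'a set). \<rho>)" unfolding h0_def using \<rho> by (intro sum_norm_le) auto
  also have "\<dots> = R / 2" using N by (simp add: \<rho>_def N_def)
  finally have h0: "h0 \<in> ball 0 R" using R by simp
  have mono0: "monomial k h0 = (\<Prod>b\<in>(Basis::'a set). \<rho> ^ k b)" for k
    unfolding monomial_def by (intro prod.cong) (auto simp: h0b)
  have "(\<lambda>k. monomial k h0 * c k) summable_on multi_indices" using c[OF h0] by (auto simp: summable_on_def)
  then have abs0: "(\<lambda>k. norm (monomial k h0 * c k)) summable_on multi_indices"
    by (rule summable_on_iff_abs_summable_on_real[THEN iffD1])
  define e where "e = from_nat_into (multi_indices :: ('a \<Rightarrow> nat) set)"
  have e: "bij_betw e UNIV multi_indices"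
    unfolding e_def by (rule bij_betw_from_nat_into[OF countable_multi_indices infinite_multi_indices])
  have sum0: "summable (\<lambda>n. norm (monomial (e n) h0 * c (e n)))"
    using abs0 summable_on_reindex_bij_betw[OF e, of "\<lambda>k. norm (monomial k h0 * c k)"]
    by (simp add: summable_on_imp_summable)
  have partial_le: "\<bar>monomial_partial b k h\<bar> \<le> (2 / \<rho>) * monomial k h0"
    if b: "b \<in> Basis" and h: "\<And>b'. b' \<in> Basis \<Longrightarrow> \<bar>h \<bullet> b'\<bar> \<le> \<rho> / 2" for b k and h :: 'a
  proof -
    have rest: "\<bar>\<Prod>b'\<in>Basis-{b}. (h \<bullet> b') ^ k b'\<bar> \<le> (\<Prod>b'\<in>Basis-{b}. \<rho> ^ k b')"
      unfolding abs_prod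
    proof (intro prod_mono conjI)
      fix b' assume "b' \<in> Basis - {b}"
      then have "\<bar>h \<bullet> b'\<bar> \<le> \<rho>" using h[of b'] \<rho> by simp
      then show "\<bar>(h \<bullet> b') ^ k b'\<bar> \<le> \<rho> ^ k b'" by (simp add: power_abs power_mono)
    qed auto
    have fst: "real (k b) * \<bar>h \<bullet> b\<bar> ^ (k b - 1) \<le> (2 / \<rho>) * \<rho> ^ k b"
    proof (cases "k b")
      case (Suc m)
      have "real (Suc m) \<le> 2 ^ Suc m" using of_nat_less_two_power[of "Suc m", where 'a=real] by (rule less_imp_le)
      have "real (Suc m) * \<bar>h \<bullet> b\<bar> ^ m \<le> 2 ^ Suc m * (\<rho> / 2) ^ m"
        by (intro mult_mono power_mono h b \<open>real (Suc m) \<le> 2 ^ Suc m\<close>) auto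
      also have "\<dots> = (2 / \<rho>) * \<rho> ^ Suc m" using \<rho> by (simp add: power_divide)
      finally show ?thesis using Suc by simp
    qed (use \<rho> in simp)
    have "\<bar>monomial_partial b k h\<bar> = (real (k b) * \<bar>h \<bullet> b\<bar> ^ (k b - 1)) * \<bar>\<Prod>b'\<in>Basis-{b}. (h \<bullet> b') ^ k b'\<bar>"
      by (simp add: monomial_partial_def abs_mult power_abs)
    also have "\<dots> \<le> ((2 / \<rho>) * \<rho> ^ k b) * (\<Prod>b'\<in>Basis-{b}. \<rho> ^ k b')"
      by (intro mult_mono fst rest) (use \<rho> in \<open>auto intro!: prod_nonneg\<close>)
    also have "\<dots> = (2 / \<rho>) * monomial k h0"
      unfolding mono0 using b by (simp add: prod.remove[of Basis b])
    finally show ?thesis .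
  qed
  define S where "S = ball (0::'a) (\<rho> / 2)"
  have hS: "\<bar>h \<bullet> b\<bar> \<le> \<rho> / 2" if "h \<in> S" "b \<in> Basis" for h b
    using Basis_le_norm[OF that(2), of h] that(1) by (simp add: S_def)
  have "\<rho> / 2 \<le> R" unfolding \<rho>_def using N R by (auto simp: field_simps)
  then have SR: "S \<subseteq> ball 0 R" by (auto simp: S_def)
  define f' where "f' n h v = (\<Sum>b\<in>Basis. (v \<bullet> b) * monomial_partial b (e n) h) * c (e n)" for n h v
  define M where "M n = (2 * N / \<rho>) * norm (monomial (e n) h0 * c (e n))" for n
  have m0: "monomial k h0 \<ge> 0" for k unfolding mono0 using \<rho> by (intro prod_nonneg) auto
  have f'_le: "norm (f' n h v) \<le> M n * norm v" if "h \<in> S" for n h v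
  proof -
    have "\<bar>\<Sum>b\<in>Basis. (v \<bullet> b) * monomial_partial b (e n) h\<bar> \<le> (\<Sum>b\<in>(Basis::'a set). norm v * ((2 / \<rho>) * monomial (e n) h0))"
    proof (intro order_trans[OF sum_abs] sum_mono)
      fix b :: 'a assume b: "b \<in> Basis"
      show "\<bar>(v \<bullet> b) * monomial_partial b (e n) h\<bar> \<le> norm v * ((2 / \<rho>) * monomial (e n) h0)"
        unfolding abs_mult by (intro mult_mono Basis_le_norm b partial_le hS[OF that]) auto
    qed
    also have "\<dots> = norm v * (2 * N / \<rho>) * monomial (e n) h0" by (simp add: N_def)
    finally have "norm (f' n h v) \<le> (norm v * (2 * N / \<rho>) * monomial (e n) h0) * \<bar>c (e n)\<bar>"
      unfolding f'_def real_norm_def abs_mult by (rule mult_right_mono) simp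
    also have "\<dots> = M n * norm v" using m0[of "e n"] by (simp add: M_def abs_mult)
    finally show ?thesis .
  qed
  have sumM: "summable M" unfolding M_def by (intro summable_mult sum0)
  have M0: "M n \<ge> 0" for n using N \<rho> by (simp add: M_def)
  have sumf': "summable (\<lambda>n. norm (f' n h v))" if "h \<in> S" for h v
    by (rule summable_comparison_test'[OF summable_mult2[OF sumM, of "norm v"], of 0]) (use f'_le[OF that] in simp)
  define g' where "g' h v = (\<Sum>n. f' n h v)" for h v
  have g'_sums: "(\<lambda>n. f' n h v) sums g' h v" if "h \<in> S" for h v
    unfolding g'_def by (rule summable_sums[OF summable_norm_cancel[OF sumf'[OF that]]])
  have gs: "(\<lambda>n. monomial (e n) h * c (e n)) sums g (x + h)" if "h \<in> S" for h
  proof -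
    have "((\<lambda>n. monomial (e n) h * c (e n)) has_sum g (x + h)) UNIV"
      using c[of h] SR that has_sum_reindex_bij_betw[OF e, of "\<lambda>k. monomial k h * c k"] by auto
    then show ?thesis by (rule has_sum_imp_sums)
  qed
  have "\<exists>G. \<forall>h\<in>S. (\<lambda>n. monomial (e n) h * c (e n)) sums G h \<and> (G has_derivative g' h) (at h within S)"
  proof (rule has_derivative_series)
    show "convex S" by (simp add: S_def)
    show "((\<lambda>h. monomial (e n) h * c (e n)) has_derivative f' n h) (at h within S)" for n h
      unfolding f'_def[abs_def]
      by (rule has_derivative_mult_left[OF has_derivative_at_withinI[OF monomial_has_derivative]])
    show "0 \<in> S" using \<rho> by (simp add: S_def)
    then show "(\<lambda>n. monomial (e n) 0 * c (e n)) sums g (x + 0)" by (rule gs)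
    fix \<epsilon> :: real assume \<epsilon>: "\<epsilon> > 0"
    have "(\<lambda>n. \<Sum>i. M (i + n)) \<longlonglongrightarrow> 0" by (rule suminf_exist_split2[OF sumM])
    then have "\<forall>\<^sub>F n in sequentially. (\<Sum>i. M (i + n)) < \<epsilon>" using \<epsilon> by (rule order_tendstoD)
    then show "\<forall>\<^sub>F n in sequentially. \<forall>h\<in>S. \<forall>v. norm (sum (\<lambda>i. f' i h v) {..<n} - g' h v) \<le> \<epsilon> * norm v"
    proof eventually_elim
      case (elim n)
      show ?case
      proof (intro ballI allI)
        fix h v assume h: "h \<in> S"
        have sf: "summable (\<lambda>i. f' i h v)" using sumf'[OF h] by (rule summable_norm_cancel)
        have sn: "summable (\<lambda>i. norm (f' (i + n) h v))" using sumf'[OF h, of v] summable_iff_shift[of "\<lambda>i. norm (f' i h v)"] by simp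
        have "g' h v - sum (\<lambda>i. f' i h v) {..<n} = (\<Sum>i. f' (i + n) h v)"
          unfolding g'_def using suminf_split_initial_segment[OF sf, of n] by simp
        then have "norm (sum (\<lambda>i. f' i h v) {..<n} - g' h v) = norm (\<Sum>i. f' (i + n) h v)"
          by (subst norm_minus_commute) simp
        also have "\<dots> \<le> (\<Sum>i. norm (f' (i + n) h v))" by (rule summable_norm[OF sn])
        also have "\<dots> \<le> (\<Sum>i. M (i + n) * norm v)"
          using sumM summable_iff_shift[of M n] by (intro suminf_le sn summable_mult2 f'_le h) auto
        also have "\<dots> = (\<Sum>i. M (i + n)) * norm v"
          using sumM summable_iff_shift[of M n] by (intro suminf_mult2[symmetric]) auto
        also have "\<dots> \<le> \<epsilon> * norm v" using elim by (intro mult_right_mono) auto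
        finally show "norm (sum (\<lambda>i. f' i h v) {..<n} - g' h v) \<le> \<epsilon> * norm v" .
      qed
    qed
  qed
  then obtain G where G: "\<And>h. h \<in> S \<Longrightarrow> (\<lambda>n. monomial (e n) h * c (e n)) sums G h"
      "\<And>h. h \<in> S \<Longrightarrow> (G has_derivative g' h) (at h within S)" by blast
  have GG: "G h = g (x + h)" if "h \<in> S" for h using G(1)[OF that] gs[OF that] by (rule sums_unique2)
  have openS: "open S" by (simp add: S_def)
  have der: "(g has_derivative g' (y - x)) (at y)" if "y \<in> ball x (\<rho> / 2)" for y
  proof -
    have yS: "y - x \<in> S" using that by (simp add: S_def dist_norm norm_minus_commute)
    have "(G has_derivative g' (y - x)) (at (y - x))" using G(2)[OF yS] at_within_open[OF yS openS] by simp
    then have "((\<lambda>h. g (x + h)) has_derivative g' (y - x)) (at (y - x))"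
      by (rule has_derivative_transform_within_open[OF _ openS yS]) (simp add: GG)
    then have "((\<lambda>y. g (x + (y - x))) has_derivative g' (y - x)) (at y)"
      by (intro has_derivative_compose[of "\<lambda>y. y - x" "\<lambda>v. v" y UNIV "\<lambda>h. g (x + h)"]) (auto intro!: derivative_eq_intros)
    then show ?thesis by simp
  qed
  have an: "real_analytic_at (\<lambda>y. g' (y - x) v) x" for v
    unfolding real_analytic_at_real_iff
  proof (intro exI conjI ballI)
    show "\<rho> / 2 > 0" using \<rho> by simp
    fix h :: 'a assume "h \<in> ball 0 (\<rho> / 2)"
    then have h: "h \<in> S" by (simp add: S_def)
    let ?t = "\<lambda>b k. (v \<bullet> b) * real (Suc (k b)) * c (k(b := Suc (k b)))"
    have one: "((\<lambda>k. monomial k h * (real (Suc (k b)) * c (k(b := Suc (k b))))) has_sum (\<Sum>n. monomial_partial b (e n) h * c (e n))) multi_indices"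
      if b: "b \<in> Basis" for b
    proof -
      have eqf: "f' n h b = monomial_partial b (e n) h * c (e n)" for n
        unfolding f'_def using b by (simp add: inner_Basis if_distrib if_distribR sum.If_cases cong: if_cong)
      have "((\<lambda>n. monomial_partial b (e n) h * c (e n)) has_sum (\<Sum>n. monomial_partial b (e n) h * c (e n))) UNIV"
        using norm_summable_imp_has_sum[OF sumf'[OF h, of b] g'_sums[OF h]] by (simp add: eqf g'_def)
      then have "((\<lambda>k. monomial_partial b k h * c k) has_sum (\<Sum>n. monomial_partial b (e n) h * c (e n))) multi_indices"
        using has_sum_reindex_bij_betw[OF e, of "\<lambda>k. monomial_partial b k h * c k"] by simp
      \<comment> \<open>Indices with \<open>k b = 0\<close> contribute nothing; on the others,
        lowering the entry \<open>b\<close> inverts the shift, so the sum can be reindexed over all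
        multi-indices.\<close>
      then have "((\<lambda>k. monomial_partial b k h * c k) has_sum (\<Sum>n. monomial_partial b (e n) h * c (e n))) {k\<in>multi_indices. k b > 0}"
        by (subst (asm) has_sum_cong_neutral[of _ _ "\<lambda>k. monomial_partial b k h * c k"]) (auto simp: monomial_partial_def)
      moreover have "bij_betw (\<lambda>k. k(b := Suc (k b))) multi_indices {k\<in>multi_indices. k b > 0}"
      proof (rule bij_betwI[where g="\<lambda>k. k(b := k b - 1)"])
        show "(\<lambda>k. k(b := Suc (k b))) \<in> multi_indices \<rightarrow> {k \<in> multi_indices. 0 < k b}"
          using b by (auto simp: multi_indices_def PiE_iff extensional_def)
        show "(\<lambda>k. k(b := k b - 1)) \<in> {k \<in> multi_indices. 0 < k b} \<rightarrow> multi_indices"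
          using b by (auto simp: multi_indices_def PiE_iff extensional_def)
      qed auto
      ultimately have "((\<lambda>k. monomial_partial b (k(b := Suc (k b))) h * c (k(b := Suc (k b)))) has_sum (\<Sum>n. monomial_partial b (e n) h * c (e n))) multi_indices"
        using has_sum_reindex_bij_betw[of "\<lambda>k. k(b := Suc (k b))" multi_indices _ "\<lambda>k. monomial_partial b k h * c k"] by blast
      then show ?thesis by (simp only: monomial_partial_shift[OF b] mult_ac)
    qed
    have fin: "((\<lambda>k. \<Sum>b\<in>B. (v \<bullet> b) * (monomial k h * (real (Suc (k b)) * c (k(b := Suc (k b)))))) has_sum
        (\<Sum>b\<in>B. (v \<bullet> b) * (\<Sum>n. monomial_partial b (e n) h * c (e n)))) multi_indices" if "B \<subseteq> Basis" for B
      using finite_subset[OF that finite_Basis] that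
    proof (induction B rule: finite_induct)
      case (insert b B)
      then have "b \<in> Basis" "B \<subseteq> Basis" by auto
      then show ?case
        unfolding sum.insert[OF insert.hyps(1,2)] by (intro has_sum_add has_sum_cmult_right one insert.IH)
    qed simp
    have "g' h v = (\<Sum>b\<in>Basis. (v \<bullet> b) * (\<Sum>n. monomial_partial b (e n) h * c (e n)))"
    proof -
      have sb: "(\<lambda>n. monomial_partial b (e n) h * c (e n)) sums (\<Sum>n. monomial_partial b (e n) h * c (e n))" if b: "b \<in> Basis" for b
      proof -
        have "f' n h b = monomial_partial b (e n) h * c (e n)" for n
          unfolding f'_def using b by (simp add: inner_Basis if_distrib if_distribR sum.If_cases cong: if_cong)
        then show ?thesis using g'_sums[OF h, of b] by (simp add: g'_def)
      qed
      have "(\<lambda>n. \<Sum>b\<in>Basis. (v \<bullet> b) * (monomial_partial b (e n) h * c (e n))) sums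
         (\<Sum>b\<in>Basis. (v \<bullet> b) * (\<Sum>n. monomial_partial b (e n) h * c (e n)))"
        by (intro sums_sum sums_mult sb)
      moreover have "(\<lambda>n. \<Sum>b\<in>Basis. (v \<bullet> b) * (monomial_partial b (e n) h * c (e n))) = (\<lambda>n. f' n h v)"
        by (simp add: f'_def[abs_def] sum_distrib_right mult.assoc)
      ultimately have "(\<lambda>n. f' n h v) sums (\<Sum>b\<in>Basis. (v \<bullet> b) * (\<Sum>n. monomial_partial b (e n) h * c (e n)))"
        by simp
      then show ?thesis by (rule sums_unique2[OF g'_sums[OF h]])
    qed
    then show "((\<lambda>k. monomial k h * (\<Sum>b\<in>Basis. ?t b k)) has_sum g' (x + h - x) v) multi_indices"
      using fin[OF order_refl] by (simp add: sum_distrib_left mult_ac)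
  qed
  show ?thesis
    by (intro exI[of _ "\<rho> / 2"] exI[of _ "\<lambda>y. g' (y - x)"] conjI ballI allI der an) (use \<rho> in auto)
qed

lemma real_analytic_at_cong:
  fixes f g :: "'a::euclidean_space \<Rightarrow> real"
  assumes "real_analytic_at f x" "r > 0" "\<And>y. y \<in> ball x r \<Longrightarrow> f y = g y"
  shows "real_analytic_at g x"
proof -
  obtain R c where R: "R > 0" "\<And>h. h \<in> ball 0 R \<Longrightarrow> ((\<lambda>k. monomial k h * c k) has_sum f (x + h)) multi_indices"
    using assms(1) unfolding real_analytic_at_real_iff by blast
  have "((\<lambda>k. monomial k h * c k) has_sum g (x + h)) multi_indices" if "h \<in> ball 0 (min R r)" for h
    using R(2)[of h] assms(3)[of "x + h"] that by (simp add: dist_norm)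
  then show ?thesis unfolding real_analytic_at_real_iff using R(1) assms(2) by (intro exI[of _ "min R r"] exI[of _ c] conjI ballI) auto
qed

text \<open>The locally constructed derivatives agree with the global one by uniqueness. The
  directional derivatives are therefore again analytic, and the induction continues with
  them.\<close>

lemma real_analytic_Ck_real:
  fixes g :: "'a::euclidean_space \<Rightarrow> real"
  assumes "\<And>x. real_analytic_at g x"
  shows "Ck k g"
  using assms
proof (induction k arbitrary: g)
  case 0
  have "isCont g x" for x
    using real_analytic_derivative[OF 0[of x]] by (metis centre_in_ball has_derivative_continuous)
  then show ?case by (simp add: continuous_on_eq_continuous_at)
next
  case (Suc k)
  have "\<exists>g'. (g has_derivative g') (at x)" for x
    using real_analytic_derivative[OF Suc.prems[of x]] by (metis centre_in_ball)
  then obtain D where D: "\<And>x. (g has_derivative D x) (at x)" by metis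
  have "real_analytic_at (\<lambda>y. D y v) x" for v x
  proof -
    obtain r g' where r: "r > 0" "\<And>y. y \<in> ball x r \<Longrightarrow> (g has_derivative g' y) (at y)" "real_analytic_at (\<lambda>y. g' y v) x"
      using real_analytic_derivative[OF Suc.prems[of x]] by metis
    show ?thesis
      by (rule real_analytic_at_cong[OF r(3,1)]) (use has_derivative_unique[OF r(2) D] in metis)
  qed
  then show ?case by (intro Ck_SucI[OF D] Suc.IH)
qed

lemma real_analytic_Ck:
  fixes g :: "'a::euclidean_space \<Rightarrow> 'b::euclidean_space"
  assumes "\<And>x. real_analytic_at g x"
  shows "Ck k g"
proof (rule Ck_componentwise, rule real_analytic_Ck_real)
  fix b :: 'b and x :: 'a
  obtain R c where R: "R > 0"
    "\<And>h. h \<in> ball 0 R \<Longrightarrow> ((\<lambda>k. (\<Prod>b\<in>Basis. (h \<bullet> b) ^ k b) *\<^sub>R c k) has_sum g (x + h)) (Basis \<rightarrow>\<^sub>E UNIV)"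
    using assms[of x] unfolding real_analytic_at_def by blast
  show "real_analytic_at (\<lambda>x. g x \<bullet> b) x"
    unfolding real_analytic_at_def
    using R has_sum_bounded_linear[OF bounded_linear_inner_left[of b] R(2)]
    by (intro exI[of _ R] exI[of _ "\<lambda>k. c k \<bullet> b"] conjI ballI) auto
qed

subsection \<open>Superposition operators on bounded continuous functions\<close>

definition nemytskii :: "('e::metric_space \<Rightarrow> 'f::real_normed_vector) \<Rightarrow> ('d::metric_space \<Rightarrow>\<^sub>C 'e) \<Rightarrow> ('d \<Rightarrow>\<^sub>C 'f)" where
  "nemytskii N z = Bcontfun (\<lambda>t. N (apply_bcontfun z t))"

text \<open>A bounded function has relatively compact range, on which the continuous map
  \<open>N\<close> is bounded; hence the superposition is a genuine element of the space and
  \<open>Bcontfun\<close> returns it unchanged.\<close>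

lemma nemytskii_apply:
  fixes N :: "'e::euclidean_space \<Rightarrow> 'f::real_normed_vector"
  assumes "continuous_on UNIV N"
  shows "apply_bcontfun (nemytskii N z) t = N (apply_bcontfun z t)"
proof -
  have "bounded (range (apply_bcontfun z))" using apply_bcontfun[of z] by (simp add: bcontfun_def)
  then have "compact (closure (range (apply_bcontfun z)))" by simp
  then have "compact (N ` closure (range (apply_bcontfun z)))"
    by (intro compact_continuous_image continuous_on_subset[OF assms]) auto
  then have "bounded (N ` closure (range (apply_bcontfun z)))" by (rule compact_imp_bounded)
  then have "bounded (range (\<lambda>t. N (apply_bcontfun z t)))"
    by (rule bounded_subset) (auto intro!: imageI closure_subset[THEN subsetD])
  moreover have "continuous_on UNIV (\<lambda>t. N (apply_bcontfun z t))"
    by (intro continuous_on_compose2[OF assms]) auto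
  ultimately show ?thesis unfolding nemytskii_def by (subst Bcontfun_inverse) (auto simp: bcontfun_def)
qed

lemma bounded_linear_pos_bound:
  assumes "bounded_linear f" obtains K where "K > 0" "\<And>x. norm (f x) \<le> K * norm x"
  using bounded_linear.pos_bounded[OF assms] by (metis mult.commute)

lemma bounded_linear_postcompose:
  fixes P :: "'a::real_normed_vector \<Rightarrow> 'b::real_normed_vector"
  assumes P: "bounded_linear P"
  shows "\<exists>Q :: ('d::topological_space \<Rightarrow>\<^sub>C 'a) \<Rightarrow> ('d \<Rightarrow>\<^sub>C 'b). bounded_linear Q \<and> (\<forall>h t. apply_bcontfun (Q h) t = P (apply_bcontfun h t))"
proof -
  interpret bounded_linear P by fact
  obtain M where M: "M > 0" "\<And>x. norm (P x) \<le> M * norm x" using bounded_linear_pos_bound[OF P] by blast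
  have "\<exists>Q :: ('d \<Rightarrow>\<^sub>C 'a) \<Rightarrow> ('d \<Rightarrow>\<^sub>C 'b). bounded_linear Q \<and> (\<forall>h t. apply_bcontfun (Q h) t = P (apply_bcontfun h t)) \<and>
     (\<forall>h. norm (Q h) \<le> M * norm h)"
    by (rule bounded_linear_bcontfunI)
      (auto simp: plus_bcontfun.rep_eq scaleR_bcontfun.rep_eq add scaleR intro!: continuous_on continuous_on_apply_bcontfun
         order_trans[OF M(2)] mult_left_mono norm_apply_bcontfun less_imp_le[OF M(1)])
  then show ?thesis by blast
qed

lemma norm_fst_snd_le: "norm (fst y) \<le> norm y" "norm (snd y) \<le> norm y"
  using norm_fst_le[of "fst y" "snd y"] norm_snd_le[of "snd y" "fst y"] by auto

lemma mult_le_of_le_divide: "x \<le> a / (c * k) \<Longrightarrow> 0 < c \<Longrightarrow> 0 < k \<Longrightarrow> x * k \<le> a / (c :: real)"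
  by (simp add: pos_le_divide_eq mult_ac)

text \<open>An implicit function theorem in fixed point form, with unknown \<open>y\<close> and
  parameter \<alpha>. The hypothesis \<open>zero\<close> says that at the base point
  \<open>N\<close> does not depend on \<open>y\<close> to first order: the linear dependence is
  supposed to have been moved into \<open>Q\<close>. The right-hand side is therefore a contraction
  near \<open>y0\<close> without inverting a linearisation.\<close>

theorem nemytskii_fixed_point:
  fixes N :: "'e::euclidean_space \<Rightarrow> 'f::euclidean_space"
    and Z0 L1 :: "real \<Rightarrow>\<^sub>C 'e" and L0 :: "'x::banach \<Rightarrow> (real \<Rightarrow>\<^sub>C 'e)" and Q :: "(real \<Rightarrow>\<^sub>C 'f) \<Rightarrow> 'x"
  assumes N: "Ck (Suc 0) N" and L0: "bounded_linear L0" and Q: "bounded_linear Q"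
    and base: "y0 = Q (nemytskii N (Z0 + L0 y0))"
    and zero: "\<And>y t. frechet_derivative N (at (apply_bcontfun (Z0 + L0 y0) t)) (apply_bcontfun (L0 y) t) = 0"
  shows "\<exists>\<epsilon>>0. \<exists>C\<ge>0. \<exists>Y. Y 0 = y0 \<and> (\<forall>\<alpha>. \<bar>\<alpha>\<bar> < \<epsilon> \<longrightarrow>
     Y \<alpha> = Q (nemytskii N (Z0 + \<alpha> *\<^sub>R L1 + L0 (Y \<alpha>))) \<and> norm (Y \<alpha> - y0) \<le> C * \<bar>\<alpha>\<bar> \<and>
     (\<exists>d. (Y has_vector_derivative d) (at \<alpha>) \<and> norm d \<le> C))"
proof -
  note cN = Ck_continuous[OF N]
  let ?D = "\<lambda>p. frechet_derivative N (at p)"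
  let ?a = "apply_bcontfun"
  interpret Q: bounded_linear Q by fact
  interpret L0: bounded_linear L0 by fact
  obtain KQ where KQ: "KQ > 0" "\<And>h. norm (Q h) \<le> KQ * norm h" using bounded_linear_pos_bound[OF Q] by blast
  obtain KL where KL: "KL > 0" "\<And>y. norm (L0 y) \<le> KL * norm y" using bounded_linear_pos_bound[OF L0] by blast
  define R where "R = norm (Z0 + L0 y0)"
  \<comment> \<open>The variation of the derivative of \<open>N\<close> that is still allowed if the
    composition with \<open>L0\<close> and \<open>Q\<close> is to contract by 1/2.\<close>
  define e where "e = 1 / (2 * KQ * KL)"
  have e: "e > 0" "KQ * (e * KL) = 1/2" using KQ(1) KL(1) by (auto simp: e_def)
  obtain \<delta> where \<delta>: "\<delta> > 0"
    "\<And>p p1 p2. norm p \<le> R \<Longrightarrow> norm (p1 - p) < \<delta> \<Longrightarrow> norm (p2 - p) < \<delta> \<Longrightarrow>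
       norm (N p1 - N p2 - ?D p (p1 - p2)) \<le> e * norm (p1 - p2)"
    "\<And>p p1 v. norm p \<le> R \<Longrightarrow> norm (p1 - p) < \<delta> \<Longrightarrow> norm (?D p1 v - ?D p v) \<le> e * norm v"
    using C1_uniformly_strict[OF N e(1), of R] by metis
  obtain M where M: "M \<ge> 0" "\<And>p v. norm p \<le> R + \<delta> \<Longrightarrow> norm (?D p v) \<le> M * norm v"
    using C1_derivative_bound[OF N, of "R + \<delta>"] by blast
  define Z where "Z \<alpha> y = Z0 + \<alpha> *\<^sub>R L1 + L0 y" for \<alpha> y
  define T where "T \<alpha> y = Q (nemytskii N (Z \<alpha> y))" for \<alpha> y
  define C1 where "C1 = KQ * ((e + M) * norm L1)"
  have C1: "C1 \<ge> 0" using KQ(1) e(1) M(1) by (simp add: C1_def)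
  define \<eta> where "\<eta> = \<delta> / (4 * KL)"
  have \<eta>: "\<eta> > 0" "KL * \<eta> = \<delta> / 4" using \<delta>(1) KL(1) by (auto simp: \<eta>_def)
  \<comment> \<open>One entry keeps the shift by \<open>\<alpha> L1\<close> within
    \<open>\<delta> / 4\<close>, the other makes the right-hand side map the ball of radius \<eta>
    around \<open>y0\<close> into itself.\<close>
  define \<epsilon> where "\<epsilon> = min (\<delta> / (4 * (norm L1 + 1))) (\<eta> / (2 * (C1 + 1)))"
  have \<epsilon>: "\<epsilon> > 0" using \<delta>(1) \<eta>(1) C1 by (auto simp: \<epsilon>_def intro!: divide_pos_pos add_nonneg_pos)
  have \<epsilon>1: "\<bar>\<alpha>\<bar> * norm L1 \<le> \<delta> / 4" if "\<bar>\<alpha>\<bar> < \<epsilon>" for \<alpha>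
  proof -
    have "\<bar>\<alpha>\<bar> \<le> \<delta> / (4 * (norm L1 + 1))" using that by (simp add: \<epsilon>_def)
    then have "\<bar>\<alpha>\<bar> * (norm L1 + 1) \<le> \<delta> / 4" by (rule mult_le_of_le_divide) (auto intro: add_nonneg_pos)
    moreover have "\<bar>\<alpha>\<bar> * norm L1 \<le> \<bar>\<alpha>\<bar> * (norm L1 + 1)" by (intro mult_left_mono) auto
    ultimately show ?thesis by linarith
  qed
  have \<epsilon>2: "C1 * \<bar>\<alpha>\<bar> \<le> \<eta> / 2" if "\<bar>\<alpha>\<bar> < \<epsilon>" for \<alpha>
  proof -
    have "\<bar>\<alpha>\<bar> \<le> \<eta> / (2 * (C1 + 1))" using that by (simp add: \<epsilon>_def)
    then have "\<bar>\<alpha>\<bar> * (C1 + 1) \<le> \<eta> / 2" by (rule mult_le_of_le_divide) (use C1 in auto)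
    moreover have "\<bar>\<alpha>\<bar> * C1 \<le> \<bar>\<alpha>\<bar> * (C1 + 1)" by (intro mult_left_mono) auto
    ultimately show ?thesis by (simp add: mult.commute)
  qed
  let ?p = "\<lambda>t. ?a (Z0 + L0 y0) t"
  have pR: "norm (?p t) \<le> R" for t unfolding R_def by (rule norm_apply_bcontfun)
  have near: "norm (?a (Z \<alpha> y) t - ?p t) < \<delta>" if "\<bar>\<alpha>\<bar> < \<epsilon>" "norm (y - y0) \<le> \<eta>" for \<alpha> y t
  proof -
    have "?a (Z \<alpha> y) t - ?p t = ?a (\<alpha> *\<^sub>R L1 + L0 (y - y0)) t"
      by (simp add: Z_def L0.diff plus_bcontfun.rep_eq minus_bcontfun.rep_eq)
    then have "norm (?a (Z \<alpha> y) t - ?p t) \<le> norm (\<alpha> *\<^sub>R L1 + L0 (y - y0))" by (simp only: norm_apply_bcontfun)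
    also have "\<dots> \<le> \<bar>\<alpha>\<bar> * norm L1 + KL * norm (y - y0)"
      using norm_triangle_ineq[of "\<alpha> *\<^sub>R L1" "L0 (y - y0)"] KL(2)[of "y - y0"] by simp
    also have "\<dots> \<le> \<delta> / 4 + KL * \<eta>" using \<epsilon>1[OF that(1)] that(2) KL(1) by (intro add_mono mult_left_mono) auto
    finally show ?thesis using \<eta>(2) \<delta>(1) by simp
  qed
  have Tdiff: "norm (T \<alpha> y - T \<beta> z) \<le> KQ * c"
    if "\<And>t. norm (N (?a (Z \<alpha> y) t) - N (?a (Z \<beta> z) t)) \<le> c" for \<alpha> \<beta> y z c
  proof -
    have "norm (nemytskii N (Z \<alpha> y) - nemytskii N (Z \<beta> z)) \<le> c"
      by (rule norm_bound) (simp add: minus_bcontfun.rep_eq nemytskii_apply[OF cN] that)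
    then have "norm (Q (nemytskii N (Z \<alpha> y) - nemytskii N (Z \<beta> z))) \<le> KQ * c"
      using KQ by (meson less_imp_le mult_left_mono order_trans)
    then show ?thesis by (simp add: T_def Q.diff)
  qed
  have contr: "norm (T \<alpha> y - T \<alpha> z) \<le> 1/2 * norm (y - z)"
    if "\<bar>\<alpha>\<bar> < \<epsilon>" "norm (y - y0) \<le> \<eta>" "norm (z - y0) \<le> \<eta>" for \<alpha> y z
  proof -
    have "norm (N (?a (Z \<alpha> y) t) - N (?a (Z \<alpha> z) t)) \<le> e * (KL * norm (y - z))" for t
    proof -
      have d: "?a (Z \<alpha> y) t - ?a (Z \<alpha> z) t = ?a (L0 (y - z)) t"
        by (simp add: Z_def L0.diff plus_bcontfun.rep_eq minus_bcontfun.rep_eq)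
      have "norm (N (?a (Z \<alpha> y) t) - N (?a (Z \<alpha> z) t)) \<le> e * norm (?a (L0 (y - z)) t)"
        using \<delta>(2)[OF pR near[OF that(1,2)] near[OF that(1,3)], of t] unfolding d zero by simp
      also have "\<dots> \<le> e * (KL * norm (y - z))"
        using e(1) by (intro mult_left_mono order_trans[OF norm_apply_bcontfun KL(2)]) auto
      finally show ?thesis .
    qed
    from Tdiff[OF this] have "norm (T \<alpha> y - T \<alpha> z) \<le> (KQ * (e * KL)) * norm (y - z)" by (simp add: mult.assoc)
    then show ?thesis unfolding e(2) .
  qed
  have lip: "norm (T \<alpha> y - T \<beta> y) \<le> C1 * \<bar>\<alpha> - \<beta>\<bar>"
    if "\<bar>\<alpha>\<bar> < \<epsilon>" "\<bar>\<beta>\<bar> < \<epsilon>" "norm (y - y0) \<le> \<eta>" for \<alpha> \<beta> y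
  proof -
    have "norm (N (?a (Z \<alpha> y) t) - N (?a (Z \<beta> y) t)) \<le> (e + M) * (\<bar>\<alpha> - \<beta>\<bar> * norm L1)" for t
    proof -
      let ?d = "?a (Z \<alpha> y) t - ?a (Z \<beta> y) t"
      have d: "?d = (\<alpha> - \<beta>) *\<^sub>R ?a L1 t"
        by (simp add: Z_def plus_bcontfun.rep_eq scaleR_bcontfun.rep_eq algebra_simps)
      have nd: "norm ?d \<le> \<bar>\<alpha> - \<beta>\<bar> * norm L1" unfolding d by (simp add: mult_left_mono norm_apply_bcontfun)
      have "norm (N (?a (Z \<alpha> y) t) - N (?a (Z \<beta> y) t)) \<le> norm (N (?a (Z \<alpha> y) t) - N (?a (Z \<beta> y) t) - ?D (?p t) ?d) + norm (?D (?p t) ?d)"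
        by (metis diff_add_cancel norm_triangle_ineq)
      also have "\<dots> \<le> e * norm ?d + M * norm ?d"
        using pR[of t] \<delta>(1) by (intro add_mono \<delta>(2)[OF pR near near] M(2) that) auto
      also have "\<dots> = (e + M) * norm ?d" by (simp add: algebra_simps)
      also have "\<dots> \<le> (e + M) * (\<bar>\<alpha> - \<beta>\<bar> * norm L1)" using e(1) M(1) nd by (intro mult_left_mono) auto
      finally show ?thesis .
    qed
    from Tdiff[OF this] show ?thesis by (simp add: C1_def mult_ac)
  qed
  have T0: "T 0 y0 = y0" unfolding T_def Z_def using base by simp
  have ex: "\<exists>!y\<in>cball y0 \<eta>. T \<alpha> y = y" if \<alpha>: "\<bar>\<alpha>\<bar> < \<epsilon>" for \<alpha>
  proof (rule Banach_fix[where c="1/2"])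
    show "complete (cball y0 \<eta>)" by (simp add: complete_eq_closed)
    show "cball y0 \<eta> \<noteq> {}" using \<eta>(1) by simp
    show "T \<alpha> ` cball y0 \<eta> \<subseteq> cball y0 \<eta>"
    proof (rule image_subsetI)
      fix y assume "y \<in> cball y0 \<eta>"
      then have y: "norm (y - y0) \<le> \<eta>" by (simp add: dist_norm norm_minus_commute)
      have "T \<alpha> y - y0 = (T \<alpha> y - T \<alpha> y0) + (T \<alpha> y0 - T 0 y0)" by (simp add: T0)
      then have "norm (T \<alpha> y - y0) \<le> norm (T \<alpha> y - T \<alpha> y0) + norm (T \<alpha> y0 - T 0 y0)" by (metis norm_triangle_ineq)
      also have "\<dots> \<le> 1/2 * norm (y - y0) + C1 * \<bar>\<alpha> - 0\<bar>"
        using \<eta>(1) \<epsilon> by (intro add_mono contr lip \<alpha> y) auto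
      also have "\<dots> \<le> \<eta>" using y \<epsilon>2[OF \<alpha>] by simp
      finally show "T \<alpha> y \<in> cball y0 \<eta>" by (simp add: dist_norm norm_minus_commute)
    qed
    show "dist (T \<alpha> y) (T \<alpha> z) \<le> 1/2 * dist y z" if "y \<in> cball y0 \<eta>" "z \<in> cball y0 \<eta>" for y z
      using contr[OF \<alpha>, of y z] that by (simp add: dist_norm norm_minus_commute)
  qed auto
  define Y where "Y \<alpha> = (SOME y. y \<in> cball y0 \<eta> \<and> T \<alpha> y = y)" for \<alpha>
  have Yc: "Y \<alpha> \<in> cball y0 \<eta> \<and> T \<alpha> (Y \<alpha>) = Y \<alpha>" if "\<bar>\<alpha>\<bar> < \<epsilon>" for \<alpha>
    unfolding Y_def by (rule someI_ex) (use ex[OF that] in blast)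
  then have Y: "norm (Y \<alpha> - y0) \<le> \<eta>" "T \<alpha> (Y \<alpha>) = Y \<alpha>" if "\<bar>\<alpha>\<bar> < \<epsilon>" for \<alpha>
    using that by (auto simp: dist_norm norm_minus_commute)
  have z: "\<bar>0\<bar> < \<epsilon>" using \<epsilon> by simp
  have Y0: "Y 0 = y0" using ex[OF z] Yc[OF z] T0 \<eta>(1) by (metis centre_in_cball less_imp_le)
  have Ylip: "norm (Y \<alpha> - Y \<beta>) \<le> (2 * C1) * \<bar>\<alpha> - \<beta>\<bar>" if "\<bar>\<alpha>\<bar> < \<epsilon>" "\<bar>\<beta>\<bar> < \<epsilon>" for \<alpha> \<beta>
  proof -
    have "norm (Y \<alpha> - Y \<beta>) = norm ((T \<alpha> (Y \<alpha>) - T \<alpha> (Y \<beta>)) + (T \<alpha> (Y \<beta>) - T \<beta> (Y \<beta>)))"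
      using Y(2)[OF that(1)] Y(2)[OF that(2)] by simp
    also have "\<dots> \<le> 1/2 * norm (Y \<alpha> - Y \<beta>) + C1 * \<bar>\<alpha> - \<beta>\<bar>"
      by (intro norm_triangle_le add_mono contr lip that Y(1))
    finally show ?thesis by simp
  qed
  have deriv: "\<exists>d. (Y has_vector_derivative d) (at \<alpha>) \<and> norm d \<le> 2 * C1" if \<alpha>: "\<bar>\<alpha>\<bar> < \<epsilon>" for \<alpha>
  proof -
    let ?z = "Z \<alpha> (Y \<alpha>)"
    have zR: "norm (?a ?z t) \<le> R + \<delta>" for t
    proof -
      have "norm (?a ?z t) \<le> norm (?p t) + norm (?a ?z t - ?p t)" by (metis add_diff_cancel_left' diff_add_cancel norm_triangle_ineq)
      then show ?thesis using pR[of t] near[OF \<alpha> Y(1)[OF \<alpha>], of t] by linarith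
    qed
    \<comment> \<open>\<open>P\<close> is the candidate for the derivative of the superposition
      operator at the solution: pointwise application of the derivative of \<open>N\<close>.\<close>
    have "\<exists>P. bounded_linear P \<and> (\<forall>w t. ?a (P w) t = ?D (?a ?z t) (?a w t)) \<and> (\<forall>w. norm (P w) \<le> M * norm w)"
    proof (rule bounded_linear_bcontfunI)
      fix w v :: "real \<Rightarrow>\<^sub>C 'e" and t r
      interpret D: bounded_linear "?D (?a ?z t)" for t by (rule frechet_derivative_linear[OF N])
      have "?D (?a ?z t) (?a w t) = (\<Sum>b\<in>Basis. (?a w t \<bullet> b) *\<^sub>R ?D (?a ?z t) b)" for t
        by (subst euclidean_representation[symmetric, of "?a w t"]) (simp add: D.sum D.scaleR)
      moreover have "continuous_on UNIV (\<lambda>t. ?D (?a ?z t) b)" for b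
        using Ck_dirderiv[OF N, of b] unfolding Ck.simps by (rule continuous_on_compose2) auto
      ultimately show "continuous_on UNIV (\<lambda>t. ?D (?a ?z t) (?a w t))"
        by (auto intro!: continuous_intros)
      show "norm (?D (?a ?z t) (?a w t)) \<le> M * norm w"
        using M by (intro order_trans[OF M(2)[OF zR]] mult_left_mono norm_apply_bcontfun)
      show "?D (?a ?z t) (?a (w + v) t) = ?D (?a ?z t) (?a w t) + ?D (?a ?z t) (?a v t)"
        by (simp add: plus_bcontfun.rep_eq D.add)
      show "?D (?a ?z t) (?a (r *\<^sub>R w) t) = r *\<^sub>R ?D (?a ?z t) (?a w t)"
        by (simp add: scaleR_bcontfun.rep_eq D.scaleR)
    qed
    then obtain P where P: "bounded_linear P" "\<And>w t. ?a (P w) t = ?D (?a ?z t) (?a w t)" "\<And>w. norm (P w) \<le> M * norm w" by blast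
    interpret P: bounded_linear P by fact
    have half: "norm (Q (P (L0 v))) \<le> norm v / 2" for v
    proof -
      have "norm (P (L0 v)) \<le> e * (KL * norm v)"
      proof (rule norm_bound)
        fix t
        have "norm (?D (?a ?z t) (?a (L0 v) t)) \<le> e * norm (?a (L0 v) t)"
          using \<delta>(3)[OF pR near[OF \<alpha> Y(1)[OF \<alpha>]], of t "?a (L0 v) t"] unfolding zero diff_zero .
        also have "\<dots> \<le> e * (KL * norm v)"
          using e(1) by (intro mult_left_mono order_trans[OF norm_apply_bcontfun KL(2)]) auto
        finally show "norm (?a (P (L0 v)) t) \<le> e * (KL * norm v)" by (simp add: P(2))
      qed
      then have "norm (Q (P (L0 v))) \<le> KQ * (e * (KL * norm v))"
        using KQ by (meson less_imp_le mult_left_mono order_trans)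
      also have "\<dots> = (KQ * (e * KL)) * norm v" by simp
      finally show ?thesis unfolding e(2) by simp
    qed
    have "bounded_linear (\<lambda>v. Q (P (L0 v)))"
      by (intro bounded_linear_compose[OF Q] bounded_linear_compose[OF P(1)] L0)
    \<comment> \<open>Formal differentiation of the fixed point equation gives this linear equation
      for the derivative \<open>d\<close>. It is solvable because the linear part still has norm at
      most 1/2 at the perturbed solution.\<close>
    from neumann_inverse[OF this half] obtain d where d: "d = Q (P L1) + Q (P (L0 d))" by metis
    have "norm (Q (P L1)) \<le> C1"
    proof -
      have "norm (Q (P L1)) \<le> KQ * (M * norm L1)" using KQ P(3) by (meson less_imp_le mult_left_mono order_trans)
      also have "\<dots> \<le> C1" unfolding C1_def using KQ(1) e(1) by (intro mult_left_mono mult_right_mono) auto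
      finally show ?thesis .
    qed
    then have nd: "norm d \<le> 2 * C1"
      using half[of d] norm_triangle_ineq[of "Q (P L1)" "Q (P (L0 d))"] d by simp
    define c where "c = 2 * KQ * (norm L1 + KL * (2 * C1)) + 1"
    have c: "c > 0" using KQ(1) KL(1) C1 by (auto simp: c_def intro!: add_nonneg_pos mult_nonneg_nonneg)
    have "(Y has_derivative (\<lambda>h. h *\<^sub>R d)) (at \<alpha>)"
      unfolding has_derivative_at_alt
    proof (intro conjI allI impI)
      show "bounded_linear (\<lambda>h. h *\<^sub>R d)" by (rule bounded_linear_scaleR_left)
      fix e3 :: real assume e3: "e3 > 0"
      define e2 where "e2 = e3 / c"
      have e2: "e2 > 0" "e2 * c = e3" using e3 c by (auto simp: e2_def)
      obtain \<delta>2 where \<delta>2: "\<delta>2 > 0" "\<And>p p1 p2. norm p \<le> R + \<delta> \<Longrightarrow> norm (p1 - p) < \<delta>2 \<Longrightarrow> norm (p2 - p) < \<delta>2 \<Longrightarrow>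
         norm (N p1 - N p2 - ?D p (p1 - p2)) \<le> e2 * norm (p1 - p2)"
        using C1_uniformly_strict[OF N e2(1), of "R + \<delta>"] by metis
      define G where "G = norm L1 + KL * (2 * C1)"
      have G: "G \<ge> 0" using KL(1) C1 by (simp add: G_def)
      define m where "m = min (\<epsilon> - \<bar>\<alpha>\<bar>) (\<delta>2 / (G + 1))"
      have m: "m > 0" using \<alpha> \<delta>2(1) G by (auto simp: m_def)
      show "\<exists>m>0. \<forall>\<beta>. norm (\<beta> - \<alpha>) < m \<longrightarrow> norm (Y \<beta> - Y \<alpha> - (\<beta> - \<alpha>) *\<^sub>R d) \<le> e3 * norm (\<beta> - \<alpha>)"
      proof (intro exI[of _ m] conjI m allI impI)
        fix \<beta> assume b: "norm (\<beta> - \<alpha>) < m"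
        define h where "h = \<beta> - \<alpha>"
        have \<beta>: "\<bar>\<beta>\<bar> < \<epsilon>" using b by (auto simp: m_def)
        define \<Delta> where "\<Delta> = Y \<beta> - Y \<alpha>"
        have n\<Delta>: "norm \<Delta> \<le> 2 * C1 * \<bar>h\<bar>" unfolding \<Delta>_def h_def by (rule Ylip[OF \<beta> \<alpha>])
        have dz: "Z \<beta> (Y \<beta>) - ?z = h *\<^sub>R L1 + L0 \<Delta>" by (simp add: Z_def h_def \<Delta>_def L0.diff algebra_simps)
        have "norm (Z \<beta> (Y \<beta>) - ?z) \<le> \<bar>h\<bar> * norm L1 + KL * norm \<Delta>"
          unfolding dz using norm_triangle_ineq[of "h *\<^sub>R L1" "L0 \<Delta>"] KL(2)[of \<Delta>] by simp
        also have "\<dots> \<le> \<bar>h\<bar> * norm L1 + KL * (2 * C1 * \<bar>h\<bar>)" using n\<Delta> KL(1) by simp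
        also have "\<dots> = G * \<bar>h\<bar>" by (simp add: G_def algebra_simps)
        finally have ndz: "norm (Z \<beta> (Y \<beta>) - ?z) \<le> G * \<bar>h\<bar>" .
        have "G * \<bar>h\<bar> < \<delta>2"
        proof -
          have "\<bar>h\<bar> < \<delta>2 / (G + 1)" using b by (simp add: h_def m_def)
          then have "\<bar>h\<bar> * (G + 1) < \<delta>2" using G by (simp add: pos_less_divide_eq)
          then show ?thesis by (simp add: algebra_simps)
        qed
        with ndz have ndz2: "norm (Z \<beta> (Y \<beta>) - ?z) < \<delta>2" by simp
        have "norm (nemytskii N (Z \<beta> (Y \<beta>)) - nemytskii N ?z - P (Z \<beta> (Y \<beta>) - ?z)) \<le> e2 * (G * \<bar>h\<bar>)"
        proof (rule norm_bound)
          fix t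
          let ?q = "?a (Z \<beta> (Y \<beta>)) t"
          have nq: "norm (?q - ?a ?z t) \<le> norm (Z \<beta> (Y \<beta>) - ?z)"
            using norm_apply_bcontfun[of "Z \<beta> (Y \<beta>) - ?z" t] by (simp add: minus_bcontfun.rep_eq)
          have "norm (N ?q - N (?a ?z t) - ?D (?a ?z t) (?q - ?a ?z t)) \<le> e2 * norm (?q - ?a ?z t)"
            using nq ndz2 \<delta>2(1) by (intro \<delta>2(2)[OF zR]) auto
          also have "\<dots> \<le> e2 * (G * \<bar>h\<bar>)" using nq ndz e2(1) by (intro mult_left_mono) auto
          finally show "norm (?a (nemytskii N (Z \<beta> (Y \<beta>)) - nemytskii N ?z - P (Z \<beta> (Y \<beta>) - ?z)) t) \<le> e2 * (G * \<bar>h\<bar>)"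
            by (simp add: minus_bcontfun.rep_eq nemytskii_apply[OF cN] P(2))
        qed
        then have "norm (Q (nemytskii N (Z \<beta> (Y \<beta>)) - nemytskii N ?z - P (Z \<beta> (Y \<beta>) - ?z))) \<le> KQ * (e2 * (G * \<bar>h\<bar>))"
          using KQ by (meson less_imp_le mult_left_mono order_trans)
        then have r: "norm (\<Delta> - Q (P (h *\<^sub>R L1 + L0 \<Delta>))) \<le> KQ * (e2 * (G * \<bar>h\<bar>))"
          using Y(2)[OF \<alpha>] Y(2)[OF \<beta>] by (simp add: Q.diff dz T_def \<Delta>_def)
        \<comment> \<open>The error \<open>\<Delta> - h d\<close> satisfies the linearised equation
          up to a small remainder; the linear part accounts for at most half of the error, which is
          absorbed on the left.\<close>
        have split: "\<Delta> - h *\<^sub>R d = (\<Delta> - Q (P (h *\<^sub>R L1 + L0 \<Delta>))) + Q (P (L0 (\<Delta> - h *\<^sub>R d)))"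
        proof -
          have "h *\<^sub>R d = h *\<^sub>R Q (P L1) + h *\<^sub>R Q (P (L0 d))" by (subst d) (rule scaleR_add_right)
          moreover have "Q (P (h *\<^sub>R L1 + L0 \<Delta>)) = h *\<^sub>R Q (P L1) + Q (P (L0 \<Delta>))"
            by (simp add: P.add P.scaleR Q.add Q.scaleR)
          moreover have "Q (P (L0 (\<Delta> - h *\<^sub>R d))) = Q (P (L0 \<Delta>)) - h *\<^sub>R Q (P (L0 d))"
            by (simp add: P.diff P.scaleR Q.diff Q.scaleR L0.diff L0.scaleR)
          moreover have "\<Delta> - (x + z) = (\<Delta> - (x + y)) + (y - z)" for x y z by simp
          ultimately show ?thesis by (simp only:)
        qed
        have "norm (\<Delta> - h *\<^sub>R d) \<le> KQ * (e2 * (G * \<bar>h\<bar>)) + norm (\<Delta> - h *\<^sub>R d) / 2"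
          using norm_triangle_ineq[of "\<Delta> - Q (P (h *\<^sub>R L1 + L0 \<Delta>))" "Q (P (L0 (\<Delta> - h *\<^sub>R d)))", folded split] r half[of "\<Delta> - h *\<^sub>R d"] by linarith
        then have "norm (\<Delta> - h *\<^sub>R d) \<le> (e2 * (2 * KQ * G)) * \<bar>h\<bar>" by (simp add: mult_ac)
        also have "\<dots> \<le> (e2 * c) * \<bar>h\<bar>"
          using e2(1) by (intro mult_right_mono mult_left_mono) (auto simp: c_def G_def)
        finally show "norm (Y \<beta> - Y \<alpha> - (\<beta> - \<alpha>) *\<^sub>R d) \<le> e3 * norm (\<beta> - \<alpha>)"
          unfolding e2(2) \<Delta>_def h_def by simp
      qed
    qed
    then have "(Y has_vector_derivative d) (at \<alpha>)" by (simp add: has_vector_derivative_def)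
    with nd show ?thesis by blast
  qed
  show ?thesis
  proof (rule exI[of _ \<epsilon>], rule conjI[OF \<epsilon>], rule exI[of _ "2 * C1"], rule conjI, goal_cases nonneg solution)
    case nonneg
    show ?case using C1 by simp
  next
    case solution
    show ?case
    proof (rule exI[of _ Y], intro conjI allI impI Y0)
    fix \<alpha> assume \<alpha>: "\<bar>\<alpha>\<bar> < \<epsilon>"
    show "Y \<alpha> = Q (nemytskii N (Z0 + \<alpha> *\<^sub>R L1 + L0 (Y \<alpha>)))" using Y(2)[OF \<alpha>] by (simp add: T_def Z_def)
    show "norm (Y \<alpha> - y0) \<le> 2 * C1 * \<bar>\<alpha>\<bar>" using Ylip[OF \<alpha>, of 0] \<epsilon> by (simp add: Y0)
    show "\<exists>d. (Y has_vector_derivative d) (at \<alpha>) \<and> norm d \<le> 2 * C1" by (rule deriv[OF \<alpha>])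
    qed
  qed
qed

section \<open>Iterated directional derivatives and Taylor remainders\<close>

definition dirder :: "'a::real_normed_vector \<Rightarrow> ('a \<Rightarrow> 'b::real_normed_vector) \<Rightarrow> 'a \<Rightarrow> 'b" where
  "dirder v G x = frechet_derivative G (at x) v"

lemma Ck_dirder: "Ck (Suc k) G \<Longrightarrow> Ck k (dirder v G)"
  unfolding dirder_def[abs_def] by (rule Ck_dirderiv)

lemma dirder_along:
  assumes "Ck (Suc k) G" "(g has_vector_derivative d) (at t)"
  shows "((\<lambda>t. G (g t)) has_vector_derivative dirder d G (g t)) (at t)"
  unfolding dirder_def by (rule Ck_line_derivative[OF assms])

lemma dirder_eqI:
  assumes "Ck (Suc k) G" "((\<lambda>s. G (x + s *\<^sub>R v)) has_vector_derivative d) (at 0)"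
  shows "dirder v G x = d"
proof -
  have "((\<lambda>s. G (x + s *\<^sub>R v)) has_vector_derivative dirder v G (x + 0 *\<^sub>R v)) (at 0)"
    by (rule dirder_along[OF assms(1)]) (auto intro!: derivative_eq_intros)
  then show ?thesis using vector_derivative_unique_at[OF assms(2)] by simp
qed

lemma
  assumes "Ck (Suc k) G"
  shows dirder_add: "dirder (v + w) G x = dirder v G x + dirder w G x"
    and dirder_scaleR: "dirder (r *\<^sub>R v) G x = r *\<^sub>R dirder v G x"
    and dirder_zero: "dirder 0 G x = 0"
proof -
  interpret bounded_linear "frechet_derivative G (at x)" by (rule frechet_derivative_linear[OF assms])
  show "dirder (v + w) G x = dirder v G x + dirder w G x" "dirder (r *\<^sub>R v) G x = r *\<^sub>R dirder v G x" "dirder 0 G x = 0"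
    by (simp_all add: dirder_def add scaleR zero)
qed

lemma dirder_commute:
  fixes G :: "'a::euclidean_space \<Rightarrow> 'b::euclidean_space"
  shows "Ck (Suc (Suc 0)) G \<Longrightarrow> dirder a (dirder b G) p = dirder b (dirder a G) p"
  using second_derivative_symmetric[of G b p a] by (simp add: dirder_def[abs_def])

lemma frechet_derivative_fst_slice:
  assumes "Ck (Suc k) G"
  shows "frechet_derivative (\<lambda>y. G (y, m)) (at x) u = dirder (u, 0) G (x, m)"
proof -
  have "((\<lambda>y. G (y, m)) has_derivative (\<lambda>v. frechet_derivative G (at (x, m)) (v, 0))) (at x)"
    by (rule has_derivative_compose[of "\<lambda>p. (p, m)" "\<lambda>v. (v, 0)", OF _ Ck_has_derivative[OF assms]])
      (auto intro!: derivative_eq_intros)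
  from frechet_derivative_at[OF this, symmetric] show ?thesis by (simp add: dirder_def)
qed

lemma frechet_derivative_snd_slice:
  assumes "Ck (Suc k) G"
  shows "frechet_derivative (\<lambda>m. G (x, m)) (at m) u = dirder (0, u) G (x, m)"
proof -
  have "((\<lambda>m. G (x, m)) has_derivative (\<lambda>v. frechet_derivative G (at (x, m)) (0, v))) (at m)"
    by (rule has_derivative_compose[of "\<lambda>p. (x, p)" "\<lambda>v. (0, v)", OF _ Ck_has_derivative[OF assms]])
      (auto intro!: derivative_eq_intros)
  from frechet_derivative_at[OF this, symmetric] show ?thesis by (simp add: dirder_def)
qed

lemma Ck_funpow_dirder: "(\<And>k. Ck k G) \<Longrightarrow> Ck k ((dirder v ^^ i) G)"
  by (induction i arbitrary: k) (auto intro: Ck_dirder)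

text \<open>In the integral form of the Taylor remainder the factor \<open>\<alpha> ^ m\<close>
  comes out of the integral. The quotient by \<open>\<alpha> ^ m\<close> is thus a parameter
  integral and continuously differentiable across \<alpha> = 0, as the rescaled equation
  requires.\<close>

lemma hadamard_remainder:
  fixes K :: "'q::euclidean_space \<times> real \<Rightarrow> 'b::euclidean_space"
  assumes K: "\<And>k. Ck k K" and m: "m > 0"
  shows "\<exists>L. Ck (Suc 0) L \<and> (\<forall>q. L (q, 0) = (1 / fact m) *\<^sub>R (dirder (0, 1) ^^ m) K (q, 0)) \<and>
    (\<forall>q \<alpha>. K (q, \<alpha>) = (\<Sum>i<m. (\<alpha> ^ i / fact i) *\<^sub>R (dirder (0, 1) ^^ i) K (q, 0)) + \<alpha> ^ m *\<^sub>R L (q, \<alpha>))"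
proof -
  let ?D = "\<lambda>i. (dirder (0, 1) ^^ i) K"
  note C = Ck_funpow_dirder[OF K]
  define H where "H = (\<lambda>z::('q \<times> real) \<times> real. ((1 - snd z) ^ (m - 1) / fact (m - 1)) *\<^sub>R ?D m (fst (fst z), snd z * snd (fst z)))"
  define L where "L p = integral {0..1} (\<lambda>s. H (p, s))" for p
  have "Ck (Suc 0) H"
  proof -
    have "Ck (Suc 0) (\<lambda>z::('q \<times> real) \<times> real. (1 / fact (m - 1) :: real) *\<^sub>R (1 - snd z) ^ (m - 1))"
      by (intro Ck_scaleR Ck_power Ck_const Ck_diff Ck_snd Ck_ident)
    moreover have "Ck (Suc 0) (\<lambda>z::('q \<times> real) \<times> real. ?D m (fst (fst z), snd z * snd (fst z)))"
      by (intro Ck_compose[OF C] Ck_Pair Ck_fst Ck_snd Ck_ident Ck_bilinear[OF bounded_bilinear_mult])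
    ultimately have "Ck (Suc 0) (\<lambda>z::('q \<times> real) \<times> real. ((1 / fact (m - 1) :: real) *\<^sub>R (1 - snd z) ^ (m - 1)) *\<^sub>R
        ?D m (fst (fst z), snd z * snd (fst z)))" by (rule Ck_scaleR)
    then show ?thesis by (simp add: H_def)
  qed
  then have "Ck (Suc 0) L" unfolding L_def[abs_def] by (rule C1_parameter_integral)
  moreover have "L (q, 0) = (1 / fact m) *\<^sub>R ?D m (q, 0)" for q
  proof -
    have "((\<lambda>s. - ((1 - s) ^ m / fact m)) has_real_derivative (1 - s) ^ (m - 1) / fact (m - 1)) (at s)" for s :: real
      using m by (auto intro!: derivative_eq_intros simp: fact_reduce[of m])
    then have "((\<lambda>s::real. (1 - s) ^ (m - 1) / fact (m - 1)) has_integral - ((1 - 1) ^ m / fact m) - - ((1 - 0) ^ m / fact m)) {0..1}"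
      by (intro fundamental_theorem_of_calculus)
        (auto simp flip: has_real_derivative_iff_has_vector_derivative intro: has_field_derivative_at_within)
    then have "((\<lambda>s::real. (1 - s) ^ (m - 1) / fact (m - 1)) has_integral 1 / fact m) {0..1}" using m by (simp add: zero_power)
    then have "((\<lambda>s::real. ((1 - s) ^ (m - 1) / fact (m - 1)) *\<^sub>R ?D m (q, 0)) has_integral (1 / fact m) *\<^sub>R ?D m (q, 0)) {0..1}"
      by (rule has_integral_scaleR_left)
    then show ?thesis unfolding L_def H_def by (simp add: integral_unique)
  qed
  moreover have "K (q, \<alpha>) = (\<Sum>i<m. (\<alpha> ^ i / fact i) *\<^sub>R ?D i (q, 0)) + \<alpha> ^ m *\<^sub>R L (q, \<alpha>)" for q \<alpha>
  proof -
    define Df where "Df i s = \<alpha> ^ i *\<^sub>R ?D i (q, s * \<alpha>)" for i s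
    have "(Df i has_vector_derivative Df (Suc i) s) (at s within {0..1})" for i s
    proof -
      have "((\<lambda>s. ?D i (q, s * \<alpha>)) has_vector_derivative dirder (0, \<alpha>) (?D i) (q, s * \<alpha>)) (at s)"
        by (rule dirder_along[OF C, of "\<lambda>s. (q, s * \<alpha>)"])
          (auto intro!: has_vector_derivative_Pair derivative_eq_intros)
      moreover have "dirder (0, \<alpha>) (?D i) (q, s * \<alpha>) = \<alpha> *\<^sub>R ?D (Suc i) (q, s * \<alpha>)"
        using dirder_scaleR[OF C, of \<alpha> "(0, 1)"] by (simp add: scaleR_Pair)
      ultimately have "((\<lambda>s. ?D i (q, s * \<alpha>)) has_vector_derivative \<alpha> *\<^sub>R ?D (Suc i) (q, s * \<alpha>)) (at s)" by simp
      from bounded_linear.has_vector_derivative[OF bounded_linear_scaleR_right[of "\<alpha> ^ i"] this] show ?thesis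
        unfolding Df_def power_Suc2 scaleR_scaleR by (rule has_vector_derivative_at_within)
    qed
    then have "Df 0 1 = (\<Sum>i<m. ((1 - 0) ^ i / fact i) *\<^sub>R Df i 0) + integral {0..1} (\<lambda>x. ((1 - x) ^ (m - 1) / fact (m - 1)) *\<^sub>R Df m x)"
      by (intro Taylor_integral[OF m refl]) auto
    also have "integral {0..1} (\<lambda>x. ((1 - x) ^ (m - 1) / fact (m - 1)) *\<^sub>R Df m x) = \<alpha> ^ m *\<^sub>R L (q, \<alpha>)"
      unfolding L_def H_def Df_def by (subst integral_cmul[symmetric]) (simp add: mult.commute)
    finally show ?thesis by (simp add: Df_def)
  qed
  ultimately show ?thesis by blast
qed

text \<open>All coefficients of the path form one parameter, so that remainders become smooth in the
  coefficients and \<alpha> jointly.\<close>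

definition cubic_path :: "'e \<times> 'e \<times> 'e \<times> 'e \<Rightarrow> real \<Rightarrow> 'e::real_vector" where
  "cubic_path = (\<lambda>(p, a, b, c) \<alpha>. p + \<alpha> *\<^sub>R a + \<alpha>\<^sup>2 *\<^sub>R b + \<alpha> ^ 3 *\<^sub>R c)"

lemma cubic_path_derivatives:
  fixes F :: "'e::euclidean_space \<Rightarrow> 'b::euclidean_space"
  assumes F: "\<And>k. Ck k F" and q: "q = (p, a, b, c)"
  defines "K \<equiv> (\<lambda>(q, \<alpha>). F (cubic_path q \<alpha>))"
  shows "Ck k K"
    and "dirder (0, 1) K (q, 0) = dirder a F p"
    and "(dirder (0, 1) ^^ 2) K (q, 0) = dirder a (dirder a F) p + 2 *\<^sub>R dirder b F p"
    and "(dirder (0, 1) ^^ 3) K (q, 0) = dirder a (dirder a (dirder a F)) p + 6 *\<^sub>R dirder b (dirder a F) p + 6 *\<^sub>R dirder c F p"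
proof -
  have CK: "Ck k K" for k
    unfolding K_def cubic_path_def split_beta
    by (intro Ck_compose[OF F] Ck_add Ck_scaleR Ck_power Ck_fst Ck_snd Ck_ident)
  then show "Ck k K" .
  let ?g = "cubic_path q"
  have CD: "Ck k (dirder v G)" if "\<And>k. Ck k G" for k v and G :: "'e \<Rightarrow> 'b" by (rule Ck_dirder[OF that])
  have g': "(?g has_vector_derivative a + (2 * \<alpha>) *\<^sub>R b + (3 * \<alpha>\<^sup>2) *\<^sub>R c) (at \<alpha>)" for \<alpha>
    unfolding q cubic_path_def by (auto intro!: derivative_eq_intros simp: power2_eq_square)
  have G': "((\<lambda>\<alpha>. G (?g \<alpha>)) has_vector_derivative
      dirder a G (?g \<alpha>) + (2 * \<alpha>) *\<^sub>R dirder b G (?g \<alpha>) + (3 * \<alpha>\<^sup>2) *\<^sub>R dirder c G (?g \<alpha>)) (at \<alpha>)"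
    if "\<And>k. Ck k G" for G :: "'e \<Rightarrow> 'b" and \<alpha>
    using dirder_along[OF that g'[of \<alpha>]] by (simp add: dirder_add[OF that] dirder_scaleR[OF that])
  have step: "dirder (0, 1) H (q, \<alpha>) = d"
    if H: "\<And>k. Ck k H" and d: "((\<lambda>\<alpha>. H (q, \<alpha>)) has_vector_derivative d) (at \<alpha>)"
    for H :: "('e \<times> 'e \<times> 'e \<times> 'e) \<times> real \<Rightarrow> 'b" and \<alpha> d
  proof (rule vector_derivative_unique_at[OF _ d])
    show "((\<lambda>\<alpha>. H (q, \<alpha>)) has_vector_derivative dirder (0, 1) H (q, \<alpha>)) (at \<alpha>)"
      by (rule dirder_along[OF H, of "\<lambda>\<alpha>. (q, \<alpha>)"]) (auto intro!: has_vector_derivative_Pair derivative_eq_intros)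
  qed
  have Kq: "(\<lambda>\<alpha>. K (q, \<alpha>)) = (\<lambda>\<alpha>. F (?g \<alpha>))" by (simp add: K_def)
  let ?A = "dirder a" and ?B = "dirder b" and ?C = "dirder c"
  have K1: "dirder (0, 1) K (q, \<alpha>) = ?A F (?g \<alpha>) + (2 * \<alpha>) *\<^sub>R ?B F (?g \<alpha>) + (3 * \<alpha>\<^sup>2) *\<^sub>R ?C F (?g \<alpha>)" for \<alpha>
    by (rule step[OF CK]) (use G'[OF F] in \<open>simp add: Kq\<close>)
  have g0: "?g 0 = p" by (simp add: q cubic_path_def)
  show "dirder (0, 1) K (q, 0) = dirder a F p" unfolding K1 by (simp add: g0)
  note C1 = CD[OF F] and C2 = CD[OF CD[OF F]]
  have r1: "((\<lambda>\<alpha>. 2 * \<alpha>) has_real_derivative 2) (at \<alpha>)" and r2: "((\<lambda>\<alpha>. 3 * \<alpha>\<^sup>2) has_real_derivative 6 * \<alpha>) (at \<alpha>)"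
    and r3: "((\<lambda>\<alpha>. 6 * \<alpha>) has_real_derivative 6) (at \<alpha>)" for \<alpha> :: real
    by (auto intro!: derivative_eq_intros)
  have K2: "dirder (0, 1) (dirder (0, 1) K) (q, \<alpha>) =
      (?A (?A F) (?g \<alpha>) + (2 * \<alpha>) *\<^sub>R ?B (?A F) (?g \<alpha>) + (3 * \<alpha>\<^sup>2) *\<^sub>R ?C (?A F) (?g \<alpha>))
      + ((2 * \<alpha>) *\<^sub>R (?A (?B F) (?g \<alpha>) + (2 * \<alpha>) *\<^sub>R ?B (?B F) (?g \<alpha>) + (3 * \<alpha>\<^sup>2) *\<^sub>R ?C (?B F) (?g \<alpha>)) + 2 *\<^sub>R ?B F (?g \<alpha>))
      + ((3 * \<alpha>\<^sup>2) *\<^sub>R (?A (?C F) (?g \<alpha>) + (2 * \<alpha>) *\<^sub>R ?B (?C F) (?g \<alpha>) + (3 * \<alpha>\<^sup>2) *\<^sub>R ?C (?C F) (?g \<alpha>)) + (6 * \<alpha>) *\<^sub>R ?C F (?g \<alpha>))" for \<alpha>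
    by (rule step[OF Ck_dirder[OF CK]], unfold K1)
      (intro has_vector_derivative_add has_vector_derivative_scaleR r1 r2 G' C1)
  then show "(dirder (0, 1) ^^ 2) K (q, 0) = dirder a (dirder a F) p + 2 *\<^sub>R dirder b F p"
    by (simp add: numeral_2_eq_2 g0)
  have "dirder (0, 1) (dirder (0, 1) (dirder (0, 1) K)) (q, 0) =
      ?A (?A (?A F)) p + 2 *\<^sub>R ?B (?A F) p + 2 *\<^sub>R ?A (?B F) p + 2 *\<^sub>R ?A (?B F) p + 6 *\<^sub>R ?C F p"
  proof (rule step[OF Ck_dirder[OF Ck_dirder[OF CK]]], unfold K2)
    \<comment> \<open>When the scalar factor vanishes at 0, the derivative of the product there is
      the derivative of the scalar times the value of the vector factor; of the latter only
      differentiability enters.\<close>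
    have z: "((\<lambda>\<alpha>. r \<alpha> *\<^sub>R X \<alpha>) has_vector_derivative r' *\<^sub>R X 0) (at 0)"
      if r: "r 0 = 0" "(r has_real_derivative r') (at 0)" and X: "\<exists>X'. (X has_vector_derivative X') (at 0)"
      for r r' and X :: "real \<Rightarrow> 'b"
    proof -
      obtain X' where "(X has_vector_derivative X') (at 0)" using X by blast
      from has_vector_derivative_scaleR[OF r(2) this] r(1) show ?thesis by simp
    qed
    have exG: "\<exists>d. ((\<lambda>\<alpha>. G (?g \<alpha>)) has_vector_derivative d) (at 0)" if "\<And>k. Ck k G" for G :: "'e \<Rightarrow> 'b"
      using G'[OF that] by blast
    have ex3: "\<exists>d. ((\<lambda>\<alpha>. G (?g \<alpha>) + (2 * \<alpha>) *\<^sub>R H (?g \<alpha>) + (3 * \<alpha>\<^sup>2) *\<^sub>R J (?g \<alpha>)) has_vector_derivative d) (at 0)"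
      if "\<And>k. Ck k G" "\<And>k. Ck k H" "\<And>k. Ck k J" for G H J :: "'e \<Rightarrow> 'b"
      using has_vector_derivative_add[OF has_vector_derivative_add[OF G'[OF that(1)] has_vector_derivative_scaleR[OF r1 G'[OF that(2)]]]
          has_vector_derivative_scaleR[OF r2 G'[OF that(3)]]] by blast
    have r0: "((\<lambda>\<alpha>. 3 * \<alpha>\<^sup>2) has_real_derivative 0) (at (0::real))" using r2[of 0] by simp
    have A0: "((\<lambda>\<alpha>. G (?g \<alpha>)) has_vector_derivative ?A G p) (at 0)" if "\<And>k. Ck k G" for G :: "'e \<Rightarrow> 'b"
      using G'[OF that, of 0] by (simp add: g0)
    have "((\<lambda>\<alpha>. (?A (?A F) (?g \<alpha>) + (2 * \<alpha>) *\<^sub>R ?B (?A F) (?g \<alpha>) + (3 * \<alpha>\<^sup>2) *\<^sub>R ?C (?A F) (?g \<alpha>))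
      + ((2 * \<alpha>) *\<^sub>R (?A (?B F) (?g \<alpha>) + (2 * \<alpha>) *\<^sub>R ?B (?B F) (?g \<alpha>) + (3 * \<alpha>\<^sup>2) *\<^sub>R ?C (?B F) (?g \<alpha>)) + 2 *\<^sub>R ?B F (?g \<alpha>))
      + ((3 * \<alpha>\<^sup>2) *\<^sub>R (?A (?C F) (?g \<alpha>) + (2 * \<alpha>) *\<^sub>R ?B (?C F) (?g \<alpha>) + (3 * \<alpha>\<^sup>2) *\<^sub>R ?C (?C F) (?g \<alpha>)) + (6 * \<alpha>) *\<^sub>R ?C F (?g \<alpha>)))
      has_vector_derivative
      (?A (?A (?A F)) p + 2 *\<^sub>R ?B (?A F) (?g 0) + 0 *\<^sub>R ?C (?A F) (?g 0))
      + (2 *\<^sub>R (?A (?B F) (?g 0) + (2 * 0) *\<^sub>R ?B (?B F) (?g 0) + (3 * 0\<^sup>2) *\<^sub>R ?C (?B F) (?g 0)) + 2 *\<^sub>R ?A (?B F) p)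
      + (0 *\<^sub>R (?A (?C F) (?g 0) + (2 * 0) *\<^sub>R ?B (?C F) (?g 0) + (3 * 0\<^sup>2) *\<^sub>R ?C (?C F) (?g 0)) + 6 *\<^sub>R ?C F (?g 0))) (at 0)"
      by (intro has_vector_derivative_add z[OF _ r1] z[OF _ r0] z[OF _ r3] A0 C2 C1 exG ex3
          bounded_linear.has_vector_derivative[OF bounded_linear_scaleR_right]) simp_all
    then show "((\<lambda>\<alpha>. (?A (?A F) (?g \<alpha>) + (2 * \<alpha>) *\<^sub>R ?B (?A F) (?g \<alpha>) + (3 * \<alpha>\<^sup>2) *\<^sub>R ?C (?A F) (?g \<alpha>))
      + ((2 * \<alpha>) *\<^sub>R (?A (?B F) (?g \<alpha>) + (2 * \<alpha>) *\<^sub>R ?B (?B F) (?g \<alpha>) + (3 * \<alpha>\<^sup>2) *\<^sub>R ?C (?B F) (?g \<alpha>)) + 2 *\<^sub>R ?B F (?g \<alpha>))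
      + ((3 * \<alpha>\<^sup>2) *\<^sub>R (?A (?C F) (?g \<alpha>) + (2 * \<alpha>) *\<^sub>R ?B (?C F) (?g \<alpha>) + (3 * \<alpha>\<^sup>2) *\<^sub>R ?C (?C F) (?g \<alpha>)) + (6 * \<alpha>) *\<^sub>R ?C F (?g \<alpha>)))
      has_vector_derivative ?A (?A (?A F)) p + 2 *\<^sub>R ?B (?A F) p + 2 *\<^sub>R ?A (?B F) p + 2 *\<^sub>R ?A (?B F) p + 6 *\<^sub>R ?C F p) (at 0)"
      by (simp add: g0 add.assoc)
  qed
  \<comment> \<open>By symmetry of second derivatives the three mixed terms with coefficient 2 merge
    into one with coefficient 6.\<close>
  also have "?A (?B F) p = ?B (?A F) p" by (rule dirder_commute[OF F])
  finally show "(dirder (0, 1) ^^ 3) K (q, 0) = dirder a (dirder a (dirder a F)) p + 6 *\<^sub>R dirder b (dirder a F) p + 6 *\<^sub>R dirder c F p"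
    by (simp add: numeral_3_eq_3 algebra_simps flip: scaleR_add_left)
qed

subsection \<open>Reduction along the homoclinic orbit\<close>

lemma dirder_basis_sum:
  fixes G :: "'a::euclidean_space \<Rightarrow> 'b::real_normed_vector"
  assumes "Ck (Suc k) G"
  shows "dirder u G p = (\<Sum>b\<in>Basis. (u \<bullet> b) *\<^sub>R dirder b G p)"
proof -
  interpret bounded_linear "frechet_derivative G (at p)" by (rule frechet_derivative_linear[OF assms])
  show ?thesis unfolding dirder_def
    by (subst euclidean_representation[symmetric, of u]) (simp add: sum scaleR)
qed

text \<open>Bilinearity in the two directions. Along the loop the directions vary with time while
  smoothness concerns fixed directions, so continuity and bounds are transferred through basis
  vectors.\<close>

lemma dirder_dirder_basis_sum:
  fixes G :: "'a::euclidean_space \<Rightarrow> 'b::real_normed_vector"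
  assumes "Ck (Suc (Suc k)) G"
  shows "dirder u (dirder w G) p = (\<Sum>b\<in>Basis. \<Sum>c\<in>Basis. ((u \<bullet> b) * (w \<bullet> c)) *\<^sub>R dirder b (dirder c G) p)"
proof -
  have C: "Ck (Suc k) (dirder c G)" for c by (rule Ck_dirder[OF assms])
  have "dirder u (dirder w G) p = (\<Sum>c\<in>Basis. (w \<bullet> c) *\<^sub>R dirder u (dirder c G) p)"
  proof (rule dirder_eqI[OF C])
    have "((\<lambda>s. \<Sum>c\<in>Basis. (w \<bullet> c) *\<^sub>R dirder c G (p + s *\<^sub>R u)) has_vector_derivative
       (\<Sum>c\<in>Basis. (w \<bullet> c) *\<^sub>R dirder u (dirder c G) (p + 0 *\<^sub>R u))) (at 0)"
      by (intro has_vector_derivative_sum bounded_linear.has_vector_derivative[OF bounded_linear_scaleR_right]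
          dirder_along[OF C]) (auto intro!: derivative_eq_intros)
    then show "((\<lambda>s. dirder w G (p + s *\<^sub>R u)) has_vector_derivative (\<Sum>c\<in>Basis. (w \<bullet> c) *\<^sub>R dirder u (dirder c G) p)) (at 0)"
      by (simp add: dirder_basis_sum[OF assms, of w])
  qed
  also have "\<dots> = (\<Sum>c\<in>Basis. (w \<bullet> c) *\<^sub>R (\<Sum>b\<in>Basis. (u \<bullet> b) *\<^sub>R dirder b (dirder c G) p))"
    by (simp add: dirder_basis_sum[OF C, of u])
  also have "\<dots> = (\<Sum>c\<in>Basis. \<Sum>b\<in>Basis. ((u \<bullet> b) * (w \<bullet> c)) *\<^sub>R dirder b (dirder c G) p)"
    by (simp add: scaleR_sum_right mult.commute)
  finally show ?thesis by (subst sum.swap)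
qed

lemma bounded_range_compose:
  fixes p :: "'d \<Rightarrow> 'e::euclidean_space" and g :: "'e \<Rightarrow> 'f::real_normed_vector"
  assumes "continuous_on UNIV g" "bounded (range p)"
  shows "bounded (range (\<lambda>t. g (p t)))"
proof -
  have "compact (g ` closure (range p))"
    using assms by (intro compact_continuous_image) (auto intro: continuous_on_subset)
  then have "bounded (g ` closure (range p))" by (rule compact_imp_bounded)
  then show ?thesis by (rule bounded_subset) (auto intro!: imageI closure_subset[THEN subsetD])
qed

text \<open>The functions \<open>\<psi>1\<close> and \<open>\<psi>2\<close> span the obstructions to
  solving the inhomogeneous variational equation in bounded functions, and \<open>K0\<close> is a solution
  operator wherever both obstructions vanish.\<close>

locale homoclinic_reduction =
  fixes f :: "'n::finite vfield" and S :: "real^'n^'n" and xh \<phi>2 \<psi>1 \<psi>2 :: "real \<Rightarrow> real^'n"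
    and K0 :: "(real \<Rightarrow>\<^sub>C (real^'n)) \<Rightarrow> (real \<Rightarrow>\<^sub>C (real^'n))"
  assumes smooth: "Ck k (\<lambda>(x, \<mu>). f x \<mu>)"
    and equilibrium: "\<forall>\<^sub>F \<mu> in nhds 0. f 0 \<mu> = 0"
    and hyperbolic: "hyperbolic_matrix (matrix (Dx f 0 0))"
    and S_involution: "S ** S = mat 1" and S_equivariant: "S *v f x \<mu> = f (S *v x) \<mu>"
    and loop: "homoclinic f 0 xh"
    and xh_plus: "xh t \<in> Xplus S" and \<phi>2_minus: "\<phi>2 t \<in> Xminus S"
    and \<psi>1_minus: "v \<in> Xminus S \<Longrightarrow> \<psi>1 t \<bullet> v = 0" and \<psi>2_plus: "v \<in> Xplus S \<Longrightarrow> \<psi>2 t \<bullet> v = 0"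
    and \<phi>2: "VE_solution f xh \<phi>2" "bounded (range \<phi>2)" "\<exists>t. \<phi>2 t \<noteq> 0"
    and bounded_VE: "VE_solution f xh \<xi> \<Longrightarrow> bounded (range \<xi>) \<Longrightarrow>
      \<exists>c d. \<forall>t. \<xi> t = c *\<^sub>R f (xh t) 0 + d *\<^sub>R \<phi>2 t"
    and \<psi>1_int: "integrable lborel \<psi>1" "continuous_on UNIV \<psi>1"
    and \<psi>2_int: "integrable lborel \<psi>2" "continuous_on UNIV \<psi>2"
    and \<psi>2_lim: "(\<psi>2 \<longlongrightarrow> 0) at_top" "(\<psi>2 \<longlongrightarrow> 0) at_bot"
    and \<psi>2_pairing: "(w has_vector_derivative Dx f (xh t) 0 (w t) + g) (at t) \<Longrightarrow>
      ((\<lambda>t. \<psi>2 t \<bullet> w t) has_vector_derivative \<psi>2 t \<bullet> g) (at t)"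
    and K0: "bounded_linear K0"
      "(LINT t|lborel. \<psi>1 t \<bullet> apply_bcontfun h t) = 0 \<Longrightarrow> (LINT t|lborel. \<psi>2 t \<bullet> apply_bcontfun h t) = 0 \<Longrightarrow>
       (apply_bcontfun (K0 h) has_vector_derivative Dx f (xh t) 0 (apply_bcontfun (K0 h) t) + apply_bcontfun h t) (at t)"
begin

definition F :: "(real^'n) \<times> (real^2) \<Rightarrow> real^'n" where "F = (\<lambda>(x, \<mu>). f x \<mu>)"

lemma F_apply [simp]: "F (x, \<mu>) = f x \<mu>"
  by (simp add: F_def)

lemma CF: "Ck k F"
  unfolding F_def by (rule smooth)

lemma CdF: "Ck k (dirder v F)" and CddF: "Ck k (dirder w (dirder v F))"
  by (intro Ck_dirder CF)+

lemma Dx_F: "Dx f x \<mu> u = dirder (u, 0) F (x, \<mu>)"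
  using frechet_derivative_fst_slice[OF CF, of \<mu> x u] by (simp add: Dx_def)

lemma Dxx_F: "Dxx f x \<mu> u v = dirder (u, 0) (dirder (v, 0) F) (x, \<mu>)"
  using frechet_derivative_fst_slice[OF CdF, of "(v, 0)" \<mu> x u] by (simp add: Dxx_def Dx_F)

lemma Dxxx_F: "Dxxx f x \<mu> u v w = dirder (u, 0) (dirder (v, 0) (dirder (w, 0) F)) (x, \<mu>)"
  using frechet_derivative_fst_slice[OF CddF, of "(v, 0)" "(w, 0)" \<mu> x u] by (simp add: Dxxx_def Dxx_F)

lemma Dmu_F: "Dmu f x \<mu> m = dirder (0, m) F (x, \<mu>)"
  using frechet_derivative_snd_slice[OF CF, of x \<mu> m] by (simp add: Dmu_def)

lemma DmuDx_F: "DmuDx f x \<mu> m v = dirder (0, m) (dirder (v, 0) F) (x, \<mu>)"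
  using frechet_derivative_snd_slice[OF CdF, of "(v, 0)" x \<mu> m] by (simp add: DmuDx_def Dx_F)

lemma Dx_linear: "Dx f x \<mu> (u + v) = Dx f x \<mu> u + Dx f x \<mu> v" "Dx f x \<mu> (r *\<^sub>R u) = r *\<^sub>R Dx f x \<mu> u"
  using dirder_add[OF CF, of "(u, 0)" "(v, 0)"] dirder_scaleR[OF CF, of r "(u, 0)"]
  by (simp_all add: Dx_F scaleR_Pair)

lemma Dxx_linear: "Dxx f x \<mu> (u + v) w = Dxx f x \<mu> u w + Dxx f x \<mu> v w" "Dxx f x \<mu> (r *\<^sub>R u) w = r *\<^sub>R Dxx f x \<mu> u w"
  using dirder_add[OF CdF, of "(u, 0)" "(v, 0)" "(w, 0)"] dirder_scaleR[OF CdF, of r "(u, 0)" "(w, 0)"]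
  by (simp_all add: Dxx_F scaleR_Pair)

lemma Dx_zero: "Dx f x 0 0 = 0" and Dmu_zero: "Dmu f x 0 0 = 0" and Dxx_zero: "Dxx f x 0 0 w = 0"
  and DmuDx_zero: "DmuDx f x 0 0 w = 0"
  using dirder_zero[OF CF] dirder_zero[OF CdF] by (simp_all add: Dx_F Dmu_F Dxx_F DmuDx_F zero_prod_def)

lemmas derivatives_zero = Dx_zero Dmu_zero Dxx_zero DmuDx_zero

lemma S_S: "S *v (S *v x) = x"
  by (simp add: matrix_vector_mul_assoc S_involution)

text \<open>\<open>Pp\<close> and \<open>Pm\<close> are the projections onto the eigenspaces of the
  involution. They are oblique when \<open>S\<close> is not symmetric, which is why the locale
  states directly that \<open>\<psi>1\<close> and \<open>\<psi>2\<close> annihilate the opposite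
  eigenspace.\<close>

definition Pp :: "real^'n \<Rightarrow> real^'n" where "Pp x = (1/2) *\<^sub>R (x + S *v x)"
definition Pm :: "real^'n \<Rightarrow> real^'n" where "Pm x = (1/2) *\<^sub>R (x - S *v x)"

lemma bounded_linear_S: "bounded_linear (\<lambda>x. S *v x)"
  using matrix_vector_mul_linear linear_conv_bounded_linear by blast

lemma bounded_linear_Pp: "bounded_linear Pp" and bounded_linear_Pm: "bounded_linear Pm"
  unfolding Pp_def[abs_def] Pm_def[abs_def]
  by (intro bounded_linear_compose[OF bounded_linear_scaleR_right] bounded_linear_add bounded_linear_sub
      bounded_linear_ident bounded_linear_S)+

lemma Pp_Xplus: "Pp x \<in> Xplus S" and Pm_Xminus: "Pm x \<in> Xminus S"
  by (simp_all add: Pp_def Pm_def Xplus_def Xminus_def matrix_vector_mult_scaleR matrix_vector_right_distrib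
      matrix_vector_mult_diff_distrib S_S add.commute flip: scaleR_minus_right)

lemma Pp_add_Pm: "Pp x + Pm x = x"
  by (simp add: Pp_def Pm_def algebra_simps flip: scaleR_add_left)

lemma
  shows Pp_on_plus: "x \<in> Xplus S \<Longrightarrow> Pp x = x" and Pm_on_plus: "x \<in> Xplus S \<Longrightarrow> Pm x = 0"
    and Pp_on_minus: "x \<in> Xminus S \<Longrightarrow> Pp x = 0" and Pm_on_minus: "x \<in> Xminus S \<Longrightarrow> Pm x = x"
  by (simp_all add: Pp_def Pm_def Xplus_def Xminus_def scaleR_2[symmetric])

lemma Pp_Pp: "Pp (Pp x) = Pp x" and Pm_Pm: "Pm (Pm x) = Pm x"
  by (simp_all add: Pp_on_plus[OF Pp_Xplus] Pm_on_minus[OF Pm_Xminus])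

text \<open>Each obstruction sees only the component of its own parity.\<close>

lemma \<psi>1_Pp: "\<psi>1 t \<bullet> Pp x = \<psi>1 t \<bullet> x" and \<psi>2_Pm: "\<psi>2 t \<bullet> Pm x = \<psi>2 t \<bullet> x"
  using Pp_add_Pm[of x] \<psi>1_minus[OF Pm_Xminus[of x], of t] \<psi>2_plus[OF Pp_Xplus[of x], of t]
  by (metis add.right_neutral add.left_neutral inner_add_right)+

lemma f_plus: "x \<in> Xplus S \<Longrightarrow> f x \<mu> \<in> Xplus S"
  using S_equivariant[of x \<mu>] by (simp add: Xplus_def)

text \<open>Equivariance is differentiated along a line through a point that \<open>S\<close>
  fixes.\<close>

lemma S_Dx: assumes "x \<in> Xplus S" shows "S *v Dx f x \<mu> u = Dx f x \<mu> (S *v u)"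
proof -
  have d: "((\<lambda>s. f (x + s *\<^sub>R v) \<mu>) has_vector_derivative Dx f x \<mu> v) (at 0)" for v
  proof -
    have "((\<lambda>s. (x + s *\<^sub>R v, \<mu>)) has_vector_derivative (v, 0)) (at 0)"
      by (rule has_vector_derivative_Pair) (auto intro!: derivative_eq_intros)
    from dirder_along[OF CF this] show ?thesis by (simp add: Dx_F)
  qed
  have "((\<lambda>s. S *v f (x + s *\<^sub>R u) \<mu>) has_vector_derivative S *v Dx f x \<mu> u) (at 0)"
    by (rule bounded_linear.has_vector_derivative[OF bounded_linear_S d])
  moreover have "S *v f (x + s *\<^sub>R u) \<mu> = f (x + s *\<^sub>R (S *v u)) \<mu>" for s
    using assms by (simp add: S_equivariant matrix_vector_right_distrib matrix_vector_mult_scaleR Xplus_def)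
  ultimately show ?thesis using d[of "S *v u"] vector_derivative_unique_at by auto
qed

lemma Dx_minus: "Dx f x \<mu> (u - v) = Dx f x \<mu> u - Dx f x \<mu> v"
  using Dx_linear(1)[of x \<mu> u "(-1) *\<^sub>R v"] Dx_linear(2)[of x \<mu> "-1" v] by simp

lemma Pp_Dx: "x \<in> Xplus S \<Longrightarrow> Pp (Dx f x \<mu> u) = Dx f x \<mu> (Pp u)"
  and Pm_Dx: "x \<in> Xplus S \<Longrightarrow> Pm (Dx f x \<mu> u) = Dx f x \<mu> (Pm u)"
  by (simp_all add: Pp_def Pm_def S_Dx Dx_linear Dx_minus)

lemma Dmu_plus: assumes "x \<in> Xplus S" shows "Dmu f x \<mu> m \<in> Xplus S"
proof -
  have d: "((\<lambda>s. f x (\<mu> + s *\<^sub>R m)) has_vector_derivative Dmu f x \<mu> m) (at 0)"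
  proof -
    have "((\<lambda>s. (x, \<mu> + s *\<^sub>R m)) has_vector_derivative (0, m)) (at 0)"
      by (rule has_vector_derivative_Pair) (auto intro!: derivative_eq_intros)
    from dirder_along[OF CF this] show ?thesis by (simp add: Dmu_F)
  qed
  have "((\<lambda>s. S *v f x (\<mu> + s *\<^sub>R m)) has_vector_derivative S *v Dmu f x \<mu> m) (at 0)"
    by (rule bounded_linear.has_vector_derivative[OF bounded_linear_S d])
  moreover have "S *v f x (\<mu> + s *\<^sub>R m) = f x (\<mu> + s *\<^sub>R m)" for s
    using f_plus[OF assms] by (simp add: Xplus_def)
  ultimately have "S *v Dmu f x \<mu> m = Dmu f x \<mu> m" using d vector_derivative_unique_at by auto
  then show ?thesis by (simp add: Xplus_def)
qed

lemma xh_derivative: "(xh has_vector_derivative f (xh t) 0) (at t)"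
  and xh_lim: "(xh \<longlongrightarrow> 0) at_top" "(xh \<longlongrightarrow> 0) at_bot"
  using loop by (auto simp: homoclinic_def)

lemma xh_continuous: "continuous_on UNIV xh"
  using xh_derivative by (meson continuous_at_imp_continuous_on has_vector_derivative_continuous)

lemma xh_bounded: "bounded (range xh)"
proof -
  obtain a where a: "\<And>t. t \<ge> a \<Longrightarrow> norm (xh t) < 1"
    using tendstoD[OF xh_lim(1) zero_less_one] by (auto simp: eventually_at_top_linorder)
  obtain b where b: "\<And>t. t \<le> b \<Longrightarrow> norm (xh t) < 1"
    using tendstoD[OF xh_lim(2) zero_less_one] by (auto simp: eventually_at_bot_linorder)
  have "bounded (xh ` {b..a})"
    by (intro compact_imp_bounded compact_continuous_image continuous_on_subset[OF xh_continuous]) auto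
  moreover have "range xh \<subseteq> cball 0 1 \<union> xh ` {b..a}"
  proof
    fix y assume "y \<in> range xh"
    then obtain t where t: "y = xh t" by blast
    consider "t \<ge> a" | "t \<le> b" | "t \<in> {b..a}" by fastforce
    then show "y \<in> cball 0 1 \<union> xh ` {b..a}"
      by cases (use a[of t] b[of t] t in \<open>auto simp: less_imp_le\<close>)
  qed
  ultimately show ?thesis by (meson bounded_Un bounded_cball bounded_subset)
qed

lemma \<phi>2_derivative: "(\<phi>2 has_vector_derivative Dx f (xh t) 0 (\<phi>2 t)) (at t)"
  using \<phi>2(1) by (simp add: VE_solution_def)

lemma \<phi>2_continuous: "continuous_on UNIV \<phi>2"
  using \<phi>2_derivative by (meson continuous_at_imp_continuous_on has_vector_derivative_continuous)

lemma integrable_pairing: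
  fixes \<psi> g :: "real \<Rightarrow> real^'n"
  assumes "integrable lborel \<psi>" "continuous_on UNIV \<psi>" "continuous_on UNIV g" "\<And>t. norm (g t) \<le> M"
  shows "integrable lborel (\<lambda>t. \<psi> t \<bullet> g t)" and "\<bar>LINT t|lborel. \<psi> t \<bullet> g t\<bar> \<le> (LINT t|lborel. norm (\<psi> t)) * M"
proof -
  have le: "norm (\<psi> t \<bullet> g t) \<le> norm (\<psi> t) * M" for t
    using order_trans[OF Cauchy_Schwarz_ineq2 mult_left_mono[OF assms(4) norm_ge_zero]] by simp
  have i: "integrable lborel (\<lambda>t. norm (\<psi> t) * M)" using assms(1) by (intro integrable_mult_left integrable_norm)
  show int: "integrable lborel (\<lambda>t. \<psi> t \<bullet> g t)"
  proof (rule Bochner_Integration.integrable_bound[OF i])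
    show "(\<lambda>t. \<psi> t \<bullet> g t) \<in> borel_measurable lborel"
      using assms by (simp add: borel_measurable_continuous_onI continuous_on_inner)
    show "AE t in lborel. norm (\<psi> t \<bullet> g t) \<le> norm (norm (\<psi> t) * M)"
      by (rule AE_I2, rule order_trans[OF le]) (simp only: real_norm_def abs_ge_self)
  qed
  have "\<bar>LINT t|lborel. \<psi> t \<bullet> g t\<bar> \<le> (LINT t|lborel. norm (\<psi> t \<bullet> g t))"
    using integral_norm_bound[of lborel "\<lambda>t. \<psi> t \<bullet> g t"] by simp
  also have "\<dots> \<le> (LINT t|lborel. norm (\<psi> t) * M)"
    by (rule integral_mono[OF integrable_norm[OF int] i le])
  finally show "\<bar>LINT t|lborel. \<psi> t \<bullet> g t\<bar> \<le> (LINT t|lborel. norm (\<psi> t)) * M" by simp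
qed

text \<open>\<open>l1\<close> and \<open>l2\<close> are the solvability functionals of the
  inhomogeneous variational equation, bounded because \<psi>1 and \<psi>2 are integrable.\<close>

definition l1 :: "(real \<Rightarrow>\<^sub>C (real^'n)) \<Rightarrow> real" where "l1 h = (LINT t|lborel. \<psi>1 t \<bullet> apply_bcontfun h t)"
definition l2 :: "(real \<Rightarrow>\<^sub>C (real^'n)) \<Rightarrow> real" where "l2 h = (LINT t|lborel. \<psi>2 t \<bullet> apply_bcontfun h t)"

lemma bounded_linear_pairing:
  fixes \<psi> :: "real \<Rightarrow> real^'n"
  assumes "integrable lborel \<psi>" "continuous_on UNIV \<psi>"
  shows "bounded_linear (\<lambda>h :: real \<Rightarrow>\<^sub>C (real^'n). LINT t|lborel. \<psi> t \<bullet> apply_bcontfun h t)"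
proof (rule bounded_linear_intro)
  have i: "integrable lborel (\<lambda>t. \<psi> t \<bullet> apply_bcontfun h t)" for h :: "real \<Rightarrow>\<^sub>C (real^'n)"
    by (rule integrable_pairing[OF assms]) (auto intro: norm_apply_bcontfun)
  show "(LINT t|lborel. \<psi> t \<bullet> apply_bcontfun (h + k) t) = (LINT t|lborel. \<psi> t \<bullet> apply_bcontfun h t) + (LINT t|lborel. \<psi> t \<bullet> apply_bcontfun k t)" for h k :: "real \<Rightarrow>\<^sub>C (real^'n)"
    by (simp add: plus_bcontfun.rep_eq inner_add_right i)
  show "(LINT t|lborel. \<psi> t \<bullet> apply_bcontfun (r *\<^sub>R h) t) = r *\<^sub>R (LINT t|lborel. \<psi> t \<bullet> apply_bcontfun h t)" for r and h :: "real \<Rightarrow>\<^sub>C (real^'n)"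
    by (simp add: scaleR_bcontfun.rep_eq)
  show "norm (LINT t|lborel. \<psi> t \<bullet> apply_bcontfun h t) \<le> norm h * (LINT t|lborel. norm (\<psi> t))" for h :: "real \<Rightarrow>\<^sub>C (real^'n)"
    using integrable_pairing(2)[OF assms, of "apply_bcontfun h" "norm h"] by (auto intro: norm_apply_bcontfun simp: mult.commute)
qed

lemma bounded_linear_l1: "bounded_linear l1" and bounded_linear_l2: "bounded_linear l2"
  unfolding l1_def[abs_def] l2_def[abs_def] by (intro bounded_linear_pairing \<psi>1_int \<psi>2_int)+

lemma l1_eq: "l1 h = (LINT t|lborel. \<psi>1 t \<bullet> Pp (apply_bcontfun h t))"
  and l2_eq: "l2 h = (LINT t|lborel. \<psi>2 t \<bullet> Pm (apply_bcontfun h t))"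
  by (simp_all add: l1_def l2_def \<psi>1_Pp \<psi>2_Pm)

text \<open>\<open>K0\<close> is sandwiched between projections. A forcing of one parity satisfies
  the obstruction of the other parity automatically, so each of the two operators has a single
  solvability condition.\<close>

lemma solution_operators:
  "\<exists>Kp Km. bounded_linear Kp \<and> bounded_linear Km \<and>
     (\<forall>h t. apply_bcontfun (Kp h) t \<in> Xplus S) \<and> (\<forall>h t. apply_bcontfun (Km h) t \<in> Xminus S) \<and>
     (\<forall>h t. l1 h = 0 \<longrightarrow> (apply_bcontfun (Kp h) has_vector_derivative
        Dx f (xh t) 0 (apply_bcontfun (Kp h) t) + Pp (apply_bcontfun h t)) (at t)) \<and>
     (\<forall>h t. l2 h = 0 \<longrightarrow> (apply_bcontfun (Km h) has_vector_derivative
        Dx f (xh t) 0 (apply_bcontfun (Km h) t) + Pm (apply_bcontfun h t)) (at t))"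
proof -
  obtain QP :: "(real \<Rightarrow>\<^sub>C (real^'n)) \<Rightarrow> (real \<Rightarrow>\<^sub>C (real^'n))" where QP: "bounded_linear QP" "\<And>h t. apply_bcontfun (QP h) t = Pp (apply_bcontfun h t)"
    using bounded_linear_postcompose[OF bounded_linear_Pp] by blast
  obtain QM :: "(real \<Rightarrow>\<^sub>C (real^'n)) \<Rightarrow> (real \<Rightarrow>\<^sub>C (real^'n))" where QM: "bounded_linear QM" "\<And>h t. apply_bcontfun (QM h) t = Pm (apply_bcontfun h t)"
    using bounded_linear_postcompose[OF bounded_linear_Pm] by blast
  have z1: "(LINT t|lborel. \<psi>2 t \<bullet> apply_bcontfun (QP h) t) = 0" for h by (simp add: QP(2) \<psi>2_plus[OF Pp_Xplus])
  have z2: "(LINT t|lborel. \<psi>1 t \<bullet> apply_bcontfun (QM h) t) = 0" for h by (simp add: QM(2) \<psi>1_minus[OF Pm_Xminus])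
  show ?thesis
  proof (rule exI[of _ "\<lambda>h. QP (K0 (QP h))"], rule exI[of _ "\<lambda>h. QM (K0 (QM h))"], intro conjI allI impI)
    fix h t
    show "apply_bcontfun (QP (K0 (QP h))) t \<in> Xplus S" by (simp add: QP(2) Pp_Xplus)
    show "apply_bcontfun (QM (K0 (QM h))) t \<in> Xminus S" by (simp add: QM(2) Pm_Xminus)
    {
      assume "l1 h = 0"
      then have "(apply_bcontfun (K0 (QP h)) has_vector_derivative
         Dx f (xh t) 0 (apply_bcontfun (K0 (QP h)) t) + apply_bcontfun (QP h) t) (at t)"
        by (intro K0(2) z1) (simp add: QP(2) l1_eq)
      then have "((\<lambda>t. Pp (apply_bcontfun (K0 (QP h)) t)) has_vector_derivative
         Pp (Dx f (xh t) 0 (apply_bcontfun (K0 (QP h)) t) + apply_bcontfun (QP h) t)) (at t)"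
        by (rule bounded_linear.has_vector_derivative[OF bounded_linear_Pp])
      moreover have "apply_bcontfun (QP (K0 (QP h))) = (\<lambda>t. Pp (apply_bcontfun (K0 (QP h)) t))" by (auto simp: QP(2))
      ultimately show "(apply_bcontfun (QP (K0 (QP h))) has_vector_derivative
         Dx f (xh t) 0 (apply_bcontfun (QP (K0 (QP h))) t) + Pp (apply_bcontfun h t)) (at t)"
        by (simp add: linear_add[OF bounded_linear.linear[OF bounded_linear_Pp]] Pp_Dx[OF xh_plus] QP(2) Pp_Pp)
    next
      assume "l2 h = 0"
      then have "(apply_bcontfun (K0 (QM h)) has_vector_derivative
         Dx f (xh t) 0 (apply_bcontfun (K0 (QM h)) t) + apply_bcontfun (QM h) t) (at t)"
        by (intro K0(2) z2) (simp add: QM(2) l2_eq)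
      then have "((\<lambda>t. Pm (apply_bcontfun (K0 (QM h)) t)) has_vector_derivative
         Pm (Dx f (xh t) 0 (apply_bcontfun (K0 (QM h)) t) + apply_bcontfun (QM h) t)) (at t)"
        by (rule bounded_linear.has_vector_derivative[OF bounded_linear_Pm])
      moreover have "apply_bcontfun (QM (K0 (QM h))) = (\<lambda>t. Pm (apply_bcontfun (K0 (QM h)) t))" by (auto simp: QM(2))
      ultimately show "(apply_bcontfun (QM (K0 (QM h))) has_vector_derivative
         Dx f (xh t) 0 (apply_bcontfun (QM (K0 (QM h))) t) + Pm (apply_bcontfun h t)) (at t)"
        by (simp add: linear_add[OF bounded_linear.linear[OF bounded_linear_Pm]] Pm_Dx[OF xh_plus] QM(2) Pm_Pm)
    }
  qed (intro bounded_linear_compose[OF QP(1)] bounded_linear_compose[OF QM(1)] bounded_linear_compose[OF K0(1)] QP(1) QM(1))+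
qed

definition Kp where "Kp = (SOME Kp. \<exists>Km. bounded_linear Kp \<and> bounded_linear Km \<and>
     (\<forall>h t. apply_bcontfun (Kp h) t \<in> Xplus S) \<and> (\<forall>h t. apply_bcontfun (Km h) t \<in> Xminus S) \<and>
     (\<forall>h t. l1 h = 0 \<longrightarrow> (apply_bcontfun (Kp h) has_vector_derivative
        Dx f (xh t) 0 (apply_bcontfun (Kp h) t) + Pp (apply_bcontfun h t)) (at t)) \<and>
     (\<forall>h t. l2 h = 0 \<longrightarrow> (apply_bcontfun (Km h) has_vector_derivative
        Dx f (xh t) 0 (apply_bcontfun (Km h) t) + Pm (apply_bcontfun h t)) (at t)))"

definition Km where "Km = (SOME Km. bounded_linear Km \<and> (\<forall>h t. apply_bcontfun (Km h) t \<in> Xminus S) \<and>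
     (\<forall>h t. l2 h = 0 \<longrightarrow> (apply_bcontfun (Km h) has_vector_derivative
        Dx f (xh t) 0 (apply_bcontfun (Km h) t) + Pm (apply_bcontfun h t)) (at t)))"

lemma Kp: "bounded_linear Kp" "apply_bcontfun (Kp h) t \<in> Xplus S"
    "l1 h = 0 \<Longrightarrow> (apply_bcontfun (Kp h) has_vector_derivative
        Dx f (xh t) 0 (apply_bcontfun (Kp h) t) + Pp (apply_bcontfun h t)) (at t)"
  and Km: "bounded_linear Km" "apply_bcontfun (Km h) t \<in> Xminus S"
    "l2 h = 0 \<Longrightarrow> (apply_bcontfun (Km h) has_vector_derivative
        Dx f (xh t) 0 (apply_bcontfun (Km h) t) + Pm (apply_bcontfun h t)) (at t)"
proof -
  note p = someI_ex[OF solution_operators, folded Kp_def]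
  have m: "\<exists>Km. bounded_linear Km \<and> (\<forall>h t. apply_bcontfun (Km h) t \<in> Xminus S) \<and>
     (\<forall>h t. l2 h = 0 \<longrightarrow> (apply_bcontfun (Km h) has_vector_derivative
        Dx f (xh t) 0 (apply_bcontfun (Km h) t) + Pm (apply_bcontfun h t)) (at t))" using p by blast
  note m' = someI_ex[OF m, folded Km_def]
  show "bounded_linear Kp" "apply_bcontfun (Kp h) t \<in> Xplus S"
    "l1 h = 0 \<Longrightarrow> (apply_bcontfun (Kp h) has_vector_derivative
        Dx f (xh t) 0 (apply_bcontfun (Kp h) t) + Pp (apply_bcontfun h t)) (at t)" using p by blast+
  show "bounded_linear Km" "apply_bcontfun (Km h) t \<in> Xminus S"
    "l2 h = 0 \<Longrightarrow> (apply_bcontfun (Km h) has_vector_derivative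
        Dx f (xh t) 0 (apply_bcontfun (Km h) t) + Pm (apply_bcontfun h t)) (at t)" using m' by blast+
qed

end

lemma has_vector_derivative_quadratic:
  fixes g :: "real \<Rightarrow> 'a::real_normed_vector"
  assumes "\<epsilon> > 0" "\<And>h. \<bar>h\<bar> < \<epsilon> \<Longrightarrow> norm (g h - g 0 - h *\<^sub>R d) \<le> C * h\<^sup>2"
  shows "(g has_vector_derivative d) (at 0)"
  unfolding has_vector_derivative_def has_derivative_at_alt
proof (intro conjI allI impI)
  show "bounded_linear (\<lambda>x. x *\<^sub>R d)" by (rule bounded_linear_scaleR_left)
  fix e :: real assume e: "e > 0"
  show "\<exists>m>0. \<forall>y. norm (y - 0) < m \<longrightarrow> norm (g y - g 0 - (y - 0) *\<^sub>R d) \<le> e * norm (y - 0)"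
  proof (intro exI[of _ "min \<epsilon> (e / (\<bar>C\<bar> + 1))"] conjI allI impI)
    show "0 < min \<epsilon> (e / (\<bar>C\<bar> + 1))" using assms(1) e by (simp add: add_nonneg_pos)
    fix y :: real assume y: "norm (y - 0) < min \<epsilon> (e / (\<bar>C\<bar> + 1))"
    have "norm (g y - g 0 - y *\<^sub>R d) \<le> C * y\<^sup>2" using y by (intro assms(2)) simp
    also have "\<dots> \<le> (\<bar>C\<bar> + 1) * (\<bar>y\<bar> * \<bar>y\<bar>)"
      unfolding power2_eq_square abs_mult_self_eq by (intro mult_right_mono) auto
    also have "\<dots> = ((\<bar>C\<bar> + 1) * \<bar>y\<bar>) * \<bar>y\<bar>" by simp
    also have "\<dots> \<le> e * \<bar>y\<bar>"
    proof (intro mult_right_mono)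
      have "\<bar>y\<bar> \<le> e / (\<bar>C\<bar> + 1)" using y by simp
      then show "(\<bar>C\<bar> + 1) * \<bar>y\<bar> \<le> e" by (simp add: pos_le_divide_eq add_nonneg_pos mult.commute)
    qed simp
    finally show "norm (g y - g 0 - (y - 0) *\<^sub>R d) \<le> e * norm (y - 0)" by simp
  qed
qed

lemma has_vector_derivative_reflect:
  fixes x :: "real \<Rightarrow> 'a::real_normed_vector"
  assumes "(x has_vector_derivative d) (at (- t))"
  shows "((\<lambda>t. x (- t)) has_vector_derivative - d) (at t)"
proof -
  have "((\<lambda>t. x (- t)) has_vector_derivative (-1) *\<^sub>R d) (at t)"
    by (rule vector_diff_chain_at[of uminus "-1" t x, unfolded o_def]) (use assms in \<open>auto intro!: derivative_eq_intros\<close>)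
  then show ?thesis by simp
qed

section \<open>Linear terms along the loop and orbits close to it\<close>

context homoclinic_reduction
begin

lemma continuous_d:
  assumes "continuous_on UNIV u"
  shows "continuous_on UNIV (\<lambda>t. dirder (u t) F (xh t, 0))"
proof -
  have "continuous_on UNIV (\<lambda>t. dirder b F (xh t, 0))" for b
    by (rule continuous_on_compose2[OF Ck_continuous[OF CdF]]) (auto intro!: continuous_intros xh_continuous)
  then show ?thesis unfolding dirder_basis_sum[OF CF, of "u _"] by (intro continuous_intros assms)
qed

lemma continuous_dd:
  assumes "continuous_on UNIV u" "continuous_on UNIV w"
  shows "continuous_on UNIV (\<lambda>t. dirder (u t) (dirder (w t) F) (xh t, 0))"
proof -
  have "continuous_on UNIV (\<lambda>t. dirder b (dirder c F) (xh t, 0))" for b c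
    by (rule continuous_on_compose2[OF Ck_continuous[OF CddF]]) (auto intro!: continuous_intros xh_continuous)
  then show ?thesis unfolding dirder_dirder_basis_sum[OF CF, of "u _"] by (intro continuous_intros assms)
qed

lemma bounded_xh_pair: "bounded (range (\<lambda>t. (xh t, 0 :: real^2)))"
proof -
  have "range (\<lambda>t. (xh t, 0 :: real^2)) \<subseteq> range xh \<times> {0}" by auto
  then show ?thesis by (rule bounded_subset[rotated]) (intro bounded_Times xh_bounded, simp)
qed

lemma bound_d: "\<exists>M\<ge>0. \<forall>t u. norm (dirder u F (xh t, 0)) \<le> M * norm u"
proof -
  let ?g = "\<lambda>p. \<Sum>b\<in>Basis. norm (dirder b F p)"
  have "bounded (range (\<lambda>t. ?g (xh t, 0)))"
    by (rule bounded_range_compose[OF _ bounded_xh_pair]) (intro continuous_intros Ck_continuous[OF CdF])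
  then obtain M where M: "\<And>t. norm (?g (xh t, 0)) \<le> M" unfolding bounded_iff by blast
  have M0: "0 \<le> M" using M[of 0] norm_ge_zero order_trans by blast
  have "norm (dirder u F (xh t, 0)) \<le> M * norm u" for t u
  proof -
    have "norm (dirder u F (xh t, 0)) \<le> (\<Sum>b\<in>Basis. norm u * norm (dirder b F (xh t, 0)))"
      unfolding dirder_basis_sum[OF CF, of u] by (intro sum_norm_le) (auto intro!: mult_right_mono Basis_le_norm)
    also have "\<dots> = norm u * ?g (xh t, 0)" by (simp add: sum_distrib_left)
    also have "\<dots> \<le> norm u * M" using M[of t] by (intro mult_left_mono) auto
    finally show ?thesis by (simp add: mult.commute)
  qed
  with M0 show ?thesis by blast
qed

lemma bound_dd: "\<exists>M\<ge>0. \<forall>t u w. norm (dirder u (dirder w F) (xh t, 0)) \<le> M * norm u * norm w"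
proof -
  let ?g = "\<lambda>p. \<Sum>b\<in>Basis. \<Sum>c\<in>Basis. norm (dirder b (dirder c F) p)"
  have "bounded (range (\<lambda>t. ?g (xh t, 0)))"
    by (rule bounded_range_compose[OF _ bounded_xh_pair]) (intro continuous_intros Ck_continuous[OF CddF])
  then obtain M where M: "\<And>t. norm (?g (xh t, 0)) \<le> M" unfolding bounded_iff by blast
  have M0: "0 \<le> M" using M[of 0] norm_ge_zero order_trans by blast
  have "norm (dirder u (dirder w F) (xh t, 0)) \<le> M * norm u * norm w" for t u w
  proof -
    have "norm (dirder u (dirder w F) (xh t, 0)) \<le> (\<Sum>b\<in>Basis. \<Sum>c\<in>Basis. norm u * norm w * norm (dirder b (dirder c F) (xh t, 0)))"
      unfolding dirder_dirder_basis_sum[OF CF, of u]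
      by (intro sum_norm_le) (auto simp: abs_mult intro!: mult_right_mono mult_mono Basis_le_norm)
    also have "\<dots> = norm u * norm w * ?g (xh t, 0)" by (simp add: sum_distrib_left)
    also have "\<dots> \<le> norm u * norm w * M" using M[of t] by (intro mult_left_mono) auto
    finally show ?thesis by (simp add: mult_ac)
  qed
  with M0 show ?thesis by blast
qed

lemma exists_operators:
  "\<exists>G1. bounded_linear G1 \<and> (\<forall>\<nu> t. apply_bcontfun (G1 \<nu>) t = Dmu f (xh t) 0 \<nu>)"
  "\<exists>G2. bounded_linear G2 \<and> (\<forall>\<nu> t. apply_bcontfun (G2 \<nu>) t = DmuDx f (xh t) 0 \<nu> (\<phi>2 t))"
  "\<exists>G3 :: (real \<Rightarrow>\<^sub>C (real^'n)) \<Rightarrow> (real \<Rightarrow>\<^sub>C (real^'n)). bounded_linear G3 \<and>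
     (\<forall>w t. apply_bcontfun (G3 w) t = Dxx f (xh t) 0 (apply_bcontfun w t) (\<phi>2 t))"
proof -
  obtain M1 where M1: "\<And>t u. norm (dirder u F (xh t, 0)) \<le> M1 * norm u" using bound_d by blast
  obtain M2 where M2: "M2 \<ge> 0" "\<And>t u w. norm (dirder u (dirder w F) (xh t, 0)) \<le> M2 * norm u * norm w" using bound_dd by blast
  obtain B where B: "\<And>t. norm (\<phi>2 t) \<le> B" using \<phi>2(2) by (auto simp: bounded_iff)
  have B0: "0 \<le> B" using B[of 0] norm_ge_zero order_trans by blast
  have M2': "norm (dirder (u, m) (dirder (\<phi>2 t, 0) F) (xh t, 0)) \<le> (M2 * B) * N" if "norm (u, m) \<le> N" for t u m N
  proof -
    have "norm (dirder (u, m) (dirder (\<phi>2 t, 0) F) (xh t, 0)) \<le> M2 * norm (u, m) * norm (\<phi>2 t, 0::real^2)" by (rule M2)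
    also have "\<dots> \<le> M2 * N * B"
      using B[of t] B0 M2(1) that order_trans[OF norm_ge_zero that] by (intro mult_mono) (auto simp: norm_Pair)
    finally show ?thesis by (simp add: mult_ac)
  qed
  have "\<exists>G1 :: real^2 \<Rightarrow> (real \<Rightarrow>\<^sub>C (real^'n)). bounded_linear G1 \<and> (\<forall>\<nu> t. apply_bcontfun (G1 \<nu>) t = dirder (0, \<nu>) F (xh t, 0)) \<and> (\<forall>\<nu>. norm (G1 \<nu>) \<le> M1 * norm \<nu>)"
  proof (rule bounded_linear_bcontfunI)
    show "norm (dirder (0, \<nu>) F (xh t, 0)) \<le> M1 * norm \<nu>" for \<nu> t using M1[of "(0, \<nu>)" t] by (simp add: norm_Pair)
  qed (use dirder_add[OF CF, of "(0, _)" "(0, _)"] dirder_scaleR[OF CF, of _ "(0, _)"] in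
      \<open>auto simp: scaleR_Pair intro!: continuous_d continuous_intros\<close>)
  then show "\<exists>G1. bounded_linear G1 \<and> (\<forall>\<nu> t. apply_bcontfun (G1 \<nu>) t = Dmu f (xh t) 0 \<nu>)"
    unfolding Dmu_F by blast
  have "\<exists>G2 :: real^2 \<Rightarrow> (real \<Rightarrow>\<^sub>C (real^'n)). bounded_linear G2 \<and>
     (\<forall>\<nu> t. apply_bcontfun (G2 \<nu>) t = dirder (0, \<nu>) (dirder (\<phi>2 t, 0) F) (xh t, 0)) \<and> (\<forall>\<nu>. norm (G2 \<nu>) \<le> (M2 * B) * norm \<nu>)"
  proof (rule bounded_linear_bcontfunI)
    show "norm (dirder (0, \<nu>) (dirder (\<phi>2 t, 0) F) (xh t, 0)) \<le> (M2 * B) * norm \<nu>" for \<nu> t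
      by (rule M2') (simp add: norm_Pair)
  qed (use dirder_add[OF CdF, of "(0, _)" "(0, _)"] dirder_scaleR[OF CdF, of _ "(0, _)"] in
      \<open>auto simp: scaleR_Pair intro!: continuous_dd continuous_intros \<phi>2_continuous\<close>)
  then show "\<exists>G2. bounded_linear G2 \<and> (\<forall>\<nu> t. apply_bcontfun (G2 \<nu>) t = DmuDx f (xh t) 0 \<nu> (\<phi>2 t))"
    unfolding DmuDx_F by blast
  have "\<exists>G3 :: (real \<Rightarrow>\<^sub>C (real^'n)) \<Rightarrow> (real \<Rightarrow>\<^sub>C (real^'n)). bounded_linear G3 \<and>
     (\<forall>w t. apply_bcontfun (G3 w) t = dirder (apply_bcontfun w t, 0) (dirder (\<phi>2 t, 0) F) (xh t, 0)) \<and> (\<forall>w. norm (G3 w) \<le> (M2 * B) * norm w)"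
  proof (rule bounded_linear_bcontfunI)
    show "norm (dirder (apply_bcontfun w t, 0) (dirder (\<phi>2 t, 0) F) (xh t, 0)) \<le> (M2 * B) * norm w" for w :: "real \<Rightarrow>\<^sub>C (real^'n)" and t
      by (rule M2') (simp add: norm_Pair norm_apply_bcontfun)
  qed (use dirder_add[OF CdF, of "(_, 0)" "(_, 0)"] dirder_scaleR[OF CdF, of _ "(_, 0)"] in
      \<open>auto simp: scaleR_Pair plus_bcontfun.rep_eq scaleR_bcontfun.rep_eq intro!: continuous_dd continuous_intros \<phi>2_continuous continuous_on_apply_bcontfun\<close>)
  then show "\<exists>G3 :: (real \<Rightarrow>\<^sub>C (real^'n)) \<Rightarrow> (real \<Rightarrow>\<^sub>C (real^'n)). bounded_linear G3 \<and>
     (\<forall>w t. apply_bcontfun (G3 w) t = Dxx f (xh t) 0 (apply_bcontfun w t) (\<phi>2 t))"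
    unfolding Dxx_F by blast
qed

text \<open>The forcing terms that are linear in the unknowns: \<open>G1\<close> comes from the
  parameter at second order in \<alpha>, \<open>G2\<close> from the parameter and \<open>G3\<close>
  from the even correction at third order.\<close>

definition G1 where "G1 = (SOME G1. bounded_linear G1 \<and> (\<forall>\<nu> t. apply_bcontfun (G1 \<nu>) t = Dmu f (xh t) 0 \<nu>))"
definition G2 where "G2 = (SOME G2. bounded_linear G2 \<and> (\<forall>\<nu> t. apply_bcontfun (G2 \<nu>) t = DmuDx f (xh t) 0 \<nu> (\<phi>2 t)))"
definition G3 :: "(real \<Rightarrow>\<^sub>C (real^'n)) \<Rightarrow> (real \<Rightarrow>\<^sub>C (real^'n))" where
  "G3 = (SOME G3. bounded_linear G3 \<and> (\<forall>w t. apply_bcontfun (G3 w) t = Dxx f (xh t) 0 (apply_bcontfun w t) (\<phi>2 t)))"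

lemma G1: "bounded_linear G1" "apply_bcontfun (G1 \<nu>) t = Dmu f (xh t) 0 \<nu>"
  and G2: "bounded_linear G2" "apply_bcontfun (G2 \<nu>) t = DmuDx f (xh t) 0 \<nu> (\<phi>2 t)"
  and G3: "bounded_linear G3" "apply_bcontfun (G3 w) t = Dxx f (xh t) 0 (apply_bcontfun w t) (\<phi>2 t)"
  using someI_ex[OF exists_operators(1), folded G1_def] someI_ex[OF exists_operators(2), folded G2_def]
    someI_ex[OF exists_operators(3), folded G3_def] by blast+

text \<open>Where \<open>xh\<close> is small the equation is the linearisation at 0 plus an error
  that is small relative to \<open>x\<close>, because 0 remains an equilibrium for small
  \<open>\<mu>\<close>. The decay result applies at plus infinity, and after reversing time at minus
  infinity.\<close>

lemma near_loop_homoclinic: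
  "\<exists>\<eta>>0. \<forall>\<mu> x. norm \<mu> < \<eta> \<longrightarrow> (\<forall>t. (x has_vector_derivative f (x t) \<mu>) (at t)) \<longrightarrow>
     (\<forall>t. norm (x t - xh t) < \<eta>) \<longrightarrow> homoclinic f \<mu> x"
proof -
  let ?B = "matrix (Dx f 0 0)"
  have B: "?B *v y = Dx f 0 0 y" for y
    by (rule matrix_vector_mul(2)[THEN fun_cong]) (auto intro!: linearI simp: Dx_linear)
  obtain e1 where e1: "e1 > 0" "\<And>x r T. (\<forall>t. (x has_vector_derivative ?B *v x t + r t) (at t)) \<Longrightarrow> continuous_on UNIV r \<Longrightarrow>
     bounded (range x) \<Longrightarrow> bounded (range r) \<Longrightarrow> (\<forall>t\<ge>T. norm (r t) \<le> e1 * norm (x t)) \<Longrightarrow> (x \<longlongrightarrow> 0) at_top"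
    using hyperbolic_decay[OF hyperbolic] by blast
  obtain e2 where e2: "e2 > 0" "\<And>x r T. (\<forall>t. (x has_vector_derivative (- ?B) *v x t + r t) (at t)) \<Longrightarrow> continuous_on UNIV r \<Longrightarrow>
     bounded (range x) \<Longrightarrow> bounded (range r) \<Longrightarrow> (\<forall>t\<ge>T. norm (r t) \<le> e2 * norm (x t)) \<Longrightarrow> (x \<longlongrightarrow> 0) at_top"
    using hyperbolic_decay[OF hyperbolic_matrix_uminus[OF hyperbolic]] by blast
  define e where "e = min e1 e2"
  have e: "e > 0" "e \<le> e1" "e \<le> e2" using e1(1) e2(1) by (auto simp: e_def)
  obtain \<delta> where \<delta>: "\<delta> > 0" "\<And>p1 p2. norm (p1 :: (real^'n) \<times> (real^2)) < \<delta> \<Longrightarrow> norm p2 < \<delta> \<Longrightarrow>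
     norm (F p1 - F p2 - frechet_derivative F (at 0) (p1 - p2)) \<le> e * norm (p1 - p2)"
    using C1_uniformly_strict[OF CF e(1), of 0] by (metis diff_zero norm_zero order_refl)
  obtain \<delta>3 where \<delta>3: "\<delta>3 > 0" "\<And>\<mu>. norm \<mu> < \<delta>3 \<Longrightarrow> f 0 \<mu> = 0"
    using equilibrium unfolding eventually_nhds_metric by (auto simp: dist_norm)
  obtain a where a: "\<And>t. t \<ge> a \<Longrightarrow> norm (xh t) < \<delta> / 4"
    using tendstoD[OF xh_lim(1), of "\<delta>/4"] \<delta>(1) by (auto simp: eventually_at_top_linorder)
  obtain b where b: "\<And>t. t \<le> b \<Longrightarrow> norm (xh t) < \<delta> / 4"
    using tendstoD[OF xh_lim(2), of "\<delta>/4"] \<delta>(1) by (auto simp: eventually_at_bot_linorder)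
  obtain t0 where t0: "xh t0 \<noteq> 0" using loop by (auto simp: homoclinic_def)
  \<comment> \<open>The entries keep the tails of \<open>x\<close> together with
    \<open>\<mu>\<close> in the region of uniform linearisation, keep 0 an equilibrium, and prevent
    \<open>x\<close> from vanishing identically.\<close>
  define \<eta> where "\<eta> = Min {\<delta> / 4, \<delta>3, norm (xh t0)}"
  have \<eta>: "\<eta> > 0" "\<eta> \<le> \<delta> / 4" "\<eta> \<le> \<delta>3" "\<eta> \<le> norm (xh t0)"
    using \<delta>(1) \<delta>3(1) t0 by (auto simp: \<eta>_def)
  show ?thesis
  proof (intro exI[of _ \<eta>] conjI \<eta>(1) allI impI)
    fix \<mu> :: "real^2" and x
    assume \<mu>: "norm \<mu> < \<eta>" and x: "\<forall>t. (x has_vector_derivative f (x t) \<mu>) (at t)" and near: "\<forall>t. norm (x t - xh t) < \<eta>"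
    define r where "r t = f (x t) \<mu> - ?B *v x t" for t
    have f0: "f 0 \<mu> = 0" using \<mu> \<eta> by (intro \<delta>3(2)) auto
    have small: "norm (r t) \<le> e * norm (x t)" if "norm (xh t) < \<delta> / 4" for t
    proof -
      have "norm (x t) \<le> norm (xh t) + norm (x t - xh t)" by (metis add_diff_cancel_left' diff_add_cancel norm_triangle_ineq)
      then have "norm (x t) < \<delta> / 2" using that near[rule_format, of t] \<eta>(2) by linarith
      moreover have "norm (x t, \<mu>) \<le> norm (x t) + norm \<mu>" by (rule norm_Pair_le)
      moreover have "norm (0 :: real^'n, \<mu>) = norm \<mu>" by (simp add: norm_Pair)
      ultimately have "norm (F (x t, \<mu>) - F (0, \<mu>) - frechet_derivative F (at 0) ((x t, \<mu>) - (0, \<mu>))) \<le> e * norm ((x t, \<mu>) - (0, \<mu>))"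
        using \<mu> \<eta>(2) \<delta>(1) by (intro \<delta>(2)) linarith+
      then show ?thesis by (simp add: r_def f0 B Dx_F dirder_def norm_Pair zero_prod_def)
    qed
    have cx: "continuous_on UNIV x" using x by (meson continuous_at_imp_continuous_on has_vector_derivative_continuous)
    have bx: "bounded (range x)"
    proof -
      have "bounded (range (\<lambda>t. x t - xh t))" using near by (auto simp: bounded_iff intro: less_imp_le)
      then have "bounded (range (\<lambda>t. (x t - xh t) + xh t))" by (intro bounded_plus_comp xh_bounded)
      then show ?thesis by simp
    qed
    have g: "continuous_on UNIV (\<lambda>y. f y \<mu> - ?B *v y)"
    proof -
      have "continuous_on UNIV (\<lambda>y. F (y, \<mu>))"
        by (rule continuous_on_compose2[OF Ck_continuous[OF CF]]) (auto intro!: continuous_intros)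
      then show ?thesis by (auto intro!: continuous_intros linear_continuous_on[OF matrix_vector_mul_bounded_linear])
    qed
    have cr: "continuous_on UNIV r" unfolding r_def[abs_def] by (rule continuous_on_compose2[OF g cx]) auto
    have br: "bounded (range r)" unfolding r_def[abs_def] by (rule bounded_range_compose[OF g bx])
    have top: "(x \<longlongrightarrow> 0) at_top"
    proof (rule e1(2)[of x r a])
      show "\<forall>t. (x has_vector_derivative ?B *v x t + r t) (at t)" using x by (simp add: r_def)
      show "\<forall>t\<ge>a. norm (r t) \<le> e1 * norm (x t)" using small[OF a] e(2) by (meson mult_right_mono norm_ge_zero order_trans)
    qed (rule cr bx br)+
    have "((\<lambda>t. x (- t)) \<longlongrightarrow> 0) at_top"
    proof (rule e2(2)[of "\<lambda>t. x (- t)" "\<lambda>t. - r (- t)" "- b"])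
      show "\<forall>t. ((\<lambda>t. x (- t)) has_vector_derivative (- ?B) *v x (- t) + - r (- t)) (at t)"
      proof
        fix t
        have "((\<lambda>t. x (- t)) has_vector_derivative - f (x (- t)) \<mu>) (at t)"
          by (rule has_vector_derivative_reflect) (use x in blast)
        moreover have "(- ?B) *v x (- t) = - (?B *v x (- t))" by (simp add: matrix_vector_mult_def vec_eq_iff sum_negf)
        ultimately show "((\<lambda>t. x (- t)) has_vector_derivative (- ?B) *v x (- t) + - r (- t)) (at t)" by (simp add: r_def)
      qed
      show "continuous_on UNIV (\<lambda>t. - r (- t))" by (intro continuous_intros continuous_on_compose2[OF cr]) auto
      show "bounded (range (\<lambda>t. x (- t)))" using bx by (rule bounded_subset) auto
      show "bounded (range (\<lambda>t. - r (- t)))" using br by (auto simp: bounded_iff)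
      have "norm (- r (- t)) \<le> e2 * norm (x (- t))" if "- b \<le> t" for t
        using order_trans[OF small[OF b, of "- t"] mult_right_mono[OF e(3) norm_ge_zero]] that by simp
      then show "\<forall>t\<ge>-b. norm (- r (- t)) \<le> e2 * norm (x (- t))" by blast
    qed
    then have bot: "(x \<longlongrightarrow> 0) at_bot" unfolding filterlim_at_bot_mirror .
    have "x t0 \<noteq> 0" using near[rule_format, of t0] \<eta>(4) by auto
    with x top bot show "homoclinic f \<mu> x" unfolding homoclinic_def by blast
  qed
qed

text \<open>Two bounded solutions of the same inhomogeneous variational equation differ by a combination
  of \<open>xh'\<close> and \<open>\<phi>2\<close>.  The first contributes a total derivative, because \<open>\<phi>2''\<close> is the derivative of
  \<open>Dx f (xh t) \<phi>2\<close> along the loop; the second vanishes by symmetry.\<close>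

lemma pairing_independent:
  assumes sym: "\<And>t. Dxx f (xh t) 0 (\<phi>2 t) (\<phi>2 t) \<in> Xplus S"
    and w1: "\<And>t. (w1 has_vector_derivative Dx f (xh t) 0 (w1 t) + g t) (at t)" "bounded (range w1)"
    and w2: "\<And>t. (w2 has_vector_derivative Dx f (xh t) 0 (w2 t) + g t) (at t)" "bounded (range w2)"
    and c: "continuous_on UNIV c" "\<And>t. norm (c t) \<le> Mc"
  shows "(LINT t|lborel. \<psi>2 t \<bullet> (c t + Dxx f (xh t) 0 (w1 t) (\<phi>2 t))) = (LINT t|lborel. \<psi>2 t \<bullet> (c t + Dxx f (xh t) 0 (w2 t) (\<phi>2 t)))"
proof -
  have "VE_solution f xh (\<lambda>t. w1 t - w2 t)"
    unfolding VE_solution_def using has_vector_derivative_diff[OF w1(1) w2(1)] by (simp add: Dx_minus)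
  moreover have "bounded (range (\<lambda>t. w1 t - w2 t))" using w1(2) w2(2) by (rule bounded_minus_comp)
  ultimately obtain k d where kd: "\<And>t. w1 t - w2 t = k *\<^sub>R f (xh t) 0 + d *\<^sub>R \<phi>2 t" using bounded_VE by blast
  let ?D = "\<lambda>t. dirder (f (xh t) 0, 0) (dirder (\<phi>2 t, 0) F) (xh t, 0)"
  have "continuous_on UNIV (\<lambda>t. (xh t, 0 :: real^2))" by (intro continuous_intros xh_continuous)
  from continuous_on_compose2[OF Ck_continuous[OF CF] this subset_UNIV]
  have cxh': "continuous_on UNIV (\<lambda>t. f (xh t) 0)" by simp
  have bxh': "bounded (range (\<lambda>t. f (xh t) 0))"
    using bounded_range_compose[OF Ck_continuous[OF CF] bounded_xh_pair] by simp
  \<comment> \<open>By the product rule \<open>Dx f (xh t) 0 (\<phi>2 t)\<close>, the velocity of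
    \<open>\<phi>2\<close>, solves the inhomogeneous variational equation with forcing
    \<open>Dxx f (xh t) 0 (f (xh t) 0) (\<phi>2 t)\<close>.\<close>
  have d2: "((\<lambda>t. Dx f (xh t) 0 (\<phi>2 t)) has_vector_derivative Dx f (xh t) 0 (Dx f (xh t) 0 (\<phi>2 t)) + ?D t) (at t)" for t
  proof -
    have path: "((\<lambda>t. (xh t, 0)) has_vector_derivative (f (xh t) 0, 0)) (at t)"
      by (rule has_vector_derivative_Pair[OF xh_derivative has_vector_derivative_const])
    have "((\<lambda>t. \<Sum>b\<in>Basis. ((\<phi>2 t, 0) \<bullet> b) *\<^sub>R dirder b F (xh t, 0)) has_vector_derivative
       (\<Sum>b\<in>Basis. ((\<phi>2 t, 0) \<bullet> b) *\<^sub>R dirder (f (xh t) 0, 0) (dirder b F) (xh t, 0) + ((Dx f (xh t) 0 (\<phi>2 t), 0) \<bullet> b) *\<^sub>R dirder b F (xh t, 0))) (at t)"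
    proof (intro has_vector_derivative_sum bounded_bilinear.has_vector_derivative[OF bounded_bilinear_scaleR])
      fix b :: "(real^'n) \<times> (real^2)"
      show "((\<lambda>t. (\<phi>2 t, 0) \<bullet> b) has_vector_derivative (Dx f (xh t) 0 (\<phi>2 t), 0) \<bullet> b) (at t)"
        by (rule bounded_linear.has_vector_derivative[OF bounded_linear_inner_left has_vector_derivative_Pair[OF \<phi>2_derivative has_vector_derivative_const]])
      show "((\<lambda>t. dirder b F (xh t, 0)) has_vector_derivative dirder (f (xh t) 0, 0) (dirder b F) (xh t, 0)) (at t)"
        by (rule dirder_along[OF CdF path])
    qed
    moreover have "(\<Sum>b\<in>Basis. ((\<phi>2 t, 0) \<bullet> b) *\<^sub>R dirder (f (xh t) 0, 0) (dirder b F) (xh t, 0)) = ?D t"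
    proof -
      have "(\<Sum>b\<in>Basis. ((\<phi>2 t, 0) \<bullet> b) *\<^sub>R dirder (f (xh t) 0, 0) (dirder b F) (xh t, 0))
         = (\<Sum>b\<in>Basis. \<Sum>e\<in>Basis. (((f (xh t) 0, 0) \<bullet> e) * ((\<phi>2 t, 0) \<bullet> b)) *\<^sub>R dirder e (dirder b F) (xh t, 0))"
        by (subst dirder_basis_sum[OF CdF, of "(f (xh t) 0, 0)"]) (simp only: scaleR_sum_right scaleR_scaleR mult.commute)
      also have "\<dots> = ?D t" by (subst dirder_dirder_basis_sum[OF CF], rule sum.swap)
      finally show ?thesis .
    qed
    ultimately show ?thesis
      by (simp only: Dx_F dirder_basis_sum[OF CF, of "(\<phi>2 _, 0)", symmetric] sum.distrib
          dirder_basis_sum[OF CF, of "(dirder (\<phi>2 t, 0) F (xh t, 0), 0)", symmetric] add.commute)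
  qed
  obtain M1 where M1: "\<And>t u. norm (dirder u F (xh t, 0)) \<le> M1 * norm u" "M1 \<ge> 0" using bound_d by blast
  obtain M2 where M2: "M2 \<ge> 0" "\<And>t u w. norm (dirder u (dirder w F) (xh t, 0)) \<le> M2 * norm u * norm w" using bound_dd by blast
  obtain B where B: "\<And>t. norm (\<phi>2 t) \<le> B" using \<phi>2(2) by (auto simp: bounded_iff)
  have B0: "0 \<le> B" using B[of 0] norm_ge_zero order_trans by blast
  have bd: "norm (Dxx f (xh t) 0 (w t) (\<phi>2 t)) \<le> M2 * Mw * B" if "\<And>t. norm (w t) \<le> Mw" for w Mw t
  proof -
    have "norm (Dxx f (xh t) 0 (w t) (\<phi>2 t)) \<le> M2 * norm (w t, 0 :: real^2) * norm (\<phi>2 t, 0 :: real^2)" unfolding Dxx_F by (rule M2)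
    also have "\<dots> \<le> M2 * Mw * B" using B[of t] that[of t] M2(1) order_trans[OF norm_ge_zero that] by (intro mult_mono) (auto simp: norm_Pair)
    finally show ?thesis .
  qed
  have cD: "continuous_on UNIV (\<lambda>t. Dxx f (xh t) 0 (w t) (\<phi>2 t))" if "continuous_on UNIV w" for w
    unfolding Dxx_F by (intro continuous_dd continuous_intros that \<phi>2_continuous)
  have int: "integrable lborel (\<lambda>t. \<psi>2 t \<bullet> Dxx f (xh t) 0 (w t) (\<phi>2 t))" if w: "continuous_on UNIV w" "bounded (range w)" for w
  proof -
    obtain Mw where "\<And>t. norm (w t) \<le> Mw" using w(2) by (auto simp: bounded_iff)
    from bd[OF this] show ?thesis by (intro integrable_pairing(1)[OF \<psi>2_int] cD w)
  qed
  \<comment> \<open>The integrand is the derivative of the pairing of \<psi>2 with the bounded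
    velocity of \<open>\<phi>2\<close>, and this pairing vanishes at both ends.\<close>
  have z1: "(LINT t|lborel. \<psi>2 t \<bullet> Dxx f (xh t) 0 (f (xh t) 0) (\<phi>2 t)) = 0 - 0"
  proof (rule integral_FTC_line[where F="\<lambda>t. \<psi>2 t \<bullet> Dx f (xh t) 0 (\<phi>2 t)"])
    show "((\<lambda>t. \<psi>2 t \<bullet> Dx f (xh t) 0 (\<phi>2 t)) has_vector_derivative \<psi>2 t \<bullet> Dxx f (xh t) 0 (f (xh t) 0) (\<phi>2 t)) (at t)" for t
      unfolding Dxx_F by (rule \<psi>2_pairing[OF d2])
    show "continuous_on UNIV (\<lambda>t. \<psi>2 t \<bullet> Dxx f (xh t) 0 (f (xh t) 0) (\<phi>2 t))"
      by (intro continuous_intros \<psi>2_int cD cxh')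
    show "integrable lborel (\<lambda>t. \<psi>2 t \<bullet> Dxx f (xh t) 0 (f (xh t) 0) (\<phi>2 t))" by (rule int[OF cxh' bxh'])
    have lim: "((\<lambda>t. \<psi>2 t \<bullet> Dx f (xh t) 0 (\<phi>2 t)) \<longlongrightarrow> 0) G" if "(\<psi>2 \<longlongrightarrow> 0) G" for G
    proof (rule Lim_null_comparison)
      have "norm (Dx f (xh t) 0 (\<phi>2 t)) \<le> M1 * B" for t
        using M1(1)[of "(\<phi>2 t, 0)" t] mult_left_mono[OF B[of t] M1(2)] by (simp add: Dx_F norm_Pair)
      then show "\<forall>\<^sub>F t in G. norm (\<psi>2 t \<bullet> Dx f (xh t) 0 (\<phi>2 t)) \<le> norm (\<psi>2 t) * (M1 * B)"
        unfolding real_norm_def by (intro always_eventually allI order_trans[OF Cauchy_Schwarz_ineq2] mult_left_mono) auto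
      show "((\<lambda>t. norm (\<psi>2 t) * (M1 * B)) \<longlongrightarrow> 0) G" by (rule tendsto_mult_left_zero[OF tendsto_norm_zero[OF that]])
    qed
    show "((\<lambda>t. \<psi>2 t \<bullet> Dx f (xh t) 0 (\<phi>2 t)) \<longlongrightarrow> 0) at_top" "((\<lambda>t. \<psi>2 t \<bullet> Dx f (xh t) 0 (\<phi>2 t)) \<longlongrightarrow> 0) at_bot"
      by (intro lim \<psi>2_lim)+
  qed
  have cw: "continuous_on UNIV w1" "continuous_on UNIV w2"
    using w1(1) w2(1) by (meson continuous_at_imp_continuous_on has_vector_derivative_continuous)+
  have ic: "integrable lborel (\<lambda>t. \<psi>2 t \<bullet> c t)" by (rule integrable_pairing(1)[OF \<psi>2_int c])
  have eq: "\<psi>2 t \<bullet> Dxx f (xh t) 0 (w1 t) (\<phi>2 t) = \<psi>2 t \<bullet> Dxx f (xh t) 0 (w2 t) (\<phi>2 t) + k * (\<psi>2 t \<bullet> Dxx f (xh t) 0 (f (xh t) 0) (\<phi>2 t))" for t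
  proof -
    have "w1 t = w2 t + (k *\<^sub>R f (xh t) 0 + d *\<^sub>R \<phi>2 t)" using kd[of t] by (simp add: algebra_simps)
    then show ?thesis by (simp add: Dxx_linear inner_add_right \<psi>2_plus[OF sym])
  qed
  have "(LINT t|lborel. \<psi>2 t \<bullet> (c t + Dxx f (xh t) 0 (w1 t) (\<phi>2 t)))
      = (LINT t|lborel. \<psi>2 t \<bullet> c t) + ((LINT t|lborel. \<psi>2 t \<bullet> Dxx f (xh t) 0 (w2 t) (\<phi>2 t)) + k * (LINT t|lborel. \<psi>2 t \<bullet> Dxx f (xh t) 0 (f (xh t) 0) (\<phi>2 t)))"
    by (simp add: inner_add_right eq ic int[OF cw(2) w2(2)] int[OF cxh' bxh'])
  also have "\<dots> = (LINT t|lborel. \<psi>2 t \<bullet> (c t + Dxx f (xh t) 0 (w2 t) (\<phi>2 t)))"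
    unfolding z1 by (simp add: inner_add_right ic int[OF cw(2) w2(2)])
  finally show ?thesis .
qed

text \<open>Coefficients of the path
  \<open>x + \<alpha> w + \<alpha>\<^sup>2 u + \<alpha> ^ 3 v\<close> in state space together with
  \<open>\<alpha>\<^sup>2 \<nu>\<close> in parameter space: the parameter sits in the quadratic slot
  only.\<close>

abbreviation pack :: "real^'n \<Rightarrow> real^'n \<Rightarrow> real^'n \<Rightarrow> real^'n \<Rightarrow> real^2 \<Rightarrow>
    ((real^'n) \<times> (real^2)) \<times> ((real^'n) \<times> (real^2)) \<times> ((real^'n) \<times> (real^2)) \<times> ((real^'n) \<times> (real^2))" where
  "pack x w u v \<nu> \<equiv> ((x, 0), (w, 0), (u, \<nu>), (v, 0))"

lemma pack_path: "F (cubic_path (pack x w u v \<nu>) \<alpha>) = f (x + \<alpha> *\<^sub>R w + \<alpha>\<^sup>2 *\<^sub>R u + \<alpha> ^ 3 *\<^sub>R v) (\<alpha>\<^sup>2 *\<^sub>R \<nu>)"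
  by (simp add: cubic_path_def scaleR_Pair)

text \<open>The same expansion is needed with two remainders: the even part of the equation is
  divided by \<open>\<alpha>\<^sup>2\<close> and uses \<open>L2\<close>, the odd part is divided by
  \<open>\<alpha> ^ 3\<close> and uses \<open>L3\<close>. The conditions form a predicate on the
  pair so that one pair can be fixed by choice.\<close>

definition taylor_remainders ::
  "((((real^'n) \<times> (real^2)) \<times> ((real^'n) \<times> (real^2)) \<times> ((real^'n) \<times> (real^2)) \<times> ((real^'n) \<times> (real^2))) \<times> real \<Rightarrow> real^'n) \<Rightarrow>
   ((((real^'n) \<times> (real^2)) \<times> ((real^'n) \<times> (real^2)) \<times> ((real^'n) \<times> (real^2)) \<times> ((real^'n) \<times> (real^2))) \<times> real \<Rightarrow> real^'n) \<Rightarrow> bool"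
  where "taylor_remainders L2 L3 \<longleftrightarrow> Ck (Suc 0) L2 \<and> Ck (Suc 0) L3 \<and>
    (\<forall>x w u v \<nu>. L2 (pack x w u v \<nu>, 0) = (1/2) *\<^sub>R Dxx f x 0 w w + (Dx f x 0 u + Dmu f x 0 \<nu>)) \<and>
    (\<forall>x w u v \<nu>. L3 (pack x w u v \<nu>, 0) = (1/6) *\<^sub>R Dxxx f x 0 w w w + (Dxx f x 0 u w + DmuDx f x 0 \<nu> w + Dx f x 0 v)) \<and>
    (\<forall>x w u v \<nu> \<alpha>. f (x + \<alpha> *\<^sub>R w + \<alpha>\<^sup>2 *\<^sub>R u + \<alpha> ^ 3 *\<^sub>R v) (\<alpha>\<^sup>2 *\<^sub>R \<nu>)
       = f x 0 + \<alpha> *\<^sub>R Dx f x 0 w + \<alpha>\<^sup>2 *\<^sub>R L2 (pack x w u v \<nu>, \<alpha>)) \<and>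
    (\<forall>x w u v \<nu> \<alpha>. f (x + \<alpha> *\<^sub>R w + \<alpha>\<^sup>2 *\<^sub>R u + \<alpha> ^ 3 *\<^sub>R v) (\<alpha>\<^sup>2 *\<^sub>R \<nu>)
       = f x 0 + \<alpha> *\<^sub>R Dx f x 0 w + \<alpha>\<^sup>2 *\<^sub>R L2 (pack x w u v \<nu>, 0) + \<alpha> ^ 3 *\<^sub>R L3 (pack x w u v \<nu>, \<alpha>))"

lemma exists_taylor_remainders: "\<exists>p. taylor_remainders (fst p) (snd p)"
proof -
  define K where "K = (\<lambda>(q, \<alpha>). F (cubic_path q \<alpha>))"
  have CK: "Ck k K" for k unfolding K_def by (rule cubic_path_derivatives(1)[OF CF refl])
  obtain L2 where "Ck (Suc 0) L2 \<and> (\<forall>q. L2 (q, 0) = (1 / fact 2) *\<^sub>R (dirder (0, 1) ^^ 2) K (q, 0)) \<and>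
    (\<forall>q \<alpha>. K (q, \<alpha>) = (\<Sum>i<2. (\<alpha> ^ i / fact i) *\<^sub>R (dirder (0, 1) ^^ i) K (q, 0)) + \<alpha> ^ 2 *\<^sub>R L2 (q, \<alpha>))"
    using hadamard_remainder[OF CK, of 2, OF zero_less_numeral] ..
  then have L2: "Ck (Suc 0) L2" "\<And>q. L2 (q, 0) = (1 / fact 2) *\<^sub>R (dirder (0, 1) ^^ 2) K (q, 0)"
    "\<And>q \<alpha>. K (q, \<alpha>) = (\<Sum>i<2. (\<alpha> ^ i / fact i) *\<^sub>R (dirder (0, 1) ^^ i) K (q, 0)) + \<alpha> ^ 2 *\<^sub>R L2 (q, \<alpha>)"
    by blast+
  obtain L3 where "Ck (Suc 0) L3 \<and> (\<forall>q. L3 (q, 0) = (1 / fact 3) *\<^sub>R (dirder (0, 1) ^^ 3) K (q, 0)) \<and>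
    (\<forall>q \<alpha>. K (q, \<alpha>) = (\<Sum>i<3. (\<alpha> ^ i / fact i) *\<^sub>R (dirder (0, 1) ^^ i) K (q, 0)) + \<alpha> ^ 3 *\<^sub>R L3 (q, \<alpha>))"
    using hadamard_remainder[OF CK, of 3, OF zero_less_numeral] ..
  then have L3: "Ck (Suc 0) L3" "\<And>q. L3 (q, 0) = (1 / fact 3) *\<^sub>R (dirder (0, 1) ^^ 3) K (q, 0)"
    "\<And>q \<alpha>. K (q, \<alpha>) = (\<Sum>i<3. (\<alpha> ^ i / fact i) *\<^sub>R (dirder (0, 1) ^^ i) K (q, 0)) + \<alpha> ^ 3 *\<^sub>R L3 (q, \<alpha>)"
    by blast+
  note deriv = cubic_path_derivatives(2-4)[OF CF refl, folded K_def]
  have D1: "dirder (0, 1) K (pack x w u v \<nu>, 0) = Dx f x 0 w" for x w u v \<nu>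
    unfolding deriv(1) by (simp add: Dx_F)
  have split: "dirder (u, \<nu>) G p = dirder (u, 0) G p + dirder (0, \<nu>) G p" if "\<And>k. Ck k G"
    for u \<nu> p and G :: "(real^'n) \<times> (real^2) \<Rightarrow> real^'n"
    using dirder_add[OF that, of "(u, 0)" "(0, \<nu>)" p] by simp
  have D2: "(dirder (0, 1) ^^ 2) K (pack x w u v \<nu>, 0) = Dxx f x 0 w w + 2 *\<^sub>R (Dx f x 0 u + Dmu f x 0 \<nu>)" for x w u v \<nu>
    unfolding deriv(2) by (simp add: Dxx_F Dx_F Dmu_F split[OF CF, of u \<nu>])
  have D3: "(dirder (0, 1) ^^ 3) K (pack x w u v \<nu>, 0) = Dxxx f x 0 w w w + 6 *\<^sub>R (Dxx f x 0 u w + DmuDx f x 0 \<nu> w + Dx f x 0 v)" for x w u v \<nu>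
    unfolding deriv(3)
    by (simp add: Dxxx_F Dxx_F Dx_F DmuDx_F split[OF CdF, of u \<nu>] scaleR_add_right)
  have v2: "L2 (pack x w u v \<nu>, 0) = (1/2) *\<^sub>R Dxx f x 0 w w + (Dx f x 0 u + Dmu f x 0 \<nu>)" for x w u v \<nu>
    unfolding L2(2) D2 by (simp add: scaleR_add_right)
  have v3: "L3 (pack x w u v \<nu>, 0) = (1/6) *\<^sub>R Dxxx f x 0 w w w + (Dxx f x 0 u w + DmuDx f x 0 \<nu> w + Dx f x 0 v)" for x w u v \<nu>
    unfolding L3(2) D3 by (simp add: scaleR_add_right fact_numeral)
  have t2: "f (x + \<alpha> *\<^sub>R w + \<alpha>\<^sup>2 *\<^sub>R u + \<alpha> ^ 3 *\<^sub>R v) (\<alpha>\<^sup>2 *\<^sub>R \<nu>)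
       = f x 0 + \<alpha> *\<^sub>R Dx f x 0 w + \<alpha>\<^sup>2 *\<^sub>R L2 (pack x w u v \<nu>, \<alpha>)" for x w u v \<nu> \<alpha>
  proof -
    have "K (pack x w u v \<nu>, \<alpha>) = K (pack x w u v \<nu>, 0) + \<alpha> *\<^sub>R Dx f x 0 w + \<alpha>\<^sup>2 *\<^sub>R L2 (pack x w u v \<nu>, \<alpha>)"
      unfolding L2(3)[of "pack x w u v \<nu>" \<alpha>] by (simp add: numeral_2_eq_2 D1 del: split_paired_All)
    then show ?thesis by (simp add: pack_path K_def)
  qed
  have t3: "f (x + \<alpha> *\<^sub>R w + \<alpha>\<^sup>2 *\<^sub>R u + \<alpha> ^ 3 *\<^sub>R v) (\<alpha>\<^sup>2 *\<^sub>R \<nu>)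
       = f x 0 + \<alpha> *\<^sub>R Dx f x 0 w + \<alpha>\<^sup>2 *\<^sub>R L2 (pack x w u v \<nu>, 0) + \<alpha> ^ 3 *\<^sub>R L3 (pack x w u v \<nu>, \<alpha>)" for x w u v \<nu> \<alpha>
  proof -
    have "L2 (pack x w u v \<nu>, 0) = (1/2) *\<^sub>R dirder (0, 1) (dirder (0, 1) K) (pack x w u v \<nu>, 0)"
      unfolding L2(2) by (simp add: numeral_2_eq_2)
    then have "K (pack x w u v \<nu>, \<alpha>) = K (pack x w u v \<nu>, 0) + \<alpha> *\<^sub>R Dx f x 0 w + \<alpha>\<^sup>2 *\<^sub>R L2 (pack x w u v \<nu>, 0) + \<alpha> ^ 3 *\<^sub>R L3 (pack x w u v \<nu>, \<alpha>)"
      unfolding L3(3)[of "pack x w u v \<nu>" \<alpha>] by (simp add: numeral_3_eq_3 D1 power2_eq_square)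
    then show ?thesis by (simp add: pack_path K_def)
  qed
  show ?thesis
    unfolding taylor_remainders_def by (rule exI[of _ "(L2, L3)"], unfold fst_conv snd_conv, intro conjI allI L2(1) L3(1) v2 v3 t2 t3)
qed

definition L2 where "L2 = fst (SOME p. taylor_remainders (fst p) (snd p))"
definition L3 where "L3 = snd (SOME p. taylor_remainders (fst p) (snd p))"

lemma
  shows CL2: "Ck (Suc 0) L2" and CL3: "Ck (Suc 0) L3"
    and L2_0: "L2 (pack x w u v \<nu>, 0) = (1/2) *\<^sub>R Dxx f x 0 w w + (Dx f x 0 u + Dmu f x 0 \<nu>)"
    and L3_0: "L3 (pack x w u v \<nu>, 0) = (1/6) *\<^sub>R Dxxx f x 0 w w w + (Dxx f x 0 u w + DmuDx f x 0 \<nu> w + Dx f x 0 v)"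
    and taylor2: "f (x + \<alpha> *\<^sub>R w + \<alpha>\<^sup>2 *\<^sub>R u + \<alpha> ^ 3 *\<^sub>R v) (\<alpha>\<^sup>2 *\<^sub>R \<nu>)
       = f x 0 + \<alpha> *\<^sub>R Dx f x 0 w + \<alpha>\<^sup>2 *\<^sub>R L2 (pack x w u v \<nu>, \<alpha>)"
    and taylor3: "f (x + \<alpha> *\<^sub>R w + \<alpha>\<^sup>2 *\<^sub>R u + \<alpha> ^ 3 *\<^sub>R v) (\<alpha>\<^sup>2 *\<^sub>R \<nu>)
       = f x 0 + \<alpha> *\<^sub>R Dx f x 0 w + \<alpha>\<^sup>2 *\<^sub>R L2 (pack x w u v \<nu>, 0) + \<alpha> ^ 3 *\<^sub>R L3 (pack x w u v \<nu>, \<alpha>)"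
proof -
  note p = someI_ex[OF exists_taylor_remainders, folded L2_def L3_def, unfolded taylor_remainders_def]
  note q = p[THEN conjunct2, THEN conjunct2]
  show "Ck (Suc 0) L2" by (rule p[THEN conjunct1])
  show "Ck (Suc 0) L3" by (rule p[THEN conjunct2, THEN conjunct1])
  show "L2 (pack x w u v \<nu>, 0) = (1/2) *\<^sub>R Dxx f x 0 w w + (Dx f x 0 u + Dmu f x 0 \<nu>)"
    by (rule q[THEN conjunct1, rule_format])
  show "L3 (pack x w u v \<nu>, 0) = (1/6) *\<^sub>R Dxxx f x 0 w w w + (Dxx f x 0 u w + DmuDx f x 0 \<nu> w + Dx f x 0 v)"
    by (rule q[THEN conjunct2, THEN conjunct1, rule_format])
  show "f (x + \<alpha> *\<^sub>R w + \<alpha>\<^sup>2 *\<^sub>R u + \<alpha> ^ 3 *\<^sub>R v) (\<alpha>\<^sup>2 *\<^sub>R \<nu>)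
       = f x 0 + \<alpha> *\<^sub>R Dx f x 0 w + \<alpha>\<^sup>2 *\<^sub>R L2 (pack x w u v \<nu>, \<alpha>)"
    by (rule q[THEN conjunct2, THEN conjunct2, THEN conjunct1, rule_format])
  show "f (x + \<alpha> *\<^sub>R w + \<alpha>\<^sup>2 *\<^sub>R u + \<alpha> ^ 3 *\<^sub>R v) (\<alpha>\<^sup>2 *\<^sub>R \<nu>)
       = f x 0 + \<alpha> *\<^sub>R Dx f x 0 w + \<alpha>\<^sup>2 *\<^sub>R L2 (pack x w u v \<nu>, 0) + \<alpha> ^ 3 *\<^sub>R L3 (pack x w u v \<nu>, \<alpha>)"
    by (rule q[THEN conjunct2, THEN conjunct2, THEN conjunct2, rule_format])
qed

text \<open>The reflection \<open>S\<close> acts on the expansion as \<open>\<alpha> \<mapsto> - \<alpha>\<close>, so the even remainder at \<open>0\<close> is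
  invariant.\<close>

lemma L2_0_plus:
  assumes "x \<in> Xplus S" "w \<in> Xminus S" "u \<in> Xplus S" "v \<in> Xminus S"
  shows "L2 (pack x w u v \<nu>, 0) \<in> Xplus S"
proof -
  let ?q = "pack x w u v \<nu>"
  have Sx: "S *v x = x" "S *v w = - w" "S *v u = u" "S *v v = - v" using assms by (auto simp: Xplus_def Xminus_def)
  \<comment> \<open>Comparing the expansions for \<alpha> and its negative leaves a factor
    \<open>\<alpha>\<^sup>2\<close>; the identity is therefore obtained off zero and reaches
    \<alpha> = 0 by continuity.\<close>
  have even: "S *v L2 (?q, \<alpha>) = L2 (?q, - \<alpha>)" if "\<alpha> \<noteq> 0" for \<alpha>
  proof -
    have "S *v f (x + \<alpha> *\<^sub>R w + \<alpha>\<^sup>2 *\<^sub>R u + \<alpha> ^ 3 *\<^sub>R v) (\<alpha>\<^sup>2 *\<^sub>R \<nu>)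
      = f (x + (- \<alpha>) *\<^sub>R w + (- \<alpha>)\<^sup>2 *\<^sub>R u + (- \<alpha>) ^ 3 *\<^sub>R v) ((- \<alpha>)\<^sup>2 *\<^sub>R \<nu>)"
      by (simp add: S_equivariant matrix_vector_right_distrib matrix_vector_mult_scaleR Sx power3_eq_cube
          flip: scaleR_minus_left)
    then have "S *v f x 0 + \<alpha> *\<^sub>R (S *v Dx f x 0 w) + \<alpha>\<^sup>2 *\<^sub>R (S *v L2 (?q, \<alpha>)) = f x 0 + (- \<alpha>) *\<^sub>R Dx f x 0 w + \<alpha>\<^sup>2 *\<^sub>R L2 (?q, - \<alpha>)"
      unfolding taylor2 by (simp add: matrix_vector_right_distrib matrix_vector_mult_scaleR matrix_vector_mult_diff_distrib)
    moreover have "S *v Dx f x 0 w = - Dx f x 0 w"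
      using S_Dx[OF assms(1), of 0 w] Dx_linear(2)[of x 0 "-1" w] by (simp add: Sx)
    moreover have "S *v f x 0 = f x 0" using f_plus[OF assms(1)] by (simp add: Xplus_def)
    ultimately have "\<alpha>\<^sup>2 *\<^sub>R (S *v L2 (?q, \<alpha>)) = \<alpha>\<^sup>2 *\<^sub>R L2 (?q, - \<alpha>)" by simp
    then show ?thesis using that by simp
  qed
  have cL: "continuous_on UNIV L2" by (rule Ck_continuous[OF CL2])
  have c1: "continuous_on UNIV (\<lambda>\<alpha>. L2 (?q, \<alpha>))" by (rule continuous_on_compose2[OF cL]) (auto intro!: continuous_intros)
  have c2: "continuous_on UNIV (\<lambda>\<alpha>. L2 (?q, - \<alpha>))" by (rule continuous_on_compose2[OF cL]) (auto intro!: continuous_intros)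
  have "((\<lambda>\<alpha>. S *v L2 (?q, \<alpha>)) \<longlongrightarrow> S *v L2 (?q, 0)) (at 0)"
    using c1 by (intro bounded_linear.tendsto[OF bounded_linear_S]) (auto simp: continuous_on_def)
  moreover have "isCont (\<lambda>\<alpha>. L2 (?q, - \<alpha>)) 0" using c2 by (auto simp: continuous_on_eq_continuous_at)
  then have "((\<lambda>\<alpha>. L2 (?q, - \<alpha>)) \<longlongrightarrow> L2 (?q, 0)) (at 0)" unfolding isCont_def by simp
  then have "((\<lambda>\<alpha>. S *v L2 (?q, \<alpha>)) \<longlongrightarrow> L2 (?q, 0)) (at 0)"
    by (rule Lim_transform_eventually) (auto simp: eventually_at_filter even)
  ultimately have "S *v L2 (?q, 0) = L2 (?q, 0)" using tendsto_unique[OF at_neq_bot] by blast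
  then show ?thesis by (simp add: Xplus_def)
qed

text \<open>The case of zero \<open>u\<close>, \<open>v\<close> and \<open>\<nu>\<close> of the
  invariance of the even remainder, used in place of differentiating the equivariance twice.\<close>

lemma Dxx_plus: "Dxx f (xh t) 0 (\<phi>2 t) (\<phi>2 t) \<in> Xplus S"
proof -
  have "0 \<in> Xplus S" "0 \<in> Xminus S" by (auto simp: Xplus_def Xminus_def)
  from L2_0_plus[OF xh_plus \<phi>2_minus this, where \<nu>=0]
  have "L2 (pack (xh t) (\<phi>2 t) 0 0 0, 0) \<in> Xplus S" .
  moreover have "Dx f (xh t) 0 0 = 0" "Dmu f (xh t) 0 0 = 0"
    using dirder_zero[OF CF, of "(xh t, 0)"] by (simp_all add: Dx_F Dmu_F zero_prod_def)
  ultimately have "(1/2) *\<^sub>R Dxx f (xh t) 0 (\<phi>2 t) (\<phi>2 t) \<in> Xplus S"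
    unfolding L2_0 by (simp only: add_0_right)
  then show ?thesis by (simp add: Xplus_def matrix_vector_mult_scaleR)
qed

text \<open>The even part is read off from the second-order expansion, the odd part from the
  third-order one, whose quadratic coefficient is even and drops out.\<close>

lemma even_odd_expansion:
  assumes "x \<in> Xplus S" "w \<in> Xminus S" "u \<in> Xplus S" "v \<in> Xminus S"
  shows "f (x + \<alpha> *\<^sub>R w + \<alpha>\<^sup>2 *\<^sub>R u + \<alpha> ^ 3 *\<^sub>R v) (\<alpha>\<^sup>2 *\<^sub>R \<nu>)
     = f x 0 + \<alpha> *\<^sub>R Dx f x 0 w + \<alpha>\<^sup>2 *\<^sub>R Pp (L2 (pack x w u v \<nu>, \<alpha>)) + \<alpha> ^ 3 *\<^sub>R Pm (L3 (pack x w u v \<nu>, \<alpha>))"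
proof -
  let ?K = "f (x + \<alpha> *\<^sub>R w + \<alpha>\<^sup>2 *\<^sub>R u + \<alpha> ^ 3 *\<^sub>R v) (\<alpha>\<^sup>2 *\<^sub>R \<nu>)"
  interpret P: bounded_linear Pp by (rule bounded_linear_Pp)
  interpret M: bounded_linear Pm by (rule bounded_linear_Pm)
  have w: "Pp (Dx f x 0 w) = 0" "Pm (Dx f x 0 w) = Dx f x 0 w"
    using Dx_linear(2)[of x 0 0 0] by (simp_all add: Pp_Dx Pm_Dx assms Pp_on_minus Pm_on_minus)
  have A: "Pp ?K = f x 0 + \<alpha>\<^sup>2 *\<^sub>R Pp (L2 (pack x w u v \<nu>, \<alpha>))"
    unfolding taylor2 by (simp add: P.add P.scaleR w Pp_on_plus f_plus assms)
  have B: "Pm ?K = \<alpha> *\<^sub>R Dx f x 0 w + \<alpha> ^ 3 *\<^sub>R Pm (L3 (pack x w u v \<nu>, \<alpha>))"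
    unfolding taylor3 by (simp add: M.add M.scaleR w Pm_on_plus f_plus assms L2_0_plus)
  show ?thesis by (rule trans[OF Pp_add_Pm[of ?K, symmetric]]) (simp only: A B, simp only: add_ac)
qed

end

subsection \<open>The bifurcating branches\<close>

lemma axis_combination_eq_iff:
  "a *\<^sub>R axis 1 1 + b *\<^sub>R axis 2 1 = c *\<^sub>R axis 1 1 + (d *\<^sub>R axis 2 1 :: real^2) \<longleftrightarrow> a = c \<and> b = d"
  by (auto simp: vec_eq_iff forall_2 axis_def)

context homoclinic_reduction
begin

text \<open>The linear problem at \<alpha> = 0 is triangular. The two solvability conditions fix
  \<nu>, as their dependence on \<nu> is an injective linear map of the plane; \<open>u\<close>
  follows from the even equation and enters the odd equation for \<open>v\<close> through
  \<open>G3\<close>. The last clause says that \<nu> can be zero only if the forcing is solvable by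
  itself, which later yields a nonzero initial direction of the branch.\<close>

lemma pair_operator:
  assumes inv: "\<And>\<nu>. l1 (G1 \<nu>) = 0 \<Longrightarrow> l2 (G2 \<nu> + G3 (Kp (G1 \<nu>))) = 0 \<Longrightarrow> \<nu> = 0"
  shows "\<exists>Q :: (real \<Rightarrow>\<^sub>C ((real^'n) \<times> (real^'n))) \<Rightarrow> (real \<Rightarrow>\<^sub>C (real^'n)) \<times> (real \<Rightarrow>\<^sub>C (real^'n)) \<times> (real^2).
    bounded_linear Q \<and> (\<forall>h u v \<nu>. Q h = (u, v, \<nu>) \<longrightarrow>
      (\<forall>t. apply_bcontfun u t \<in> Xplus S \<and> apply_bcontfun v t \<in> Xminus S \<and>
        (apply_bcontfun u has_vector_derivative Dx f (xh t) 0 (apply_bcontfun u t) +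
           Pp (Dmu f (xh t) 0 \<nu> + fst (apply_bcontfun h t))) (at t) \<and>
        (apply_bcontfun v has_vector_derivative Dx f (xh t) 0 (apply_bcontfun v t) +
           Pm (DmuDx f (xh t) 0 \<nu> (\<phi>2 t) + Dxx f (xh t) 0 (apply_bcontfun u t) (\<phi>2 t) + snd (apply_bcontfun h t))) (at t)) \<and>
      (\<forall>h1 h2. (\<forall>t. apply_bcontfun h t = (apply_bcontfun h1 t, apply_bcontfun h2 t)) \<longrightarrow> \<nu> = 0 \<longrightarrow>
         l1 h1 = 0 \<and> l2 (h2 + G3 (Kp h1)) = 0))"
proof -
  obtain f1 :: "(real \<Rightarrow>\<^sub>C ((real^'n) \<times> (real^'n))) \<Rightarrow> (real \<Rightarrow>\<^sub>C (real^'n))" where f1: "bounded_linear f1" "\<And>h t. apply_bcontfun (f1 h) t = fst (apply_bcontfun h t)"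
    using bounded_linear_postcompose[OF bounded_linear_fst] by blast
  obtain f2 :: "(real \<Rightarrow>\<^sub>C ((real^'n) \<times> (real^'n))) \<Rightarrow> (real \<Rightarrow>\<^sub>C (real^'n))" where f2: "bounded_linear f2" "\<And>h t. apply_bcontfun (f2 h) t = snd (apply_bcontfun h t)"
    using bounded_linear_postcompose[OF bounded_linear_snd] by blast
  note BL = bounded_linear_add bounded_linear_minus bounded_linear_Pair
    bounded_linear_compose[OF bounded_linear_scaleR_left] bounded_linear_compose[OF bounded_linear_l1]
    bounded_linear_compose[OF bounded_linear_l2] bounded_linear_compose[OF G1(1)] bounded_linear_compose[OF G2(1)]
    bounded_linear_compose[OF G3(1)] bounded_linear_compose[OF Kp(1)] bounded_linear_compose[OF Km(1)] bounded_linear_ident f1(1) f2(1)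
  interpret l1: bounded_linear l1 by (rule bounded_linear_l1)
  interpret l2: bounded_linear l2 by (rule bounded_linear_l2)
  interpret G1: bounded_linear G1 by (rule G1)
  interpret G2: bounded_linear G2 by (rule G2)
  interpret G3: bounded_linear G3 by (rule G3)
  interpret Kp: bounded_linear Kp by (rule Kp)
  define \<Lambda> where "\<Lambda> \<nu> = l1 (G1 \<nu>) *\<^sub>R axis 1 1 + l2 (G2 \<nu> + G3 (Kp (G1 \<nu>))) *\<^sub>R (axis 2 1 :: real^2)" for \<nu>
  have lin: "bounded_linear \<Lambda>" unfolding \<Lambda>_def[abs_def] by (intro BL)
  have "inj \<Lambda>"
  proof (subst linear_injective_0[OF bounded_linear.linear[OF lin]], intro allI impI)
    fix \<nu> assume "\<Lambda> \<nu> = 0"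
    then have "l1 (G1 \<nu>) = 0 \<and> l2 (G2 \<nu> + G3 (Kp (G1 \<nu>))) = 0"
      using axis_combination_eq_iff[of _ _ 0 0] unfolding \<Lambda>_def by simp
    then show "\<nu> = 0" using inv by blast
  qed
  then obtain N where N: "linear N" "\<And>x. \<Lambda> (N x) = x"
    using linear_injective_isomorphism[OF bounded_linear.linear[OF lin]] by blast
  have bN: "bounded_linear N" using N(1) by (simp add: linear_conv_bounded_linear)
  \<comment> \<open>The term \<open>G3 (Kp (f1 h))\<close> is the response of \<open>u\<close> to
    the even forcing as it appears in the odd solvability condition.\<close>
  define \<nu>' where "\<nu>' h = N ((- l1 (f1 h)) *\<^sub>R axis 1 1 + (- l2 (f2 h + G3 (Kp (f1 h)))) *\<^sub>R axis 2 1)" for h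
  define u' where "u' h = Kp (G1 (\<nu>' h) + f1 h)" for h
  define v' where "v' h = Km (G2 (\<nu>' h) + G3 (u' h) + f2 h)" for h
  define Q where "Q h = (u' h, v' h, \<nu>' h)" for h
  have b\<nu>: "bounded_linear \<nu>'" unfolding \<nu>'_def[abs_def] by (intro bounded_linear_compose[OF bN] BL)
  have bu: "bounded_linear u'" unfolding u'_def[abs_def] by (intro BL b\<nu>)
  have bv: "bounded_linear v'" unfolding v'_def[abs_def] by (intro BL b\<nu> bu)
  have "bounded_linear Q" unfolding Q_def[abs_def] by (intro bounded_linear_Pair b\<nu> bu bv)
  moreover have "(\<forall>t. apply_bcontfun u t \<in> Xplus S \<and> apply_bcontfun v t \<in> Xminus S \<and>
        (apply_bcontfun u has_vector_derivative Dx f (xh t) 0 (apply_bcontfun u t) +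
           Pp (Dmu f (xh t) 0 \<nu> + fst (apply_bcontfun h t))) (at t) \<and>
        (apply_bcontfun v has_vector_derivative Dx f (xh t) 0 (apply_bcontfun v t) +
           Pm (DmuDx f (xh t) 0 \<nu> (\<phi>2 t) + Dxx f (xh t) 0 (apply_bcontfun u t) (\<phi>2 t) + snd (apply_bcontfun h t))) (at t)) \<and>
      (\<forall>h1 h2. (\<forall>t. apply_bcontfun h t = (apply_bcontfun h1 t, apply_bcontfun h2 t)) \<longrightarrow> \<nu> = 0 \<longrightarrow>
         l1 h1 = 0 \<and> l2 (h2 + G3 (Kp h1)) = 0)"
    if "Q h = (u, v, \<nu>)" for h u v \<nu>
  proof -
    have uv: "u = Kp (G1 \<nu> + f1 h)" "v = Km (G2 \<nu> + G3 u + f2 h)" "\<nu> = \<nu>' h"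
      using that by (auto simp: Q_def u'_def v'_def)
    have "\<Lambda> \<nu> = (- l1 (f1 h)) *\<^sub>R axis 1 1 + (- l2 (f2 h + G3 (Kp (f1 h)))) *\<^sub>R axis 2 1"
      unfolding uv(3) \<nu>'_def N(2) ..
    then have \<Lambda>: "l1 (G1 \<nu>) = - l1 (f1 h)" "l2 (G2 \<nu> + G3 (Kp (G1 \<nu>))) = - l2 (f2 h + G3 (Kp (f1 h)))"
      unfolding \<Lambda>_def axis_combination_eq_iff by blast+
    have c1: "l1 (G1 \<nu> + f1 h) = 0" using \<Lambda>(1) by (simp add: l1.add)
    have c2: "l2 (G2 \<nu> + G3 u + f2 h) = 0"
      using \<Lambda>(2) unfolding uv(1) by (simp add: l2.add G3.add Kp.add)
    have "l1 h1 = 0 \<and> l2 (h2 + G3 (Kp h1)) = 0"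
      if h: "\<forall>t. apply_bcontfun h t = (apply_bcontfun h1 t, apply_bcontfun h2 t)" and "\<nu> = 0" for h1 h2
    proof -
      have "f1 h = h1" "f2 h = h2" by (auto intro!: bcontfun_eqI simp: f1 f2 h)
      then show ?thesis using \<Lambda> \<open>\<nu> = 0\<close> by (simp add: G1.zero G2.zero G3.zero Kp.zero l1.zero l2.zero)
    qed
    moreover have "apply_bcontfun u t \<in> Xplus S \<and> apply_bcontfun v t \<in> Xminus S \<and>
        (apply_bcontfun u has_vector_derivative Dx f (xh t) 0 (apply_bcontfun u t) +
           Pp (Dmu f (xh t) 0 \<nu> + fst (apply_bcontfun h t))) (at t) \<and>
        (apply_bcontfun v has_vector_derivative Dx f (xh t) 0 (apply_bcontfun v t) +
           Pm (DmuDx f (xh t) 0 \<nu> (\<phi>2 t) + Dxx f (xh t) 0 (apply_bcontfun u t) (\<phi>2 t) + snd (apply_bcontfun h t))) (at t)" for t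
    proof (intro conjI)
      show "apply_bcontfun u t \<in> Xplus S" unfolding uv(1) by (rule Kp(2))
      show "apply_bcontfun v t \<in> Xminus S" unfolding uv(2) by (rule Km(2))
      show "(apply_bcontfun u has_vector_derivative Dx f (xh t) 0 (apply_bcontfun u t) +
           Pp (Dmu f (xh t) 0 \<nu> + fst (apply_bcontfun h t))) (at t)"
        using Kp(3)[OF c1, of t, folded uv(1)] by (simp only: plus_bcontfun.rep_eq G1 f1)
      show "(apply_bcontfun v has_vector_derivative Dx f (xh t) 0 (apply_bcontfun v t) +
           Pm (DmuDx f (xh t) 0 \<nu> (\<phi>2 t) + Dxx f (xh t) 0 (apply_bcontfun u t) (\<phi>2 t) + snd (apply_bcontfun h t))) (at t)"
        using Km(3)[OF c2, of t, folded uv(2)] by (simp only: plus_bcontfun.rep_eq G2 G3 f2)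
    qed
    ultimately show ?thesis by blast
  qed
  ultimately show ?thesis by blast
qed

lemma reflected_solution:
  assumes "(x has_vector_derivative f (x t) \<mu>) (at t)"
  shows "((\<lambda>t. S *v x t) has_vector_derivative f (S *v x t) \<mu>) (at t)"
  using bounded_linear.has_vector_derivative[OF bounded_linear_S assms] by (simp add: S_equivariant)

text \<open>The fixed point theorem is applied to the unknowns \<open>(u, v, \<nu>)\<close>, and the
  two hypotheses \<open>inv\<close> and \<open>nz\<close> provide the linear inverse and the nonzero
  starting value of \<nu>. Orbits are built for positive \<alpha>; their reflections have amplitude
  \<open>- \<alpha>\<close>.\<close>

theorem pitchfork_branch:
  assumes inv: "\<And>\<nu>. l1 (G1 \<nu>) = 0 \<Longrightarrow> l2 (G2 \<nu> + G3 (Kp (G1 \<nu>))) = 0 \<Longrightarrow> \<nu> = 0"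
    and H1: "\<And>t. apply_bcontfun H1 t = (1/2) *\<^sub>R Dxx f (xh t) 0 (\<phi>2 t) (\<phi>2 t)"
    and H2: "\<And>t. apply_bcontfun H2 t = (1/6) *\<^sub>R Dxxx f (xh t) 0 (\<phi>2 t) (\<phi>2 t) (\<phi>2 t)"
    and nz: "\<not> (l1 H1 = 0 \<and> l2 (H2 + G3 (Kp H1)) = 0)"
  shows "\<exists>\<epsilon>>0. \<exists>C\<ge>0. \<exists>\<nu>0 (\<nu> :: real \<Rightarrow> real^2). \<nu>0 \<noteq> 0 \<and>
    (\<forall>\<alpha>. \<bar>\<alpha>\<bar> < \<epsilon> \<longrightarrow> norm (\<nu> \<alpha> - \<nu>0) \<le> C * \<bar>\<alpha>\<bar> \<and> (\<exists>d. (\<nu> has_vector_derivative d) (at \<alpha>) \<and> norm d \<le> C)) \<and>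
    (\<forall>\<alpha>. 0 < \<alpha> \<and> \<alpha> < \<epsilon> \<longrightarrow> (\<exists>x. homoclinic f (\<alpha>\<^sup>2 *\<^sub>R \<nu> \<alpha>) x \<and> homoclinic f (\<alpha>\<^sup>2 *\<^sub>R \<nu> \<alpha>) (\<lambda>t. S *v x t) \<and>
       (\<exists>t. S *v x t \<noteq> x t) \<and> (\<forall>t. norm (x t - (xh t + \<alpha> *\<^sub>R \<phi>2 t)) \<le> C * \<alpha>\<^sup>2) \<and>
       (\<forall>t. norm (S *v x t - (xh t - \<alpha> *\<^sub>R \<phi>2 t)) \<le> C * \<alpha>\<^sup>2)))"
proof -
  let ?a = "apply_bcontfun"
  obtain Q :: "(real \<Rightarrow>\<^sub>C ((real^'n) \<times> (real^'n))) \<Rightarrow> (real \<Rightarrow>\<^sub>C (real^'n)) \<times> (real \<Rightarrow>\<^sub>C (real^'n)) \<times> (real^2)" where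
    Q: "bounded_linear Q" and Qsol: "\<And>h u v \<nu>. Q h = (u, v, \<nu>) \<Longrightarrow>
      (\<forall>t. ?a u t \<in> Xplus S \<and> ?a v t \<in> Xminus S \<and>
        (?a u has_vector_derivative Dx f (xh t) 0 (?a u t) + Pp (Dmu f (xh t) 0 \<nu> + fst (?a h t))) (at t) \<and>
        (?a v has_vector_derivative Dx f (xh t) 0 (?a v t) +
           Pm (DmuDx f (xh t) 0 \<nu> (\<phi>2 t) + Dxx f (xh t) 0 (?a u t) (\<phi>2 t) + snd (?a h t))) (at t)) \<and>
      (\<forall>h1 h2. (\<forall>t. ?a h t = (?a h1 t, ?a h2 t)) \<longrightarrow> \<nu> = 0 \<longrightarrow> l1 h1 = 0 \<and> l2 (h2 + G3 (Kp h1)) = 0)"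
    using pair_operator[OF inv] by blast
  \<comment> \<open>The terms linear in \<open>(u, v, \<nu>)\<close> at \<alpha> = 0 are subtracted
    because they are built into \<open>Q\<close>. What remains at \<alpha> = 0 depends on
    \<open>xh\<close> and \<open>\<phi>2\<close> alone, so the derivative in the directions of the
    unknowns vanishes there, as the fixed point theorem demands.\<close>
  define N :: "(real^'n) \<times> (real^'n) \<times> real \<times> (real^'n) \<times> (real^'n) \<times> (real^2) \<Rightarrow> (real^'n) \<times> (real^'n)" where
    "N = (\<lambda>(x, w, \<alpha>, u, v, \<nu>).
      (L2 (pack x w u v \<nu>, \<alpha>) - L2 (pack x w u v \<nu>, 0) + L2 (pack x w 0 0 0, 0),
       L3 (pack x w u v \<nu>, \<alpha>) - L3 (pack x w u v \<nu>, 0) + L3 (pack x w 0 0 0, 0)))"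
  have CN: "Ck (Suc 0) N"
    unfolding N_def split_beta
    by (intro Ck_Pair Ck_add Ck_diff Ck_compose[OF CL2] Ck_compose[OF CL3] Ck_fst Ck_snd Ck_ident Ck_const)
  define Z0 where "Z0 = Bcontfun (\<lambda>t. (xh t, \<phi>2 t, 0::real, 0 :: real^'n, 0 :: real^'n, 0 :: real^2))"
  obtain Bx where Bx: "\<And>t. norm (xh t) \<le> Bx" using xh_bounded by (auto simp: bounded_iff)
  obtain B where B: "\<And>t. norm (\<phi>2 t) \<le> B" using \<phi>2(2) by (auto simp: bounded_iff)
  have B0: "0 \<le> B" using B[of 0] norm_ge_zero order_trans by blast
  have Z0: "?a Z0 t = (xh t, \<phi>2 t, 0, 0, 0, 0)" for t
  proof -
    have "(\<lambda>t. (xh t, \<phi>2 t, 0::real, 0 :: real^'n, 0 :: real^'n, 0 :: real^2)) \<in> bcontfun"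
    proof (rule bcontfun_normI)
      show "continuous_on UNIV (\<lambda>t. (xh t, \<phi>2 t, 0::real, 0 :: real^'n, 0 :: real^'n, 0 :: real^2))"
        by (intro continuous_intros xh_continuous \<phi>2_continuous)
      show "norm (xh t, \<phi>2 t, 0::real, 0 :: real^'n, 0 :: real^'n, 0 :: real^2) \<le> Bx + B" for t
        using norm_Pair_le[of "xh t" "(\<phi>2 t, 0::real, 0 :: real^'n, 0 :: real^'n, 0 :: real^2)"] Bx[of t] B[of t]
        by (simp add: norm_Pair)
    qed
    then show ?thesis by (simp add: Z0_def Bcontfun_inverse)
  qed
  define L1 :: "real \<Rightarrow>\<^sub>C ((real^'n) \<times> (real^'n) \<times> real \<times> (real^'n) \<times> (real^'n) \<times> (real^2))" where
    "L1 = const_bcontfun (0, 0, 1, 0, 0, 0)"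
  have L1: "?a L1 t = (0, 0, 1, 0, 0, 0)" for t by (simp add: L1_def const_bcontfun.rep_eq)
  have "\<exists>L0 :: (real \<Rightarrow>\<^sub>C (real^'n)) \<times> (real \<Rightarrow>\<^sub>C (real^'n)) \<times> (real^2) \<Rightarrow>
      (real \<Rightarrow>\<^sub>C ((real^'n) \<times> (real^'n) \<times> real \<times> (real^'n) \<times> (real^'n) \<times> (real^2))).
     bounded_linear L0 \<and> (\<forall>y t. ?a (L0 y) t = (0, 0, 0, ?a (fst y) t, ?a (fst (snd y)) t, snd (snd y))) \<and>
     (\<forall>y. norm (L0 y) \<le> 3 * norm y)"
  proof (rule bounded_linear_bcontfunI)
    fix y :: "(real \<Rightarrow>\<^sub>C (real^'n)) \<times> (real \<Rightarrow>\<^sub>C (real^'n)) \<times> (real^2)" and t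
    have "norm (0::real^'n, 0::real^'n, 0::real, ?a (fst y) t, ?a (fst (snd y)) t, snd (snd y)) \<le> norm (?a (fst y) t) + (norm (?a (fst (snd y)) t) + norm (snd (snd y)))"
      using norm_Pair_le[of "?a (fst y) t" "(?a (fst (snd y)) t, snd (snd y))"] norm_Pair_le[of "?a (fst (snd y)) t" "snd (snd y)"]
      by (simp add: norm_Pair)
    also have "\<dots> \<le> norm y + (norm y + norm y)"
      by (intro add_mono order_trans[OF norm_apply_bcontfun] norm_fst_snd_le
          order_trans[OF norm_fst_snd_le(1) norm_fst_snd_le(2)] order_trans[OF norm_fst_snd_le(2) norm_fst_snd_le(2)])
    finally show "norm (0::real^'n, 0::real^'n, 0::real, ?a (fst y) t, ?a (fst (snd y)) t, snd (snd y)) \<le> 3 * norm y" by simp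
  qed (auto intro!: continuous_intros continuous_on_apply_bcontfun simp: plus_bcontfun.rep_eq scaleR_bcontfun.rep_eq)
  then obtain L0 :: "(real \<Rightarrow>\<^sub>C (real^'n)) \<times> (real \<Rightarrow>\<^sub>C (real^'n)) \<times> (real^2) \<Rightarrow>
      (real \<Rightarrow>\<^sub>C ((real^'n) \<times> (real^'n) \<times> real \<times> (real^'n) \<times> (real^'n) \<times> (real^2)))" where
    L0: "bounded_linear L0" "\<And>u v \<nu> t. ?a (L0 (u, v, \<nu>)) t = (0, 0, 0, ?a u t, ?a v t, \<nu>)" by auto
  define y0 where "y0 = Q (nemytskii N Z0)"
  obtain u0 v0 \<nu>0 where y0: "y0 = (u0, v0, \<nu>0)" by (cases y0)
  note NA = nemytskii_apply[OF Ck_continuous[OF CN]]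
  have N0: "N (x, w, 0, u, v, \<nu>) = (L2 (pack x w 0 0 0, 0), L3 (pack x w 0 0 0, 0))" for x w u v \<nu> by (simp add: N_def)
  have ZL: "?a (Z0 + \<alpha> *\<^sub>R L1 + L0 (u, v, \<nu>)) t = (xh t, \<phi>2 t, \<alpha>, ?a u t, ?a v t, \<nu>)" for \<alpha> u v \<nu> t
    by (simp add: plus_bcontfun.rep_eq scaleR_bcontfun.rep_eq Z0 L1 L0)
  have ZL0: "?a (Z0 + L0 (u, v, \<nu>)) t = (xh t, \<phi>2 t, 0, ?a u t, ?a v t, \<nu>)" for u v \<nu> t
    by (simp add: plus_bcontfun.rep_eq Z0 L0)
  have base: "y0 = Q (nemytskii N (Z0 + L0 y0))"
  proof -
    have "nemytskii N (Z0 + L0 y0) = nemytskii N Z0"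
      by (rule bcontfun_eqI) (simp only: NA y0 ZL0 Z0 N0)
    then show ?thesis by (simp add: y0_def)
  qed
  have zero: "frechet_derivative N (at (?a (Z0 + L0 y0) t)) (?a (L0 y) t) = 0" for y t
  proof -
    obtain u v \<nu> where y: "y = (u, v, \<nu>)" by (cases y)
    have "dirder (?a (L0 y) t) N (?a (Z0 + L0 y0) t) = 0"
    proof (rule dirder_eqI[OF CN])
      have "N (?a (Z0 + L0 y0) t + s *\<^sub>R ?a (L0 y) t) = (L2 (pack (xh t) (\<phi>2 t) 0 0 0, 0), L3 (pack (xh t) (\<phi>2 t) 0 0 0, 0))" for s
        unfolding y y0 ZL0 L0 by (simp add: N0)
      then show "((\<lambda>s. N (?a (Z0 + L0 y0) t + s *\<^sub>R ?a (L0 y) t)) has_vector_derivative 0) (at 0)" by simp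
    qed
    then show ?thesis by (simp add: dirder_def)
  qed
  obtain \<epsilon> C Y where \<epsilon>: "\<epsilon> > 0" and C: "C \<ge> 0" and Y: "\<And>\<alpha>. \<bar>\<alpha>\<bar> < \<epsilon> \<Longrightarrow> Y \<alpha> = Q (nemytskii N (Z0 + \<alpha> *\<^sub>R L1 + L0 (Y \<alpha>)))"
    "\<And>\<alpha>. \<bar>\<alpha>\<bar> < \<epsilon> \<Longrightarrow> norm (Y \<alpha> - y0) \<le> C * \<bar>\<alpha>\<bar>"
    "\<And>\<alpha>. \<bar>\<alpha>\<bar> < \<epsilon> \<Longrightarrow> \<exists>d. (Y has_vector_derivative d) (at \<alpha>) \<and> norm d \<le> C"
    using nemytskii_fixed_point[OF CN L0(1) Q base zero, of L1] by blast
  define u where "u \<alpha> = fst (Y \<alpha>)" for \<alpha>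
  define v where "v \<alpha> = fst (snd (Y \<alpha>))" for \<alpha>
  define \<nu> where "\<nu> \<alpha> = snd (snd (Y \<alpha>))" for \<alpha>
  have Yuv: "Y \<alpha> = (u \<alpha>, v \<alpha>, \<nu> \<alpha>)" for \<alpha> by (simp add: u_def v_def \<nu>_def)
  \<comment> \<open>At \<alpha> = 0 the forcing consists of the Taylor coefficients
    \<open>H1\<close> and \<open>H2\<close>; a zero parameter would make it solvable by itself,
    which \<open>nz\<close> excludes.\<close>
  have "\<nu>0 \<noteq> 0"
  proof
    assume z: "\<nu>0 = 0"
    have "?a (nemytskii N Z0) t = (?a H1 t, ?a H2 t)" for t
      by (simp only: NA Z0 N0 H1 H2 L2_0 L3_0 derivatives_zero add_0_right)
    moreover have "Q (nemytskii N Z0) = (u0, v0, \<nu>0)" using y0 by (simp add: y0_def)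
    ultimately show False using Qsol[of "nemytskii N Z0" u0 v0 \<nu>0] nz z by blast
  qed
  define M where "M = norm y0 + C"
  have M0: "M \<ge> 0" using C by (simp add: M_def)
  have YM: "norm (Y \<alpha>) \<le> M" if "\<bar>\<alpha>\<bar> < \<epsilon>" "\<bar>\<alpha>\<bar> \<le> 1" for \<alpha>
  proof -
    have "norm (Y \<alpha>) \<le> norm y0 + norm (Y \<alpha> - y0)" by (metis add_diff_cancel_left' diff_add_cancel norm_triangle_ineq)
    also have "norm (Y \<alpha> - y0) \<le> C * 1" using Y(2)[OF that(1)] mult_left_mono[OF that(2) C] by linarith
    finally show ?thesis by (simp add: M_def)
  qed
  obtain \<eta> where \<eta>: "\<eta> > 0" "\<And>\<mu> x. norm \<mu> < \<eta> \<Longrightarrow> (\<And>t. (x has_vector_derivative f (x t) \<mu>) (at t)) \<Longrightarrow>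
     (\<And>t. norm (x t - xh t) < \<eta>) \<Longrightarrow> homoclinic f \<mu> x" using near_loop_homoclinic by blast
  obtain t0 where t0: "\<phi>2 t0 \<noteq> 0" using \<phi>2(3) by blast
  \<comment> \<open>The third entry keeps both orbits and the parameter within the radius \<eta>;
    the fourth makes the cubic odd term too small to cancel \<open>\<alpha> \<phi>2\<close> at
    \<open>t0\<close>, so that the orbit differs from its reflection.\<close>
  define \<epsilon>' where "\<epsilon>' = Min {\<epsilon>, 1, \<eta> / (B + 2 * M + 1), norm (\<phi>2 t0) / (M + 1)}"
  have BM: "B + 2 * M + 1 > 0" "M + 1 > 0" using B0 M0 by auto
  have \<epsilon>': "\<epsilon>' > 0" "\<epsilon>' \<le> \<epsilon>" "\<epsilon>' \<le> 1" "\<epsilon>' \<le> \<eta> / (B + 2 * M + 1)" "\<epsilon>' \<le> norm (\<phi>2 t0) / (M + 1)"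
    using \<epsilon> \<eta>(1) t0 BM by (auto simp: \<epsilon>'_def)
  have branch: "\<exists>x. homoclinic f (\<alpha>\<^sup>2 *\<^sub>R \<nu> \<alpha>) x \<and> homoclinic f (\<alpha>\<^sup>2 *\<^sub>R \<nu> \<alpha>) (\<lambda>t. S *v x t) \<and>
       (\<exists>t. S *v x t \<noteq> x t) \<and> (\<forall>t. norm (x t - (xh t + \<alpha> *\<^sub>R \<phi>2 t)) \<le> (C + 2 * M) * \<alpha>\<^sup>2) \<and>
       (\<forall>t. norm (S *v x t - (xh t - \<alpha> *\<^sub>R \<phi>2 t)) \<le> (C + 2 * M) * \<alpha>\<^sup>2)" if \<alpha>: "0 < \<alpha>" "\<alpha> < \<epsilon>'" for \<alpha>
  proof -
    have ab: "\<bar>\<alpha>\<bar> < \<epsilon>" "\<bar>\<alpha>\<bar> \<le> 1" using \<alpha> \<epsilon>' by auto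
    let ?u = "?a (u \<alpha>)" and ?v = "?a (v \<alpha>)" and ?\<nu> = "\<nu> \<alpha>"
    let ?h = "nemytskii N (Z0 + \<alpha> *\<^sub>R L1 + L0 (Y \<alpha>))"
    have "Q ?h = (u \<alpha>, v \<alpha>, ?\<nu>)" using Y(1)[OF ab(1)] Yuv[of \<alpha>] by argo
    note sol = Qsol[OF this, THEN conjunct1, rule_format]
    have ht: "?a ?h t = N (xh t, \<phi>2 t, \<alpha>, ?u t, ?v t, ?\<nu>)" for t unfolding NA Yuv ZL ..
    have up: "?u t \<in> Xplus S" and vm: "?v t \<in> Xminus S" for t using sol by blast+
    interpret P: bounded_linear Pp by (rule bounded_linear_Pp)
    interpret Pm: bounded_linear Pm by (rule bounded_linear_Pm)
    let ?L2 = "\<lambda>t. L2 (pack (xh t) (\<phi>2 t) (?u t) (?v t) ?\<nu>, \<alpha>)" and ?L3 = "\<lambda>t. L3 (pack (xh t) (\<phi>2 t) (?u t) (?v t) ?\<nu>, \<alpha>)"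
    have fst_h: "fst (?a ?h t) = ?L2 t - (Dx f (xh t) 0 (?u t) + Dmu f (xh t) 0 ?\<nu>)" for t
      unfolding ht by (simp add: N_def L2_0 derivatives_zero)
    have snd_h: "snd (?a ?h t) = ?L3 t - (Dxx f (xh t) 0 (?u t) (\<phi>2 t) + DmuDx f (xh t) 0 ?\<nu> (\<phi>2 t) + Dx f (xh t) 0 (?v t))" for t
      unfolding ht by (simp add: N_def L3_0 derivatives_zero)
    have u': "(?u has_vector_derivative Pp (?L2 t)) (at t)" for t
    proof -
      have "(?u has_vector_derivative Dx f (xh t) 0 (?u t) + Pp (Dmu f (xh t) 0 ?\<nu> + fst (?a ?h t))) (at t)" using sol by blast
      also have "Dx f (xh t) 0 (?u t) + Pp (Dmu f (xh t) 0 ?\<nu> + fst (?a ?h t)) = Pp (?L2 t)"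
        unfolding fst_h by (simp add: P.add P.diff Pp_Dx[OF xh_plus] Pp_on_plus[OF up])
      finally show ?thesis .
    qed
    have v': "(?v has_vector_derivative Pm (?L3 t)) (at t)" for t
    proof -
      have "(?v has_vector_derivative Dx f (xh t) 0 (?v t) +
           Pm (DmuDx f (xh t) 0 ?\<nu> (\<phi>2 t) + Dxx f (xh t) 0 (?u t) (\<phi>2 t) + snd (?a ?h t))) (at t)" using sol by blast
      also have "Dx f (xh t) 0 (?v t) + Pm (DmuDx f (xh t) 0 ?\<nu> (\<phi>2 t) + Dxx f (xh t) 0 (?u t) (\<phi>2 t) + snd (?a ?h t)) = Pm (?L3 t)"
        unfolding snd_h by (simp add: Pm.add Pm.diff Pm_Dx[OF xh_plus] Pm_on_minus[OF vm])
      finally show ?thesis .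
    qed
    define x where "x t = xh t + \<alpha> *\<^sub>R \<phi>2 t + \<alpha>\<^sup>2 *\<^sub>R ?u t + \<alpha> ^ 3 *\<^sub>R ?v t" for t
    have Sx: "S *v x t = xh t - \<alpha> *\<^sub>R \<phi>2 t + \<alpha>\<^sup>2 *\<^sub>R ?u t - \<alpha> ^ 3 *\<^sub>R ?v t" for t
      using xh_plus[of t] \<phi>2_minus[of t] up[of t] vm[of t]
      by (simp add: x_def Xplus_def Xminus_def matrix_vector_right_distrib matrix_vector_mult_scaleR)
    have x': "(x has_vector_derivative f (x t) (\<alpha>\<^sup>2 *\<^sub>R ?\<nu>)) (at t)" for t
    proof -
      have "(x has_vector_derivative f (xh t) 0 + \<alpha> *\<^sub>R Dx f (xh t) 0 (\<phi>2 t) + \<alpha>\<^sup>2 *\<^sub>R Pp (?L2 t) + \<alpha> ^ 3 *\<^sub>R Pm (?L3 t)) (at t)"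
        unfolding x_def[abs_def]
        by (intro has_vector_derivative_add xh_derivative bounded_linear.has_vector_derivative[OF bounded_linear_scaleR_right]
            \<phi>2_derivative u' v')
      then show ?thesis unfolding x_def even_odd_expansion[OF xh_plus \<phi>2_minus up vm] .
    qed
    have nu: "norm (?u t) \<le> M" and nv: "norm (?v t) \<le> M" and n\<nu>: "norm ?\<nu> \<le> M" for t
      using YM[OF ab] norm_apply_bcontfun[of "u \<alpha>" t] norm_apply_bcontfun[of "v \<alpha>" t]
        norm_fst_snd_le[of "Y \<alpha>"] norm_fst_snd_le[of "snd (Y \<alpha>)"]
      unfolding u_def v_def \<nu>_def by linarith+
    have a2: "\<alpha>\<^sup>2 \<le> \<alpha>" "\<alpha> ^ 3 \<le> \<alpha>\<^sup>2" "\<alpha> ^ 3 \<le> \<alpha>" "0 \<le> \<alpha>\<^sup>2" "0 \<le> \<alpha> ^ 3"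
      using \<alpha>(1) ab(2) power_decreasing[of 1 2 \<alpha>] power_decreasing[of 2 3 \<alpha>] power_decreasing[of 1 3 \<alpha>] by auto
    have n2: "norm (\<alpha>\<^sup>2 *\<^sub>R ?u t) \<le> \<alpha>\<^sup>2 * M" and n3: "norm (\<alpha> ^ 3 *\<^sub>R ?v t) \<le> \<alpha>\<^sup>2 * M" for t
    proof -
      show "norm (\<alpha>\<^sup>2 *\<^sub>R ?u t) \<le> \<alpha>\<^sup>2 * M" using nu[of t] by (simp add: mult_left_mono)
      have "norm (\<alpha> ^ 3 *\<^sub>R ?v t) = \<alpha> ^ 3 * norm (?v t)" using a2(5) by simp
      also have "\<dots> \<le> \<alpha>\<^sup>2 * M" using nv[of t] a2 by (intro mult_mono) auto
      finally show "norm (\<alpha> ^ 3 *\<^sub>R ?v t) \<le> \<alpha>\<^sup>2 * M" .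
    qed
    have lr: "\<alpha>\<^sup>2 * M + \<alpha>\<^sup>2 * M \<le> (C + 2 * M) * \<alpha>\<^sup>2" using C a2(4) mult_nonneg_nonneg[of C "\<alpha>\<^sup>2"] by (simp add: algebra_simps)
    have near1: "norm (x t - (xh t + \<alpha> *\<^sub>R \<phi>2 t)) \<le> (C + 2 * M) * \<alpha>\<^sup>2" for t
    proof -
      have "x t - (xh t + \<alpha> *\<^sub>R \<phi>2 t) = \<alpha>\<^sup>2 *\<^sub>R ?u t + \<alpha> ^ 3 *\<^sub>R ?v t" by (simp add: x_def)
      then show ?thesis by (simp only: order_trans[OF norm_triangle_le[OF add_mono[OF n2 n3]] lr])
    qed
    have near2: "norm (S *v x t - (xh t - \<alpha> *\<^sub>R \<phi>2 t)) \<le> (C + 2 * M) * \<alpha>\<^sup>2" for t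
    proof -
      have "S *v x t - (xh t - \<alpha> *\<^sub>R \<phi>2 t) = \<alpha>\<^sup>2 *\<^sub>R ?u t - \<alpha> ^ 3 *\<^sub>R ?v t" by (simp add: Sx)
      then show ?thesis by (simp only: order_trans[OF norm_triangle_le_diff[OF add_mono[OF n2 n3]] lr])
    qed
    have small: "\<alpha> * (B + 2 * M) < \<eta>"
    proof -
      have "\<alpha> * (B + 2 * M + 1) < \<eta>" using less_le_trans[OF \<alpha>(2) \<epsilon>'(4)] BM(1) by (simp add: pos_less_divide_eq)
      then show ?thesis using \<alpha>(1) by (simp add: algebra_simps)
    qed
    have nB: "norm (\<alpha> *\<^sub>R \<phi>2 t) \<le> \<alpha> * B" for t using B[of t] \<alpha>(1) by simp
    have aM: "\<alpha>\<^sup>2 * M \<le> \<alpha> * M" using a2(1) M0 by (rule mult_right_mono)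
    have d1: "norm (x t - xh t) < \<eta>" and d2: "norm (S *v x t - xh t) < \<eta>" for t
    proof -
      have "x t - xh t = \<alpha> *\<^sub>R \<phi>2 t + (\<alpha>\<^sup>2 *\<^sub>R ?u t + \<alpha> ^ 3 *\<^sub>R ?v t)" by (simp add: x_def)
      then have "norm (x t - xh t) \<le> \<alpha> * B + (\<alpha>\<^sup>2 * M + \<alpha>\<^sup>2 * M)"
        using norm_triangle_le[OF add_mono[OF nB[of t] norm_triangle_le[OF add_mono[OF n2[of t] n3[of t]]]]] by simp
      then show "norm (x t - xh t) < \<eta>" using small aM by (simp add: algebra_simps)
      have "S *v x t - xh t = (\<alpha>\<^sup>2 *\<^sub>R ?u t - \<alpha> ^ 3 *\<^sub>R ?v t) - \<alpha> *\<^sub>R \<phi>2 t" by (simp add: Sx)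
      then have "norm (S *v x t - xh t) \<le> (\<alpha>\<^sup>2 * M + \<alpha>\<^sup>2 * M) + \<alpha> * B"
        using norm_triangle_le_diff[OF add_mono[OF norm_triangle_le_diff[OF add_mono[OF n2[of t] n3[of t]]] nB[of t]]] by simp
      then show "norm (S *v x t - xh t) < \<eta>" using small aM by (simp add: algebra_simps)
    qed
    have "norm (\<alpha>\<^sup>2 *\<^sub>R ?\<nu>) \<le> \<alpha>\<^sup>2 * M" using n\<nu> by (simp add: mult_left_mono)
    also have "\<dots> \<le> \<alpha> * M" by (rule aM)
    also have "\<dots> \<le> \<alpha> * (B + 2 * M)" using \<alpha>(1) B0 M0 by (intro mult_left_mono) auto
    finally have n\<mu>: "norm (\<alpha>\<^sup>2 *\<^sub>R ?\<nu>) < \<eta>" using small by simp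
    have "S *v x t0 \<noteq> x t0"
    proof
      assume "S *v x t0 = x t0"
      then have "2 *\<^sub>R (\<alpha> *\<^sub>R \<phi>2 t0 + \<alpha> ^ 3 *\<^sub>R ?v t0) = 0"
        unfolding Sx unfolding x_def scaleR_2 by (simp add: algebra_simps)
      then have "\<alpha> *\<^sub>R \<phi>2 t0 + \<alpha> ^ 3 *\<^sub>R ?v t0 = 0"
        unfolding scaleR_eq_0_iff by simp
      then have "\<alpha> *\<^sub>R (\<phi>2 t0 + \<alpha>\<^sup>2 *\<^sub>R ?v t0) = 0"
        by (simp add: scaleR_add_right power3_eq_cube power2_eq_square mult.assoc)
      then have "\<phi>2 t0 = - (\<alpha>\<^sup>2 *\<^sub>R ?v t0)" using \<alpha>(1) by (simp add: eq_neg_iff_add_eq_0)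
      then have "norm (\<phi>2 t0) = \<alpha>\<^sup>2 * norm (?v t0)" by simp
      also have "\<dots> \<le> \<alpha> * M" using a2(1) nv[of t0] \<alpha>(1) by (intro mult_mono) auto
      also have "\<dots> < norm (\<phi>2 t0)"
      proof -
        have "\<alpha> * (M + 1) < norm (\<phi>2 t0)" using less_le_trans[OF \<alpha>(2) \<epsilon>'(5)] BM(2) by (simp add: pos_less_divide_eq)
        then show ?thesis using \<alpha>(1) by (simp add: algebra_simps)
      qed
      finally show False by simp
    qed
    then show ?thesis
      using \<eta>(2)[OF n\<mu> x' d1] \<eta>(2)[OF n\<mu> reflected_solution[OF x'] d2] near1 near2 by blast
  qed
  have \<nu>: "norm (\<nu> \<alpha> - \<nu>0) \<le> (C + 2 * M) * \<bar>\<alpha>\<bar> \<and> (\<exists>d. (\<nu> has_vector_derivative d) (at \<alpha>) \<and> norm d \<le> C + 2 * M)"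
    if "\<bar>\<alpha>\<bar> < \<epsilon>'" for \<alpha>
  proof
    have ab: "\<bar>\<alpha>\<bar> < \<epsilon>" using that \<epsilon>' by auto
    have "\<nu> \<alpha> - \<nu>0 = snd (snd (Y \<alpha> - y0))" by (simp add: \<nu>_def y0)
    then have "norm (\<nu> \<alpha> - \<nu>0) \<le> norm (Y \<alpha> - y0)" using order_trans[OF norm_fst_snd_le(2) norm_fst_snd_le(2)] by metis
    also have "\<dots> \<le> C * \<bar>\<alpha>\<bar>" by (rule Y(2)[OF ab])
    also have "\<dots> \<le> (C + 2 * M) * \<bar>\<alpha>\<bar>" using M0 by (intro mult_right_mono) auto
    finally show "norm (\<nu> \<alpha> - \<nu>0) \<le> (C + 2 * M) * \<bar>\<alpha>\<bar>" .
    obtain d where d: "(Y has_vector_derivative d) (at \<alpha>)" "norm d \<le> C" using Y(3)[OF ab] by blast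
    have "(\<nu> has_vector_derivative snd (snd d)) (at \<alpha>)"
      unfolding \<nu>_def[abs_def]
      by (intro bounded_linear.has_vector_derivative[OF bounded_linear_snd] d)
    moreover have "norm (snd (snd d)) \<le> C + 2 * M"
      using d(2) M0 norm_fst_snd_le(2)[of d] norm_fst_snd_le(2)[of "snd d"] by linarith
    ultimately show "\<exists>d. (\<nu> has_vector_derivative d) (at \<alpha>) \<and> norm d \<le> C + 2 * M" by blast
  qed
  show ?thesis
    by (rule exI[of _ \<epsilon>'], rule conjI[OF \<epsilon>'(1)], rule exI[of _ "C + 2 * M"], rule conjI, use C M0 in simp,
        rule exI[of _ \<nu>0], rule exI[of _ \<nu>]) (use \<open>\<nu>0 \<noteq> 0\<close> \<nu> branch in blast)
qed

text \<open>Inside \<open>Xplus\<close> only the obstruction \<open>l1\<close> is left, and moving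
  the parameter along \<open>e\<close> removes it. The unknowns are the even correction
  \<open>u\<close> and the amount \<open>m\<close> along \<open>e\<close>, while \<open>s\<close> is
  prescribed along \<open>e'\<close>.\<close>

theorem symmetric_branch:
  assumes e: "l1 (G1 e) \<noteq> 0"
  shows "\<exists>\<epsilon>>0. \<exists>C\<ge>0. \<exists>m :: real \<Rightarrow> real. m 0 = 0 \<and> (\<forall>s. \<bar>s\<bar> < \<epsilon> \<longrightarrow>
    (\<exists>d. (m has_vector_derivative d) (at s)) \<and>
    (\<exists>x. homoclinic f (m s *\<^sub>R e + s *\<^sub>R e') x \<and> (\<forall>t. x t \<in> Xplus S) \<and> (\<forall>t. norm (x t - xh t) \<le> C * \<bar>s\<bar>)))"
proof -
  let ?a = "apply_bcontfun"
  interpret l1: bounded_linear l1 by (rule bounded_linear_l1)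
  interpret G1: bounded_linear G1 by (rule G1)
  \<comment> \<open>The multiple of \<open>G1 e\<close> that cancels the obstruction of
    \<open>h\<close>.\<close>
  define Qm where "Qm h = - l1 h / l1 (G1 e)" for h
  define Q where "Q h = (Kp (h + Qm h *\<^sub>R G1 e), Qm h)" for h
  have bQm: "bounded_linear Qm"
    unfolding Qm_def[abs_def] divide_inverse by (intro bounded_linear_mult_const bounded_linear_minus bounded_linear_l1)
  have Q: "bounded_linear Q"
    unfolding Q_def[abs_def]
    by (intro bounded_linear_Pair bounded_linear_compose[OF Kp(1)] bounded_linear_add bounded_linear_ident
        bounded_linear_compose[OF bounded_linear_scaleR_left bQm] bQm)
  interpret Q: bounded_linear Q by (rule Q)
  \<comment> \<open>The increment of the vector field minus its part linear in
    \<open>(u, m)\<close>. That part is written as a value of \<open>L2\<close> with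
    \<open>w = 0\<close>, where the quadratic term disappears, so that its smoothness comes for
    free.\<close>
  define N :: "(real^'n) \<times> (real^'n) \<times> real \<times> real \<Rightarrow> real^'n" where
    "N = (\<lambda>(x, u, m, s). F (x + u, m *\<^sub>R e + s *\<^sub>R e') - F (x, 0) - L2 (pack x 0 u 0 (m *\<^sub>R e), 0))"
  have CN: "Ck (Suc 0) N"
    unfolding N_def split_beta
    by (intro Ck_Pair Ck_add Ck_diff Ck_compose[OF CL2] Ck_compose[OF CF] Ck_scaleR Ck_fst Ck_snd Ck_ident Ck_const)
  have N: "N (x, u, m, s) = f (x + u) (m *\<^sub>R e + s *\<^sub>R e') - f x 0 - (Dx f x 0 u + m *\<^sub>R Dmu f x 0 e)" for x u m s
  proof -
    have "Dmu f x 0 (m *\<^sub>R e) = m *\<^sub>R Dmu f x 0 e"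
      using dirder_scaleR[OF CF, of m "(0, e)" "(x, 0)"] by (simp add: Dmu_F)
    then show ?thesis unfolding N_def by (simp add: L2_0 derivatives_zero)
  qed
  obtain Bx where Bx: "\<And>t. norm (xh t) \<le> Bx" using xh_bounded by (auto simp: bounded_iff)
  define Z0 where "Z0 = Bcontfun (\<lambda>t. (xh t, 0 :: real^'n, 0::real, 0::real))"
  have Z0: "?a Z0 t = (xh t, 0, 0, 0)" for t
  proof -
    have "(\<lambda>t. (xh t, 0 :: real^'n, 0::real, 0::real)) \<in> bcontfun"
      by (rule bcontfun_normI[of _ Bx]) (auto intro!: continuous_intros xh_continuous Bx simp: norm_Pair)
    then show ?thesis by (simp add: Z0_def Bcontfun_inverse)
  qed
  define L1 :: "real \<Rightarrow>\<^sub>C ((real^'n) \<times> (real^'n) \<times> real \<times> real)" where "L1 = const_bcontfun (0, 0, 0, 1)"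
  have L1: "?a L1 t = (0, 0, 0, 1)" for t by (simp add: L1_def const_bcontfun.rep_eq)
  have "\<exists>L0 :: (real \<Rightarrow>\<^sub>C (real^'n)) \<times> real \<Rightarrow> (real \<Rightarrow>\<^sub>C ((real^'n) \<times> (real^'n) \<times> real \<times> real)).
     bounded_linear L0 \<and> (\<forall>y t. ?a (L0 y) t = (0, ?a (fst y) t, snd y, 0)) \<and> (\<forall>y. norm (L0 y) \<le> 2 * norm y)"
  proof (rule bounded_linear_bcontfunI)
    fix y :: "(real \<Rightarrow>\<^sub>C (real^'n)) \<times> real" and t
    have "norm (0::real^'n, ?a (fst y) t, snd y, 0::real) \<le> norm (?a (fst y) t) + norm (snd y)"
      using norm_Pair_le[of "?a (fst y) t" "snd y"] by (simp add: norm_Pair)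
    also have "\<dots> \<le> norm y + norm y"
      by (intro add_mono order_trans[OF norm_apply_bcontfun] norm_fst_snd_le)
    finally show "norm (0::real^'n, ?a (fst y) t, snd y, 0::real) \<le> 2 * norm y" by simp
  qed (auto intro!: continuous_intros continuous_on_apply_bcontfun simp: plus_bcontfun.rep_eq scaleR_bcontfun.rep_eq)
  then obtain L0 :: "(real \<Rightarrow>\<^sub>C (real^'n)) \<times> real \<Rightarrow> (real \<Rightarrow>\<^sub>C ((real^'n) \<times> (real^'n) \<times> real \<times> real))" where
    L0: "bounded_linear L0" "\<And>u m t. ?a (L0 (u, m)) t = (0, ?a u t, m, 0)" by auto
  note NA = nemytskii_apply[OF Ck_continuous[OF CN]]
  have ZL: "?a (Z0 + s *\<^sub>R L1 + L0 (u, m)) t = (xh t, ?a u t, m, s)" for s u m t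
    by (simp add: plus_bcontfun.rep_eq scaleR_bcontfun.rep_eq Z0 L1 L0)
  have ZL0: "?a (Z0 + L0 0) t = (xh t, 0, 0, 0)" for t
    using bounded_linear.linear[OF L0(1), THEN linear_0] by (simp add: Z0)
  have base: "0 = Q (nemytskii N (Z0 + L0 0))"
  proof -
    have "nemytskii N (Z0 + L0 0) = 0"
      by (rule bcontfun_eqI, unfold NA ZL0 N) (simp add: derivatives_zero zero_bcontfun.rep_eq)
    then show ?thesis by (simp add: Q.zero)
  qed
  have zero: "frechet_derivative N (at (?a (Z0 + L0 0) t)) (?a (L0 y) t) = 0" for y t
  proof -
    obtain u m where y: "y = (u, m)" by (cases y)
    let ?w = "(?a u t, m *\<^sub>R e)"
    have w: "dirder ?w F (xh t, 0) = Dx f (xh t) 0 (?a u t) + m *\<^sub>R Dmu f (xh t) 0 e"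
      using dirder_add[OF CF, of "(?a u t, 0)" "(0, m *\<^sub>R e)" "(xh t, 0)"] dirder_scaleR[OF CF, of m "(0, e)" "(xh t, 0)"]
      by (simp add: Dx_F Dmu_F)
    have "dirder (?a (L0 y) t) N (?a (Z0 + L0 0) t) = 0"
    proof (rule dirder_eqI[OF CN])
      have "((\<lambda>s. F ((xh t, 0) + s *\<^sub>R ?w) - F (xh t, 0) - s *\<^sub>R dirder ?w F (xh t, 0)) has_vector_derivative
          dirder ?w F ((xh t, 0) + 0 *\<^sub>R ?w) - 0 - 1 *\<^sub>R dirder ?w F (xh t, 0)) (at 0)"
        by (intro has_vector_derivative_diff dirder_along[OF CF] has_vector_derivative_const)
          (auto intro!: derivative_eq_intros)
      moreover have "N (?a (Z0 + L0 0) t + s *\<^sub>R ?a (L0 y) t) = F ((xh t, 0) + s *\<^sub>R ?w) - F (xh t, 0) - s *\<^sub>R dirder ?w F (xh t, 0)" for s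
        unfolding y ZL0 L0 w by (simp add: N Dx_linear scaleR_add_right)
      ultimately show "((\<lambda>s. N (?a (Z0 + L0 0) t + s *\<^sub>R ?a (L0 y) t)) has_vector_derivative 0) (at 0)" by simp
    qed
    then show ?thesis by (simp add: dirder_def)
  qed
  obtain \<epsilon> C Y where \<epsilon>: "\<epsilon> > 0" and C: "C \<ge> 0" and Y0: "Y 0 = 0" and Y: "\<And>s. \<bar>s\<bar> < \<epsilon> \<Longrightarrow> Y s = Q (nemytskii N (Z0 + s *\<^sub>R L1 + L0 (Y s)))"
    "\<And>s. \<bar>s\<bar> < \<epsilon> \<Longrightarrow> norm (Y s - 0) \<le> C * \<bar>s\<bar>"
    "\<And>s. \<bar>s\<bar> < \<epsilon> \<Longrightarrow> \<exists>d. (Y has_vector_derivative d) (at s) \<and> norm d \<le> C"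
    using nemytskii_fixed_point[OF CN L0(1) Q base zero, of L1] by blast
  obtain \<eta> where \<eta>: "\<eta> > 0" "\<And>\<mu> x. norm \<mu> < \<eta> \<Longrightarrow> (\<And>t. (x has_vector_derivative f (x t) \<mu>) (at t)) \<Longrightarrow>
     (\<And>t. norm (x t - xh t) < \<eta>) \<Longrightarrow> homoclinic f \<mu> x" using near_loop_homoclinic by blast
  define K where "K = C * norm e + norm e' + C + 1"
  have K: "K > 0" using C by (simp add: K_def add_nonneg_pos)
  define \<epsilon>' where "\<epsilon>' = min \<epsilon> (\<eta> / K)"
  have \<epsilon>': "\<epsilon>' > 0" "\<epsilon>' \<le> \<epsilon>" "\<epsilon>' \<le> \<eta> / K" using \<epsilon> \<eta>(1) K by (auto simp: \<epsilon>'_def)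
  have branch: "(\<exists>d. ((\<lambda>s. snd (Y s)) has_vector_derivative d) (at s)) \<and>
    (\<exists>x. homoclinic f (snd (Y s) *\<^sub>R e + s *\<^sub>R e') x \<and> (\<forall>t. x t \<in> Xplus S) \<and> (\<forall>t. norm (x t - xh t) \<le> C * \<bar>s\<bar>))"
    if s: "\<bar>s\<bar> < \<epsilon>'" for s
  proof
    have s\<epsilon>: "\<bar>s\<bar> < \<epsilon>" using s \<epsilon>' by simp
    show "\<exists>d. ((\<lambda>s. snd (Y s)) has_vector_derivative d) (at s)"
      using Y(3)[OF s\<epsilon>] bounded_linear.has_vector_derivative[OF bounded_linear_snd] by blast
    obtain u m where um: "Y s = (u, m)" by (cases "Y s")
    let ?h = "nemytskii N (Z0 + s *\<^sub>R L1 + L0 (Y s))" and ?\<mu> = "m *\<^sub>R e + s *\<^sub>R e'"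
    have "(Kp (?h + Qm ?h *\<^sub>R G1 e), Qm ?h) = (u, m)" using Y(1)[OF s\<epsilon>] um unfolding Q_def by argo
    then have eq: "u = Kp (?h + m *\<^sub>R G1 e)" "m = - l1 ?h / l1 (G1 e)"
      unfolding prod.inject Qm_def by blast+
    have l: "l1 (?h + m *\<^sub>R G1 e) = 0"
      unfolding l1.add l1.scaleR eq(2) using e by simp
    have up: "?a u t \<in> Xplus S" for t using Kp(2)[of "?h + m *\<^sub>R G1 e" t] eq(1) by simp
    have xup: "xh t + ?a u t \<in> Xplus S" for t
      using up[of t] xh_plus[of t] by (simp add: Xplus_def matrix_vector_right_distrib)
    have ht: "?a (?h + m *\<^sub>R G1 e) t = f (xh t + ?a u t) ?\<mu> - f (xh t) 0 - Dx f (xh t) 0 (?a u t)" for t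
    proof -
      have "?a ?h t = N (xh t, ?a u t, m, s)" unfolding NA um ZL ..
      then show ?thesis by (simp add: plus_bcontfun.rep_eq[of ?h] scaleR_bcontfun.rep_eq[of m] G1(2) N del: plus_bcontfun.rep_eq)
    qed
    interpret P: bounded_linear Pp by (rule bounded_linear_Pp)
    have "(?a u has_vector_derivative f (xh t + ?a u t) ?\<mu> - f (xh t) 0) (at t)" for t
    proof -
      have "(?a u has_vector_derivative Dx f (xh t) 0 (?a u t) + Pp (?a (?h + m *\<^sub>R G1 e) t)) (at t)"
        using Kp(3)[OF l] eq(1) by metis
      also have "Dx f (xh t) 0 (?a u t) + Pp (?a (?h + m *\<^sub>R G1 e) t) = f (xh t + ?a u t) ?\<mu> - f (xh t) 0"
        unfolding ht by (simp only: P.diff Pp_on_plus f_plus xup xh_plus Pp_Dx up) simp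
      finally show ?thesis .
    qed
    from has_vector_derivative_add[OF xh_derivative this]
    have x': "((\<lambda>t. xh t + ?a u t) has_vector_derivative f (xh t + ?a u t) ?\<mu>) (at t)" for t by simp
    have um_le: "norm u \<le> C * \<bar>s\<bar>" "\<bar>m\<bar> \<le> C * \<bar>s\<bar>"
      using Y(2)[OF s\<epsilon>] norm_fst_snd_le[of "Y s"] by (auto simp: um)
    have near: "norm (xh t + ?a u t - xh t) \<le> C * \<bar>s\<bar>" for t
      using order_trans[OF norm_apply_bcontfun um_le(1)] by simp
    have sK: "\<bar>s\<bar> * K < \<eta>" using less_le_trans[OF s \<epsilon>'(3)] K by (simp add: pos_less_divide_eq)
    then have sK': "C * \<bar>s\<bar> * norm e + \<bar>s\<bar> * norm e' + C * \<bar>s\<bar> + \<bar>s\<bar> < \<eta>" by (simp add: K_def algebra_simps)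
    have pos: "0 \<le> C * \<bar>s\<bar> * norm e" "0 \<le> \<bar>s\<bar> * norm e'" "0 \<le> C * \<bar>s\<bar>" using C by auto
    have "norm ?\<mu> \<le> \<bar>m\<bar> * norm e + \<bar>s\<bar> * norm e'" by (metis norm_scaleR norm_triangle_ineq)
    also have "\<dots> \<le> C * \<bar>s\<bar> * norm e + \<bar>s\<bar> * norm e'" by (intro add_right_mono mult_right_mono um_le) simp
    finally have n\<mu>: "norm ?\<mu> < \<eta>" using sK' pos by linarith
    have d: "norm (xh t + ?a u t - xh t) < \<eta>" for t using near[of t] sK' pos by linarith
    show "\<exists>x. homoclinic f (snd (Y s) *\<^sub>R e + s *\<^sub>R e') x \<and> (\<forall>t. x t \<in> Xplus S) \<and> (\<forall>t. norm (x t - xh t) \<le> C * \<bar>s\<bar>)"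
      unfolding um snd_conv using \<eta>(2)[OF n\<mu> x' d] xup near by blast
  qed
  show ?thesis
    by (rule exI[of _ \<epsilon>'], rule conjI[OF \<epsilon>'(1)], rule exI[of _ C], rule conjI[OF C], rule exI[of _ "\<lambda>s. snd (Y s)"])
      (use Y0 branch in auto)
qed

end

subsection \<open>The dual system of the saddle\<close>

text \<open>The polynomial factor is absorbed into an exponential of arbitrarily small rate.\<close>

lemma power_exp_growth:
  fixes x :: "real \<Rightarrow> 'a::real_normed_vector"
  assumes O: "(\<lambda>t. norm ((exp (- \<rho> * t) / t ^ k) *\<^sub>R x t)) \<in> O[at_top](\<lambda>_. 1)" and \<epsilon>: "\<epsilon> > 0"
  shows "\<exists>C. \<forall>\<^sub>F t in at_top. norm (x t) \<le> C * exp ((\<rho> + \<epsilon>) * t)"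
proof -
  obtain c where c: "\<forall>\<^sub>F t in at_top. norm (norm ((exp (- \<rho> * t) / t ^ k) *\<^sub>R x t)) \<le> c * norm (1::real)" "c > 0"
    using O by (rule landau_o.bigE)
  have "filterlim (\<lambda>t. \<epsilon> * t) at_top at_top" using \<epsilon> by (intro filterlim_tendsto_pos_mult_at_top[OF tendsto_const _ filterlim_ident])
  from filterlim_compose[OF tendsto_power_div_exp_0[of k] this]
  have "\<forall>\<^sub>F t in at_top. (\<epsilon> * t) ^ k / exp (\<epsilon> * t) < 1" by (rule order_tendstoD) simp
  with c(1) eventually_gt_at_top[of 0] have "\<forall>\<^sub>F t in at_top. norm (x t) \<le> (c / \<epsilon> ^ k) * exp ((\<rho> + \<epsilon>) * t)"
  proof eventually_elim
    case (elim t)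
    have "exp (- \<rho> * t) / t ^ k * norm (x t) \<le> c" using elim(1,2) by (simp add: abs_mult)
    then have "norm (x t) \<le> c * (t ^ k / exp (- \<rho> * t))" using elim(2) by (simp add: field_simps)
    also have "t ^ k \<le> exp (\<epsilon> * t) / \<epsilon> ^ k" using elim(3) \<epsilon> by (simp add: field_simps power_mult_distrib)
    finally show ?case using c(2) \<epsilon> by (simp add: field_simps exp_add exp_minus mult_left_mono divide_right_mono)
  qed
  then show ?thesis ..
qed

text \<open>Reversing time changes the sign of the rate; in the polynomial factor it produces at
  most a sign, which the norm ignores.\<close>

lemma power_exp_growth_at_bot:
  fixes x :: "real \<Rightarrow> 'a::real_normed_vector"
  assumes O: "(\<lambda>t. norm ((exp (- \<rho> * t) / t ^ k) *\<^sub>R x t)) \<in> O[at_bot](\<lambda>_. 1)" and \<epsilon>: "\<epsilon> > 0"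
  shows "\<exists>C. \<forall>\<^sub>F t in at_top. norm (x (- t)) \<le> C * exp ((- \<rho> + \<epsilon>) * t)"
proof (rule power_exp_growth[OF _ \<epsilon>])
  have "(\<lambda>t. norm ((exp (- \<rho> * - t) / (- t) ^ k) *\<^sub>R x (- t))) \<in> O[at_top](\<lambda>_. 1)"
    using landau_o.big.compose[OF O filterlim_uminus_at_bot_at_top] by simp
  then show "(\<lambda>t. norm ((exp (- (- \<rho>) * t) / t ^ k) *\<^sub>R x (- t))) \<in> O[at_top](\<lambda>_. 1)"
    by (simp add: abs_divide power_abs)
qed

lemma tendsto_zero_exp_bound:
  fixes x :: "real \<Rightarrow> 'a::real_normed_vector"
  assumes "\<forall>\<^sub>F t in at_top. norm (x t) \<le> C * exp (\<rho> * t)" "\<rho> < 0"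
  shows "(x \<longlongrightarrow> 0) at_top"
proof (rule Lim_null_comparison[OF assms(1)])
  show "((\<lambda>t. C * exp (\<rho> * t)) \<longlongrightarrow> 0) at_top" using assms(2) by real_asymp
qed

lemma bounded_half_line:
  fixes x :: "real \<Rightarrow> 'a::real_normed_vector"
  assumes c: "continuous_on UNIV x" and lim: "(x \<longlongrightarrow> 0) at_top"
  shows "bounded (x ` {0..})"
proof -
  have "\<forall>\<^sub>F t in at_top. dist (x t) 0 < 1" using lim by (rule tendstoD) simp
  then obtain T where T: "\<And>t. t \<ge> T \<Longrightarrow> norm (x t) < 1" unfolding eventually_at_top_linorder by auto
  have "bounded (x ` {0..max 0 T})"
    by (intro compact_imp_bounded compact_continuous_image continuous_on_subset[OF c]) auto
  moreover have "bounded (x ` {T..})" using T by (intro boundedI[of _ 1]) (auto intro: less_imp_le)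
  ultimately have "bounded (x ` {0..max 0 T} \<union> x ` {T..})" by (rule bounded_Un[THEN iffD2, OF conjI])
  moreover have "{0..} \<subseteq> {0..max 0 T} \<union> {T..}" by auto
  ultimately show ?thesis by (metis bounded_subset image_Un image_mono)
qed

lemma minus_matrix_vector: "(- M) *v x = - (M *v (x :: real^'n))"
  by (simp add: matrix_vector_mult_def vec_eq_iff sum_negf)

lemma (in dual_frame) reversed: "dual_frame (\<lambda>t. - A (- t)) (\<lambda>j t. \<Phi> j (- t)) (\<lambda>j t. \<Psi> j (- t))"
proof
  show "((\<lambda>t. \<Phi> j (- t)) has_vector_derivative - A (- t) *v \<Phi> j (- t)) (at t)" for j t
    using has_vector_derivative_reflect[OF solution[of j "- t"]] by (simp add: minus_matrix_vector)
qed (rule dual)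

locale saddle_loop =
  fixes f :: "'n::finite vfield" and xh :: "real \<Rightarrow> real^'n" and ns nu :: nat and l :: "nat \<Rightarrow> complex"
    and \<phi> \<psi> :: "nat \<Rightarrow> real \<Rightarrow> real^'n"
  assumes smooth: "Ck k (\<lambda>(x, \<mu>). f x \<mu>)" and saddle: "hyperbolic_saddle f ns nu l"
    and loop: "homoclinic f 0 xh" and fundamental: "fundamental_system f xh ns l \<phi>" and dual: "dual_system \<phi> \<psi>"
begin

definition A where "A t = matrix (Dx f (xh t) 0)"

lemma Dx_dirder: "Dx f x \<mu> u = dirder (u, 0) (\<lambda>(x, \<mu>). f x \<mu>) (x, \<mu>)"
  unfolding Dx_def dirder_def using frechet_derivative_fst_slice[OF smooth, of \<mu> x u, unfolded dirder_def split_conv] by simp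

lemma matrix_Dx: "matrix (Dx f x \<mu>) *v u = Dx f x \<mu> u"
  by (rule matrix_vector_mul(2)[THEN fun_cong])
    (use dirder_add[OF smooth, of "(_, 0)" "(_, 0)"] dirder_scaleR[OF smooth, of _ "(_, 0)"] in
      \<open>auto intro!: linearI simp: Dx_dirder\<close>)

lemma A_continuous: "continuous_on UNIV A"
  and A_lim: "(A \<longlongrightarrow> matrix (Dx f 0 0)) at_top" "(A \<longlongrightarrow> matrix (Dx f 0 0)) at_bot"
proof -
  have C: "continuous_on UNIV (\<lambda>x. matrix (Dx f x 0))"
    unfolding matrix_def Dx_dirder
    by (intro continuous_intros continuous_on_compose2[OF Ck_continuous[OF Ck_dirder[OF smooth]]]) auto
  have "continuous_on UNIV xh"
    using loop by (auto simp: homoclinic_def intro!: continuous_at_imp_continuous_on has_vector_derivative_continuous)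
  then show "continuous_on UNIV A" unfolding A_def[abs_def] by (rule continuous_on_compose2[OF C]) simp
  have "isCont (\<lambda>x. matrix (Dx f x 0)) 0" using C by (simp add: continuous_on_eq_continuous_at)
  then show "(A \<longlongrightarrow> matrix (Dx f 0 0)) at_top" "(A \<longlongrightarrow> matrix (Dx f 0 0)) at_bot"
    unfolding A_def[abs_def] using loop by (auto intro: isCont_tendsto_compose simp: homoclinic_def)
qed

lemma dims: "1 \<le> ns" "1 \<le> nu" "ns + nu = CARD('n)" and eigenvalues: "eigenvalue_list (matrix (Dx f 0 0)) l"
  and Re_l: "j \<in> {1..ns} \<Longrightarrow> Re (l j) < 0" "j \<in> {ns+1..CARD('n)} \<Longrightarrow> Re (l j) > 0"
  using saddle unfolding hyperbolic_saddle_def by auto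

lemma hyperbolic: "hyperbolic_matrix (matrix (Dx f 0 0))"
  unfolding hyperbolic_matrix_def cmatrix_def
proof (intro allI impI)
  fix z :: complex assume z: "Re z = 0"
  have "det (mat z - (\<chi> i j. complex_of_real (matrix (Dx f 0 0) $ i $ j))) = (\<Prod>j=1..CARD('n). z - l j)"
    using eigenvalues unfolding eigenvalue_list_def by blast
  moreover have "z \<noteq> l j" if "j \<in> {1..CARD('n)}" for j
    using that z Re_l(1)[of j] Re_l(2)[of j] by (cases "j \<le> ns") auto
  ultimately show "det (mat z - (\<chi> i j. complex_of_real (matrix (Dx f 0 0) $ i $ j))) \<noteq> 0" by auto
qed

text \<open>The fundamental system is numbered by natural numbers, matrix entries by the type
  \<open>'n\<close>; this bijection translates between the two.\<close>

definition \<iota> where "\<iota> = (SOME \<iota> :: 'n \<Rightarrow> nat. bij_betw \<iota> UNIV {1..CARD('n)})"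

lemma \<iota>: "bij_betw \<iota> UNIV {1..CARD('n)}"
proof -
  have "\<exists>\<iota> :: 'n \<Rightarrow> nat. bij_betw \<iota> UNIV {1..CARD('n)}" by (rule finite_same_card_bij) auto
  then show ?thesis unfolding \<iota>_def by (rule someI_ex)
qed

lemma \<iota>_range: "\<iota> j \<in> {1..CARD('n)}" and \<iota>_eq: "\<iota> j = \<iota> k \<longleftrightarrow> j = k"
  using \<iota> by (auto simp: bij_betw_def inj_on_def)

lemma \<iota>_surj: "k \<in> {1..CARD('n)} \<Longrightarrow> \<exists>j. \<iota> j = k"
  using \<iota> unfolding bij_betw_def by (metis rangeE)

sublocale fr: dual_frame A "\<lambda>j. \<phi> (\<iota> j)" "\<lambda>j. \<psi> (\<iota> j)"
proof
  show "(\<phi> (\<iota> j) has_vector_derivative A t *v \<phi> (\<iota> j) t) (at t)" for j t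
    using fundamental \<iota>_range[of j] unfolding fundamental_system_def VE_solution_def A_def matrix_Dx by blast
  show "\<psi> (\<iota> j) t \<bullet> \<phi> (\<iota> k) t = (if j = k then 1 else 0)" for j k t
    using dual \<iota>_range[of j] \<iota>_range[of k] unfolding dual_system_def by (simp add: \<iota>_eq)
qed

text \<open>Growth rates with an arbitrarily small loss \<epsilon>. At each end the dual functions
  have rates opposite to those of the \<phi>; behaviour at minus infinity is expressed through
  \<open>- t\<close> so that all bounds are at plus infinity.\<close>

definition asymptotic_permutation :: "(nat \<Rightarrow> nat) \<Rightarrow> bool" where
  "asymptotic_permutation \<sigma> \<longleftrightarrow> \<sigma> permutes {1..CARD('n)} \<and> (\<forall>j\<in>{1..CARD('n)}. \<forall>\<epsilon>>0.
    (\<exists>C. \<forall>\<^sub>F t in at_top. norm (\<phi> j (- t)) \<le> C * exp ((- Re (l (\<sigma> j)) + \<epsilon>) * t)) \<and>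
    (\<exists>C. \<forall>\<^sub>F t in at_top. norm (\<psi> j t) \<le> C * exp ((\<epsilon> - Re (l j)) * t)) \<and>
    (\<exists>C. \<forall>\<^sub>F t in at_top. norm (\<psi> j (- t)) \<le> C * exp ((\<epsilon> + Re (l (\<sigma> j))) * t)))"

text \<open>The growth rates add up to the limit of the trace of the coefficient, for the reversed
  system as well because \<sigma> merely permutes the eigenvalues. The bound on dual vectors
  therefore applies to the frame and to its time reversal.\<close>

lemma asymptotics: "\<exists>\<sigma>. asymptotic_permutation \<sigma>"
proof -
  obtain k \<sigma> where \<sigma>: "\<sigma> permutes {1..CARD('n)}" and O: "\<And>j. j \<in> {1..CARD('n)} \<Longrightarrow>
      (\<lambda>t. norm ((exp (- Re (l j) * t) / t ^ k j) *\<^sub>R \<phi> j t)) \<in> O[at_top](\<lambda>_. 1)"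
      "\<And>j. j \<in> {1..CARD('n)} \<Longrightarrow>
      (\<lambda>t. norm ((exp (- Re (l (\<sigma> j)) * t) / t ^ k (\<sigma> j)) *\<^sub>R \<phi> j t)) \<in> O[at_bot](\<lambda>_. 1)"
    using fundamental unfolding fundamental_system_def by blast
  let ?B = "matrix (Dx f 0 0)"
  have tr: "trace ?B = (\<Sum>j=1..CARD('n). Re (l j))" by (rule trace_eq_sum_eigenvalues[OF eigenvalues])
  have s1: "(\<Sum>j\<in>UNIV. Re (l (\<iota> j))) = (\<Sum>j=1..CARD('n). Re (l j))" by (rule sum.reindex_bij_betw[OF \<iota>])
  have s2: "(\<Sum>j\<in>UNIV. - Re (l (\<sigma> (\<iota> j)))) = - (\<Sum>j=1..CARD('n). Re (l j))"
    using sum.reindex_bij_betw[OF \<iota>, of "\<lambda>j. Re (l (\<sigma> j))"] sum.permute[OF \<sigma>, of "\<lambda>j. Re (l j)"]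
    by (simp add: sum_negf o_def)
  have tl: "((\<lambda>t. trace (M t)) \<longlongrightarrow> trace X) F" if "(M \<longlongrightarrow> X) F" for M :: "real \<Rightarrow> real^'n^'n" and X F
    unfolding trace_def using that by (intro tendsto_intros)
  have "(A \<longlongrightarrow> ?B) at_bot" by (rule A_lim)
  from filterlim_compose[OF this filterlim_uminus_at_bot_at_top]
  have rl: "((\<lambda>t. - A (- t)) \<longlongrightarrow> - ?B) at_top" by (rule tendsto_minus)
  interpret rv: dual_frame "\<lambda>t. - A (- t)" "\<lambda>j t. \<phi> (\<iota> j) (- t)" "\<lambda>j t. \<psi> (\<iota> j) (- t)" by (rule fr.reversed)
  have bot: "\<exists>C. \<forall>\<^sub>F t in at_top. norm (\<phi> j (- t)) \<le> C * exp ((- Re (l (\<sigma> j)) + \<epsilon>) * t)" if "j \<in> {1..CARD('n)}" "\<epsilon> > 0" for j \<epsilon>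
    by (rule power_exp_growth_at_bot[OF O(2)[OF that(1)] that(2)])
  have 1: "\<exists>C. \<forall>\<^sub>F t in at_top. norm (\<psi> (\<iota> j) t) \<le> C * exp ((\<epsilon> - Re (l (\<iota> j))) * t)" if "\<epsilon> > 0" for j \<epsilon>
  proof (rule fr.dual_exp_bound[OF _ _ that])
    show "((\<lambda>t. trace (A t)) \<longlongrightarrow> (\<Sum>j\<in>UNIV. Re (l (\<iota> j)))) at_top" unfolding s1 using tl[OF A_lim(1)] tr by simp
  qed (rule power_exp_growth[OF O(1)[OF \<iota>_range]])
  have 2: "\<exists>C. \<forall>\<^sub>F t in at_top. norm (\<psi> (\<iota> j) (- t)) \<le> C * exp ((\<epsilon> - - Re (l (\<sigma> (\<iota> j)))) * t)" if "\<epsilon> > 0" for j \<epsilon>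
  proof (rule rv.dual_exp_bound[OF _ _ that])
    show "((\<lambda>t. trace (- A (- t))) \<longlongrightarrow> (\<Sum>j\<in>UNIV. - Re (l (\<sigma> (\<iota> j))))) at_top"
      unfolding s2 using tl[OF rl] tr by (simp add: trace_def sum_negf)
  qed (rule bot[OF \<iota>_range])
  have "\<exists>C. \<forall>\<^sub>F t in at_top. norm (\<psi> j t) \<le> C * exp ((\<epsilon> - Re (l j)) * t)"
    "\<exists>C. \<forall>\<^sub>F t in at_top. norm (\<psi> j (- t)) \<le> C * exp ((\<epsilon> + Re (l (\<sigma> j))) * t)"
    if "j \<in> {1..CARD('n)}" "\<epsilon> > 0" for j \<epsilon>
    using \<iota>_surj[OF that(1)] 1[OF that(2)] 2[OF that(2)] by force+
  with \<sigma> bot show ?thesis unfolding asymptotic_permutation_def by (intro exI[of _ \<sigma>] conjI ballI allI impI)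
qed

lemma phi_lims:
  "j \<in> {1, 2} \<Longrightarrow> (\<phi> j \<longlongrightarrow> 0) at_top" "j \<in> {1, 2} \<Longrightarrow> (\<phi> j \<longlongrightarrow> 0) at_bot"
  "j \<in> {1..ns} \<Longrightarrow> (\<phi> j \<longlongrightarrow> 0) at_top"
  "j \<in> {ns+3..CARD('n)} \<Longrightarrow> (\<phi> j \<longlongrightarrow> 0) at_bot"
  "j \<in> {ns+1, ns+2} \<Longrightarrow> filterlim (\<phi> j) at_infinity at_top"
  "j \<in> {ns+1, ns+2} \<Longrightarrow> filterlim (\<phi> j) at_infinity at_bot"
proof -
  note F = fundamental[unfolded fundamental_system_def, THEN conjunct2, THEN conjunct2]
  show a: "j \<in> {1, 2} \<Longrightarrow> (\<phi> j \<longlongrightarrow> 0) at_top" "j \<in> {1, 2} \<Longrightarrow> (\<phi> j \<longlongrightarrow> 0) at_bot"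
    "j \<in> {ns+3..CARD('n)} \<Longrightarrow> (\<phi> j \<longlongrightarrow> 0) at_bot"
    "j \<in> {ns+1, ns+2} \<Longrightarrow> filterlim (\<phi> j) at_infinity at_top"
    "j \<in> {ns+1, ns+2} \<Longrightarrow> filterlim (\<phi> j) at_infinity at_bot" using F by blast+
  have "(\<phi> j \<longlongrightarrow> 0) at_top" if "j \<in> {3..ns}" using F that by blast
  moreover have "j \<in> {1, 2} \<or> j \<in> {3..ns}" if "j \<in> {1..ns}" using that by auto
  ultimately show "j \<in> {1..ns} \<Longrightarrow> (\<phi> j \<longlongrightarrow> 0) at_top" using a(1) by blast
qed

text \<open>Otherwise \<open>\<phi> 2\<close> is also the function with index \<open>ns + 1\<close>
  and would have to decay and blow up at plus infinity.\<close>

lemma ns_ge_2: "2 \<le> ns"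
proof (rule ccontr)
  assume "\<not> 2 \<le> ns"
  then have "2 = ns + 1" using dims(1) by simp
  then have "(\<phi> 2 \<longlongrightarrow> 0) at_top" "filterlim (\<phi> 2) at_infinity at_top" using phi_lims(1)[of 2] phi_lims(5)[of 2] by auto
  then show False using not_tendsto_and_filterlim_at_infinity[OF trivial_limit_at_top_linorder] by blast
qed

text \<open>Were the unstable dimension one, then \<open>\<sigma>\<close> would send \<open>1\<close> or \<open>2\<close> to a stable index; the
  corresponding \<open>\<psi>\<close> would tend to \<open>0\<close> at \<open>-\<infinity>\<close> like \<open>\<phi>\<close>, although their pairing is \<open>1\<close>.\<close>

lemma nu_ge_2: "2 \<le> nu"
proof (rule ccontr)
  assume "\<not> 2 \<le> nu"
  then have n: "CARD('n) = ns + 1" using dims by simp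
  obtain \<sigma> where as: "asymptotic_permutation \<sigma>" using asymptotics ..
  note \<sigma> = as[unfolded asymptotic_permutation_def, THEN conjunct1]
  note b3 = as[unfolded asymptotic_permutation_def, THEN conjunct2, rule_format, THEN conjunct2, THEN conjunct2]
  have "\<sigma> 1 \<noteq> \<sigma> 2" unfolding inj_eq[OF permutes_inj[OF \<sigma>]] by simp
  moreover have "\<sigma> 1 \<in> {1..ns+1}" "\<sigma> 2 \<in> {1..ns+1}" unfolding n[symmetric] permutes_in_image[OF \<sigma>] using ns_ge_2 n by auto
  \<comment> \<open>Two distinct values in \<open>{1..ns+1}\<close> cannot both be the single
    unstable index.\<close>
  ultimately have "\<sigma> 1 \<in> {1..ns} \<or> \<sigma> 2 \<in> {1..ns}" unfolding atLeastAtMost_iff by linarith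
  then obtain j where j: "j \<in> {1, 2}" "\<sigma> j \<in> {1..ns}" by blast
  then have jn: "j \<in> {1..CARD('n)}" using ns_ge_2 n by auto
  obtain C where C: "\<forall>\<^sub>F t in at_top. norm (\<psi> j (- t)) \<le> C * exp ((- Re (l (\<sigma> j)) / 2 + Re (l (\<sigma> j))) * t)"
    using b3[OF jn, of "- Re (l (\<sigma> j)) / 2"] Re_l(1)[OF j(2)] by auto
  have "((\<lambda>t. \<psi> j (- t)) \<longlongrightarrow> 0) at_top" by (rule tendsto_zero_exp_bound[OF C]) (use Re_l(1)[OF j(2)] in simp)
  moreover have "((\<lambda>t. \<phi> j (- t)) \<longlongrightarrow> 0) at_top"
    by (rule filterlim_compose[OF phi_lims(2)[OF j(1)] filterlim_uminus_at_bot_at_top])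
  ultimately have "((\<lambda>t. \<psi> j (- t) \<bullet> \<phi> j (- t)) \<longlongrightarrow> 0 \<bullet> (0 :: real^'n)) at_top"
    by (rule tendsto_inner)
  moreover have "\<psi> j t \<bullet> \<phi> j t = 1" for t using dual jn unfolding dual_system_def by simp
  ultimately show False by (simp add: tendsto_const_iff)
qed

text \<open>The index j is unstable, which gives decay at plus infinity. At minus infinity
  \<open>\<phi> j\<close> blows up, so its rate there cannot belong to an unstable eigenvalue; hence
  \<open>\<sigma> j\<close> is a stable index and \<open>\<psi> j\<close> decays at that end
  too.\<close>

lemma psi:
  assumes "j \<in> {ns+1, ns+2}"
  shows "integrable lborel (\<psi> j)" "continuous_on UNIV (\<psi> j)" "(\<psi> j \<longlongrightarrow> 0) at_top" "(\<psi> j \<longlongrightarrow> 0) at_bot"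
proof -
  obtain \<sigma> where as: "asymptotic_permutation \<sigma>" using asymptotics ..
  note \<sigma> = as[unfolded asymptotic_permutation_def, THEN conjunct1]
  note b = as[unfolded asymptotic_permutation_def, THEN conjunct2, rule_format]
  note b1 = b[THEN conjunct1] and b2 = b[THEN conjunct2, THEN conjunct1] and b3 = b[THEN conjunct2, THEN conjunct2]
  have j: "j \<in> {1..CARD('n)}" "j \<in> {ns+1..CARD('n)}" using assms dims(3) nu_ge_2 by auto
  have \<sigma>j: "\<sigma> j \<in> {1..CARD('n)}" using permutes_in_image[OF \<sigma>] j by simp
  have "\<sigma> j \<in> {1..ns}"
  proof (rule ccontr)
    assume "\<sigma> j \<notin> {1..ns}"
    then have r: "Re (l (\<sigma> j)) > 0" using \<sigma>j Re_l(2)[of "\<sigma> j"] by auto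
    then obtain C where C: "\<forall>\<^sub>F t in at_top. norm (\<phi> j (- t)) \<le> C * exp ((- Re (l (\<sigma> j)) + Re (l (\<sigma> j)) / 2) * t)"
      using b1[OF j(1), of "Re (l (\<sigma> j)) / 2"] by auto
    have "((\<lambda>t. \<phi> j (- t)) \<longlongrightarrow> 0) at_top" by (rule tendsto_zero_exp_bound[OF C]) (use r in simp)
    moreover have "filterlim (\<lambda>t. \<phi> j (- t)) at_infinity at_top"
      by (rule filterlim_compose[OF phi_lims(6)[OF assms] filterlim_uminus_at_bot_at_top])
    ultimately show False using not_tendsto_and_filterlim_at_infinity[OF trivial_limit_at_top_linorder] by blast
  qed
  then have r: "Re (l j) > 0" "Re (l (\<sigma> j)) < 0" using Re_l j(2) by blast+
  define \<delta> where "\<delta> = min (Re (l j)) (- Re (l (\<sigma> j))) / 2"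
  have \<delta>: "\<delta> > 0" "Re (l j) - \<delta> > 0" "- Re (l (\<sigma> j)) - \<delta> > 0" using r by (auto simp: \<delta>_def)
  obtain C where C: "\<forall>\<^sub>F t in at_top. norm (\<psi> j t) \<le> C * exp (- \<delta> * t)" using b2[OF j(1) \<delta>(2)] by auto
  obtain D where "\<forall>\<^sub>F t in at_top. norm (\<psi> j (- t)) \<le> D * exp (- \<delta> * t)" using b3[OF j(1) \<delta>(3)] by auto
  then have D: "\<forall>\<^sub>F t in at_bot. norm (\<psi> j t) \<le> D * exp (\<delta> * t)" unfolding eventually_at_bot_linorder eventually_at_top_linorder
    by (metis minus_le_iff minus_minus mult_minus_left mult_minus_right)
  obtain i where i: "\<iota> i = j" using \<iota>_surj[OF j(1)] by blast
  show c: "continuous_on UNIV (\<psi> j)" using fr.dual_continuous[of UNIV i] by (simp add: i)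
  show "integrable lborel (\<psi> j)" "(\<psi> j \<longlongrightarrow> 0) at_top" "(\<psi> j \<longlongrightarrow> 0) at_bot"
    by (rule integrable_exp_decay[OF c \<delta>(1) C D])+
qed

lemma psi_pairing:
  assumes "j \<in> {ns+1, ns+2}" "(w has_vector_derivative Dx f (xh t) 0 (w t) + g) (at t)"
  shows "((\<lambda>t. \<psi> j t \<bullet> w t) has_vector_derivative \<psi> j t \<bullet> g) (at t)"
proof -
  have "j \<in> {1..CARD('n)}" using assms dims nu_ge_2 by auto
  then obtain i where i: "\<iota> i = j" using \<iota>_surj by blast
  have "(w has_vector_derivative A t *v w t + g) (at t)" using assms(2) by (simp add: A_def matrix_Dx)
  from fr.dual_pairing_derivative[OF this, of i] show ?thesis by (simp add: i)
qed

text \<open>Apart from the two exceptional indices every \<phi> is bounded on a half line: those up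
  to \<open>ns\<close> towards plus infinity, those from \<open>ns + 3\<close> on towards minus
  infinity.\<close>

lemma right_inverse:
  "\<exists>K. bounded_linear K \<and> (\<forall>h :: real \<Rightarrow>\<^sub>C (real^'n).
     (\<forall>j\<in>{ns+1, ns+2}. (LINT t|lborel. \<psi> j t \<bullet> apply_bcontfun h t) = 0) \<longrightarrow>
     (\<forall>t. (apply_bcontfun (K h) has_vector_derivative Dx f (xh t) 0 (apply_bcontfun (K h) t) + apply_bcontfun h t) (at t)))"
proof -
  let ?N = "{j. \<iota> j \<in> {ns+1, ns+2}}"
  have cont: "continuous_on UNIV (\<phi> (\<iota> j))" for j
    by (intro continuous_at_imp_continuous_on ballI has_vector_derivative_continuous[OF fr.solution])
  have "bounded (\<phi> (\<iota> j) ` {0..}) \<or> bounded (\<phi> (\<iota> j) ` {..0}) \<or> j \<in> ?N" for j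
  proof -
    consider "\<iota> j \<in> {1..ns}" | "\<iota> j \<in> {ns+1, ns+2}" | "\<iota> j \<in> {ns+3..CARD('n)}"
      using \<iota>_range[of j] by fastforce
    then show ?thesis
    proof cases
      case 1 then show ?thesis using bounded_half_line[OF cont phi_lims(3)] by blast
    next
      case 3
      have "bounded ((\<lambda>t. \<phi> (\<iota> j) (- t)) ` {0..})"
        by (intro bounded_half_line continuous_on_compose2[OF cont] continuous_intros
          filterlim_compose[OF phi_lims(4)[OF 3] filterlim_uminus_at_bot_at_top]) auto
      also have "(\<lambda>t. \<phi> (\<iota> j) (- t)) ` {0..} = \<phi> (\<iota> j) ` {..0}"
      proof (safe, goal_cases)
        case (2 _ t) then show ?case by (intro image_eqI[of _ _ "- t"]) auto
      qed auto
      finally show ?thesis by blast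
    qed simp
  qed
  from fr.bounded_right_inverse[OF hyperbolic A_continuous A_lim this]
  obtain K where K: "bounded_linear K" "\<And>h :: real \<Rightarrow>\<^sub>C (real^'n). (\<forall>j\<in>?N. (LINT t|lborel. \<psi> (\<iota> j) t \<bullet> apply_bcontfun h t) = 0) \<Longrightarrow>
     (\<forall>t. (apply_bcontfun (K h) has_vector_derivative A t *v apply_bcontfun (K h) t + apply_bcontfun h t) (at t))"
    using psi by auto
  then show ?thesis
    by (intro exI[of _ K] conjI allI impI) (auto simp: A_def matrix_Dx)
qed

end

section \<open>The coefficient matrix and curves in the parameter plane\<close>

lemma vector_axis_2: "(vector [a, b] :: real^2) = a *\<^sub>R axis 1 1 + b *\<^sub>R axis 2 1"
  by (auto simp: vec_eq_iff forall_2 axis_def vector_2)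

lemma linear_axis_2:
  fixes a :: "real^2 \<Rightarrow> real"
  assumes "linear a"
  shows "a \<nu> = a (axis 1 1) * \<nu> $ 1 + a (axis 2 1) * \<nu> $ 2"
proof -
  have "\<nu> = (\<nu> $ 1) *\<^sub>R axis 1 1 + (\<nu> $ 2) *\<^sub>R axis 2 1" by (auto simp: vec_eq_iff forall_2 axis_def)
  then have "a \<nu> = a ((\<nu> $ 1) *\<^sub>R axis 1 1 + (\<nu> $ 2) *\<^sub>R axis 2 1)" by simp
  then show ?thesis by (simp add: linear_add[OF assms] linear_scale[OF assms])
qed

text \<open>Multiplying the row vector \<nu> by the matrix gives the pair
  \<open>(a1 \<nu>, a2 \<nu>)\<close>, so a common zero of the forms lies in the kernel; and if
  \<open>a1\<close> were zero, the first column would vanish.\<close>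

lemma coeff_matrix_invertible:
  assumes M: "invertible (coeff_matrix a1 a2)" and lin: "linear a1" "linear a2"
  shows "a1 \<nu> = 0 \<Longrightarrow> a2 \<nu> = 0 \<Longrightarrow> \<nu> = 0" and "a1 (axis 1 1) \<noteq> 0 \<or> a1 (axis 2 1) \<noteq> 0"
proof -
  obtain N where N: "coeff_matrix a1 a2 ** N = mat 1" "N ** coeff_matrix a1 a2 = mat 1"
    using M unfolding invertible_def by blast
  show "\<nu> = 0" if "a1 \<nu> = 0" "a2 \<nu> = 0"
  proof -
    have "\<nu> v* coeff_matrix a1 a2 = 0"
      using that unfolding linear_axis_2[OF lin(1), of \<nu>] linear_axis_2[OF lin(2), of \<nu>]
      by (auto simp: vec_eq_iff forall_2 vector_matrix_mult_def coeff_matrix_def sum_2 mult.commute)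
    then have "(\<nu> v* coeff_matrix a1 a2) v* N = 0" by simp
    then show ?thesis by (simp add: vector_matrix_mul_assoc N)
  qed
  show "a1 (axis 1 1) \<noteq> 0 \<or> a1 (axis 2 1) \<noteq> 0"
  proof (rule ccontr)
    assume "\<not> ?thesis"
    then have "coeff_matrix a1 a2 *v axis 1 1 = 0"
      by (auto simp: vec_eq_iff forall_2 matrix_vector_mult_def coeff_matrix_def sum_2 axis_def)
    then have "N *v (coeff_matrix a1 a2 *v axis 1 1) = 0" by simp
    then have "axis 1 1 = (0 :: real^2)" by (simp add: matrix_vector_mul_assoc N)
    then show False by (simp add: axis_eq_0_iff)
  qed
qed

text \<open>Either bound suffices because \<open>\<alpha>\<^sup>2\<close> and
  \<open>norm \<mu>\<close> are both at most the square root.\<close>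

lemma near_orbitI:
  fixes xh \<phi>2 x :: "real \<Rightarrow> 'a::real_normed_vector"
  assumes "\<And>t. norm (x t - (xh t + \<alpha> *\<^sub>R \<phi>2 t)) \<le> B" "0 \<le> C" "B \<le> C * \<alpha>\<^sup>2 \<or> B \<le> C * norm \<mu>"
  shows "near_orbit C xh \<phi>2 \<alpha> \<mu> x"
  unfolding near_orbit_def
proof
  fix t
  have "\<alpha>\<^sup>2 \<le> sqrt (\<alpha> ^ 4 + (norm \<mu>)\<^sup>2)" "norm \<mu> \<le> sqrt (\<alpha> ^ 4 + (norm \<mu>)\<^sup>2)"
    by (auto intro!: real_le_rsqrt simp flip: power_mult)
  then have "B \<le> C * sqrt (\<alpha> ^ 4 + (norm \<mu>)\<^sup>2)" using assms(2,3) by (meson mult_left_mono order_trans)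
  then show "norm (x t - (xh t + \<alpha> *\<^sub>R \<phi>2 t)) \<le> C * sqrt (\<alpha> ^ 4 + (norm \<mu>)\<^sup>2)" using assms(1)[of t] by linarith
qed

text \<open>Composing with the absolute value makes the curve even and uses \<nu> on one side only.
  Away from 0 the product rule applies; at 0 the factor \<open>\<alpha>\<^sup>2\<close> smooths the
  corner, and the Lipschitz bound together with the bound on the slopes gives the second derivative
  through a quadratic error estimate.\<close>

lemma even_quadratic_curve:
  fixes \<nu> :: "real \<Rightarrow> 'a::real_normed_vector"
  assumes \<epsilon>: "\<epsilon> > 0" and C: "C \<ge> 0" and lip: "\<And>\<alpha>. \<bar>\<alpha>\<bar> < \<epsilon> \<Longrightarrow> norm (\<nu> \<alpha> - \<nu>0) \<le> C * \<bar>\<alpha>\<bar>"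
    and der: "\<And>\<alpha>. \<bar>\<alpha>\<bar> < \<epsilon> \<Longrightarrow> \<exists>d. (\<nu> has_vector_derivative d) (at \<alpha>) \<and> norm d \<le> C"
  defines "\<mu> \<equiv> \<lambda>\<alpha>. \<alpha>\<^sup>2 *\<^sub>R \<nu> \<bar>\<alpha>\<bar>"
  shows "\<exists>\<mu>'. (\<forall>\<alpha>. \<bar>\<alpha>\<bar> < \<epsilon> \<longrightarrow> (\<mu> has_vector_derivative \<mu>' \<alpha>) (at \<alpha>)) \<and> (\<mu>' has_vector_derivative 2 *\<^sub>R \<nu>0) (at 0)"
proof -
  obtain d where d: "\<And>\<alpha>. \<bar>\<alpha>\<bar> < \<epsilon> \<Longrightarrow> (\<nu> has_vector_derivative d \<alpha>) (at \<alpha>)" "\<And>\<alpha>. \<bar>\<alpha>\<bar> < \<epsilon> \<Longrightarrow> norm (d \<alpha>) \<le> C"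
    using der by metis
  define \<mu>' where "\<mu>' \<alpha> = (2 * \<alpha>) *\<^sub>R \<nu> \<bar>\<alpha>\<bar> + (\<alpha> * \<bar>\<alpha>\<bar>) *\<^sub>R d \<bar>\<alpha>\<bar>" for \<alpha>
  let ?g = "\<lambda>\<beta>. \<beta>\<^sup>2 *\<^sub>R \<nu> \<beta>"
  have g: "(?g has_vector_derivative (2 * \<beta>) *\<^sub>R \<nu> \<beta> + \<beta>\<^sup>2 *\<^sub>R d \<beta>) (at \<beta>)" if "\<bar>\<beta>\<bar> < \<epsilon>" for \<beta>
    by (rule has_vector_derivative_eq_rhs[OF has_vector_derivative_scaleR[OF _ d(1)[OF that]]])
      (auto intro!: derivative_eq_intros)
  have "(\<mu> has_vector_derivative \<mu>' \<alpha>) (at \<alpha>)" if \<alpha>: "\<bar>\<alpha>\<bar> < \<epsilon>" for \<alpha>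
  proof (cases \<alpha> "0::real" rule: linorder_cases)
    case greater
    have "(?g has_vector_derivative \<mu>' \<alpha>) (at \<alpha>)"
      using g[OF \<alpha>] greater by (simp add: \<mu>'_def power2_eq_square)
    then show ?thesis
      by (rule has_vector_derivative_transform_within_open[OF _ open_greaterThan[of 0]]) (use greater in \<open>auto simp: \<mu>_def\<close>)
  next
    case less
    have "((\<lambda>\<beta>. ?g (- \<beta>)) has_vector_derivative - ((2 * - \<alpha>) *\<^sub>R \<nu> (- \<alpha>) + (- \<alpha>)\<^sup>2 *\<^sub>R d (- \<alpha>))) (at \<alpha>)"
      by (rule has_vector_derivative_reflect, rule g) (use \<alpha> in simp)
    then have "((\<lambda>\<beta>. ?g (- \<beta>)) has_vector_derivative \<mu>' \<alpha>) (at \<alpha>)"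
      using less by (simp add: \<mu>'_def power2_eq_square)
    then show ?thesis
      by (rule has_vector_derivative_transform_within_open[OF _ open_lessThan[of 0]]) (use less in \<open>auto simp: \<mu>_def\<close>)
  next
    case equal
    have "(\<mu> has_vector_derivative 0) (at 0)"
    proof (rule has_vector_derivative_quadratic[OF \<epsilon>])
      fix h assume h: "\<bar>h\<bar> < \<epsilon>"
      have "norm (\<nu> \<bar>h\<bar>) \<le> norm \<nu>0 + norm (\<nu> \<bar>h\<bar> - \<nu>0)" by (rule norm_triangle_sub)
      also have "norm (\<nu> \<bar>h\<bar> - \<nu>0) \<le> C * \<bar>h\<bar>" using lip[of "\<bar>h\<bar>"] h by simp
      also have "\<dots> \<le> C * \<epsilon>" using h C by (intro mult_left_mono) auto
      finally have "norm (\<nu> \<bar>h\<bar>) \<le> norm \<nu>0 + C * \<epsilon>" by simp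
      then have "h\<^sup>2 * norm (\<nu> \<bar>h\<bar>) \<le> h\<^sup>2 * (norm \<nu>0 + C * \<epsilon>)" by (intro mult_left_mono) auto
      then show "norm (\<mu> h - \<mu> 0 - h *\<^sub>R 0) \<le> (norm \<nu>0 + C * \<epsilon>) * h\<^sup>2" by (simp add: \<mu>_def mult.commute)
    qed
    then show ?thesis using equal by (simp add: \<mu>'_def)
  qed
  moreover have "(\<mu>' has_vector_derivative 2 *\<^sub>R \<nu>0) (at 0)"
  proof (rule has_vector_derivative_quadratic[OF \<epsilon>])
    fix h assume h: "\<bar>h\<bar> < \<epsilon>"
    have "\<mu>' h - \<mu>' 0 - h *\<^sub>R 2 *\<^sub>R \<nu>0 = (2 * h) *\<^sub>R (\<nu> \<bar>h\<bar> - \<nu>0) + (h * \<bar>h\<bar>) *\<^sub>R d \<bar>h\<bar>"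
      by (simp add: \<mu>'_def scaleR_diff_right mult.commute)
    also have "norm \<dots> \<le> (2 * \<bar>h\<bar>) * (C * \<bar>h\<bar>) + (\<bar>h\<bar> * \<bar>h\<bar>) * C"
    proof (rule norm_triangle_le, rule add_mono)
      show "norm ((2 * h) *\<^sub>R (\<nu> \<bar>h\<bar> - \<nu>0)) \<le> (2 * \<bar>h\<bar>) * (C * \<bar>h\<bar>)"
        using lip[of "\<bar>h\<bar>"] h unfolding norm_scaleR abs_mult by (intro mult_mono) auto
      show "norm ((h * \<bar>h\<bar>) *\<^sub>R d \<bar>h\<bar>) \<le> (\<bar>h\<bar> * \<bar>h\<bar>) * C"
        using d(2)[of "\<bar>h\<bar>"] h unfolding norm_scaleR abs_mult by (intro mult_mono) auto
    qed
    also have "\<dots> = (3 * C) * h\<^sup>2" by (simp add: power2_eq_square algebra_simps)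
    finally show "norm (\<mu>' h - \<mu>' 0 - h *\<^sub>R 2 *\<^sub>R \<nu>0) \<le> (3 * C) * h\<^sup>2" .
  qed
  ultimately show ?thesis by blast
qed

context homoclinic_reduction
begin

text \<open>Any bounded solution may replace \<open>Kp h\<close> in the second functional. This
  links the coefficients of the statement, which use normalised solutions, with the functionals of
  the reduction.\<close>

lemma coefficient_eq:
  assumes h: "\<And>t. apply_bcontfun h t \<in> Xplus S" "l1 h = 0"
    and \<xi>: "\<And>t. (\<xi> has_vector_derivative Dx f (xh t) 0 (\<xi> t) + apply_bcontfun h t) (at t)" "bounded (range \<xi>)"
  shows "(LINT t|lborel. \<psi>2 t \<bullet> (apply_bcontfun c t + Dxx f (xh t) 0 (\<xi> t) (\<phi>2 t))) = l2 (c + G3 (Kp h))"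
proof -
  have K: "(apply_bcontfun (Kp h) has_vector_derivative Dx f (xh t) 0 (apply_bcontfun (Kp h) t) + apply_bcontfun h t) (at t)" for t
    using Kp(3)[OF h(2), of t] by (simp add: Pp_on_plus[OF h(1)])
  have b: "bounded (range (apply_bcontfun (Kp h)))" using apply_bcontfun[of "Kp h"] by (simp add: bcontfun_def)
  have c: "continuous_on UNIV (apply_bcontfun c)" by (intro continuous_on_apply_bcontfun continuous_intros)
  have "(LINT t|lborel. \<psi>2 t \<bullet> (apply_bcontfun c t + Dxx f (xh t) 0 (\<xi> t) (\<phi>2 t)))
    = (LINT t|lborel. \<psi>2 t \<bullet> (apply_bcontfun c t + Dxx f (xh t) 0 (apply_bcontfun (Kp h) t) (\<phi>2 t)))"
    by (rule pairing_independent[OF Dxx_plus \<xi> K b c norm_apply_bcontfun])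
  also have "\<dots> = l2 (c + G3 (Kp h))" by (simp add: l2_def plus_bcontfun.rep_eq G3)
  finally show ?thesis .
qed

text \<open>Both functions are values of the remainders at \<alpha> = 0 with zero unknowns, hence
  superpositions by continuous maps; this settles continuity and boundedness.\<close>

lemma taylor_coefficients:
  obtains H1 H2 where "\<And>t. apply_bcontfun H1 t = (1/2) *\<^sub>R Dxx f (xh t) 0 (\<phi>2 t) (\<phi>2 t)"
    "\<And>t. apply_bcontfun H2 t = (1/6) *\<^sub>R Dxxx f (xh t) 0 (\<phi>2 t) (\<phi>2 t) (\<phi>2 t)"
proof -
  define z where "z = Bcontfun (\<lambda>t. (xh t, \<phi>2 t))"
  have "bounded (range (\<lambda>t. (xh t, \<phi>2 t)))"
    by (rule bounded_subset[OF bounded_Times[OF xh_bounded \<phi>2(2)]]) auto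
  then have z: "apply_bcontfun z t = (xh t, \<phi>2 t)" for t
    unfolding z_def by (subst Bcontfun_inverse) (auto simp: bcontfun_def intro!: continuous_intros xh_continuous \<phi>2_continuous)
  have "continuous_on UNIV (\<lambda>p. L2 (pack (fst p) (snd p) 0 0 0, 0))" "continuous_on UNIV (\<lambda>p. L3 (pack (fst p) (snd p) 0 0 0, 0))"
    by (auto intro!: continuous_on_compose2[OF Ck_continuous[OF CL2]] continuous_on_compose2[OF Ck_continuous[OF CL3]] continuous_intros)
  note A = this[THEN nemytskii_apply, of z]
  have "apply_bcontfun (nemytskii (\<lambda>p. L2 (pack (fst p) (snd p) 0 0 0, 0)) z) t = (1/2) *\<^sub>R Dxx f (xh t) 0 (\<phi>2 t) (\<phi>2 t)"
    "apply_bcontfun (nemytskii (\<lambda>p. L3 (pack (fst p) (snd p) 0 0 0, 0)) z) t = (1/6) *\<^sub>R Dxxx f (xh t) 0 (\<phi>2 t) (\<phi>2 t) (\<phi>2 t)" for t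
    unfolding A z by (simp_all add: L2_0 L3_0 derivatives_zero)
  then show ?thesis by (rule that)
qed

text \<open>\<open>a2\<close> and \<open>b2\<close> are compared with the reduced functionals only
  where the first obstruction is zero. This fits the way in which the nondegeneracy is used:
  \<open>a1\<close> is nonzero, \<open>a1\<close> and \<open>a2\<close> have no common zero, and the
  forcing by \<open>H1\<close> and \<open>H2\<close> violates at least one of the two
  obstructions.\<close>

theorem pitchfork_bifurcation:
  assumes H1: "\<And>t. apply_bcontfun H1 t = (1/2) *\<^sub>R Dxx f (xh t) 0 (\<phi>2 t) (\<phi>2 t)"
    and H2: "\<And>t. apply_bcontfun H2 t = (1/6) *\<^sub>R Dxxx f (xh t) 0 (\<phi>2 t) (\<phi>2 t) (\<phi>2 t)"
    and a1: "\<And>\<nu>. a1 \<nu> = l1 (G1 \<nu>)" and b1: "b1 = l1 H1"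
    and a2: "linear a2" "\<And>\<nu>. l1 (G1 \<nu>) = 0 \<Longrightarrow> a2 \<nu> = l2 (G2 \<nu> + G3 (Kp (G1 \<nu>)))"
    and b2: "l1 H1 = 0 \<Longrightarrow> b2 = l2 (H2 + G3 (Kp H1))"
    and nonsingular: "invertible (coeff_matrix a1 a2)" and nonzero: "(b1, b2) \<noteq> (0, 0)"
  shows "\<exists>(I :: real set) C.
     open I \<and> is_interval I \<and> 0 \<in> I \<and> (\<forall>\<alpha>\<in>I. - \<alpha> \<in> I) \<and>
     (\<exists>\<mu>c. ((\<exists>m1 :: real \<Rightarrow> real. m1 differentiable_on I \<and> m1 0 = 0 \<and> (\<forall>s. \<mu>c s = vector [m1 s, s])) \<or>
            (\<exists>m2 :: real \<Rightarrow> real. m2 differentiable_on I \<and> m2 0 = 0 \<and> (\<forall>s. \<mu>c s = vector [s, m2 s]))) \<and>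
        (\<forall>s\<in>I. \<exists>x. homoclinic f (\<mu>c s) x \<and> (\<forall>t. x t \<in> Xplus S) \<and> near_orbit C xh \<phi>2 0 (\<mu>c s) x)) \<and>
     (\<exists>(\<mu>p :: real \<Rightarrow> real^2) \<mu>p' d.
        (\<forall>\<alpha>\<in>I. (\<mu>p has_vector_derivative \<mu>p' \<alpha>) (at \<alpha>)) \<and>
        (\<mu>p' has_vector_derivative d) (at 0) \<and> d \<noteq> 0 \<and>
        \<mu>p 0 = 0 \<and> (\<forall>\<alpha>\<in>I. \<mu>p \<alpha> = \<mu>p (- \<alpha>)) \<and>
        (\<forall>\<alpha>\<in>I - {0}. \<exists>x y. homoclinic f (\<mu>p \<alpha>) x \<and> homoclinic f (\<mu>p \<alpha>) y \<and> S_conjugate S x y \<and>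
                    near_orbit C xh \<phi>2 \<alpha> (\<mu>p \<alpha>) x \<and>
                    near_orbit C xh \<phi>2 (- \<alpha>) (\<mu>p \<alpha>) y))"
proof -
  have "bounded_linear a1" unfolding a1[abs_def] by (rule bounded_linear_compose[OF bounded_linear_l1 G1(1)])
  note M = coeff_matrix_invertible[OF nonsingular bounded_linear.linear[OF this] a2(1)]
  have inv: "\<nu> = 0" if "l1 (G1 \<nu>) = 0" "l2 (G2 \<nu> + G3 (Kp (G1 \<nu>))) = 0" for \<nu>
    using M(1)[of \<nu>] that a1[of \<nu>] a2(2)[OF that(1)] by simp
  have nz: "\<not> (l1 H1 = 0 \<and> l2 (H2 + G3 (Kp H1)) = 0)" using nonzero b1 b2 by auto
  \<comment> \<open>\<open>i\<close> is a coordinate direction on which \<open>a1\<close> does not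
    vanish and \<open>j\<close> the other one, so the curve for \<open>Xplus\<close> is a graph over
    the coordinate \<open>j\<close>.\<close>
  obtain \<epsilon>1 C1 m i j where \<epsilon>1: "\<epsilon>1 > 0" "C1 \<ge> 0" "m 0 = 0" and ij: "(i, j) = (1, 2) \<or> (i, j) = (2, 1 :: 2)"
    and m: "\<And>s. \<bar>s\<bar> < \<epsilon>1 \<Longrightarrow> \<exists>d. (m has_vector_derivative d) (at s)"
    and X: "\<And>s. \<bar>s\<bar> < \<epsilon>1 \<Longrightarrow> \<exists>x. homoclinic f (m s *\<^sub>R axis i 1 + s *\<^sub>R axis j 1) x \<and>
      (\<forall>t. x t \<in> Xplus S) \<and> (\<forall>t. norm (x t - xh t) \<le> C1 * \<bar>s\<bar>)"
  proof -
    have "\<exists>i j :: 2. ((i, j) = (1, 2) \<or> (i, j) = (2, 1)) \<and> l1 (G1 (axis i 1)) \<noteq> 0" using M(2) unfolding a1 by blast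
    then obtain i j :: 2 where ij: "(i, j) = (1, 2) \<or> (i, j) = (2, 1)" and e: "l1 (G1 (axis i 1)) \<noteq> 0" by blast
    from symmetric_branch[OF e, of "axis j 1"] ij that show ?thesis by blast
  qed
  obtain \<epsilon>2 C2 \<nu>0 and \<nu> :: "real \<Rightarrow> real^2" where \<epsilon>2: "\<epsilon>2 > 0" "C2 \<ge> 0" "\<nu>0 \<noteq> 0"
    and \<nu>: "\<And>\<alpha>. \<bar>\<alpha>\<bar> < \<epsilon>2 \<Longrightarrow> norm (\<nu> \<alpha> - \<nu>0) \<le> C2 * \<bar>\<alpha>\<bar>"
      "\<And>\<alpha>. \<bar>\<alpha>\<bar> < \<epsilon>2 \<Longrightarrow> \<exists>d. (\<nu> has_vector_derivative d) (at \<alpha>) \<and> norm d \<le> C2"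
    and Y: "\<And>\<alpha>. 0 < \<alpha> \<Longrightarrow> \<alpha> < \<epsilon>2 \<Longrightarrow> \<exists>x. homoclinic f (\<alpha>\<^sup>2 *\<^sub>R \<nu> \<alpha>) x \<and> homoclinic f (\<alpha>\<^sup>2 *\<^sub>R \<nu> \<alpha>) (\<lambda>t. S *v x t) \<and>
       (\<exists>t. S *v x t \<noteq> x t) \<and> (\<forall>t. norm (x t - (xh t + \<alpha> *\<^sub>R \<phi>2 t)) \<le> C2 * \<alpha>\<^sup>2) \<and>
       (\<forall>t. norm (S *v x t - (xh t - \<alpha> *\<^sub>R \<phi>2 t)) \<le> C2 * \<alpha>\<^sup>2)"
    using pitchfork_branch[OF inv H1 H2 nz] by blast
  define \<mu>p where "\<mu>p \<alpha> = \<alpha>\<^sup>2 *\<^sub>R \<nu> \<bar>\<alpha>\<bar>" for \<alpha>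
  obtain \<mu>p' where \<mu>p': "\<And>\<alpha>. \<bar>\<alpha>\<bar> < \<epsilon>2 \<Longrightarrow> (\<mu>p has_vector_derivative \<mu>p' \<alpha>) (at \<alpha>)" "(\<mu>p' has_vector_derivative 2 *\<^sub>R \<nu>0) (at 0)"
    using even_quadratic_curve[OF \<epsilon>2(1,2) \<nu>] unfolding \<mu>p_def[abs_def] by blast
  define \<epsilon> where "\<epsilon> = min \<epsilon>1 \<epsilon>2"
  define C where "C = C1 + C2"
  have \<epsilon>: "\<epsilon> > 0" "\<epsilon> \<le> \<epsilon>1" "\<epsilon> \<le> \<epsilon>2" and C: "0 \<le> C" "C1 \<le> C" "C2 \<le> C" using \<epsilon>1 \<epsilon>2 by (auto simp: \<epsilon>_def C_def)
  let ?I = "{- \<epsilon><..<\<epsilon>}"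
  define \<mu>c :: "real \<Rightarrow> real^2" where "\<mu>c s = m s *\<^sub>R axis i 1 + s *\<^sub>R axis j 1" for s
  have "m differentiable (at s)" if "s \<in> ?I" for s
  proof -
    have "\<bar>s\<bar> < \<epsilon>1" using that \<epsilon> by auto
    then show ?thesis using m differentiableI_vector by blast
  qed
  then have md: "m differentiable_on ?I" by (auto simp: differentiable_on_def intro: differentiable_at_withinI)
  have c1: "(\<exists>m1 :: real \<Rightarrow> real. m1 differentiable_on ?I \<and> m1 0 = 0 \<and> (\<forall>s. \<mu>c s = vector [m1 s, s])) \<or>
            (\<exists>m2 :: real \<Rightarrow> real. m2 differentiable_on ?I \<and> m2 0 = 0 \<and> (\<forall>s. \<mu>c s = vector [s, m2 s]))"
  proof -
    have "(\<forall>s. \<mu>c s = vector [m s, s]) \<or> (\<forall>s. \<mu>c s = vector [s, m s])"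
      using ij by (auto simp: \<mu>c_def vector_axis_2 add.commute)
    then show ?thesis using md \<epsilon>1(3) by blast
  qed
  have c2: "\<exists>x. homoclinic f (\<mu>c s) x \<and> (\<forall>t. x t \<in> Xplus S) \<and> near_orbit C xh \<phi>2 0 (\<mu>c s) x" if s: "s \<in> ?I" for s
  proof -
    obtain x where x: "homoclinic f (\<mu>c s) x" "\<forall>t. x t \<in> Xplus S" "\<And>t. norm (x t - xh t) \<le> C1 * \<bar>s\<bar>"
    proof -
      have "\<bar>s\<bar> < \<epsilon>1" using s \<epsilon> by auto
      from X[OF this] that show ?thesis unfolding \<mu>c_def by blast
    qed
    \<comment> \<open>One coordinate of the parameter is \<open>s\<close> itself, so the bound
      linear in \<open>s\<close> is a bound by the norm of the parameter.\<close>
    have "\<bar>s\<bar> \<le> norm (\<mu>c s)"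
      using component_le_norm_cart[of "\<mu>c s" j] ij by (auto simp: \<mu>c_def axis_def)
    then have "C1 * \<bar>s\<bar> \<le> C * norm (\<mu>c s)" using C \<epsilon>1(2) by (intro mult_mono) auto
    then have "near_orbit C xh \<phi>2 0 (\<mu>c s) x"
      by (intro near_orbitI[where B="C1 * \<bar>s\<bar>"] C) (use x(3) in auto)
    then show ?thesis using x by blast
  qed
  have p: "\<exists>x y. homoclinic f (\<mu>p \<alpha>) x \<and> homoclinic f (\<mu>p \<alpha>) y \<and> S_conjugate S x y \<and>
       near_orbit C xh \<phi>2 \<alpha> (\<mu>p \<alpha>) x \<and> near_orbit C xh \<phi>2 (- \<alpha>) (\<mu>p \<alpha>) y" if \<alpha>: "\<alpha> \<in> ?I - {0}" for \<alpha>
  proof -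
    have "0 < \<bar>\<alpha>\<bar>" "\<bar>\<alpha>\<bar> < \<epsilon>2" using \<alpha> \<epsilon> by auto
    from Y[OF this] obtain x where x: "homoclinic f (\<mu>p \<alpha>) x" "homoclinic f (\<mu>p \<alpha>) (\<lambda>t. S *v x t)" "\<exists>t. S *v x t \<noteq> x t"
      "\<And>t. norm (x t - (xh t + \<bar>\<alpha>\<bar> *\<^sub>R \<phi>2 t)) \<le> C2 * \<alpha>\<^sup>2" "\<And>t. norm (S *v x t - (xh t - \<bar>\<alpha>\<bar> *\<^sub>R \<phi>2 t)) \<le> C2 * \<alpha>\<^sup>2"
      unfolding \<mu>p_def by auto
    have C\<alpha>: "C2 * \<alpha>\<^sup>2 \<le> C * \<alpha>\<^sup>2" using C(3) by (intro mult_right_mono) auto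
    have n: "near_orbit C xh \<phi>2 \<bar>\<alpha>\<bar> (\<mu>p \<alpha>) x" "near_orbit C xh \<phi>2 (- \<bar>\<alpha>\<bar>) (\<mu>p \<alpha>) (\<lambda>t. S *v x t)"
      by (rule near_orbitI[where B="C2 * \<alpha>\<^sup>2", OF _ C(1)]; use x(4,5) C\<alpha> in simp)+
    \<comment> \<open>Conjugacy is symmetric because \<open>S\<close> is an involution; for negative
      \<alpha> the two orbits exchange their roles.\<close>
    have s: "S_conjugate S x (\<lambda>t. S *v x t)" "S_conjugate S (\<lambda>t. S *v x t) x"
      using x(3) unfolding S_conjugate_def S_S fun_eq_iff by metis+
    show ?thesis
    proof (cases "\<alpha> > 0")
      case True then show ?thesis using x n s by auto
    next
      case False then show ?thesis using x n s by (intro exI[of _ "\<lambda>t. S *v x t"] exI[of _ x]) auto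
    qed
  qed
  have "open ?I \<and> is_interval ?I \<and> 0 \<in> ?I \<and> (\<forall>\<alpha>\<in>?I. - \<alpha> \<in> ?I)" using \<epsilon> by (auto simp: is_interval_1)
  moreover have "\<exists>\<mu>c. ((\<exists>m1 :: real \<Rightarrow> real. m1 differentiable_on ?I \<and> m1 0 = 0 \<and> (\<forall>s. \<mu>c s = vector [m1 s, s])) \<or>
            (\<exists>m2 :: real \<Rightarrow> real. m2 differentiable_on ?I \<and> m2 0 = 0 \<and> (\<forall>s. \<mu>c s = vector [s, m2 s]))) \<and>
        (\<forall>s\<in>?I. \<exists>x. homoclinic f (\<mu>c s) x \<and> (\<forall>t. x t \<in> Xplus S) \<and> near_orbit C xh \<phi>2 0 (\<mu>c s) x)"
    by (rule exI[of _ \<mu>c], rule conjI[OF c1], rule ballI, rule c2)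
  moreover have "\<exists>(\<mu>p :: real \<Rightarrow> real^2) \<mu>p' d.
        (\<forall>\<alpha>\<in>?I. (\<mu>p has_vector_derivative \<mu>p' \<alpha>) (at \<alpha>)) \<and>
        (\<mu>p' has_vector_derivative d) (at 0) \<and> d \<noteq> 0 \<and>
        \<mu>p 0 = 0 \<and> (\<forall>\<alpha>\<in>?I. \<mu>p \<alpha> = \<mu>p (- \<alpha>)) \<and>
        (\<forall>\<alpha>\<in>?I - {0}. \<exists>x y. homoclinic f (\<mu>p \<alpha>) x \<and> homoclinic f (\<mu>p \<alpha>) y \<and> S_conjugate S x y \<and>
                    near_orbit C xh \<phi>2 \<alpha> (\<mu>p \<alpha>) x \<and>
                    near_orbit C xh \<phi>2 (- \<alpha>) (\<mu>p \<alpha>) y)"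
  proof (rule exI[of _ \<mu>p], rule exI[of _ \<mu>p'], rule exI[of _ "2 *\<^sub>R \<nu>0"], intro conjI ballI)
    show "(\<mu>p has_vector_derivative \<mu>p' \<alpha>) (at \<alpha>)" if "\<alpha> \<in> ?I" for \<alpha>
      by (rule \<mu>p'(1)) (use that \<epsilon> in auto)
    show "(\<mu>p' has_vector_derivative 2 *\<^sub>R \<nu>0) (at 0)" by (rule \<mu>p')
    show "2 *\<^sub>R \<nu>0 \<noteq> 0" using \<epsilon>2(3) by simp
    show "\<mu>p 0 = 0" "\<mu>p \<alpha> = \<mu>p (- \<alpha>)" for \<alpha> by (simp_all add: \<mu>p_def)
  qed (rule p)
  ultimately show ?thesis by (intro exI[where x="?I"], intro exI[where x=C]) blast
qed

end

subsection \<open>The pitchfork bifurcation\<close>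

lemma Z0_combination:
  fixes x y :: "real \<Rightarrow> 'a::real_normed_vector"
  assumes "x \<in> Z0 \<kappa>" "y \<in> Z0 \<kappa>"
  shows "(\<lambda>t. a *\<^sub>R x t + b *\<^sub>R y t) \<in> Z0 \<kappa>"
proof -
  obtain B where B: "\<And>t. norm (x t) * exp (\<kappa> * \<bar>t\<bar>) \<le> B" using assms(1) by (auto simp: Z0_def bdd_above_def)
  obtain D where D: "\<And>t. norm (y t) * exp (\<kappa> * \<bar>t\<bar>) \<le> D" using assms(2) by (auto simp: Z0_def bdd_above_def)
  have "norm (a *\<^sub>R x t + b *\<^sub>R y t) * exp (\<kappa> * \<bar>t\<bar>) \<le> \<bar>a\<bar> * B + \<bar>b\<bar> * D" for t
  proof -
    have "norm (a *\<^sub>R x t + b *\<^sub>R y t) \<le> \<bar>a\<bar> * norm (x t) + \<bar>b\<bar> * norm (y t)" by (metis norm_scaleR norm_triangle_ineq)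
    then have "norm (a *\<^sub>R x t + b *\<^sub>R y t) * exp (\<kappa> * \<bar>t\<bar>) \<le> (\<bar>a\<bar> * norm (x t) + \<bar>b\<bar> * norm (y t)) * exp (\<kappa> * \<bar>t\<bar>)"
      by (rule mult_right_mono) simp
    also have "\<dots> = \<bar>a\<bar> * (norm (x t) * exp (\<kappa> * \<bar>t\<bar>)) + \<bar>b\<bar> * (norm (y t) * exp (\<kappa> * \<bar>t\<bar>))" by (simp add: algebra_simps)
    also have "\<dots> \<le> \<bar>a\<bar> * B + \<bar>b\<bar> * D" by (intro add_mono mult_left_mono B D) auto
    finally show ?thesis .
  qed
  then have "bdd_above (range (\<lambda>t. norm (a *\<^sub>R x t + b *\<^sub>R y t) * exp (\<kappa> * \<bar>t\<bar>)))" by (intro bdd_aboveI2)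
  then show ?thesis using assms by (auto simp: Z0_def intro!: continuous_intros)
qed

lemma Z1bar_combination:
  fixes x y :: "real \<Rightarrow> 'a::real_inner"
  assumes "x \<in> Z1bar \<kappa> \<psi>" "y \<in> Z1bar \<kappa> \<psi>"
  shows "(\<lambda>t. a *\<^sub>R x t + b *\<^sub>R y t) \<in> Z1bar \<kappa> \<psi>"
proof -
  obtain x' where x': "x' \<in> Z0 \<kappa>" "\<And>t. (x has_vector_derivative x' t) (at t)" using assms(1) by (auto simp: Z1bar_def Z1_def)
  obtain y' where y': "y' \<in> Z0 \<kappa>" "\<And>t. (y has_vector_derivative y' t) (at t)" using assms(2) by (auto simp: Z1bar_def Z1_def)
  have "((\<lambda>t. a *\<^sub>R x t + b *\<^sub>R y t) has_vector_derivative a *\<^sub>R x' t + b *\<^sub>R y' t) (at t)" for t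
    by (intro has_vector_derivative_add bounded_linear.has_vector_derivative[OF bounded_linear_scaleR_right] x' y')
  moreover have "x \<in> Z0 \<kappa>" "y \<in> Z0 \<kappa>" using assms by (auto simp: Z1bar_def Z1_def)
  ultimately have "(\<lambda>t. a *\<^sub>R x t + b *\<^sub>R y t) \<in> Z1 \<kappa>"
    using Z0_combination[of x \<kappa> y a b] Z0_combination[OF x'(1) y'(1), of a b] unfolding Z1_def
    by (auto intro!: bexI[of _ "\<lambda>t. a *\<^sub>R x' t + b *\<^sub>R y' t"])
  then show ?thesis using assms by (auto simp: Z1bar_def inner_add_right)
qed

lemma Z0_bounded:
  assumes "z \<in> Z0 \<kappa>" "\<kappa> > 0" shows "bounded (range z)"
proof -
  obtain B where B: "\<And>t. norm (z t) * exp (\<kappa> * \<bar>t\<bar>) \<le> B" using assms(1) by (auto simp: Z0_def bdd_above_def)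
  have "norm (z t) \<le> B" for t
  proof -
    have "norm (z t) * 1 \<le> norm (z t) * exp (\<kappa> * \<bar>t\<bar>)" using assms(2) by (intro mult_left_mono) auto
    then show ?thesis using B[of t] by simp
  qed
  then show ?thesis by (auto intro: boundedI)
qed

lemma sum_1_2: "(\<Sum>j=1..2::nat. g j) = g 1 + g 2"
proof -
  have "{1..2::nat} = {1, 2}" by auto
  then show ?thesis by simp
qed

theorem theorem2p9:
  fixes f :: "'n::finite vfield"
    and S :: "real^'n^'n"
    and xh :: "real \<Rightarrow> real^'n"
    and ns nu :: nat
    and l :: "nat \<Rightarrow> complex"
    and \<phi> \<psi> :: "nat \<Rightarrow> real \<Rightarrow> real^'n"
    and \<kappa> :: real
    and q :: "real \<Rightarrow> real"
    and \<xi>\<mu> :: "real^2 \<Rightarrow> real \<Rightarrow> real^'n"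
    and \<xi>\<alpha> :: "real \<Rightarrow> real^'n"
  defines "a1 \<equiv> coeff_a1 f xh (\<psi> (ns+1))"
    and "b1 \<equiv> coeff_b1 f xh (\<phi> 2) (\<psi> (ns+1))"
    and "a2 \<equiv> coeff_a2 f xh (\<phi> 2) (\<psi> (ns+2)) \<xi>\<mu>"
    and "b2 \<equiv> coeff_b2 f xh (\<phi> 2) (\<psi> (ns+2)) \<xi>\<alpha>"
  assumes analytic: "\<And>x \<mu>. real_analytic_at (\<lambda>(x, \<mu>). f x \<mu>) (x, \<mu>)"
    and equilibrium: "\<forall>\<^sub>F \<mu> in nhds 0. f 0 \<mu> = 0"
    and M1: "hyperbolic_saddle f ns nu l"
    and M2: "homoclinic f 0 xh"
    and M3: "bounded_VE_basis f xh 2 \<phi>"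
    and M4: "S ** S = mat 1" "\<And>x \<mu>. S *v f x \<mu> = f (S *v x) \<mu>"
    and fundamental: "fundamental_system f xh ns l \<phi>"
    and dual: "dual_system \<phi> \<psi>"
    and M5: "symmetry_types S ns xh \<phi> \<psi>"
    and C: "condition_C f xh (\<phi> 2)"
    and kappa: "0 < \<kappa>" "\<And>j. j \<in> {1..CARD('n)} \<Longrightarrow> \<kappa> < 1/4 * \<bar>Re (l j)\<bar>"
    and q: "admissible_cutoff \<kappa> ns \<phi> \<psi> q"
    and xi_mu: "\<And>\<mu>. unique_projected_solution f xh (Proj ns \<phi> \<psi> q) (Z1bar \<kappa> \<psi>)
                  (\<lambda>t. Dmu f (xh t) 0 \<mu>) (\<xi>\<mu> \<mu>)"
    and xi_alpha: "unique_projected_solution f xh (Proj ns \<phi> \<psi> q) (Z1bar \<kappa> \<psi>)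
                  (\<lambda>t. (1/2) *\<^sub>R Dxx f (xh t) 0 (\<phi> 2 t) (\<phi> 2 t)) \<xi>\<alpha>"
    and nonsingular: "invertible (coeff_matrix a1 a2)"
    and nonzero: "(b1, b2) \<noteq> (0, 0)"
  shows "\<exists>(I :: real set) C.
     open I \<and> is_interval I \<and> 0 \<in> I \<and> (\<forall>\<alpha>\<in>I. - \<alpha> \<in> I) \<and>
     \<comment> \<open>homoclinic orbits on \<open>X\<^sup>+\<close> along a curve \<open>\<mu>\<^sub>1 = \<phi>\<^sub>1(\<mu>\<^sub>2)\<close> or \<open>\<mu>\<^sub>2 = \<phi>\<^sub>2(\<mu>\<^sub>1)\<close>\<close>
     (\<exists>\<mu>c. ((\<exists>\<phi>1 :: real \<Rightarrow> real. \<phi>1 differentiable_on I \<and> \<phi>1 0 = 0 \<and>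
               (\<forall>s. \<mu>c s = vector [\<phi>1 s, s])) \<or>
            (\<exists>\<phi>2 :: real \<Rightarrow> real. \<phi>2 differentiable_on I \<and> \<phi>2 0 = 0 \<and>
               (\<forall>s. \<mu>c s = vector [s, \<phi>2 s]))) \<and>
        (\<forall>s\<in>I. \<exists>x. homoclinic f (\<mu>c s) x \<and> (\<forall>t. x t \<in> Xplus S) \<and>
                    near_orbit C xh (\<phi> 2) 0 (\<mu>c s) x)) \<and>
     \<comment> \<open>\<open>S\<close>-conjugate pairs along the curve \<open>\<mu> = \<phi>(\<alpha>)\<close>\<close>
     (\<exists>(\<mu>p :: real \<Rightarrow> real^2) \<mu>p' d.
        (\<forall>\<alpha>\<in>I. (\<mu>p has_vector_derivative \<mu>p' \<alpha>) (at \<alpha>)) \<and>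
        (\<mu>p' has_vector_derivative d) (at 0) \<and> d \<noteq> 0 \<and>
        \<mu>p 0 = 0 \<and> (\<forall>\<alpha>\<in>I. \<mu>p \<alpha> = \<mu>p (- \<alpha>)) \<and>
        (\<forall>\<alpha>\<in>I - {0}. \<exists>x y. homoclinic f (\<mu>p \<alpha>) x \<and> homoclinic f (\<mu>p \<alpha>) y \<and> S_conjugate S x y \<and>
                    near_orbit C xh (\<phi> 2) \<alpha> (\<mu>p \<alpha>) x \<and>
                    near_orbit C xh (\<phi> 2) (- \<alpha>) (\<mu>p \<alpha>) y))"
proof -
  have smooth: "Ck k (\<lambda>(x, \<mu>). f x \<mu>)" for k
    by (rule real_analytic_Ck) (simp only: split_paired_all analytic)
  interpret sl: saddle_loop f xh ns nu l \<phi> \<psi> by unfold_locales (fact smooth M1 M2 fundamental dual)+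
  define \<psi>1 where "\<psi>1 = \<psi> (ns+1)"
  define \<psi>2 where "\<psi>2 = \<psi> (ns+2)"
  have \<psi>1: "integrable lborel \<psi>1" "continuous_on UNIV \<psi>1"
    and \<psi>2: "integrable lborel \<psi>2" "continuous_on UNIV \<psi>2" "(\<psi>2 \<longlongrightarrow> 0) at_top" "(\<psi>2 \<longlongrightarrow> 0) at_bot"
    unfolding \<psi>1_def \<psi>2_def by (rule sl.psi; simp)+
  note sym = M5[unfolded symmetry_types_def, folded \<psi>1_def \<psi>2_def, rule_format]
  obtain K0 where K0: "bounded_linear K0" "\<And>h :: real \<Rightarrow>\<^sub>C (real^'n).
     (LINT t|lborel. \<psi>1 t \<bullet> apply_bcontfun h t) = 0 \<Longrightarrow> (LINT t|lborel. \<psi>2 t \<bullet> apply_bcontfun h t) = 0 \<Longrightarrow>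
     (\<forall>t. (apply_bcontfun (K0 h) has_vector_derivative Dx f (xh t) 0 (apply_bcontfun (K0 h) t) + apply_bcontfun h t) (at t))"
    using sl.right_inverse unfolding \<psi>1_def \<psi>2_def by auto
  \<comment> \<open>Both sides are the velocity of the loop: the reduction speaks of the vector
    field, the basis of bounded solutions of \<open>\<phi> 1\<close>.\<close>
  have \<phi>1: "\<phi> 1 t = f (xh t) 0" for t
    using M2 M3 unfolding homoclinic_def bounded_VE_basis_def by (blast intro: vector_derivative_unique_at)
  have \<phi>2: "VE_solution f xh (\<phi> 2)" "bounded (range (\<phi> 2))" using C unfolding condition_C_def by blast+
  have "\<exists>t. \<phi> 2 t \<noteq> 0"
  proof (rule ccontr)
    assume "\<not> ?thesis"
    then have "\<forall>t. 0 *\<^sub>R vector_derivative xh (at t) + 1 *\<^sub>R \<phi> 2 t = 0" by simp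
    then show False using C unfolding condition_C_def by (metis zero_neq_one)
  qed
  interpret K: bounded_linear K0 by (rule K0)
  interpret hr: homoclinic_reduction f S xh "\<phi> 2" \<psi>1 \<psi>2 K0
  proof
    show "\<exists>c d. \<forall>t. \<xi> t = c *\<^sub>R f (xh t) 0 + d *\<^sub>R \<phi> 2 t" if \<xi>: "VE_solution f xh \<xi>" "bounded (range \<xi>)" for \<xi>
    proof -
      obtain c where "\<forall>t. \<xi> t = (\<Sum>j=1..2. c j *\<^sub>R \<phi> j t)" using M3 \<xi> unfolding bounded_VE_basis_def by blast
      then show ?thesis
        by (simp only: sum_1_2 \<phi>1) blast
    qed
    show "(apply_bcontfun (K0 h) has_vector_derivative Dx f (xh t) 0 (apply_bcontfun (K0 h) t) + apply_bcontfun h t) (at t)"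
      if "(LINT t|lborel. \<psi>1 t \<bullet> apply_bcontfun h t) = 0" "(LINT t|lborel. \<psi>2 t \<bullet> apply_bcontfun h t) = 0" for h t
      using K0(2)[OF that] by blast
    show "((\<lambda>t. \<psi>2 t \<bullet> w t) has_vector_derivative \<psi>2 t \<bullet> g) (at t)"
      if "(w has_vector_derivative Dx f (xh t) 0 (w t) + g) (at t)" for w t g
      unfolding \<psi>2_def by (rule sl.psi_pairing[OF _ that]) simp
    show "xh t \<in> Xplus S" "\<phi> 2 t \<in> Xminus S" "v \<in> Xminus S \<Longrightarrow> \<psi>1 t \<bullet> v = 0" "v \<in> Xplus S \<Longrightarrow> \<psi>2 t \<bullet> v = 0" for t v
      using sym[of t] by blast+
  qed (fact smooth equilibrium sl.hyperbolic M2 M4 \<phi>2 \<open>\<exists>t. \<phi> 2 t \<noteq> 0\<close> \<psi>1 \<psi>2)+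
  let ?a = "apply_bcontfun"
  interpret l1: bounded_linear hr.l1 by (rule hr.bounded_linear_l1)
  interpret l2: bounded_linear hr.l2 by (rule hr.bounded_linear_l2)
  interpret G1: bounded_linear hr.G1 by (rule hr.G1)
  interpret G2: bounded_linear hr.G2 by (rule hr.G2)
  interpret G3: bounded_linear hr.G3 by (rule hr.G3)
  obtain H1 H2 where H1: "\<And>t. ?a H1 t = (1/2) *\<^sub>R Dxx f (xh t) 0 (\<phi> 2 t) (\<phi> 2 t)"
    and H2: "\<And>t. ?a H2 t = (1/6) *\<^sub>R Dxxx f (xh t) 0 (\<phi> 2 t) (\<phi> 2 t) (\<phi> 2 t)" by (rule hr.taylor_coefficients) blast
  \<comment> \<open>The projection depends on \<open>h\<close> only through the two functionals, so
    it is linear in \<open>h\<close> and vanishes where both of them do.\<close>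
  have P: "Proj ns \<phi> \<psi> q (?a h) t = q t *\<^sub>R (hr.l1 h *\<^sub>R \<phi> (ns+1) t + hr.l2 h *\<^sub>R \<phi> (ns+2) t)" for h t
    unfolding Proj_def sum_1_2 hr.l1_def hr.l2_def \<psi>1_def[symmetric] \<psi>2_def[symmetric] ..
  have l2_plus: "hr.l2 h = 0" if "\<And>t. ?a h t \<in> Xplus S" for h
    by (simp add: hr.l2_def hr.\<psi>2_plus[OF that])
  have xi_mu': "\<xi>\<mu> \<mu> \<in> Z1bar \<kappa> \<psi>"
    "(\<xi>\<mu> \<mu> has_vector_derivative Dx f (xh t) 0 (\<xi>\<mu> \<mu> t) + (?a (hr.G1 \<mu>) t - Proj ns \<phi> \<psi> q (?a (hr.G1 \<mu>)) t)) (at t)"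
    "\<eta> \<in> Z1bar \<kappa> \<psi> \<Longrightarrow> (\<And>t. (\<eta> has_vector_derivative Dx f (xh t) 0 (\<eta> t) + (?a (hr.G1 \<mu>) t - Proj ns \<phi> \<psi> q (?a (hr.G1 \<mu>)) t)) (at t)) \<Longrightarrow> \<eta> = \<xi>\<mu> \<mu>"
    for \<mu> \<eta> t
  proof -
    have g: "(\<lambda>t. Dmu f (xh t) 0 \<mu>) = ?a (hr.G1 \<mu>)" by (rule ext) (simp add: hr.G1)
    note u = xi_mu[of \<mu>, unfolded g unique_projected_solution_def Let_def]
    show "\<xi>\<mu> \<mu> \<in> Z1bar \<kappa> \<psi>"
      "(\<xi>\<mu> \<mu> has_vector_derivative Dx f (xh t) 0 (\<xi>\<mu> \<mu> t) + (?a (hr.G1 \<mu>) t - Proj ns \<phi> \<psi> q (?a (hr.G1 \<mu>)) t)) (at t)"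
      using u by blast+
    show "\<eta> = \<xi>\<mu> \<mu>" if "\<eta> \<in> Z1bar \<kappa> \<psi>"
      "\<And>t. (\<eta> has_vector_derivative Dx f (xh t) 0 (\<eta> t) + (?a (hr.G1 \<mu>) t - Proj ns \<phi> \<psi> q (?a (hr.G1 \<mu>)) t)) (at t)"
      using u that by blast
  qed
  have bdd: "bounded (range z)" "continuous_on UNIV z" if "z \<in> Z1bar \<kappa> \<psi>" for z
    using that Z0_bounded[OF _ kappa(1), of z] by (auto simp: Z1bar_def Z1_def Z0_def)
  \<comment> \<open>A combination of projected solutions is a projected solution for the combined
    parameter; uniqueness in the normalised space makes \<open>\<xi>\<mu>\<close> linear in the
    parameter, and with it \<open>a2\<close>.\<close>
  have comb: "(\<lambda>t. a *\<^sub>R \<xi>\<mu> \<mu> t + b *\<^sub>R \<xi>\<mu> \<nu> t) = \<xi>\<mu> (a *\<^sub>R \<mu> + b *\<^sub>R \<nu>)" for a b \<mu> \<nu>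
  proof (rule xi_mu'(3)[OF Z1bar_combination[OF xi_mu'(1) xi_mu'(1)]])
    fix t
    have "((\<lambda>t. a *\<^sub>R \<xi>\<mu> \<mu> t + b *\<^sub>R \<xi>\<mu> \<nu> t) has_vector_derivative
       a *\<^sub>R (Dx f (xh t) 0 (\<xi>\<mu> \<mu> t) + (?a (hr.G1 \<mu>) t - Proj ns \<phi> \<psi> q (?a (hr.G1 \<mu>)) t)) +
       b *\<^sub>R (Dx f (xh t) 0 (\<xi>\<mu> \<nu> t) + (?a (hr.G1 \<nu>) t - Proj ns \<phi> \<psi> q (?a (hr.G1 \<nu>)) t))) (at t)"
      by (intro has_vector_derivative_add bounded_linear.has_vector_derivative[OF bounded_linear_scaleR_right] xi_mu'(2))
    then show "((\<lambda>t. a *\<^sub>R \<xi>\<mu> \<mu> t + b *\<^sub>R \<xi>\<mu> \<nu> t) has_vector_derivative Dx f (xh t) 0 (a *\<^sub>R \<xi>\<mu> \<mu> t + b *\<^sub>R \<xi>\<mu> \<nu> t) +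
       (?a (hr.G1 (a *\<^sub>R \<mu> + b *\<^sub>R \<nu>)) t - Proj ns \<phi> \<psi> q (?a (hr.G1 (a *\<^sub>R \<mu> + b *\<^sub>R \<nu>))) t)) (at t)"
      unfolding P unfolding G1.add G1.scaleR l1.add l1.scaleR l2.add l2.scaleR hr.Dx_linear plus_bcontfun.rep_eq scaleR_bcontfun.rep_eq
      by (simp add: algebra_simps)
  qed
  define X where "X \<mu> = Bcontfun (\<xi>\<mu> \<mu>)" for \<mu>
  have X: "?a (X \<mu>) t = \<xi>\<mu> \<mu> t" for \<mu> t
    unfolding X_def using bdd[OF xi_mu'(1)] by (subst Bcontfun_inverse) (auto simp: bcontfun_def)
  have a2_eq: "a2 \<mu> = hr.l2 (hr.G2 \<mu> + hr.G3 (X \<mu>))" for \<mu>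
    by (simp only: a2_def \<psi>2_def[symmetric]) (simp add: coeff_a2_def hr.l2_def plus_bcontfun.rep_eq hr.G2 hr.G3 X)
  have X_lin: "X (a *\<^sub>R \<mu> + b *\<^sub>R \<nu>) = a *\<^sub>R X \<mu> + b *\<^sub>R X \<nu>" for a b \<mu> \<nu>
    by (rule bcontfun_eqI) (simp add: X plus_bcontfun.rep_eq scaleR_bcontfun.rep_eq flip: comb)
  have a2_lin: "linear a2"
  proof (rule linearI)
    show "a2 (\<mu> + \<nu>) = a2 \<mu> + a2 \<nu>" for \<mu> \<nu>
      using X_lin[of 1 \<mu> 1 \<nu>] by (simp add: a2_eq G2.add G3.add l2.add)
    show "a2 (r *\<^sub>R \<mu>) = r *\<^sub>R a2 \<mu>" for r \<mu>
      using X_lin[of r \<mu> 0 0] by (simp add: a2_eq G2.scaleR G3.scaleR l2.scaleR l2.add algebra_simps)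
  qed
  have G1_plus: "?a (hr.G1 \<nu>) t \<in> Xplus S" for \<nu> t unfolding hr.G1 by (rule hr.Dmu_plus[OF hr.xh_plus])
  have H1_plus: "?a H1 t \<in> Xplus S" for t
    using hr.Dxx_plus[of t] by (simp add: H1 Xplus_def matrix_vector_mult_scaleR)
  \<comment> \<open>On the kernel of \<open>a1\<close> the forcing satisfies both conditions, the
    second one by symmetry; the projection is zero and the given solution solves the unprojected
    equation.\<close>
  have a2: "a2 \<nu> = hr.l2 (hr.G2 \<nu> + hr.G3 (hr.Kp (hr.G1 \<nu>)))" if "hr.l1 (hr.G1 \<nu>) = 0" for \<nu>
  proof -
    have "(\<xi>\<mu> \<nu> has_vector_derivative Dx f (xh t) 0 (\<xi>\<mu> \<nu> t) + ?a (hr.G1 \<nu>) t) (at t)" for t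
      using xi_mu'(2)[of \<nu> t] by (simp add: P that l2_plus[OF G1_plus])
    from hr.coefficient_eq[OF G1_plus that this bdd(1)[OF xi_mu'(1)], of "hr.G2 \<nu>"]
    show ?thesis by (simp only: a2_def \<psi>2_def[symmetric]) (simp add: coeff_a2_def hr.G2)
  qed
  \<comment> \<open>The same argument with \<open>H1\<close> as forcing, which lies in
    \<open>Xplus\<close> and so satisfies the second condition.\<close>
  have b2: "b2 = hr.l2 (H2 + hr.G3 (hr.Kp H1))" if "hr.l1 H1 = 0"
  proof -
    have g: "(\<lambda>t. (1/2) *\<^sub>R Dxx f (xh t) 0 (\<phi> 2 t) (\<phi> 2 t)) = ?a H1" by (rule ext) (simp add: H1)
    note u = xi_alpha[unfolded g unique_projected_solution_def Let_def]
    have \<xi>\<alpha>: "\<xi>\<alpha> \<in> Z1bar \<kappa> \<psi>" using u by blast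
    have "(\<xi>\<alpha> has_vector_derivative Dx f (xh t) 0 (\<xi>\<alpha> t) + (?a H1 t - Proj ns \<phi> \<psi> q (?a H1) t)) (at t)" for t using u by blast
    then have "(\<xi>\<alpha> has_vector_derivative Dx f (xh t) 0 (\<xi>\<alpha> t) + ?a H1 t) (at t)" for t
      by (simp add: P that l2_plus[OF H1_plus])
    from hr.coefficient_eq[OF H1_plus that this bdd(1)[OF \<xi>\<alpha>], of H2]
    show ?thesis by (simp only: b2_def \<psi>2_def[symmetric]) (simp add: coeff_b2_def H2)
  qed
  have a1: "a1 \<nu> = hr.l1 (hr.G1 \<nu>)" for \<nu> by (simp only: a1_def \<psi>1_def[symmetric]) (simp add: coeff_a1_def hr.l1_def hr.G1)
  have b1: "b1 = hr.l1 H1" by (simp only: b1_def \<psi>1_def[symmetric]) (simp add: coeff_b1_def hr.l1_def H1)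
  show ?thesis by (rule hr.pitchfork_bifurcation[OF H1 H2 a1 b1 a2_lin a2 b2 nonsingular nonzero])
qed

end
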